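(* Let $k$ be a field of characteristic zero and $m\geq 3$ an integer. Let $\mathcal{SC}$ be the $m\times m$ symmetric matrix obtained from the generic symmetric matrix $(x_{i,j})$ over $k$ by replacing the entry $x_{m,m}$ in position $(m,m)$ by $x_{m-1,m-1}$. Let $R=k[x_{i,j}\mid 1\leq i\leq j\leq m,\ (i,j)\neq (m,m)]$ be the polynomial ring in the entries of $\mathcal{SC}$, let $f=\det(\mathcal{SC})\in R$, let $J\subset R$ be the gradient ideal of $f$, and let $I_{m-1}(\mathcal{SC})\subset R$ be the ideal generated by the $(m-1)$-minors of $\mathcal{SC}$. Then: (i) $J$ is an ideal of codimension $3$ contained in $I_{m-1}(\mathcal{SC})$. (ii) $R/(f)$ is a normal domain. (iii) The Hessian determinant $h(f)$ of $f$ does not vanish. (iv) The linear rank of the gradient ideal $J$ of $f$ is $\binom{m+1}{2}-2$ (the maximum possible). (v) $f$ is homaloidal.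
   Context: The generic symmetric $m\times m$ matrix has $(i,j)$-entry $x_{\min(i,j),\max(i,j)}$, where $x_{i,j}$ ($1\leq i\leq j\leq m$) are indeterminates over $k$. The gradient ideal of $f$ is the ideal generated by the partial derivatives of $f$ with respect to all variables of $R$. The Hessian determinant $h(f)$ is the determinant of the matrix of second partial derivatives of $f$ with respect to all variables of $R$. Linear rank: if an ideal $I$ of a standard graded polynomial ring $R$ is minimally generated by $n+1$ forms of the same degree, with graded presentation matrix (syzygy matrix) $\varphi$ with respect to these generators, the linear rank of $I$ is the rank of the submatrix $\varphi_1$ of $\varphi$ consisting of the columns whose entries are linear forms (i.e. of the matrix of linear syzygies); it does not depend on the minimal generators chosen and is at most $n$. The polar map of a form $f$ in a polynomial ring in $N$ variables is the rational map $\mathbb{P}^{N-1}\dashrightarrow\mathbb{P}^{N-1}$ defined by the partial derivatives of $f$; $f$ is homaloidal if its polar map is birational. *)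

theory Defs
  imports
    "HOL-Library.Poly_Mapping"
    "HOL-Library.Product_Lexorder"
    "HOL-Library.Extended_Nat"
    "HOL-Algebra.QuotRing"
    "HOL-Algebra.Polynomials"
    "Jordan_Normal_Form.Determinant"
    "Jordan_Normal_Form.DL_Submatrix"
    "Jordan_Normal_Form.DL_Rank"
begin

section \<open>Multivariate polynomials\<close>

text \<open>The type provides all elements of type \<open>'v\<close> as variables; the polynomial ring
  in the variables from a given set \<open>V\<close> is the subring \<open>mpoly_ring V\<close> below.\<close>

type_synonym ('v, 'a) mpoly = "('v \<Rightarrow>\<^sub>0 nat) \<Rightarrow>\<^sub>0 'a"

definition Const :: "'a::zero \<Rightarrow> ('v, 'a) mpoly" where
  "Const c = Poly_Mapping.single 0 c"

definition Var :: "'v \<Rightarrow> ('v, 'a::zero_neq_one) mpoly" where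
  "Var v = Poly_Mapping.single (Poly_Mapping.single v 1) 1"

definition vars :: "('v, 'a::zero) mpoly \<Rightarrow> 'v set" where
  "vars p = (\<Union>t\<in>Poly_Mapping.keys p. Poly_Mapping.keys t)"

definition mpoly_ring :: "'v set \<Rightarrow> ('v, 'a::comm_ring_1) mpoly ring" where
  "mpoly_ring V = \<lparr>carrier = {p. vars p \<subseteq> V}, mult = (*), one = 1, zero = 0, add = (+)\<rparr>"

definition mon_deg :: "('v \<Rightarrow>\<^sub>0 nat) \<Rightarrow> nat" where
  "mon_deg t = (\<Sum>v\<in>Poly_Mapping.keys t. Poly_Mapping.lookup t v)"

text \<open>The zero polynomial is a form of every degree.\<close>

definition is_form :: "'v set \<Rightarrow> nat \<Rightarrow> ('v, 'a::zero) mpoly \<Rightarrow> bool" where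
  "is_form V d p \<longleftrightarrow> vars p \<subseteq> V \<and> (\<forall>t\<in>Poly_Mapping.keys p. mon_deg t = d)"

text \<open>For \<open>lookup t v = 0\<close> the subtraction of exponents truncates, but then the coefficient is \<open>0\<close>.\<close>

definition partial :: "'v \<Rightarrow> ('v, 'a::comm_ring_1) mpoly \<Rightarrow> ('v, 'a) mpoly" where
  "partial v p = (\<Sum>t\<in>Poly_Mapping.keys p.
     Poly_Mapping.single (t - Poly_Mapping.single v 1)
       (of_nat (Poly_Mapping.lookup t v) * Poly_Mapping.lookup p t))"

definition poly_subst :: "('v \<Rightarrow> ('w, 'a::comm_ring_1) mpoly) \<Rightarrow> ('v, 'a) mpoly \<Rightarrow> ('w, 'a) mpoly" where
  "poly_subst g p = (\<Sum>t\<in>Poly_Mapping.keys p.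
     Const (Poly_Mapping.lookup p t) *
     (\<Prod>v\<in>Poly_Mapping.keys t. g v ^ Poly_Mapping.lookup t v))"

definition gradient_ideal :: "'v set \<Rightarrow> ('v, 'a::comm_ring_1) mpoly \<Rightarrow> ('v, 'a) mpoly set" where
  "gradient_ideal V f = genideal (mpoly_ring V) ((\<lambda>v. partial v f) ` V)"

text \<open>The variables are listed in increasing order; the determinant does not depend on the order.\<close>

definition hessian_det :: "'v::linorder set \<Rightarrow> ('v, 'a::comm_ring_1) mpoly \<Rightarrow> ('v, 'a) mpoly" where
  "hessian_det V f = (let xs = sorted_list_of_set V in
     det (mat (length xs) (length xs) (\<lambda>(a, b). partial (xs ! a) (partial (xs ! b) f))))"

definition minors_ideal ::
  "'v set \<Rightarrow> nat \<Rightarrow> ('v, 'a::comm_ring_1) mpoly mat \<Rightarrow> ('v, 'a) mpoly set" where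
  "minors_ideal V t M = genideal (mpoly_ring V)
     {det (submatrix M I K) | I K. I \<subseteq> {..<dim_row M} \<and> K \<subseteq> {..<dim_col M} \<and> card I = t \<and> card K = t}"


section \<open>Codimension of an ideal\<close>

definition height :: "('a, 'b) ring_scheme \<Rightarrow> 'a set \<Rightarrow> enat" where
  "height R P = Sup {enat n | n. \<exists>C. (\<forall>i\<le>n. primeideal (C i) R) \<and>
     (\<forall>i<n. C i \<subset> C (Suc i)) \<and> C n = P}"

definition codim :: "('a, 'b) ring_scheme \<Rightarrow> 'a set \<Rightarrow> enat" where
  "codim R I = Inf {height R P | P. primeideal P R \<and> I \<subseteq> P}"


section \<open>Normal domains\<close>

definition frac_rel :: "('a, 'b) ring_scheme \<Rightarrow> (('a \<times> 'a) \<times> ('a \<times> 'a)) set" where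
  "frac_rel A = {((a, b), (c, d)).
     a \<in> carrier A \<and> b \<in> carrier A - {\<zero>\<^bsub>A\<^esub>} \<and> c \<in> carrier A \<and> d \<in> carrier A - {\<zero>\<^bsub>A\<^esub>} \<and>
     a \<otimes>\<^bsub>A\<^esub> d = c \<otimes>\<^bsub>A\<^esub> b}"

definition fraction_class :: "('a, 'b) ring_scheme \<Rightarrow> 'a \<Rightarrow> 'a \<Rightarrow> ('a \<times> 'a) set" where
  "fraction_class A a b = frac_rel A `` {(a, b)}"

text \<open>Meaningful for domains \<open>A\<close> only. The unions are over representatives; all of them yield the same class.\<close>

definition fraction_field :: "('a, 'b) ring_scheme \<Rightarrow> ('a \<times> 'a) set ring" where
  "fraction_field A = \<lparr>
     carrier = {fraction_class A a b | a b. a \<in> carrier A \<and> b \<in> carrier A - {\<zero>\<^bsub>A\<^esub>}},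
     mult = (\<lambda>x y. \<Union>(a, b)\<in>x. \<Union>(c, d)\<in>y. fraction_class A (a \<otimes>\<^bsub>A\<^esub> c) (b \<otimes>\<^bsub>A\<^esub> d)),
     one = fraction_class A \<one>\<^bsub>A\<^esub> \<one>\<^bsub>A\<^esub>,
     zero = fraction_class A \<zero>\<^bsub>A\<^esub> \<one>\<^bsub>A\<^esub>,
     add = (\<lambda>x y. \<Union>(a, b)\<in>x. \<Union>(c, d)\<in>y.
       fraction_class A ((a \<otimes>\<^bsub>A\<^esub> d) \<oplus>\<^bsub>A\<^esub> (c \<otimes>\<^bsub>A\<^esub> b)) (b \<otimes>\<^bsub>A\<^esub> d))\<rparr>"

text \<open>\<open>p\<close> is the list of coefficients, highest degree first, of a monic polynomial over \<open>S\<close>.\<close>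

definition integral_over :: "('a, 'b) ring_scheme \<Rightarrow> 'a set \<Rightarrow> 'a \<Rightarrow> bool" where
  "integral_over K S x \<longleftrightarrow>
     (\<exists>p. p \<noteq> [] \<and> set p \<subseteq> S \<and> hd p = \<one>\<^bsub>K\<^esub> \<and> ring.eval K p x = \<zero>\<^bsub>K\<^esub>)"

definition normal_domain :: "('a, 'b) ring_scheme \<Rightarrow> bool" where
  "normal_domain A \<longleftrightarrow> domain A \<and>
     (let S = (\<lambda>a. fraction_class A a \<one>\<^bsub>A\<^esub>) ` carrier A in
      \<forall>x\<in>carrier (fraction_field A). integral_over (fraction_field A) S x \<longrightarrow> x \<in> S)"


section \<open>Linear rank\<close>

definition min_form_generators ::
  "'v set \<Rightarrow> ('v, 'a::comm_ring_1) mpoly set \<Rightarrow> ('v, 'a) mpoly list \<Rightarrow> bool" where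
  "min_form_generators V I gs \<longleftrightarrow>
     (\<exists>d. \<forall>g\<in>set gs. is_form V d g) \<and>
     genideal (mpoly_ring V) (set gs) = I \<and>
     (\<forall>i<length gs. genideal (mpoly_ring V) {gs ! j | j. j < length gs \<and> j \<noteq> i} \<noteq> I)"

text \<open>The columns of \<open>\<phi>\<close> are homogeneous and generate the module of syzygies of \<open>gs\<close>;
  no minimality of this generating set is required.\<close>

definition graded_presentation ::
  "'v set \<Rightarrow> ('v, 'a::comm_ring_1) mpoly list \<Rightarrow> ('v, 'a) mpoly mat \<Rightarrow> bool" where
  "graded_presentation V gs \<phi> \<longleftrightarrow>
     dim_row \<phi> = length gs \<and>
     (\<forall>c<dim_col \<phi>. \<exists>e. \<forall>r<dim_row \<phi>. is_form V e (\<phi> $$ (r, c))) \<and>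
     (\<forall>h\<in>carrier_vec (length gs). set\<^sub>v h \<subseteq> carrier (mpoly_ring V) \<longrightarrow>
        (h \<bullet> vec_of_list gs = 0 \<longleftrightarrow>
         (\<exists>c\<in>carrier_vec (dim_col \<phi>). set\<^sub>v c \<subseteq> carrier (mpoly_ring V) \<and> h = \<phi> *\<^sub>v c)))"

definition linear_part :: "'v set \<Rightarrow> ('v, 'a::comm_ring_1) mpoly mat \<Rightarrow> ('v, 'a) mpoly mat" where
  "linear_part V \<phi> = submatrix \<phi> UNIV
     {c. c < dim_col \<phi> \<and> (\<forall>r<dim_row \<phi>. is_form V 1 (\<phi> $$ (r, c)))}"

text \<open>The rank is taken over the fraction field of the full polynomial type, an extension
  of the fraction field of \<open>mpoly_ring V\<close>; ranks do not change under field extensions.\<close>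

definition linear_rank :: "'v::linorder set \<Rightarrow> ('v, 'a::field) mpoly set \<Rightarrow> nat" where
  "linear_rank V I = (THE r. \<exists>gs \<phi>. min_form_generators V I gs \<and> graded_presentation V gs \<phi> \<and>
     r = vec_space.rank (length gs) (map_mat to_fract (linear_part V \<phi>)))"


section \<open>Homaloidal forms\<close>

text \<open>A rational self-map of the projective space with coordinates indexed by \<open>V\<close> is represented
  by a tuple of forms of the same degree that are not all zero. Two such tuples represent the
  same map iff they are proportional, and the composition of the maps given by \<open>F\<close> and \<open>G\<close>
  (first \<open>F\<close>, then \<open>G\<close>) is defined iff substituting \<open>F\<close> into \<open>G\<close> gives a nonzero tuple.\<close>

definition rational_map :: "'v set \<Rightarrow> ('v \<Rightarrow> ('v, 'a::comm_ring_1) mpoly) \<Rightarrow> bool" where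
  "rational_map V F \<longleftrightarrow> (\<exists>d. \<forall>v\<in>V. is_form V d (F v)) \<and> (\<exists>v\<in>V. F v \<noteq> 0)"

definition same_map ::
  "'v set \<Rightarrow> ('v \<Rightarrow> ('v, 'a::comm_ring_1) mpoly) \<Rightarrow> ('v \<Rightarrow> ('v, 'a) mpoly) \<Rightarrow> bool" where
  "same_map V F G \<longleftrightarrow> (\<forall>u\<in>V. \<forall>v\<in>V. F u * G v = F v * G u)"

definition map_comp_rep ::
  "('v \<Rightarrow> ('v, 'a::comm_ring_1) mpoly) \<Rightarrow> ('v \<Rightarrow> ('v, 'a) mpoly) \<Rightarrow> 'v \<Rightarrow> ('v, 'a) mpoly" where
  "map_comp_rep G F = (\<lambda>v. poly_subst F (G v))"

definition birational :: "'v set \<Rightarrow> ('v \<Rightarrow> ('v, 'a::comm_ring_1) mpoly) \<Rightarrow> bool" where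
  "birational V F \<longleftrightarrow> rational_map V F \<and>
     (\<exists>G. rational_map V G \<and>
        rational_map V (map_comp_rep G F) \<and> same_map V (map_comp_rep G F) Var \<and>
        rational_map V (map_comp_rep F G) \<and> same_map V (map_comp_rep F G) Var)"

definition homaloidal :: "'v set \<Rightarrow> ('v, 'a::comm_ring_1) mpoly \<Rightarrow> bool" where
  "homaloidal V f \<longleftrightarrow> (\<exists>d. is_form V d f) \<and> birational V (\<lambda>v. partial v f)"


section \<open>The degenerated symmetric matrix\<close>

text \<open>Matrix positions are counted from \<open>0\<close>, indices of variables from \<open>1\<close>.\<close>

definition generic_symmetric :: "nat \<Rightarrow> (nat \<times> nat, 'a::comm_ring_1) mpoly mat" where
  "generic_symmetric m = mat m m (\<lambda>(i, j). Var (min (i + 1) (j + 1), max (i + 1) (j + 1)))"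

definition SC :: "nat \<Rightarrow> (nat \<times> nat, 'a::comm_ring_1) mpoly mat" where
  "SC m = mat m m (\<lambda>(i, j). if (i + 1, j + 1) = (m, m) then Var (m - 1, m - 1)
                            else generic_symmetric m $$ (i, j))"

definition SC_vars :: "nat \<Rightarrow> (nat \<times> nat) set" where
  "SC_vars m = {(i, j). 1 \<le> i \<and> i \<le> j \<and> j \<le> m \<and> (i, j) \<noteq> (m, m)}"

end

theory Submission
  imports Defs "Jordan_Normal_Form.Char_Poly"
begin

text \<open>
  Write \<open>X\<close> for the matrix, \<open>C\<close> for its matrix of cofactors, so that \<open>X C = f I\<close>, and call the linear space of symmetric
  matrices with equal last two diagonal entries the family. Up to factors of two, the gradient of \<open>f\<close> consists of the entries of \<open>C\<close>, except that the last
  two diagonal entries of \<open>C\<close> only appear through their sum. In particular \<open>J\<close> is contained in the ideal of the submaximal minors.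

  For the codimension: a prime \<open>P\<close> over the gradient contains all cofactors (lemma \<open>principal_cofactors_in_prime\<close>), so its points are
  matrices of corank at least two, which should form a set of codimension three. A chain of primes of length three below \<open>P\<close> is built from
  the largest differential ideals in \<open>P\<close>, which are prime in characteristic zero; principal minors show that the inclusions are
  strict (theorem \<open>chain_below_prime_over_principal_cofactors\<close>). In the other direction, a generic matrix of corank two in the family gives a prime
  of height at most three. Heights are bounded from above by counting: \<open>growth\<close> plays the role of the transcendence degree of
  the quotient.

  For normality: if \<open>\<xi> \<xi>\<^sup>T\<close> lies in the family, then \<open>f\<close> is affine along this direction. Solving for the zero of this affine
  function retracts the space rationally onto the hypersurface (\<open>rho\<close>), so that the quotient by \<open>f\<close> becomes a localization of a
  polynomial ring as soon as the slope \<open>gd \<xi>\<close> is inverted. The slopes for all \<open>\<xi>\<close> together generate the gradient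
  (lemma \<open>gradient_from_iso\<close>), and the gradient has codimension three. An obstruction to \<open>f\<close> being prime would live in codimension one, and
  an obstruction to normality in codimension two: neither can be supported where all slopes vanish. The criterion
  \<open>separately_dvd\<close> makes this precise without unique factorization, by exhibiting the variables that are independent
  modulo the obstruction.

  At the identity matrix, the Hessian of \<open>f\<close> is the quadratic form \<open>(tr E)\<^sup>2 - tr (E\<^sup>2)\<close>, which is nondegenerate on the family.

  For the linear rank: if \<open>L\<close> is a matrix of trace zero such that \<open>L X + X L\<^sup>T\<close> stays in the family, then this motion does not change \<open>f\<close> and thus is a linear
  syzygy of the gradient. At the identity matrix the motions \<open>L + L\<^sup>T\<close> fill a space of codimension one, so there are as many
  independent linear syzygies as orthogonality to the gradient allows. The partial derivatives are linearly independent by the Hessian, hence a minimal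
  system of generators, and any other one arises by an invertible constant matrix. A graded presentation exists since the module
  of syzygies is finitely generated (lemma \<open>finite_generators\<close>, by Dickson's lemma).

  For the inverse of the polar map: the coordinates of the gradient determine \<open>C\<close> up to a multiple of \<open>A = diag (0, \<dots>, 0, 1, -1)\<close>, the orthogonal complement
  of the family. The correct multiple is found from the requirement that the adjoint of \<open>C\<close>, which is proportional to \<open>X\<close>, has equal last two
  diagonal entries; this is a linear equation. Taking the adjoint of the corrected matrix inverts the polar map.
\<close>

section \<open>Polynomials and evaluation homomorphisms\<close>

abbreviation "lkp \<equiv> Poly_Mapping.lookup"
abbreviation "mkeys \<equiv> Poly_Mapping.keys"
abbreviation "msingle \<equiv> Poly_Mapping.single"

definition polys :: "'v set \<Rightarrow> ('v, 'a::comm_ring_1) mpoly set" where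
  "polys V = {p. vars p \<subseteq> V}"

lemma polys_iff: "p \<in> polys V \<longleftrightarrow> (\<forall>t\<in>mkeys p. mkeys t \<subseteq> V)"
  by (auto simp: polys_def vars_def)

lemma polys_mono: "V \<subseteq> W \<Longrightarrow> p \<in> polys V \<Longrightarrow> p \<in> polys W"
  by (auto simp: polys_def)

lemma polys_UNIV [simp]: "p \<in> polys UNIV"
  by (auto simp: polys_def)

lemma polys_Const [simp]: "Const c \<in> polys V"
  by (auto simp: polys_iff Const_def)

lemma polys_Var: "v \<in> V \<Longrightarrow> Var v \<in> polys V"
  by (auto simp: polys_iff Var_def)

lemma polys_0 [simp]: "0 \<in> polys V"
  by (auto simp: polys_iff)

lemma polys_1 [simp]: "1 \<in> polys V"
  by (auto simp: polys_iff)

lemma polys_add: "p \<in> polys V \<Longrightarrow> q \<in> polys V \<Longrightarrow> p + q \<in> polys V"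
  using keys_add[of p q] by (fastforce simp: polys_iff)

lemma polys_uminus: "p \<in> polys V \<Longrightarrow> - p \<in> polys V"
  by (auto simp: polys_iff in_keys_iff)

lemma polys_diff: "p \<in> polys V \<Longrightarrow> q \<in> polys V \<Longrightarrow> p - q \<in> polys V"
  using polys_add[of p V "- q"] polys_uminus[of q V] by simp

lemma polys_mult: "p \<in> polys V \<Longrightarrow> q \<in> polys V \<Longrightarrow> p * q \<in> polys V"
proof -
  assume p: "p \<in> polys V" and q: "q \<in> polys V"
  have "mkeys t \<subseteq> V" if t: "t \<in> mkeys (p * q)" for t
  proof -
    obtain a b where "t = a + b" "a \<in> mkeys p" "b \<in> mkeys q"
      using t keys_mult[of p q] by blast
    moreover from this have "mkeys a \<subseteq> V" "mkeys b \<subseteq> V" using p q by (auto simp: polys_iff)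
    ultimately show ?thesis using keys_add[of a b] by blast
  qed
  then show ?thesis by (auto simp: polys_iff)
qed

lemma polys_power: "p \<in> polys V \<Longrightarrow> p ^ n \<in> polys V"
  by (induction n) (auto intro: polys_mult)

lemma polys_sum: "(\<And>i. i \<in> A \<Longrightarrow> f i \<in> polys V) \<Longrightarrow> sum f A \<in> polys V"
  by (induction A rule: infinite_finite_induct) (auto intro: polys_add)

lemma polys_prod: "(\<And>i. i \<in> A \<Longrightarrow> f i \<in> polys V) \<Longrightarrow> prod f A \<in> polys V"
  by (induction A rule: infinite_finite_induct) (auto intro: polys_mult)

lemma Const_0 [simp]: "Const 0 = 0" by (simp add: Const_def)
lemma Const_1 [simp]: "Const 1 = 1" by (simp add: Const_def)
lemma Const_add: "Const (a + b) = Const a + Const b" by (simp add: Const_def single_add)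
lemma Const_mult: "Const (a * b :: 'a::comm_ring_1) = Const a * Const b" by (simp add: Const_def mult_single)
lemma Const_uminus: "Const (- a :: 'a::comm_ring_1) = - Const a" by (simp add: Const_def single_uminus)
lemma Const_diff: "Const (a - b :: 'a::comm_ring_1) = Const a - Const b" by (simp add: Const_def single_diff)
lemma Const_inject [simp]: "Const a = Const b \<longleftrightarrow> a = b" by (simp add: Const_def inj_single inj_eq)
lemma Const_eq_0_iff [simp]: "Const a = 0 \<longleftrightarrow> a = 0" using Const_inject[of a 0] by (simp del: Const_inject)
lemma Const_of_nat: "Const (of_nat n :: 'a::comm_ring_1) = of_nat n" by (simp add: Const_def)
lemma Const_numeral: "Const (numeral n :: 'a::comm_ring_1) = numeral n" by (simp add: Const_def)

lemma comm_ring_hom_Const: "comm_ring_hom (Const :: 'a::comm_ring_1 \<Rightarrow> ('v, 'a) mpoly)"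
  by unfold_locales (auto simp: Const_add Const_mult)

lemma lookup_Const_mult: "lkp (Const c * p) t = c * lkp p t"
  by (simp add: Const_def mult_map_scale_conv_mult[symmetric] Poly_Mapping.map.rep_eq when_def)

lemma mpoly_sum_singles: "(\<Sum>t\<in>mkeys p. msingle t (lkp p t)) = p"
proof (rule poly_mapping_eqI)
  fix k
  have "lkp (\<Sum>t\<in>mkeys p. msingle t (lkp p t)) k = (\<Sum>t\<in>mkeys p. if t = k then lkp p t else 0)"
    by (simp add: lookup_sum lookup_single when_def)
  also have "\<dots> = lkp p k" by (simp add: in_keys_iff)
  finally show "lkp (\<Sum>t\<in>mkeys p. msingle t (lkp p t)) k = lkp p k" .
qed

definition mev :: "('v \<Rightarrow> 'r::comm_ring_1) \<Rightarrow> ('v \<Rightarrow>\<^sub>0 nat) \<Rightarrow> 'r" where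
  "mev x t = (\<Prod>v\<in>mkeys t. x v ^ lkp t v)"

lemma mev_superset: "finite A \<Longrightarrow> mkeys t \<subseteq> A \<Longrightarrow> mev x t = (\<Prod>v\<in>A. x v ^ lkp t v)"
  unfolding mev_def by (rule prod.mono_neutral_left) (auto simp: in_keys_iff)

lemma mev_0 [simp]: "mev x 0 = 1" by (simp add: mev_def)

lemma mev_add: "mev x (s + t) = mev x s * mev x t"
proof -
  let ?A = "mkeys s \<union> mkeys t"
  have "mev x (s + t) = (\<Prod>v\<in>?A. x v ^ lkp (s + t) v)"
    using keys_add[of s t] by (intro mev_superset) auto
  also have "\<dots> = (\<Prod>v\<in>?A. x v ^ lkp s v) * (\<Prod>v\<in>?A. x v ^ lkp t v)"
    by (simp add: lookup_add power_add prod.distrib)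
  also have "\<dots> = mev x s * mev x t"
    by (simp add: mev_superset[of ?A])
  finally show ?thesis .
qed

lemma mev_single [simp]: "mev x (msingle v n) = x v ^ n"
  by (auto simp: mev_def)

text \<open>Evaluation with coefficients mapped by \<open>\<phi>\<close> and variables sent to \<open>x\<close>. Points, substitutions and maps to fraction
  fields are all of this form, so that one set of homomorphism rules serves them all.\<close>
definition ins :: "('a::comm_ring_1 \<Rightarrow> 'r::comm_ring_1) \<Rightarrow> ('v \<Rightarrow> 'r) \<Rightarrow> ('v, 'a) mpoly \<Rightarrow> 'r" where
  "ins \<phi> x p = (\<Sum>t\<in>mkeys p. \<phi> (lkp p t) * mev x t)"

context
  fixes \<phi> :: "'a::comm_ring_1 \<Rightarrow> 'r::comm_ring_1"
  assumes hom: "comm_ring_hom \<phi>"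
begin

interpretation comm_ring_hom \<phi> by (rule hom)

lemma ins_add: "ins \<phi> x (p + q) = ins \<phi> x p + ins \<phi> x q"
  unfolding ins_def
  by (rule setsum_keys_plus_distrib) (auto simp: hom_add distrib_right)

lemma ins_0 [simp]: "ins \<phi> x 0 = 0" by (simp add: ins_def)

lemma ins_sum: "ins \<phi> x (sum f A) = (\<Sum>i\<in>A. ins \<phi> x (f i))"
  by (induction A rule: infinite_finite_induct) (auto simp: ins_add)

lemma ins_single: "ins \<phi> x (msingle t c) = \<phi> c * mev x t"
  by (simp add: ins_def)

lemma ins_mult: "ins \<phi> x (p * q) = ins \<phi> x p * ins \<phi> x q"
proof -
  have "p * q = (\<Sum>s\<in>mkeys p. msingle s (lkp p s)) * (\<Sum>t\<in>mkeys q. msingle t (lkp q t))"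
    by (simp add: mpoly_sum_singles)
  also have "\<dots> = (\<Sum>s\<in>mkeys p. \<Sum>t\<in>mkeys q. msingle (s + t) (lkp p s * lkp q t))"
    by (simp add: sum_product mult_single)
  finally have "ins \<phi> x (p * q) = (\<Sum>s\<in>mkeys p. \<Sum>t\<in>mkeys q. \<phi> (lkp p s * lkp q t) * mev x (s + t))"
    by (simp add: ins_sum ins_single)
  also have "\<dots> = ins \<phi> x p * ins \<phi> x q"
    by (simp add: ins_def sum_product hom_mult mev_add mult_ac)
  finally show ?thesis .
qed

lemma ins_1 [simp]: "ins \<phi> x 1 = 1"
  using ins_single[of x 0 1] by simp

lemma ins_Const [simp]: "ins \<phi> x (Const c) = \<phi> c"
  by (simp add: Const_def ins_single)

lemma ins_Var [simp]: "ins \<phi> x (Var v) = x v"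
  by (simp add: Var_def ins_single)

lemma comm_ring_hom_ins: "comm_ring_hom (ins \<phi> x)"
  by unfold_locales (auto simp: ins_add ins_mult)

end

lemma Var_power: "Var v ^ n = msingle (msingle v n) (1::'a::comm_ring_1)"
  by (induction n) (auto simp: Var_def mult_single single_add[symmetric])

lemma mev_Var: "mev Var t = msingle t (1::'a::comm_ring_1)"
proof -
  have "mev Var t = (\<Prod>v\<in>mkeys t. msingle (msingle v (lkp t v)) (1::'a))"
    by (simp add: mev_def Var_power)
  also have "\<dots> = msingle (\<Sum>v\<in>mkeys t. msingle v (lkp t v)) 1"
    by (induction rule: finite_induct[OF finite_keys[of t]]) (auto simp: mult_single)
  also have "(\<Sum>v\<in>mkeys t. msingle v (lkp t v)) = t" by (rule mpoly_sum_singles)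
  finally show ?thesis .
qed

lemma single_eq_mev: "msingle t c = Const c * mev Var t"
  by (simp add: mev_Var Const_def mult_single)

lemma mpoly_induct [consumes 1, case_names Const Var add mult]:
  fixes p :: "('v, 'a::comm_ring_1) mpoly"
  assumes "p \<in> polys V"
    and C: "\<And>c. Q (Const c)"
    and Va: "\<And>v. v \<in> V \<Longrightarrow> Q (Var v)"
    and ad: "\<And>p q. p \<in> polys V \<Longrightarrow> q \<in> polys V \<Longrightarrow> Q p \<Longrightarrow> Q q \<Longrightarrow> Q (p + q)"
    and mu: "\<And>p q. p \<in> polys V \<Longrightarrow> q \<in> polys V \<Longrightarrow> Q p \<Longrightarrow> Q q \<Longrightarrow> Q (p * q)"
  shows "Q p"
proof -
  have pw: "Q (Var v ^ n) \<and> (Var v ^ n :: ('v, 'a) mpoly) \<in> polys V" if "v \<in> V" for v and n :: nat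
    using that C[of 1] by (induction n) (auto intro!: mu Va intro: polys_Var polys_mult)
  have mo: "Q (mev Var t) \<and> (mev Var t :: ('v, 'a) mpoly) \<in> polys V" if "mkeys t \<subseteq> V" for t
  proof -
    have "A \<subseteq> V \<Longrightarrow> Q (\<Prod>v\<in>A. Var v ^ lkp t v) \<and> (\<Prod>v\<in>A. (Var v :: ('v, 'a) mpoly) ^ lkp t v) \<in> polys V" if "finite A" for A
      using that C[of 1] by (induction A) (auto intro!: mu polys_mult simp: pw)
    then show ?thesis using that by (simp add: mev_def)
  qed
  have "A \<subseteq> mkeys p \<Longrightarrow> Q (\<Sum>t\<in>A. msingle t (lkp p t)) \<and> (\<Sum>t\<in>A. msingle t (lkp p t)) \<in> polys V"
    if "finite A" for A
    using that
  proof (induction A)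
    case empty
    then show ?case using C[of 0] by simp
  next
    case (insert t A)
    then have "mkeys t \<subseteq> V" using assms(1) by (auto simp: polys_iff)
    then have "Q (msingle t (lkp p t))" "msingle t (lkp p t) \<in> polys V"
      using mo[of t] C[of "lkp p t"] by (auto simp: single_eq_mev intro!: mu polys_mult)
    with insert show ?case by (auto intro!: ad polys_add)
  qed
  from this[OF finite_keys[of p]] show ?thesis by (simp add: mpoly_sum_singles)
qed

lemma comm_ring_hom_unique:
  assumes "comm_ring_hom f" "comm_ring_hom g" "p \<in> polys V"
    and "\<And>c. f (Const c) = g (Const c)" "\<And>v. v \<in> V \<Longrightarrow> f (Var v) = g (Var v)"
  shows "f p = g p"
proof -
  interpret f: comm_ring_hom f by fact
  interpret g: comm_ring_hom g by fact
  show ?thesis using assms(3)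
    by (induction rule: mpoly_induct) (auto simp: assms f.hom_add g.hom_add f.hom_mult g.hom_mult)
qed

abbreviation psub :: "('v \<Rightarrow> ('w, 'a::comm_ring_1) mpoly) \<Rightarrow> ('v, 'a) mpoly \<Rightarrow> ('w, 'a) mpoly" where
  "psub \<equiv> ins Const"

lemmas psub_simps [simp] = ins_Const[OF comm_ring_hom_Const] ins_Var[OF comm_ring_hom_Const]
  ins_0[OF comm_ring_hom_Const] ins_1[OF comm_ring_hom_Const]
lemmas psub_add = ins_add[OF comm_ring_hom_Const]
lemmas psub_mult = ins_mult[OF comm_ring_hom_Const]
lemmas psub_hom = comm_ring_hom_ins[OF comm_ring_hom_Const]

lemma poly_subst_eq: "poly_subst = psub"
  by (intro ext) (simp add: poly_subst_def ins_def mev_def)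

lemma psub_polys:
  assumes "p \<in> polys V" "\<And>v. v \<in> V \<Longrightarrow> g v \<in> polys W"
  shows "psub g p \<in> polys W"
  using assms(1)
  by (induction rule: mpoly_induct) (auto simp: assms psub_add psub_mult intro: polys_add polys_mult)

lemma comm_ring_hom_id: "comm_ring_hom (\<lambda>x. x)"
  by unfold_locales auto

lemma psub_id: 
  assumes "p \<in> polys V" "\<And>v. v \<in> V \<Longrightarrow> g v = Var v"
  shows "psub g p = p"
  using comm_ring_hom_unique[OF psub_hom comm_ring_hom_id assms(1), of g] assms(2) by simp

text \<open>A retraction onto the polynomials in the variables \<open>V\<close>: it moves identities that hold among all polynomials into
  the smaller ring.\<close>
definition retr :: "'v set \<Rightarrow> ('v, 'a::comm_ring_1) mpoly \<Rightarrow> ('v, 'a) mpoly" where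
  "retr V = psub (\<lambda>v. if v \<in> V then Var v else 0)"

lemma retr_id: "p \<in> polys V \<Longrightarrow> retr V p = p"
  unfolding retr_def by (rule psub_id) auto

lemma retr_polys: "retr V p \<in> polys V"
  unfolding retr_def by (rule psub_polys[of _ UNIV]) (auto intro: polys_Var)

lemma retr_hom: "comm_ring_hom (retr V)"
  unfolding retr_def by (rule psub_hom)

text \<open>Retracting a quotient to the smaller ring changes neither factor of the product that lies there already.\<close>
lemma dvd_polysE:
  assumes "a \<in> polys V" "b \<in> polys V" "b dvd a"
  obtains c where "c \<in> polys V" "a = b * c"
proof -
  interpret r: comm_ring_hom "retr V" by (rule retr_hom)
  obtain c where "a = b * c" using assms(3) by auto
  then have "retr V a = retr V b * retr V c" by (simp add: r.hom_mult)
  with assms that[of "retr V c"] show ?thesis by (simp add: retr_id retr_polys)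
qed

section \<open>Derivations\<close>

locale derivation =
  fixes D :: "'r::comm_ring_1 \<Rightarrow> 'r"
  assumes D_add: "D (a + b) = D a + D b"
    and D_mult: "D (a * b) = D a * b + a * D b"
begin

lemma D_0 [simp]: "D 0 = 0" using D_add[of 0 0] by simp
lemma D_1 [simp]: "D 1 = 0" using D_mult[of 1 1] by simp
lemma D_uminus: "D (- a) = - D a" using D_add[of a "- a"] by (simp add: eq_neg_iff_add_eq_0 add.commute)
lemma D_diff: "D (a - b) = D a - D b" using D_add[of a "- b"] by (simp add: D_uminus)
lemma D_sum: "D (sum f A) = (\<Sum>i\<in>A. D (f i))"
  by (induction A rule: infinite_finite_induct) (auto simp: D_add)

lemma D_prod: "finite A \<Longrightarrow> D (prod f A) = (\<Sum>i\<in>A. \<Prod>j\<in>A. if j = i then D (f j) else f j)"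
proof (induction A rule: finite_induct)
  case (insert a A)
  have eq: "(\<Prod>j\<in>A. if j = a then D (f j) else f j) = prod f A"
    using insert by (intro prod.cong) auto
  have "(\<Sum>i\<in>insert a A. \<Prod>j\<in>insert a A. if j = i then D (f j) else f j)
      = D (f a) * prod f A + (\<Sum>i\<in>A. \<Prod>j\<in>insert a A. if j = i then D (f j) else f j)"
    using insert eq by simp
  also have "(\<Sum>i\<in>A. \<Prod>j\<in>insert a A. if j = i then D (f j) else f j)
     = (\<Sum>i\<in>A. f a * (\<Prod>j\<in>A. if j = i then D (f j) else f j))"
    using insert by (intro sum.cong refl) auto
  finally show ?case using insert by (simp add: D_mult sum_distrib_left)
qed auto

lemma D_signof: "D (signof p * a) = signof p * D a"
  by (simp add: sign_def D_uminus)

lemma D_det: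
  assumes M: "M \<in> carrier_mat n n"
  shows "D (det M) = (\<Sum>i<n. det (mat n n (\<lambda>(k, l). if k = i then D (M $$ (k, l)) else M $$ (k, l))))"
proof -
  have "D (det M) = (\<Sum>p\<in>{p. p permutes {0..<n}}. signof p * D (\<Prod>i = 0..<n. M $$ (i, p i)))"
    by (simp add: det_def'[OF M] D_sum D_signof)
  also have "\<dots> = (\<Sum>p\<in>{p. p permutes {0..<n}}. \<Sum>i<n. signof p * (\<Prod>j = 0..<n. if j = i then D (M $$ (j, p j)) else M $$ (j, p j)))"
    by (simp add: D_prod sum_distrib_left lessThan_atLeast0)
  also have "\<dots> = (\<Sum>i<n. \<Sum>p\<in>{p. p permutes {0..<n}}. signof p * (\<Prod>j = 0..<n. if j = i then D (M $$ (j, p j)) else M $$ (j, p j)))"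
    by (rule sum.swap)
  also have "\<dots> = (\<Sum>i<n. det (mat n n (\<lambda>(k, l). if k = i then D (M $$ (k, l)) else M $$ (k, l))))"
  proof (rule sum.cong[OF refl])
    fix i assume "i \<in> {..<n}"
    show "(\<Sum>p\<in>{p. p permutes {0..<n}}. signof p * (\<Prod>j = 0..<n. if j = i then D (M $$ (j, p j)) else M $$ (j, p j)))
      = det (mat n n (\<lambda>(k, l). if k = i then D (M $$ (k, l)) else M $$ (k, l)))"
      by (subst det_def'[of _ n], simp)
         (intro sum.cong refl arg_cong2[where f="(*)"] prod.cong, auto simp: permutes_in_image)
  qed
  finally show ?thesis .
qed

text \<open>Jacobi's formula, for an arbitrary derivation.\<close>
lemma D_det_cofactor:
  assumes M: "M \<in> carrier_mat n n"
  shows "D (det M) = (\<Sum>i<n. \<Sum>j<n. D (M $$ (i, j)) * cofactor M i j)"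
  unfolding D_det[OF M]
proof (rule sum.cong[OF refl])
  fix i assume i: "i \<in> {..<n}"
  let ?N = "mat n n (\<lambda>(k, l). if k = i then D (M $$ (k, l)) else M $$ (k, l))"
  have "det ?N = (\<Sum>j<n. ?N $$ (i, j) * cofactor ?N i j)"
    using i by (intro laplace_expansion_row) auto
  also have "\<dots> = (\<Sum>j<n. D (M $$ (i, j)) * cofactor M i j)"
  proof (rule sum.cong[OF refl])
    fix j assume j: "j \<in> {..<n}"
    have "mat_delete ?N i j = mat_delete M i j"
      using M i j by (intro eq_matI) (auto simp: mat_delete_def)
    then show "?N $$ (i, j) * cofactor ?N i j = D (M $$ (i, j)) * cofactor M i j"
      using i j by (simp add: cofactor_def)
  qed
  finally show "det ?N = (\<Sum>j<n. D (M $$ (i, j)) * cofactor M i j)" .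
qed

end

lemma partial_add: "partial v (p + q) = partial v p + partial v q"
  unfolding partial_def
  by (rule setsum_keys_plus_distrib) (auto simp: distrib_left single_add)

lemma partial_0 [simp]: "partial v 0 = 0" by (simp add: partial_def)

lemma partial_sum: "partial v (sum f A) = (\<Sum>i\<in>A. partial v (f i))"
  by (induction A rule: infinite_finite_induct) (auto simp: partial_add)

lemma partial_single: "partial v (msingle t c) = msingle (t - msingle v 1) (of_nat (lkp t v) * c)"
  by (simp add: partial_def)

lemma partial_mult_single:
  "partial v (msingle s a * msingle t b) =
     partial v (msingle s a) * msingle t b + msingle s a * partial v (msingle t b)"
proof -
  have 1: "s + t - msingle v 1 = (s - msingle v 1) + t" if "lkp s v > 0"
    using that by (intro poly_mapping_eqI) (auto simp: lookup_add lookup_minus lookup_single when_def)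
  have 2: "s + t - msingle v 1 = s + (t - msingle v 1)" if "lkp t v > 0"
    using that by (intro poly_mapping_eqI) (auto simp: lookup_add lookup_minus lookup_single when_def)
  have L: "partial v (msingle s a * msingle t b)
      = msingle (s + t - msingle v 1) (of_nat (lkp s v) * (a * b)) + msingle (s + t - msingle v 1) (of_nat (lkp t v) * (a * b))"
    by (simp add: partial_single mult_single lookup_add distrib_right single_add)
  have R1: "partial v (msingle s a) * msingle t b = msingle (s + t - msingle v 1) (of_nat (lkp s v) * (a * b))"
    using 1 by (cases "lkp s v = 0") (auto simp: partial_single mult_single mult.assoc)
  have R2: "msingle s a * partial v (msingle t b) = msingle (s + t - msingle v 1) (of_nat (lkp t v) * (a * b))"
    using 2 by (cases "lkp t v = 0") (auto simp: partial_single mult_single mult_ac)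
  show ?thesis by (simp only: L R1 R2)
qed

lemma partial_mult: "partial v (p * q) = partial v p * q + p * partial v q"
proof -
  have "p * q = (\<Sum>s\<in>mkeys p. \<Sum>t\<in>mkeys q. msingle s (lkp p s) * msingle t (lkp q t))"
    by (simp add: sum_product[symmetric] mpoly_sum_singles)
  then have "partial v (p * q) = (\<Sum>s\<in>mkeys p. \<Sum>t\<in>mkeys q.
       partial v (msingle s (lkp p s)) * msingle t (lkp q t) + msingle s (lkp p s) * partial v (msingle t (lkp q t)))"
    by (simp add: partial_sum partial_mult_single)
  also have "\<dots> = partial v (\<Sum>s\<in>mkeys p. msingle s (lkp p s)) * (\<Sum>t\<in>mkeys q. msingle t (lkp q t))
     + (\<Sum>s\<in>mkeys p. msingle s (lkp p s)) * partial v (\<Sum>t\<in>mkeys q. msingle t (lkp q t))"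
    by (simp add: partial_sum sum_product sum.distrib)
  finally show ?thesis by (simp add: mpoly_sum_singles)
qed

lemma derivation_partial: "derivation (partial v)"
  by unfold_locales (auto simp: partial_add partial_mult)

lemma partial_Const [simp]: "partial v (Const c) = 0"
  by (simp add: Const_def partial_single)

lemma partial_Var: "partial v (Var w) = (if v = w then 1 else 0)"
  by (auto simp: Var_def partial_single lookup_single when_def)

lemma partial_polys: "p \<in> polys V \<Longrightarrow> partial v p \<in> polys V"
  by (induction rule: mpoly_induct)
     (auto simp: partial_add partial_mult partial_Var intro: polys_add polys_mult)

section \<open>Forms\<close>

lemma mon_deg_superset: "finite A \<Longrightarrow> mkeys t \<subseteq> A \<Longrightarrow> mon_deg t = (\<Sum>v\<in>A. lkp t v)"
  unfolding mon_deg_def by (rule sum.mono_neutral_left) (auto simp: in_keys_iff)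

lemma mon_deg_add: "mon_deg (s + t) = mon_deg s + mon_deg t"
proof -
  let ?A = "mkeys s \<union> mkeys t"
  have "mon_deg (s + t) = (\<Sum>v\<in>?A. lkp (s + t) v)"
    using keys_add[of s t] by (intro mon_deg_superset) auto
  also have "\<dots> = (\<Sum>v\<in>?A. lkp s v) + (\<Sum>v\<in>?A. lkp t v)"
    by (simp add: lookup_add sum.distrib)
  also have "\<dots> = mon_deg s + mon_deg t"
    by (simp add: mon_deg_superset[of ?A])
  finally show ?thesis .
qed

lemma mon_deg_0 [simp]: "mon_deg 0 = 0" by (simp add: mon_deg_def)
lemma mon_deg_single [simp]: "mon_deg (msingle v n) = n" by (simp add: mon_deg_def)

lemma mon_deg_eq_0: "mon_deg t = 0 \<Longrightarrow> t = 0"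
  by (simp add: mon_deg_def in_keys_iff flip: keys_eq_empty) blast

lemma is_formI: "(p :: ('v, 'a::comm_ring_1) mpoly) \<in> polys V \<Longrightarrow> (\<And>t. t \<in> mkeys p \<Longrightarrow> mon_deg t = d) \<Longrightarrow> is_form V d p"
  by (auto simp: is_form_def polys_def)

lemma is_form_polys: "is_form V d (p :: ('v, 'a::comm_ring_1) mpoly) \<Longrightarrow> p \<in> polys V"
  by (auto simp: is_form_def polys_def)

lemma is_form_0 [simp]: "is_form V d 0" by (auto simp: is_form_def vars_def)

lemma is_form_Const [simp]: "is_form V 0 (Const (c::'a::comm_ring_1))"
  by (rule is_formI[OF polys_Const]) (auto simp: Const_def split: if_splits)

lemma is_form_Var: "v \<in> V \<Longrightarrow> is_form V 1 (Var v :: ('v, 'a::comm_ring_1) mpoly)"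
  by (rule is_formI[OF polys_Var]) (auto simp: Var_def)

lemma is_form_add: "is_form V d (p :: ('v, 'a::comm_ring_1) mpoly) \<Longrightarrow> is_form V d q \<Longrightarrow> is_form V d (p + q)"
  using keys_add[of p q] by (intro is_formI polys_add) (auto simp: is_form_polys, auto simp: is_form_def)

lemma is_form_uminus: "is_form V d (p :: ('v, 'a::comm_ring_1) mpoly) \<Longrightarrow> is_form V d (- p)"
  by (intro is_formI polys_uminus) (auto simp: is_form_polys, auto simp: is_form_def in_keys_iff)

lemma is_form_diff: "is_form V d (p :: ('v, 'a::comm_ring_1) mpoly) \<Longrightarrow> is_form V d q \<Longrightarrow> is_form V d (p - q)"
  using is_form_add[of V d p "-q"] is_form_uminus[of V d q] by simp

lemma is_form_mult: "is_form V d (p :: ('v, 'a::comm_ring_1) mpoly) \<Longrightarrow> is_form V e q \<Longrightarrow> is_form V (d + e) (p * q)"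
proof (intro is_formI polys_mult)
  fix t assume p: "is_form V d p" and q: "is_form V e q" and t: "t \<in> mkeys (p * q)"
  obtain a b where "t = a + b" "a \<in> mkeys p" "b \<in> mkeys q"
      using t keys_mult[of p q] by blast
  then show "mon_deg t = d + e" using p q by (auto simp: is_form_def mon_deg_add)
qed (auto simp: is_form_polys)

lemma is_form_Const_mult: "is_form V d (p :: ('v, 'a::comm_ring_1) mpoly) \<Longrightarrow> is_form V d (Const c * p)"
  using is_form_mult[OF is_form_Const, of V d p c] by simp

lemma is_form_sum: "(\<And>i. i \<in> A \<Longrightarrow> is_form V d (f i :: ('v, 'a::comm_ring_1) mpoly)) \<Longrightarrow> is_form V d (sum f A)"
  by (induction A rule: infinite_finite_induct) (auto intro: is_form_add)

lemma is_form_1 [simp]: "is_form V 0 (1 :: ('v, 'a::comm_ring_1) mpoly)"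
  using is_form_Const[of V "1::'a"] by (simp del: is_form_Const)

lemma is_form_prod: "finite A \<Longrightarrow> (\<And>i. i \<in> A \<Longrightarrow> is_form V (d i) (f i :: ('v, 'a::comm_ring_1) mpoly)) \<Longrightarrow> is_form V (sum d A) (prod f A)"
  by (induction A rule: finite_induct) (auto intro: is_form_mult)

lemma is_form_power: "is_form V d (p :: ('v, 'a::comm_ring_1) mpoly) \<Longrightarrow> is_form V (n * d) (p ^ n)"
  by (induction n) (auto intro: is_form_mult)

lemma is_form_partial: "is_form V d (p :: ('v, 'a::comm_ring_1) mpoly) \<Longrightarrow> is_form V (d - 1) (partial v p)"
proof -
  assume p: "is_form V d p"
  have "is_form V (d - 1) (msingle (t - msingle v 1) (of_nat (lkp t v) * lkp p t))" if t: "t \<in> mkeys p" for t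
  proof (cases "lkp t v = 0")
    case False
    have eq: "t = (t - msingle v 1) + msingle v 1"
      using False by (intro poly_mapping_eqI) (auto simp: lookup_add lookup_minus lookup_single when_def)
    have "mkeys (t - msingle v 1) \<subseteq> mkeys t"
      by (auto simp: in_keys_iff lookup_minus)
    moreover have "mkeys t \<subseteq> V" using is_form_polys[OF p] t by (simp only: polys_iff)
    moreover have "mon_deg t = d" using p t by (auto simp: is_form_def)
    moreover have "mon_deg t = mon_deg (t - msingle v 1) + 1"
      by (rule trans[OF arg_cong[OF eq, of mon_deg]]) (simp only: mon_deg_add mon_deg_single)
    ultimately show ?thesis by (intro is_formI) (auto simp: polys_iff split: if_splits)
  qed auto
  then show ?thesis unfolding partial_def by (rule is_form_sum)
qed

lemma is_form_det:
  assumes M: "M \<in> carrier_mat n n" and "\<And>i j. i < n \<Longrightarrow> j < n \<Longrightarrow> is_form V d (M $$ (i, j))"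
  shows "is_form V (n * d) (det M)"
  unfolding det_def'[OF M]
proof (rule is_form_sum)
  fix p assume "p \<in> {p. p permutes {0..<n}}"
  then have "is_form V (\<Sum>i = 0..<n. d) (\<Prod>i = 0..<n. M $$ (i, p i))"
    by (intro is_form_prod assms) (auto simp: permutes_in_image)
  then show "is_form V (n * d) (signof p * (\<Prod>i = 0..<n. M $$ (i, p i)))"
    by (auto simp: sign_def is_form_uminus)
qed

lemma polys_det:
  assumes M: "M \<in> carrier_mat n n" and "\<And>i j. i < n \<Longrightarrow> j < n \<Longrightarrow> M $$ (i, j) \<in> polys V"
  shows "det M \<in> polys V"
  unfolding det_def'[OF M]
proof (rule polys_sum)
  fix p assume "p \<in> {p. p permutes {0..<n}}"
  then have "(\<Prod>i = 0..<n. M $$ (i, p i)) \<in> polys V"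
    by (intro polys_prod assms) (auto simp: permutes_in_image)
  then show "signof p * (\<Prod>i = 0..<n. M $$ (i, p i)) \<in> polys V"
    by (auto simp: sign_def polys_uminus)
qed

section \<open>Integral closedness of polynomial rings\<close>

abbreviation "pdeg \<equiv> Polynomial.degree"
abbreviation "pcoeff \<equiv> Polynomial.coeff"

text \<open>A polynomial seen as a univariate one in \<open>T\<close>, with coefficients that no longer involve \<open>T\<close>.\<close>
definition uni :: "'v \<Rightarrow> ('v, 'a::comm_ring_1) mpoly \<Rightarrow> ('v, 'a) mpoly poly" where
  "uni T = ins (\<lambda>c. [:Const c:]) (\<lambda>v. if v = T then [:0, 1:] else [:Var v:])"

lemma uni_base_hom: "comm_ring_hom (\<lambda>c::'a::comm_ring_1. [:Const c :: ('v, 'a) mpoly:])"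
  by unfold_locales (auto simp: Const_add Const_mult)

lemma uni_hom: "comm_ring_hom (uni T :: ('v, 'a::comm_ring_1) mpoly \<Rightarrow> _)"
  unfolding uni_def by (rule comm_ring_hom_ins[OF uni_base_hom])

interpretation uni: comm_ring_hom "uni T :: ('v, 'a::comm_ring_1) mpoly \<Rightarrow> _"
  by (rule uni_hom)

lemma uni_Const [simp]: "uni T (Const c) = [:Const c:]"
  unfolding uni_def by (rule ins_Const[OF uni_base_hom])

lemma uni_Var: "uni T (Var v) = (if v = T then [:0, 1:] else [:Var v:])"
  unfolding uni_def by (rule ins_Var[OF uni_base_hom])

lemma poly_uni [simp]: "poly (uni T p) (Var T) = (p :: ('v, 'a::comm_ring_1) mpoly)"
  using polys_UNIV[of p]
  by (induction rule: mpoly_induct) (auto simp: uni_Var uni.hom_add uni.hom_mult)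

lemma uni_inj: "uni T p = uni T q \<Longrightarrow> p = q"
  by (metis poly_uni)

lemma uni_const: "p \<in> polys V \<Longrightarrow> T \<notin> V \<Longrightarrow> uni T p = [:p:]"
  by (induction rule: mpoly_induct) (auto simp: uni_Var uni.hom_add uni.hom_mult)

lemma uni_coeff: "p \<in> polys V \<Longrightarrow> pcoeff (uni T p) i \<in> polys (V - {T})"
proof (induction arbitrary: i rule: mpoly_induct)
  case (mult p q)
  then show ?case by (auto simp: uni.hom_mult coeff_mult intro!: polys_sum polys_mult)
qed (auto simp: uni.hom_add uni_Var coeff_pCons split: nat.splits intro!: polys_add polys_Var)

lemma polys_empty: "p \<in> polys {} \<Longrightarrow> p = Const (lkp p 0)"
proof (rule poly_mapping_eqI)
  fix t assume p: "p \<in> polys {}"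
  show "lkp p t = lkp (Const (lkp p 0)) t"
  proof (cases "t = 0")
    case False
    then have "t \<notin> mkeys p" using p by (metis keys_eq_empty polys_iff subset_empty)
    then show ?thesis using False by (simp add: Const_def lookup_single in_keys_iff)
  qed (simp add: Const_def)
qed

text \<open>A quotient that is polynomial in each variable separately, over the rational functions of the other variables, is
  polynomial. This replaces unique factorization and the theory of divisors: a failure of divisibility always shows in some
  variable \<open>v\<close>, in the form that every multiplier free of \<open>v\<close> fails too. The induction removes one variable \<open>v\<close> and
  clears the denominator \<open>s\<close> of the quotient, which is free of \<open>v\<close>; the coefficients of the numerator with respect to
  \<open>v\<close> inherit the hypothesis and are thus divisible by \<open>s\<close>.\<close>
lemma separately_dvd:
  fixes a b :: "('v::linorder, 'a::field) mpoly"
  assumes "finite V" "a \<in> polys V" "b \<in> polys V" "b \<noteq> 0"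
    and "\<And>v. v \<in> V \<Longrightarrow> \<exists>s\<in>polys (V - {v}). s \<noteq> 0 \<and> b dvd s * a"
  shows "b dvd a"
  using assms
proof (induction V arbitrary: a b rule: finite_induct)
  case empty
  then have b: "b = Const (lkp b 0)" by (intro polys_empty)
  with empty(3) have "lkp b 0 \<noteq> 0" by auto
  then have "b * Const (1 / lkp b 0) = 1" by (subst b) (simp add: Const_mult[symmetric])
  then have "b dvd 1" by (metis dvdI)
  then show ?case using dvd_trans one_dvd by blast
next
  case (insert v V)
  let ?W = "insert v V"
  have Wv: "?W - {v} = V" using insert by auto
  have Ww: "?W - {w} - {v} = V - {w}" if "w \<in> V" for w using insert that by auto
  obtain s where s: "s \<in> polys V" "s \<noteq> 0" "b dvd s * a"
    using insert.prems(4)[of v] Wv by auto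
  have "s \<in> polys ?W" using s(1) by (rule polys_mono[rotated]) auto
  then obtain c where c: "c \<in> polys ?W" "s * a = b * c"
    using dvd_polysE[OF _ insert.prems(2) s(3)] insert.prems(1) polys_mult by blast
  \<comment> \<open>The leading coefficient of \<open>c\<close> in \<open>v\<close> is divisible by \<open>s\<close> by the induction hypothesis; splitting off the leading term lowers the degree.\<close>
  have *: "c \<in> polys ?W \<Longrightarrow> (\<And>w. w \<in> V \<Longrightarrow> \<exists>\<sigma>\<in>polys (?W - {w}). \<sigma> \<noteq> 0 \<and> s dvd \<sigma> * c) \<Longrightarrow> s dvd c" for c
  proof (induction "pdeg (uni v c)" arbitrary: c rule: less_induct)
    case less
    define n where "n = pdeg (uni v c)"
    define l where "l = pcoeff (uni v c) n"
    have l: "l \<in> polys V" using uni_coeff[OF less.prems(1), of v n] by (simp add: l_def Wv)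
    have sdl: "s dvd l"
    proof (rule insert.IH[OF l s(1,2)])
      fix w assume w: "w \<in> V"
      obtain \<sigma> where \<sigma>: "\<sigma> \<in> polys (?W - {w})" "\<sigma> \<noteq> 0" "s dvd \<sigma> * c"
        using less.prems(2)[OF w] by auto
      obtain d where d: "\<sigma> * c = s * d" using \<sigma>(3) by auto
      define \<tau> where "\<tau> = lead_coeff (uni v \<sigma>)"
      have "uni v \<sigma> \<noteq> 0" using \<sigma>(2) uni_inj[of v \<sigma> 0] by auto
      then have \<tau>: "\<tau> \<in> polys (V - {w})" "\<tau> \<noteq> 0"
        using uni_coeff[OF \<sigma>(1), of v] Ww[OF w] by (auto simp: \<tau>_def)
      have "uni v \<sigma> * uni v c = [:s:] * uni v d"
        using arg_cong[OF d, of "uni v"] uni_const[OF s(1) insert.hyps(2)] by (simp add: uni.hom_mult)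
      from arg_cong[OF this, of lead_coeff] have "\<tau> * l = s * lead_coeff (uni v d)"
        by (simp add: lead_coeff_mult \<tau>_def l_def n_def del: mult_pCons_left)
      then show "\<exists>\<sigma>\<in>polys (V - {w}). \<sigma> \<noteq> 0 \<and> s dvd \<sigma> * l"
        using \<tau> by (metis dvd_triv_left)
    qed
    define c' where "c' = c - l * Var v ^ n"
    have unic': "uni v c' = uni v c - Polynomial.monom l n"
    proof -
      have "[:0, 1::('v,'a) mpoly:] ^ n = Polynomial.monom 1 n" 
        by (simp add: monom_altdef)
      then show ?thesis
      using uni_const[OF l insert.hyps(2)]
      by (simp add: c'_def uni.hom_minus uni.hom_mult uni.hom_power uni_Var smult_monom)
    qed
    have "pdeg (uni v c') \<le> n"
      unfolding unic' n_def by (rule degree_diff_le) (auto simp: degree_monom_le)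
    moreover have "pcoeff (uni v c') n = 0" by (simp add: unic' l_def)
    ultimately have "uni v c' = 0 \<or> pdeg (uni v c') < n" by (rule eq_zero_or_degree_less)
    then have "s dvd c'"
    proof
      assume "uni v c' = 0"
      then have "c' = 0" using uni_inj[of v c' 0] by simp
      then show ?thesis by simp
    next
      assume lt: "pdeg (uni v c') < n"
      have "c' \<in> polys ?W" using less.prems(1) l polys_mono[of V ?W l]
        by (auto simp: c'_def intro!: polys_diff polys_mult polys_power polys_Var)
      moreover have "\<exists>\<sigma>\<in>polys (?W - {w}). \<sigma> \<noteq> 0 \<and> s dvd \<sigma> * c'" if w: "w \<in> V" for w
      proof -
        obtain \<sigma> where \<sigma>: "\<sigma> \<in> polys (?W - {w})" "\<sigma> \<noteq> 0" "s dvd \<sigma> * c"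
          using less.prems(2)[OF w] by auto
        have "\<sigma> * c' = \<sigma> * c - \<sigma> * l * Var v ^ n" by (simp add: c'_def algebra_simps)
        then have "s dvd \<sigma> * c'" using \<sigma>(3) sdl by (simp add: dvd_diff dvd_mult dvd_mult2)
        then show ?thesis using \<sigma> by blast
      qed
      ultimately show ?thesis using less.hyps[of c'] lt by (simp add: n_def)
    qed
    moreover have "c = c' + l * Var v ^ n" by (simp add: c'_def)
    ultimately show "s dvd c" using sdl by (metis dvd_add dvd_mult2)
  qed
  have "s dvd c"
  proof (rule *[OF c(1)])
    fix w assume w: "w \<in> V"
    then obtain \<sigma> where \<sigma>: "\<sigma> \<in> polys (?W - {w})" "\<sigma> \<noteq> 0" "b dvd \<sigma> * a"
      using insert.prems(4)[of w] by auto
    then obtain d where d: "\<sigma> * a = b * d" by auto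
    have "b * (\<sigma> * c) = \<sigma> * (b * c)" by (simp add: ac_simps)
    also have "\<dots> = s * (\<sigma> * a)" by (simp add: c(2)[symmetric] ac_simps)
    also have "\<dots> = b * (s * d)" by (simp add: d ac_simps)
    finally have "\<sigma> * c = s * d" using insert.prems(3) by simp
    then show "\<exists>\<sigma>\<in>polys (?W - {w}). \<sigma> \<noteq> 0 \<and> s dvd \<sigma> * c" using \<sigma> by (metis dvd_triv_left)
  qed
  then obtain e where "c = s * e" by auto
  with c(2) have "s * a = s * (b * e)" by (simp add: ac_simps)
  then have "a = b * e" using s(2) by simp
  then show ?case by simp
qed

text \<open>All powers of an integral fraction \<open>A / B\<close> have the common denominator \<open>B\<^sup>n\<close>; written without fractions.\<close>
lemma almost_integral_power:
  fixes A B :: "'r::comm_ring_1"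
  assumes rel: "A ^ n + (\<Sum>i<n. c i * A ^ i * B ^ (n - i)) = 0"
  shows "B ^ k dvd B ^ n * A ^ k"
proof (induction k rule: less_induct)
  case (less k)
  show ?case
  proof (cases "k \<le> n")
    case True
    then have "B ^ n = B ^ k * B ^ (n - k)" by (simp add: power_add[symmetric])
    then show ?thesis by simp
  next
    case False
    have "A ^ n = - (\<Sum>i<n. c i * A ^ i * B ^ (n - i))" using rel by (simp add: eq_neg_iff_add_eq_0)
    moreover have "A ^ k = A ^ (k - n) * A ^ n" using False by (simp add: power_add[symmetric])
    ultimately have "B ^ n * A ^ k = - (\<Sum>i<n. c i * (B ^ n * (A ^ (k - n) * A ^ i)) * B ^ (n - i))"
      by (simp add: sum_distrib_left mult_ac)
    also have "\<dots> = - (\<Sum>i<n. c i * (B ^ n * A ^ (k - n + i)) * B ^ (n - i))"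
      by (simp add: power_add)
    finally have eq: "B ^ n * A ^ k = - (\<Sum>i<n. c i * (B ^ n * A ^ (k - n + i)) * B ^ (n - i))" .
    have "B ^ k dvd c i * (B ^ n * A ^ (k - n + i)) * B ^ (n - i)" if "i < n" for i
    proof -
      have "B ^ (k - n + i) dvd B ^ n * A ^ (k - n + i)" using less[of "k - n + i"] that False by simp
      then have "B ^ (k - n + i) * B ^ (n - i) dvd c i * (B ^ n * A ^ (k - n + i)) * B ^ (n - i)"
        by (intro mult_dvd_mono[OF dvd_mult dvd_refl])
      moreover have "B ^ (k - n + i) * B ^ (n - i) = B ^ k" using that False by (simp add: power_add[symmetric])
      ultimately show ?thesis by simp
    qed
    then show ?thesis unfolding eq dvd_minus_iff by (intro dvd_sum) auto
  qed
qed

text \<open>If all powers of \<open>A / B\<close> have the denominator \<open>B\<^sup>n\<close>, then so have those of \<open>S A / B - Q\<close>, by the binomial theorem.\<close>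
lemma almost_integral_combination:
  fixes A B :: "'r::comm_ring_1"
  assumes *: "\<And>k. B ^ k dvd B ^ n * A ^ k"
  shows "B ^ k dvd B ^ n * (S * A - B * Q) ^ k"
proof -
  have "B ^ n * (S * A + (- (B * Q))) ^ k = (\<Sum>i\<le>k. of_nat (k choose i) * S ^ i * (- Q) ^ (k - i) * ((B ^ n * A ^ i) * B ^ (k - i)))"
    by (simp add: binomial_ring sum_distrib_left power_mult_distrib minus_mult_right[of B] mult_ac del: mult_minus_right)
  also have "B ^ k dvd \<dots>"
  proof (rule dvd_sum, rule dvd_mult)
    fix i assume "i \<in> {..k}"
    then have "B ^ k = B ^ i * B ^ (k - i)" by (simp add: power_add[symmetric])
    then show "B ^ k dvd (B ^ n * A ^ i) * B ^ (k - i)" using *[of i] by (simp add: mult_dvd_mono)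
  qed
  finally show ?thesis by simp
qed

text \<open>Polynomial rings are integrally closed. Pseudo-division by \<open>b\<close> with respect to a variable \<open>v\<close> replaces the fraction by one
  whose numerator \<open>R\<close> has smaller degree than \<open>b\<close>. But the powers of that fraction have a common denominator, and for large
  exponents the degrees only fit if \<open>R = 0\<close>. So the fraction has a denominator free of \<open>v\<close>, for each \<open>v\<close>.\<close>
lemma polys_integrally_closed:
  fixes a b :: "('v::linorder, 'a::field) mpoly"
  assumes V: "finite V" "a \<in> polys V" "b \<in> polys V" "b \<noteq> 0"
    and rel: "a ^ n + (\<Sum>i<n. c i * a ^ i * b ^ (n - i)) = 0"
  shows "b dvd a"
proof (rule separately_dvd[OF V])
  fix v assume "v \<in> V"
  let ?A = "uni v a" and ?B = "uni v b"
  have B0: "?B \<noteq> 0" using V(4) uni_inj[of v b 0] by auto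
  obtain Q R where QR: "pseudo_divmod ?A ?B = (Q, R)" by fastforce
  define s where "s = lead_coeff ?B ^ (Suc (pdeg ?A) - pdeg ?B)"
  have eq: "Polynomial.smult s ?A = ?B * Q + R" and deg: "R = 0 \<or> pdeg R < pdeg ?B"
    using pseudo_divmod[OF B0 QR] by (auto simp: s_def)
  have s: "s \<in> polys (V - {v})" "s \<noteq> 0"
    using uni_coeff[OF V(3)] B0 by (auto simp: s_def intro!: polys_power)
  have "?A ^ n + (\<Sum>i<n. uni v (c i) * ?A ^ i * ?B ^ (n - i)) = 0"
    using arg_cong[OF rel, of "uni v"] by (simp add: uni.hom_add uni.hom_sum uni.hom_mult uni.hom_power)
  from almost_integral_combination[OF almost_integral_power[OF this], where S = "[:s:]" and Q = Q]
  have dv: "?B ^ k dvd ?B ^ n * R ^ k" for k using eq by simp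
  have "R = 0"
  proof (rule ccontr)
    assume R: "R \<noteq> 0"
    with deg have lt: "Suc (pdeg R) \<le> pdeg ?B" by simp
    define k where "k = Suc (n * pdeg ?B)"
    have "pdeg (?B ^ k) \<le> pdeg (?B ^ n * R ^ k)"
      using dv[of k] R B0 by (intro dvd_imp_degree_le) auto
    then have "k * pdeg ?B \<le> n * pdeg ?B + k * pdeg R"
      using R B0 by (simp add: degree_mult_eq degree_power_eq mult.commute)
    moreover have "k * Suc (pdeg R) \<le> k * pdeg ?B" using lt by (rule mult_le_mono2)
    ultimately show False by (simp add: k_def)
  qed
  with arg_cong[OF eq, of "\<lambda>P. poly P (Var v)"] have "s * a = b * poly Q (Var v)" by simp
  with s show "\<exists>s\<in>polys (V - {v}). s \<noteq> 0 \<and> b dvd s * a" by (metis dvd_triv_left)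
qed

section \<open>Ideals of polynomial rings\<close>

lemma mpoly_ring_simps [simp]:
  "carrier (mpoly_ring V) = polys V"
  "mult (mpoly_ring V) = (*)" "one (mpoly_ring V) = 1"
  "zero (mpoly_ring V) = 0" "add (mpoly_ring V) = (+)"
  by (auto simp: mpoly_ring_def polys_def)

lemma cring_mpoly_ring: "cring (mpoly_ring V :: ('v, 'a::comm_ring_1) mpoly ring)"
proof (rule cringI)
  show "abelian_group (mpoly_ring V :: ('v, 'a) mpoly ring)"
  proof (rule abelian_groupI)
    fix x :: "('v, 'a) mpoly" assume "x \<in> carrier (mpoly_ring V)"
    then show "\<exists>y\<in>carrier (mpoly_ring V). y \<oplus>\<^bsub>mpoly_ring V\<^esub> x = \<zero>\<^bsub>mpoly_ring V\<^esub>"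
      by (intro bexI[of _ "- x"]) (auto intro: polys_uminus)
  qed (auto intro: polys_add simp: add_ac)
  show "comm_monoid (mpoly_ring V :: ('v, 'a) mpoly ring)"
    by (rule comm_monoidI) (auto intro: polys_mult simp: mult_ac)
qed (auto simp: distrib_right)

lemma ring_mpoly_ring: "ring (mpoly_ring V :: ('v, 'a::comm_ring_1) mpoly ring)"
  using cring_mpoly_ring cring.axioms(1) by blast

lemma a_inv_mpoly_ring: "p \<in> polys V \<Longrightarrow> \<ominus>\<^bsub>mpoly_ring V\<^esub> p = - (p :: ('v, 'a::comm_ring_1) mpoly)"
proof -
  assume p: "p \<in> polys V"
  interpret cring "mpoly_ring V :: ('v, 'a) mpoly ring" by (rule cring_mpoly_ring)
  show ?thesis using minus_equality[of "-p" p] p by (simp add: polys_uminus)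
qed

definition is_ideal :: "'v set \<Rightarrow> ('v, 'a::comm_ring_1) mpoly set \<Rightarrow> bool" where
  "is_ideal V I \<longleftrightarrow> I \<subseteq> polys V \<and> 0 \<in> I \<and> (\<forall>a\<in>I. \<forall>b\<in>I. a + b \<in> I) \<and> (\<forall>a\<in>I. \<forall>r\<in>polys V. r * a \<in> I)"

definition is_prime :: "'v set \<Rightarrow> ('v, 'a::comm_ring_1) mpoly set \<Rightarrow> bool" where
  "is_prime V P \<longleftrightarrow> is_ideal V P \<and> 1 \<notin> P \<and>
     (\<forall>a\<in>polys V. \<forall>b\<in>polys V. a * b \<in> P \<longrightarrow> a \<in> P \<or> b \<in> P)"

lemma is_idealD:
  assumes "is_ideal V I"
  shows "a \<in> I \<Longrightarrow> a \<in> polys V" "0 \<in> I" "a \<in> I \<Longrightarrow> b \<in> I \<Longrightarrow> a + b \<in> I"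
    "a \<in> I \<Longrightarrow> r \<in> polys V \<Longrightarrow> r * a \<in> I" "a \<in> I \<Longrightarrow> r \<in> polys V \<Longrightarrow> a * r \<in> I"
    "a \<in> I \<Longrightarrow> - a \<in> I" "a \<in> I \<Longrightarrow> b \<in> I \<Longrightarrow> a - b \<in> I"
proof -
  show 1: "a \<in> I \<Longrightarrow> a \<in> polys V" "0 \<in> I" and ad: "\<And>a b. a \<in> I \<Longrightarrow> b \<in> I \<Longrightarrow> a + b \<in> I"
    and mu: "\<And>a r. a \<in> I \<Longrightarrow> r \<in> polys V \<Longrightarrow> r * a \<in> I"
    using assms by (auto simp: is_ideal_def)
  show "a \<in> I \<Longrightarrow> r \<in> polys V \<Longrightarrow> a * r \<in> I" using mu[of a r] by (simp add: mult.commute)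
  show neg: "a \<in> I \<Longrightarrow> - a \<in> I" for a using mu[of a "-1"] by (simp add: polys_uminus)
  show "a \<in> I \<Longrightarrow> b \<in> I \<Longrightarrow> a - b \<in> I" using ad[of a "-b"] neg[of b] by simp
qed

lemma is_ideal_sum: "is_ideal V I \<Longrightarrow> (\<And>i. i \<in> A \<Longrightarrow> f i \<in> I) \<Longrightarrow> sum f A \<in> I"
  by (induction A rule: infinite_finite_induct) (auto intro: is_idealD)

lemma is_prime_ideal: "is_prime V P \<Longrightarrow> is_ideal V P" by (simp add: is_prime_def)

lemma is_primeD: "is_prime V P \<Longrightarrow> a \<in> polys V \<Longrightarrow> b \<in> polys V \<Longrightarrow> a * b \<in> P \<Longrightarrow> a \<in> P \<or> b \<in> P"
  by (auto simp: is_prime_def)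

lemma is_prime_power: "is_prime V P \<Longrightarrow> a \<in> polys V \<Longrightarrow> a ^ n \<in> P \<Longrightarrow> a \<in> P"
proof (induction n)
  case 0 then show ?case by (simp add: is_prime_def)
next
  case (Suc n) then show ?case using is_primeD[of V P a "a ^ n"] polys_power[of a V n] by auto
qed

lemma ideal_iff: "ideal I (mpoly_ring V) \<longleftrightarrow> is_ideal V I"
proof
  assume "ideal I (mpoly_ring V)"
  then interpret ideal I "mpoly_ring V" .
  have as: "additive_subgroup I (mpoly_ring V)" by unfold_locales
  show "is_ideal V I"
    unfolding is_ideal_def
    using a_subset additive_subgroup.zero_closed[OF as] additive_subgroup.a_closed[OF as] I_l_closed by auto
next
  assume I: "is_ideal V I"
  interpret cring "mpoly_ring V" by (rule cring_mpoly_ring)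
  show "ideal I (mpoly_ring V)"
  proof (rule idealI)
    show "subgroup I (add_monoid (mpoly_ring V))"
    proof
      fix x assume x: "x \<in> I"
      have "inv\<^bsub>add_monoid (mpoly_ring V)\<^esub> x = - x"
        using a_inv_mpoly_ring[of x V] is_idealD(1)[OF I x] by (simp add: a_inv_def)
      then show "inv\<^bsub>add_monoid (mpoly_ring V)\<^esub> x \<in> I" using is_idealD(6)[OF I x] by simp
    qed (use I in \<open>auto simp: is_ideal_def\<close>)
  qed (use is_idealD[OF I] in \<open>auto simp: ring_mpoly_ring\<close>)
qed

lemma primeideal_iff: "primeideal P (mpoly_ring V) \<longleftrightarrow> is_prime V P"
proof
  assume "primeideal P (mpoly_ring V)"
  then interpret primeideal P "mpoly_ring V" .
  have I: "is_ideal V P" using ideal_iff is_ideal by blast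
  moreover have "1 \<notin> P"
  proof
    assume "1 \<in> P"
    then have "polys V \<subseteq> P" using is_idealD(4)[OF I] by fastforce
    then show False using I_notcarr is_idealD(1)[OF I] by auto
  qed
  ultimately show "is_prime V P" unfolding is_prime_def using I_prime by auto
next
  assume P: "is_prime V P"
  show "primeideal P (mpoly_ring V)"
    by (rule primeidealI) (use P in \<open>auto simp: ideal_iff cring_mpoly_ring is_prime_def\<close>)
qed

lemma genideal_image:
  fixes F :: "'i \<Rightarrow> ('v, 'a::comm_ring_1) mpoly"
  assumes "finite A" "\<And>i. i \<in> A \<Longrightarrow> F i \<in> polys V"
  shows "genideal (mpoly_ring V) (F ` A) = {\<Sum>i\<in>A. r i * F i | r. \<forall>i\<in>A. r i \<in> polys V}" (is "?L = ?R")
proof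
  interpret cring "mpoly_ring V" by (rule cring_mpoly_ring)
  have R: "is_ideal V ?R"
    unfolding is_ideal_def
  proof (intro conjI ballI)
    show "?R \<subseteq> polys V" using assms by (auto intro!: polys_sum polys_mult)
    show "0 \<in> ?R" by (auto intro!: exI[of _ "\<lambda>_. 0"])
  next
    fix a b :: "('v, 'a) mpoly" assume "a \<in> ?R" "b \<in> ?R"
    then obtain r s where "a = (\<Sum>i\<in>A. r i * F i)" "\<forall>i\<in>A. r i \<in> polys V"
      "b = (\<Sum>i\<in>A. s i * F i)" "\<forall>i\<in>A. s i \<in> polys V" by blast
    then show "a + b \<in> ?R"
      by (auto intro!: exI[of _ "\<lambda>i. r i + s i"] polys_add simp: distrib_right sum.distrib)
  next
    fix a c :: "('v, 'a) mpoly" assume "a \<in> ?R" "c \<in> polys V"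
    then obtain r where "a = (\<Sum>i\<in>A. r i * F i)" "\<forall>i\<in>A. r i \<in> polys V" by blast
    then show "c * a \<in> ?R" using \<open>c \<in> polys V\<close>
      by (auto intro!: exI[of _ "\<lambda>i. c * r i"] polys_mult simp: sum_distrib_left mult_ac)
  qed
  have "F ` A \<subseteq> ?R"
  proof (intro image_subsetI)
    fix i assume i: "i \<in> A"
    have "(\<Sum>j\<in>A. (if j = i then 1 else 0) * F j) = (\<Sum>j\<in>A. if j = i then F i else 0)"
      by (intro sum.cong) auto
    also have "\<dots> = F i" using i assms(1) by simp
    finally show "F i \<in> ?R" by (auto intro!: exI[of _ "\<lambda>j. if j = i then 1 else 0"])
  qed
  then show "?L \<subseteq> ?R" using R by (intro genideal_minimal) (auto simp: ideal_iff)
  have L: "is_ideal V ?L" using genideal_ideal[of "F ` A"] assms(2) by (auto simp: ideal_iff)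
  have "F i \<in> ?L" if "i \<in> A" for i using genideal_self[of "F ` A"] assms(2) that by auto
  then show "?R \<subseteq> ?L" using L by (auto intro!: is_ideal_sum[OF L] is_idealD(4)[OF L])
qed

lemma genideal_single:
  assumes "f \<in> polys V"
  shows "genideal (mpoly_ring V) {f} = {h * f | h. h \<in> polys V}"
  using genideal_image[of "{()}" "\<lambda>_. f" V] assms by auto

text \<open>A maximal ideal among those that miss a multiplicative set is prime.\<close>
lemma prime_avoiding:
  fixes I :: "('v, 'a::comm_ring_1) mpoly set"
  assumes I: "is_ideal V I" and W: "W \<subseteq> polys V" "1 \<in> W" "\<And>a b. a \<in> W \<Longrightarrow> b \<in> W \<Longrightarrow> a * b \<in> W"
    and IW: "I \<inter> W = {}"
  obtains Q where "is_prime V Q" "I \<subseteq> Q" "Q \<inter> W = {}"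
proof -
  define AA where "AA = {K :: ('v, 'a) mpoly set. is_ideal V K \<and> I \<subseteq> K \<and> K \<inter> W = {}}"
  have ex_max: "\<exists>M\<in>AA. \<forall>Y\<in>AA. M \<subseteq> Y \<longrightarrow> Y = M"
  proof (rule subset_Zorn_nonempty)
    show "AA \<noteq> {}" using I IW by (auto simp: AA_def)
    fix C assume C: "C \<noteq> {}" "subset.chain AA C"
    have id: "is_ideal V K" if "K \<in> C" for K using C that by (auto simp: subset.chain_def AA_def)
    have "is_ideal V (\<Union>C)"
      unfolding is_ideal_def
    proof (intro conjI ballI)
      show "\<Union>C \<subseteq> polys V" "0 \<in> \<Union>C" using id C(1) by (auto dest: is_idealD)
    next
      fix a b assume "a \<in> \<Union>C" "b \<in> \<Union>C"
      then obtain K where "K \<in> C" "a \<in> K" "b \<in> K" using C(2) by (fastforce simp: subset.chain_def)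
      then show "a + b \<in> \<Union>C" using id[of K] is_idealD(3) by blast
    next
      fix a r :: "('v, 'a) mpoly" assume "a \<in> \<Union>C" "r \<in> polys V"
      then show "r * a \<in> \<Union>C" using id is_idealD(4) by blast
    qed
    moreover obtain K0 where "K0 \<in> C" using C(1) by blast
    then have "I \<subseteq> \<Union>C" "\<Union>C \<inter> W = {}" using C(2) by (auto simp: subset.chain_def AA_def)
    ultimately show "\<Union>C \<in> AA" by (simp add: AA_def)
  qed
  then obtain M where M: "is_ideal V M" "I \<subseteq> M" "M \<inter> W = {}"
    and max: "\<And>Y. is_ideal V Y \<Longrightarrow> M \<subseteq> Y \<Longrightarrow> Y \<inter> W = {} \<Longrightarrow> Y = M" by (auto simp: AA_def)
  have ex: "\<exists>m\<in>M. \<exists>r\<in>polys V. m + r * a \<in> W" if a: "a \<in> polys V" "a \<notin> M" for a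
  proof -
    let ?Y = "{m + r * a | m r. m \<in> M \<and> r \<in> polys V}"
    have "is_ideal V ?Y"
      unfolding is_ideal_def
    proof (intro conjI ballI)
      show "?Y \<subseteq> polys V" using a is_idealD(1)[OF M(1)] by (auto intro!: polys_add polys_mult)
      show "0 \<in> ?Y" using is_idealD(2)[OF M(1)] by (auto intro!: exI[of _ 0])
    next
      fix x y :: "('v, 'a) mpoly" assume "x \<in> ?Y" "y \<in> ?Y"
      then obtain m r m' r' where "x = m + r * a" "m \<in> M" "r \<in> polys V" "y = m' + r' * a" "m' \<in> M" "r' \<in> polys V"
        by blast
      then show "x + y \<in> ?Y" using is_idealD(3)[OF M(1)]
        by (intro CollectI exI[of _ "m + m'"] exI[of _ "r + r'"]) (auto intro!: polys_add simp: algebra_simps)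
    next
      fix x s :: "('v, 'a) mpoly" assume "x \<in> ?Y" "s \<in> polys V"
      then obtain m r where "x = m + r * a" "m \<in> M" "r \<in> polys V" by blast
      then show "s * x \<in> ?Y" using is_idealD(4)[OF M(1)] \<open>s \<in> polys V\<close>
        by (intro CollectI exI[of _ "s * m"] exI[of _ "s * r"]) (auto intro!: polys_mult simp: algebra_simps)
    qed
    moreover have "M \<subseteq> ?Y"
    proof
      fix m assume "m \<in> M" then show "m \<in> ?Y" by (intro CollectI exI[of _ m] exI[of _ 0]) auto
    qed
    moreover have "a \<in> ?Y" using is_idealD(2)[OF M(1)] by (intro CollectI exI[of _ 0] exI[of _ 1]) auto
    ultimately have "?Y \<inter> W \<noteq> {}" using max[of ?Y] a(2) by blast
    then show ?thesis by blast
  qed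
  have "is_prime V M"
    unfolding is_prime_def
  proof (intro conjI ballI impI)
    show "is_ideal V M" "1 \<notin> M" using M W by auto
    fix a b assume ab: "a \<in> polys V" "b \<in> polys V" "a * b \<in> M"
    show "a \<in> M \<or> b \<in> M"
    proof (rule ccontr)
      assume "\<not> (a \<in> M \<or> b \<in> M)"
      then obtain m r m' r' where h: "m \<in> M" "r \<in> polys V" "m + r * a \<in> W" "m' \<in> M" "r' \<in> polys V" "m' + r' * b \<in> W"
        using ex[OF ab(1)] ex[OF ab(2)] by blast
      have "(m + r * a) * (m' + r' * b) = m' * (m + r * a) + (r' * b) * m + (r * r') * (a * b)"
        by (simp add: algebra_simps)
      moreover have "m' * (m + r * a) \<in> M" using is_idealD(5)[OF M(1) h(4)] h(3) W(1) by blast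
      moreover have "(r' * b) * m \<in> M" by (rule is_idealD(4)[OF M(1) h(1) polys_mult[OF h(5) ab(2)]])
      moreover have "(r * r') * (a * b) \<in> M" by (rule is_idealD(4)[OF M(1) ab(3) polys_mult[OF h(2,5)]])
      ultimately have "(m + r * a) * (m' + r' * b) \<in> M" using is_idealD(3)[OF M(1)] by metis
      then show False using W(3)[OF h(3,6)] M(3) by blast
    qed
  qed
  with M that show thesis by blast
qed

lemma prime_avoiding_polys:
  fixes I :: "('v::linorder, 'a::field) mpoly set"
  assumes "is_ideal V I" "U \<subseteq> V" "\<And>s. s \<in> I \<Longrightarrow> s \<in> polys U \<Longrightarrow> s = 0"
  obtains Q where "is_prime V Q" "I \<subseteq> Q" "Q \<inter> polys U \<subseteq> {0}"
proof (rule prime_avoiding[OF assms(1), of "polys U - {0}"])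
  show "polys U - {0} \<subseteq> (polys V :: ('v, 'a) mpoly set)" using polys_mono[OF assms(2)] by auto
next
  fix Q assume "is_prime V Q" "I \<subseteq> Q" "Q \<inter> (polys U - {0}) = {}"
  then show thesis by (intro that[of Q]) auto
qed (use assms(3) in \<open>auto intro: polys_mult\<close>)

section \<open>Chains of primes and growth of quotients\<close>

definition box :: "'v set \<Rightarrow> nat \<Rightarrow> ('v, 'a::comm_ring_1) mpoly set" where
  "box V n = {p \<in> polys V. \<forall>t\<in>mkeys p. \<forall>v. lkp t v \<le> n}"

lemma box_mult: "p \<in> box V m \<Longrightarrow> q \<in> box V n \<Longrightarrow> p * q \<in> box V (m + n)"
proof -
  assume p: "p \<in> box V m" and q: "q \<in> box V n"
  have "lkp t v \<le> m + n" if t: "t \<in> mkeys (p * q)" for t v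
  proof -
    obtain a b where "t = a + b" "a \<in> mkeys p" "b \<in> mkeys q" using t keys_mult[of p q] by blast
    then show ?thesis using p q by (auto simp: box_def lookup_add intro: add_mono)
  qed
  then show ?thesis using p q by (auto simp: box_def polys_mult)
qed

lemma box_mono: "m \<le> n \<Longrightarrow> p \<in> box V m \<Longrightarrow> p \<in> box V n"
  by (auto simp: box_def) (meson order_trans)

lemma box_1: "1 \<in> box V n"
  by (auto simp: box_def)

lemma box_power: "p \<in> box V n \<Longrightarrow> p ^ k \<in> box V (k * n)"
  by (induction k) (auto simp: box_1 intro: box_mult)

lemma lkp_le_mon_deg: "lkp t v \<le> mon_deg t"
proof (cases "v \<in> mkeys t")
  case True
  then show ?thesis unfolding mon_deg_def by (intro member_le_sum) auto
qed (simp add: in_keys_iff)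

lemma ex_box: "p \<in> polys V \<Longrightarrow> \<exists>e. p \<in> box V e"
proof -
  assume p: "p \<in> polys V"
  have "lkp t v \<le> (\<Sum>t\<in>mkeys p. mon_deg t)" if "t \<in> mkeys p" for t v
    using lkp_le_mon_deg[of t v] member_le_sum[OF that, of mon_deg] by (meson finite_keys le0 order_trans)
  then show ?thesis using p by (auto simp: box_def)
qed

definition indep_mod :: "('v, 'a::comm_ring_1) mpoly set \<Rightarrow> nat \<Rightarrow> (nat \<Rightarrow> ('v, 'a) mpoly) \<Rightarrow> bool" where
  "indep_mod P n F \<longleftrightarrow> (\<forall>c. (\<Sum>i<n. Const (c i) * F i) \<in> P \<longrightarrow> (\<forall>i<n. c i = 0))"

text \<open>Modulo \<open>P\<close>, the polynomials with exponents of order \<open>D\<close> span at least \<open>D\<^sup>d\<close> dimensions. This counting version of the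
  transcendence degree of the quotient ring bounds lengths of chains of primes from above.\<close>
definition growth :: "'v set \<Rightarrow> ('v, 'a::comm_ring_1) mpoly set \<Rightarrow> nat \<Rightarrow> bool" where
  "growth V P d \<longleftrightarrow> (\<exists>s. \<forall>D. \<exists>F. (\<forall>i<D ^ d. F i \<in> box V (s * D)) \<and> indep_mod P (D ^ d) F)"

text \<open>With \<open>g\<close> in \<open>Q\<close> but not in \<open>P\<close>, the products of \<open>1, g, \<dots>, g\<^sup>D\<^sup>-\<^sup>1\<close> with elements that are independent modulo \<open>Q\<close>
  are independent modulo \<open>P\<close>: reducing a relation modulo \<open>Q\<close> kills its terms without \<open>g\<close>, after which \<open>g\<close> cancels.\<close>
lemma growth_step:
  assumes P: "is_prime V P" and Q: "is_ideal V Q" and PQ: "P \<subset> Q" and gr: "growth V Q d"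
  shows "growth V P (Suc d)"
proof -
  obtain g where g: "g \<in> Q" "g \<notin> P" using PQ by blast
  have gV: "g \<in> polys V" using is_idealD(1)[OF Q g(1)] .
  obtain e where e: "g \<in> box V e" using ex_box[OF gV] by blast
  obtain s where s: "\<And>D. \<exists>F. (\<forall>i<D ^ d. F i \<in> box V (s * D)) \<and> indep_mod Q (D ^ d) F"
    using gr by (auto simp: growth_def)
  have PI: "is_ideal V P" using P by (simp add: is_prime_def)
  have "\<exists>F. (\<forall>i<D ^ Suc d. F i \<in> box V ((s + e) * D)) \<and> indep_mod P (D ^ Suc d) F" for D
  proof -
    obtain F where F: "\<And>i. i < D ^ d \<Longrightarrow> F i \<in> box V (s * D)" "indep_mod Q (D ^ d) F" using s by blast
    define n where "n = D ^ d"
    define F' where "F' k = g ^ (k div n) * F (k mod n)" for k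
    have main: "(\<Sum>m<K. g ^ m * (\<Sum>i<n. Const (c m i) * F i)) \<in> P \<Longrightarrow> \<forall>m<K. \<forall>i<n. c m i = 0" for K c
    proof (induction K arbitrary: c)
      case (Suc K)
      define B where "B m = (\<Sum>i<n. Const (c m i) * F i)" for m
      have BV: "B m \<in> polys V" for m using F(1) by (auto simp: B_def n_def box_def intro!: polys_sum polys_mult)
      define S where "S = (\<Sum>m<K. g ^ m * B (Suc m))"
      have SV: "S \<in> polys V" using BV gV by (auto simp: S_def intro!: polys_sum polys_mult polys_power)
      have "(\<Sum>m<Suc K. g ^ m * B m) = B 0 + g * S"
        by (subst sum.lessThan_Suc_shift) (simp add: S_def sum_distrib_left mult_ac)
      then have in_P: "B 0 + g * S \<in> P" using Suc.prems by (simp add: B_def)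
      then have "B 0 + g * S \<in> Q" using PQ by blast
      moreover have "g * S \<in> Q" using is_idealD(5)[OF Q g(1) SV] .
      ultimately have "B 0 + g * S - g * S \<in> Q" using is_idealD(7)[OF Q] by blast
      then have "B 0 \<in> Q" by simp
      then have c0: "\<forall>i<n. c 0 i = 0" using F(2) by (auto simp: indep_mod_def B_def n_def)
      then have "B 0 = 0" by (simp add: B_def)
      with in_P have "g * S \<in> P" by simp
      then have "S \<in> P" using is_primeD[OF P gV SV] g(2) by blast
      then have "\<forall>m<K. \<forall>i<n. c (Suc m) i = 0" unfolding S_def B_def by (rule Suc.IH)
      with c0 show ?case by (auto simp: less_Suc_eq_0_disj)
    qed auto
    have "indep_mod P (D * n) F'"
      unfolding indep_mod_def
    proof (intro allI impI)
      fix c i assume h: "(\<Sum>i<D * n. Const (c i) * F' i) \<in> P" and i: "i < D * n"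
      have "(\<Sum>i<D * n. Const (c i) * F' i) = (\<Sum>m<D. sum (\<lambda>i. Const (c i) * F' i) {m * n..<m * n + n})"
        by (rule sum.nat_group[symmetric])
      also have "\<dots> = (\<Sum>m<D. g ^ m * (\<Sum>i<n. Const (c (m * n + i)) * F i))"
      proof (rule sum.cong[OF refl])
        fix m
        have "sum (\<lambda>i. Const (c i) * F' i) {m * n..<m * n + n} = (\<Sum>i<n. Const (c (m * n + i)) * F' (m * n + i))"
          using sum.shift_bounds_nat_ivl[of "\<lambda>i. Const (c i) * F' i" 0 "m * n" n]
          by (simp add: lessThan_atLeast0 add.commute)
        also have "\<dots> = g ^ m * (\<Sum>i<n. Const (c (m * n + i)) * F i)"
          by (auto simp: F'_def sum_distrib_left mult_ac intro!: sum.cong)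
        finally show "sum (\<lambda>i. Const (c i) * F' i) {m * n..<m * n + n} = g ^ m * (\<Sum>i<n. Const (c (m * n + i)) * F i)" .
      qed
      finally have "(\<Sum>m<D. g ^ m * (\<Sum>i<n. Const (c (m * n + i)) * F i)) \<in> P" using h by simp
      then have "\<forall>m<D. \<forall>i<n. c (m * n + i) = 0" by (rule main)
      moreover have "i div n < D" using i by (simp add: less_mult_imp_div_less)
      moreover have "i mod n < n" using i by (cases n) auto
      ultimately have "c (i div n * n + i mod n) = 0" by blast
      then show "c i = 0" by simp
    qed
    moreover have "F' k \<in> box V ((s + e) * D)" if k: "k < D * n" for k
    proof -
      have "k div n < D" using k by (simp add: less_mult_imp_div_less)
      moreover have "k mod n < n" using k by (cases n) auto
      ultimately have "F' k \<in> box V ((k div n) * e + s * D)"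
        unfolding F'_def by (intro box_mult box_power e F(1)) (simp add: n_def)
      moreover have "(k div n) * e + s * D \<le> (s + e) * D"
        using mult_le_mono1[of "k div n" D e] \<open>k div n < D\<close> by (simp add: algebra_simps)
      ultimately show ?thesis using box_mono by blast
    qed
    ultimately show ?thesis by (intro exI[of _ F']) (simp add: n_def)
  qed
  then show ?thesis unfolding growth_def by blast
qed

lemma card_bounded_monomials:
  assumes U: "finite U"
  shows "finite {t :: 'v \<Rightarrow>\<^sub>0 nat. mkeys t \<subseteq> U \<and> (\<forall>v\<in>U. lkp t v < D)}" (is "finite ?T")
    and "card {t :: 'v \<Rightarrow>\<^sub>0 nat. mkeys t \<subseteq> U \<and> (\<forall>v\<in>U. lkp t v < D)} = D ^ card U"
proof -
  have bij: "bij_betw (\<lambda>t. restrict (lkp t) U) ?T (U \<rightarrow>\<^sub>E {..<D})"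
  proof (rule bij_betwI')
    fix s t assume s: "s \<in> ?T" and t: "t \<in> ?T"
    show "(restrict (lkp s) U = restrict (lkp t) U) = (s = t)"
    proof
      assume eq: "restrict (lkp s) U = restrict (lkp t) U"
      show "s = t"
      proof (rule poly_mapping_eqI)
        fix v show "lkp s v = lkp t v"
        proof (cases "v \<in> U")
          case True then show ?thesis using fun_cong[OF eq, of v] by simp
        next
          case False
          then have "v \<notin> mkeys s" "v \<notin> mkeys t" using s t by auto
          then show ?thesis by (simp add: in_keys_iff)
        qed
      qed
    qed auto
  next
    fix t assume "t \<in> ?T" then show "restrict (lkp t) U \<in> U \<rightarrow>\<^sub>E {..<D}" by auto
  next
    fix h assume h: "h \<in> U \<rightarrow>\<^sub>E {..<D}"
    define t where "t = Abs_poly_mapping (\<lambda>v. if v \<in> U then h v else 0)"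
    have "finite {v. (if v \<in> U then h v else 0) \<noteq> 0}"
      by (rule finite_subset[OF _ U]) auto
    then have l: "lkp t = (\<lambda>v. if v \<in> U then h v else 0)" by (simp add: t_def)
    then have "t \<in> ?T" using h by (auto simp: in_keys_iff PiE_iff split: if_splits)
    moreover have "h = restrict (lkp t) U" using h by (auto simp: l PiE_iff extensional_def)
    ultimately show "\<exists>t\<in>?T. h = restrict (lkp t) U" by blast
  qed
  have PE: "finite (U \<rightarrow>\<^sub>E {..<D})" "card (U \<rightarrow>\<^sub>E {..<D}) = D ^ card U"
    by (rule finite_PiE) (use U in \<open>simp_all add: card_PiE\<close>)
  show "finite ?T" using bij_betw_finite[OF bij] PE(1) by simp
  show "card ?T = D ^ card U" using bij_betw_same_card[OF bij] PE(2) by simp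
qed

lemma vector_space_mpoly: "vector_space (\<lambda>(c::'a::field) (p::('v, 'a) mpoly). Const c * p)"
  by unfold_locales (auto simp: Const_add Const_mult algebra_simps)

lemma indep_box_bound:
  fixes F :: "nat \<Rightarrow> ('v, 'a::field) mpoly"
  assumes V: "finite V" and F: "\<And>i. i < n \<Longrightarrow> F i \<in> box V k" and ind: "indep_mod {0} n F"
  shows "n \<le> Suc k ^ card V"
proof -
  interpret mp: vector_space "\<lambda>(c::'a) (p::('v, 'a) mpoly). Const c * p" by (rule vector_space_mpoly)
  let ?T = "{t :: 'v \<Rightarrow>\<^sub>0 nat. mkeys t \<subseteq> V \<and> (\<forall>v\<in>V. lkp t v < Suc k)}"
  let ?M = "(\<lambda>t. msingle t (1::'a)) ` ?T"
  have inj: "inj_on F {..<n}"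
  proof (rule inj_onI)
    fix i j assume ij: "i \<in> {..<n}" "j \<in> {..<n}" "F i = F j"
    show "i = j"
    proof (rule ccontr)
      assume ne: "i \<noteq> j"
      let ?c = "\<lambda>l. if l = i then 1 else if l = j then -1 else (0::'a)"
      have "(\<Sum>l<n. Const (?c l) * F l) = (\<Sum>l<n. (if l = i then F i else 0) + (if l = j then - F j else 0))"
        using ne by (intro sum.cong refl) (auto simp: Const_uminus)
      also have "\<dots> = 0" using ij by (simp add: sum.distrib)
      finally show False using ind[unfolded indep_mod_def, rule_format, of ?c i] ij(1) by simp
    qed
  qed
  have "\<not> mp.dependent (F ` {..<n})"
  proof
    assume "mp.dependent (F ` {..<n})"
    then obtain u where u: "\<exists>v\<in>F ` {..<n}. u v \<noteq> 0" "(\<Sum>v\<in>F ` {..<n}. Const (u v) * v) = 0"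
      by (auto simp: mp.dependent_finite)
    have "(\<Sum>i<n. Const (u (F i)) * F i) = 0" using u(2) by (simp add: sum.reindex[OF inj])
    then have "\<forall>i<n. u (F i) = 0" using ind by (auto simp: indep_mod_def)
    with u(1) show False by auto
  qed
  moreover have "F ` {..<n} \<subseteq> mp.span ?M"
  proof (intro image_subsetI)
    fix i assume "i \<in> {..<n}"
    then have Fi: "F i \<in> box V k" using F by simp
    have "(\<Sum>t\<in>mkeys (F i). Const (lkp (F i) t) * msingle t 1) \<in> mp.span ?M"
    proof (intro mp.span_sum mp.span_scale mp.span_base imageI)
      fix t assume "t \<in> mkeys (F i)"
      then show "t \<in> ?T" using Fi by (auto simp: box_def polys_iff less_Suc_eq_le)
    qed
    also have "(\<Sum>t\<in>mkeys (F i). Const (lkp (F i) t) * msingle t 1) = F i"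
      by (subst (3) mpoly_sum_singles[symmetric]) (simp add: Const_def mult_single)
    finally show "F i \<in> mp.span ?M" .
  qed
  ultimately have "card (F ` {..<n}) \<le> card ?M"
    using card_bounded_monomials(1)[OF V, of "Suc k"] by (intro conjunct2[OF mp.independent_span_bound]) auto
  also have "card ?M \<le> card ?T" using card_bounded_monomials(1)[OF V, of "Suc k"] by (rule card_image_le)
  also have "card ?T = Suc k ^ card V" by (rule card_bounded_monomials(2)[OF V])
  finally show ?thesis by (simp add: card_image[OF inj])
qed

text \<open>There are only \<open>(s D + 1)\<^sup>n\<close> monomials in \<open>n\<close> variables with exponents up to \<open>s D\<close>, which is less than \<open>D\<^sup>n\<^sup>+\<^sup>1\<close> for large \<open>D\<close>.\<close>
lemma growth_le_card:
  fixes P :: "('v, 'a::field) mpoly set"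
  assumes V: "finite V" and P: "0 \<in> P" and gr: "growth V P d"
  shows "d \<le> card V"
proof (rule ccontr)
  assume "\<not> d \<le> card V"
  then have d: "Suc (card V) \<le> d" by simp
  obtain s where s: "\<And>D. \<exists>F. (\<forall>i<D ^ d. F i \<in> box V (s * D)) \<and> indep_mod P (D ^ d) F"
    using gr by (auto simp: growth_def)
  define D where "D = Suc (Suc s ^ card V)"
  obtain F where F: "\<forall>i<D ^ d. F i \<in> box V (s * D)" "indep_mod P (D ^ d) F" using s by blast
  have "indep_mod {0} (D ^ d) F" using F(2) P by (auto simp: indep_mod_def)
  then have "D ^ d \<le> Suc (s * D) ^ card V" using indep_box_bound[OF V] F(1) by blast
  also have "\<dots> \<le> (Suc s * D) ^ card V" by (intro power_mono) (auto simp: D_def)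
  also have "\<dots> = Suc s ^ card V * D ^ card V" by (rule power_mult_distrib)
  finally have 1: "D ^ d \<le> Suc s ^ card V * D ^ card V" .
  have "D ^ Suc (card V) \<le> D ^ d" using d by (intro power_increasing) (auto simp: D_def)
  from order_trans[OF this 1] have "D * D ^ card V \<le> Suc s ^ card V * D ^ card V" by (simp only: power_Suc)
  moreover have "0 < D ^ card V" by (simp add: D_def)
  ultimately have "D \<le> Suc s ^ card V" by (simp only: mult_le_cancel2)
  then show False by (simp add: D_def)
qed

text \<open>The monomials in variables that are independent modulo \<open>P\<close> provide the growth.\<close>
lemma growth_polys:
  fixes P :: "('v, 'a::comm_ring_1) mpoly set"
  assumes U: "finite U" "U \<subseteq> V" and P: "P \<inter> polys U \<subseteq> {0}"
  shows "growth V P (card U)"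
  unfolding growth_def
proof (intro exI[of _ 1] allI)
  fix D
  let ?T = "{t :: 'v \<Rightarrow>\<^sub>0 nat. mkeys t \<subseteq> U \<and> (\<forall>v\<in>U. lkp t v < D)}"
  obtain h where h: "bij_betw h {0..<D ^ card U} ?T"
    using ex_bij_betw_nat_finite[OF card_bounded_monomials(1)[OF U(1), of D]]
    unfolding card_bounded_monomials(2)[OF U(1)] by blast
  have hT: "h i \<in> ?T" if "i < D ^ card U" for i
    by (rule bspec[OF bij_betwE[OF h]]) (use that in simp)
  define F where "F i = msingle (h i) (1::'a)" for i
  have F_polys: "F i \<in> polys U" if "i < D ^ card U" for i using hT[OF that] by (auto simp: F_def polys_iff)
  have "F i \<in> box V (1 * D)" if "i < D ^ card U" for i
  proof -
    have "lkp (h i) v \<le> D" for v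
    proof (cases "v \<in> U")
      case False
      then have "v \<notin> mkeys (h i)" using hT[OF that] by blast
      then show ?thesis by (simp add: in_keys_iff)
    qed (use hT[OF that] in \<open>auto intro: less_imp_le\<close>)
    then show ?thesis using polys_mono[OF U(2) F_polys[OF that]] by (auto simp: box_def F_def)
  qed
  moreover have "indep_mod P (D ^ card U) F"
    unfolding indep_mod_def
  proof (intro allI impI)
    fix c i assume h1: "(\<Sum>i<D ^ card U. Const (c i) * F i) \<in> P" and i: "i < D ^ card U"
    have "(\<Sum>i<D ^ card U. Const (c i) * F i) \<in> polys U" using F_polys by (auto intro!: polys_sum polys_mult)
    with h1 P have z: "(\<Sum>i<D ^ card U. Const (c i) * F i) = 0" by blast
    have "c i = (\<Sum>j<D ^ card U. if j = i then c j else 0)" using i by simp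
    also have "\<dots> = (\<Sum>j<D ^ card U. lkp (Const (c j) * F j) (h i))"
    proof (rule sum.cong[OF refl])
      fix j assume "j \<in> {..<D ^ card U}"
      then have "h j = h i \<longleftrightarrow> j = i" using h i by (auto simp: bij_betw_def inj_on_def)
      then show "(if j = i then c j else 0) = lkp (Const (c j) * F j) (h i)"
        by (auto simp: F_def lookup_Const_mult lookup_single when_def)
    qed
    also have "\<dots> = lkp (\<Sum>j<D ^ card U. Const (c j) * F j) (h i)" by (simp add: lookup_sum)
    finally show "c i = 0" by (simp add: z)
  qed
  ultimately show "\<exists>F. (\<forall>i<D ^ card U. F i \<in> box V (1 * D)) \<and> indep_mod P (D ^ card U) F" by blast
qed

definition pchain :: "'v set \<Rightarrow> nat \<Rightarrow> (nat \<Rightarrow> ('v, 'a::comm_ring_1) mpoly set) \<Rightarrow> bool" where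
  "pchain V n C \<longleftrightarrow> (\<forall>i\<le>n. is_prime V (C i)) \<and> (\<forall>i<n. C i \<subset> C (Suc i))"

lemma pchain_growth:
  fixes C :: "nat \<Rightarrow> ('v, 'a::field) mpoly set"
  assumes C: "pchain V n C" and gr: "growth V (C n) d" and V: "finite V"
  shows "n + d \<le> card V"
proof -
  have "i \<le> n \<Longrightarrow> growth V (C (n - i)) (i + d)" for i
  proof (induction i)
    case (Suc i)
    have eq: "n - i = Suc (n - Suc i)" using Suc by simp
    have "is_prime V (C (n - Suc i))" "is_prime V (C (n - i))" "C (n - Suc i) \<subset> C (n - i)"
      using C Suc.prems unfolding pchain_def eq by auto
    then show ?case using growth_step[of V "C (n - Suc i)" "C (n - i)" "i + d"] Suc
      by (auto simp: is_prime_def)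
  qed (use gr in simp)
  from this[of n] have "growth V (C 0) (n + d)" by simp
  moreover have "0 \<in> C 0" using C by (auto simp: pchain_def is_prime_def is_ideal_def)
  ultimately show ?thesis using growth_le_card[OF V] by blast
qed

lemma height_ge: "pchain V n C \<Longrightarrow> C n = P \<Longrightarrow> enat n \<le> height (mpoly_ring V) P"
  unfolding height_def by (rule Sup_upper) (auto simp: pchain_def primeideal_iff)

lemma height_le:
  assumes "\<And>n C. pchain V n C \<Longrightarrow> C n = P \<Longrightarrow> n \<le> k"
  shows "height (mpoly_ring V) P \<le> enat k"
  unfolding height_def by (rule Sup_least) (use assms in \<open>auto simp: pchain_def primeideal_iff\<close>)

section \<open>Largest differential ideals in primes\<close>

context derivation begin

lemma D_of_nat: "D (of_nat n) = 0" by (induction n) (auto simp: D_add)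

lemma D_funpow_mult:
  "(D ^^ n) (p * q) = (\<Sum>k\<le>n. of_nat (n choose k) * ((D ^^ k) p * (D ^^ (n - k)) q))"
proof (induction n)
  case (Suc n)
  let ?a = "\<lambda>k. (D ^^ k) p" and ?b = "\<lambda>k. (D ^^ k) q"
  have "(D ^^ Suc n) (p * q) = D (\<Sum>k\<le>n. of_nat (n choose k) * (?a k * ?b (n - k)))"
    using Suc by simp
  also have "\<dots> = (\<Sum>k\<le>n. of_nat (n choose k) * (?a (Suc k) * ?b (n - k) + ?a k * ?b (Suc (n - k))))"
    by (simp add: D_sum D_mult D_of_nat)
  also have "\<dots> = (\<Sum>k\<le>n. of_nat (n choose k) * (?a (Suc k) * ?b (n - k))) + (\<Sum>k\<le>n. of_nat (n choose k) * (?a k * ?b (Suc n - k)))"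
    by (simp add: sum.distrib distrib_left Suc_diff_le)
  also have "(\<Sum>k\<le>n. of_nat (n choose k) * (?a k * ?b (Suc n - k)))
     = (\<Sum>k\<le>Suc n. of_nat (n choose k) * (?a k * ?b (Suc n - k)))" by (simp add: binomial_eq_0)
  also have "\<dots> = ?a 0 * ?b (Suc n) + (\<Sum>k\<le>n. of_nat (n choose Suc k) * (?a (Suc k) * ?b (n - k)))"
    by (subst sum.atMost_Suc_shift) simp
  also have "(\<Sum>k\<le>n. of_nat (n choose k) * (?a (Suc k) * ?b (n - k))) + \<dots>
    = ?a 0 * ?b (Suc n) + (\<Sum>k\<le>n. of_nat (Suc n choose Suc k) * (?a (Suc k) * ?b (n - k)))"
    by (simp add: sum.distrib distrib_right add.left_commute del: funpow.simps)
  also have "\<dots> = (\<Sum>k\<le>Suc n. of_nat (Suc n choose k) * (?a k * ?b (Suc n - k)))"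
    by (simp add: sum.atMost_Suc_shift del: funpow.simps binomial_Suc_Suc sum.atMost_Suc)
  finally show ?case .
qed simp

lemma D_funpow_add: "(D ^^ n) (p + q) = (D ^^ n) p + (D ^^ n) q"
  by (induction n) (auto simp: D_add)

lemma D_funpow_0: "(D ^^ n) 0 = 0" by (induction n) auto

end

text \<open>The largest differential ideal inside \<open>P\<close>. It is what supplies primes strictly below a given one.\<close>
definition stable :: "'v \<Rightarrow> ('v, 'a::comm_ring_1) mpoly set \<Rightarrow> ('v, 'a) mpoly set" where
  "stable v P = {p. \<forall>n. (partial v ^^ n) p \<in> P}"

lemma stable_subset: "stable v P \<subseteq> P"
  unfolding stable_def by (auto dest: spec[of _ 0])

lemma stable_partial: "p \<in> stable v P \<Longrightarrow> partial v p \<in> stable v P"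
  unfolding stable_def mem_Collect_eq
proof
  fix n assume "\<forall>n. (partial v ^^ n) p \<in> P"
  then have "(partial v ^^ Suc n) p \<in> P" by blast
  then show "(partial v ^^ n) (partial v p) \<in> P" by (simp add: funpow_swap1)
qed

lemma stableI: "p \<in> P \<Longrightarrow> 0 \<in> P \<Longrightarrow> partial v p = 0 \<Longrightarrow> p \<in> stable v P"
proof -
  assume h: "p \<in> P" "0 \<in> P" "partial v p = 0"
  interpret derivation "partial v" by (rule derivation_partial)
  have "(partial v ^^ n) p \<in> P" for n
    using h by (cases n) (auto simp: funpow_Suc_right D_funpow_0 simp del: funpow.simps)
  then show ?thesis by (simp add: stable_def)
qed

text \<open>If \<open>i\<close> and \<open>j\<close> are minimal with \<open>D\<^sup>i a\<close> and \<open>D\<^sup>j b\<close> outside \<open>P\<close>, then by Leibniz \<open>D\<^sup>i\<^sup>+\<^sup>j (a b)\<close> is congruent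
  modulo \<open>P\<close> to a binomial coefficient times \<open>D\<^sup>i a D\<^sup>j b\<close>, and the binomial coefficient is invertible in characteristic zero.\<close>
lemma is_prime_stable:
  fixes P :: "('v, 'a::field_char_0) mpoly set"
  assumes P: "is_prime V P"
  shows "is_prime V (stable v P)"
proof -
  interpret derivation "partial v :: ('v, 'a) mpoly \<Rightarrow> _" by (rule derivation_partial)
  have I: "is_ideal V P" by (rule is_prime_ideal[OF P])
  have pV: "(partial v ^^ n) p \<in> polys V" if "p \<in> polys V" for p :: "('v, 'a) mpoly" and n
    using that by (induction n) (auto intro: partial_polys)
  have "is_ideal V (stable v P)"
    unfolding is_ideal_def
  proof (intro conjI ballI)
    show "stable v P \<subseteq> polys V" using I by (intro subset_trans[OF stable_subset]) (simp add: is_ideal_def)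
    show "0 \<in> stable v P" using is_idealD(2)[OF I] by (auto simp: stable_def D_funpow_0)
  next
    fix a b assume "a \<in> stable v P" "b \<in> stable v P"
    then show "a + b \<in> stable v P" using is_idealD(3)[OF I] by (auto simp: stable_def D_funpow_add)
  next
    fix a r :: "('v, 'a) mpoly" assume a: "a \<in> stable v P" and r: "r \<in> polys V"
    have "(partial v ^^ n) (r * a) \<in> P" for n
      unfolding D_funpow_mult
    proof (rule is_ideal_sum[OF I])
      fix k
      have "(partial v ^^ (n - k)) a \<in> P" using a by (auto simp: stable_def)
      moreover have "of_nat (n choose k) * (partial v ^^ k) r \<in> polys V"
        using polys_mult[OF polys_Const[of "of_nat (n choose k) :: 'a" V] pV[OF r]] by (simp only: Const_of_nat)
      ultimately show "of_nat (n choose k) * ((partial v ^^ k) r * (partial v ^^ (n - k)) a) \<in> P"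
        using is_idealD(4)[OF I] by (simp only: mult.assoc[symmetric])
    qed
    then show "r * a \<in> stable v P" by (simp add: stable_def)
  qed
  moreover have "1 \<notin> stable v P" using stable_subset[of v P] P by (auto simp: is_prime_def)
  moreover have "a \<in> stable v P \<or> b \<in> stable v P"
    if ab: "a \<in> polys V" "b \<in> polys V" "a * b \<in> stable v P" for a b
  proof (rule ccontr)
    assume neg: "\<not> (a \<in> stable v P \<or> b \<in> stable v P)"
    define i where "i = (LEAST i. (partial v ^^ i) a \<notin> P)"
    define j where "j = (LEAST j. (partial v ^^ j) b \<notin> P)"
    have exa: "\<exists>i. (partial v ^^ i) a \<notin> P" and exb: "\<exists>j. (partial v ^^ j) b \<notin> P"
      using neg by (auto simp: stable_def)
    have i: "(partial v ^^ i) a \<notin> P" unfolding i_def by (rule LeastI_ex[OF exa])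
    have j: "(partial v ^^ j) b \<notin> P" unfolding j_def by (rule LeastI_ex[OF exb])
    have i': "(partial v ^^ k) a \<in> P" if "k < i" for k using not_less_Least[OF that[unfolded i_def]] by blast
    have j': "(partial v ^^ k) b \<in> P" if "k < j" for k using not_less_Least[OF that[unfolded j_def]] by blast
    let ?t = "\<lambda>k. of_nat (i + j choose k) * ((partial v ^^ k) a * (partial v ^^ (i + j - k)) b)"
    have oV: "(of_nat n :: ('v, 'a) mpoly) \<in> polys V" for n
      using polys_Const[of "of_nat n :: 'a" V] by (simp add: Const_of_nat)
    have "?t k \<in> P" if "k \<in> {..i + j} - {i}" for k
    proof (cases "k < i")
      case True
      then show ?thesis using i'[OF True] pV[OF ab(2)] oV by (intro is_idealD(4,5)[OF I]) auto
    next
      case False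
      then have "i + j - k < j" using that by auto
      then show ?thesis using j' pV[OF ab(1)] oV by (intro is_idealD(4)[OF I]) auto
    qed
    then have rest: "(\<Sum>k\<in>{..i + j} - {i}. ?t k) \<in> P" by (rule is_ideal_sum[OF I])
    have total: "(\<Sum>k\<le>i + j. ?t k) \<in> P" using ab(3) by (simp add: stable_def flip: D_funpow_mult)
    have "(\<Sum>k\<le>i + j. ?t k) = ?t i + (\<Sum>k\<in>{..i + j} - {i}. ?t k)"
      by (rule sum.remove) auto
    then have "?t i \<in> P" using is_idealD(7)[OF I total rest] by (simp only: add_diff_cancel_right')
    moreover have "of_nat (i + j choose i) * (Const (1 / of_nat (i + j choose i)) :: ('v, 'a) mpoly) = 1"
    proof -
      have "(of_nat (i + j choose i) :: 'a) \<noteq> 0" by simp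
      then show ?thesis by (simp add: Const_of_nat[symmetric] Const_mult[symmetric])
    qed
    moreover have "Const (1 / of_nat (i + j choose i)) * ?t i = of_nat (i + j choose i) * Const (1 / of_nat (i + j choose i)) * ((partial v ^^ i) a * (partial v ^^ j) b)"
      by (simp only: mult_ac add_diff_cancel_left')
    ultimately have "(partial v ^^ i) a * (partial v ^^ j) b \<in> P"
      using is_idealD(4)[OF I, of "?t i" "Const (1 / of_nat (i + j choose i))"] by simp
    then show False using is_primeD[OF P pV[OF ab(1)] pV[OF ab(2)]] i j by blast
  qed
  ultimately show ?thesis unfolding is_prime_def by blast
qed

lemma is_prime_zero: "is_prime V {0 :: ('v::linorder, 'a::field) mpoly}"
  by (auto simp: is_prime_def is_ideal_def)

text \<open>The chain is \<open>0\<close>, \<open>stable v (stable w P)\<close>, \<open>stable w P\<close>, \<open>P\<close>. The three given elements of \<open>P\<close> witness the strictness of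
  the inclusions: derivatives decide how far down an element survives.\<close>
lemma chain_of_length_3:
  fixes P :: "('v::linorder, 'a::field_char_0) mpoly set"
  assumes P: "is_prime V P" and p: "p1 \<in> P" "p2 \<in> P" "p3 \<in> P"
    and p3: "partial w (partial w p3) \<notin> P"
    and p2: "partial w p2 = 0" "partial v p2 \<notin> P"
    and p1: "partial w p1 = 0" "partial v p1 = 0" "p1 \<noteq> 0"
  shows "\<exists>C. pchain V 3 C \<and> C 3 = P"
proof -
  define Q where "Q = stable w P"
  define Q' where "Q' = stable v Q"
  have Q: "is_prime V Q" unfolding Q_def by (rule is_prime_stable[OF P])
  have Q': "is_prime V Q'" unfolding Q'_def by (rule is_prime_stable[OF Q])
  have 0: "0 \<in> P" "0 \<in> Q" using is_idealD(2)[OF is_prime_ideal] P Q by auto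
  have "p3 \<notin> Q" using p3 stable_partial[of _ w P] stable_subset[of w P] by (auto simp: Q_def)
  with p(3) have QP: "Q \<subset> P" using stable_subset[of w P] by (auto simp: Q_def)
  have p2Q: "p2 \<in> Q" unfolding Q_def using p(2) 0 p2 by (intro stableI)
  have "p2 \<notin> Q'" using p2(2) stable_partial[of p2 v Q] stable_subset[of v Q] QP by (auto simp: Q'_def)
  with p2Q have Q'Q: "Q' \<subset> Q" using stable_subset[of v Q] by (auto simp: Q'_def)
  have "p1 \<in> Q'" unfolding Q'_def Q_def using p(1) 0 p1 by (intro stableI) (auto simp: Q_def)
  then have zQ': "{0} \<subset> Q'" using p1(3) is_idealD(2)[OF is_prime_ideal[OF Q']] by auto
  define C where "C i = (if i = 0 then {0} else if i = 1 then Q' else if i = 2 then Q else P)" for i :: nat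
  have "pchain V 3 C"
    unfolding pchain_def
  proof (intro conjI allI impI)
    fix i :: nat assume "i < 3"
    then have "i = 0 \<or> i = 1 \<or> i = 2" by auto
    then show "C i \<subset> C (Suc i)" using QP Q'Q zQ' by (auto simp: C_def)
  qed (auto simp: C_def is_prime_zero P Q Q')
  then show ?thesis by (intro exI[of _ C]) (auto simp: C_def)
qed

lemma partial_1 [simp]: "partial v 1 = 0"
  using partial_Const[of v 1] by simp

section \<open>Cofactors\<close>

lemma map_mat_delete:
  "i < dim_row A \<Longrightarrow> j < dim_col A \<Longrightarrow> map_mat h (mat_delete A i j) = mat_delete (map_mat h A) i j"
  by (rule eq_matI) (auto simp: mat_delete_def intro!: index_map_mat)

lemma (in comm_ring_hom) hom_cofactor:
  "i < dim_row A \<Longrightarrow> j < dim_col A \<Longrightarrow> hom (cofactor A i j) = cofactor (map_mat hom A) i j"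
  by (simp add: cofactor_def hom_mult hom_power map_mat_delete[symmetric] hom_uminus)

lemma cofactor_sym:
  assumes A: "A \<in> carrier_mat n n" "transpose_mat A = A" and ij: "i < n" "j < n"
  shows "cofactor A i j = cofactor A j i"
proof -
  have "transpose_mat (mat_delete A i j) = mat_delete (transpose_mat A) j i"
    using A(1) ij by (intro eq_matI) (auto simp: mat_delete_def)
  moreover have "mat_delete A i j \<in> carrier_mat (n - 1) (n - 1)" using A(1) by (intro carrier_matI) auto
  ultimately have "det (mat_delete A i j) = det (mat_delete A j i)" using A(2) det_transpose by metis
  then show ?thesis by (simp add: cofactor_def add.commute)
qed

lemma sum_cofactor:
  assumes A: "A \<in> carrier_mat n n" and ij: "i < n" "j < n"
  shows "(\<Sum>k<n. A $$ (i, k) * cofactor A j k) = (if i = j then det A else 0)"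
proof -
  have "(A * adj_mat A) $$ (i, j) = (\<Sum>k<n. A $$ (i, k) * cofactor A j k)"
    unfolding times_mat_def scalar_prod_def adj_mat_def using ij A by (auto intro: sum.cong)
  then show ?thesis using adj_mat(2)[OF A] ij by auto
qed

section \<open>Symmetric matrices with equal last two diagonal entries\<close>

text \<open>The variable in the matrix at the position \<open>(i, j)\<close>; positions are counted from \<open>0\<close>. The two last diagonal positions share
  one variable.\<close>
definition vx :: "nat \<Rightarrow> nat \<Rightarrow> nat \<Rightarrow> nat \<times> nat" where
  "vx m i j = (if i + 1 = m \<and> j + 1 = m then (m - 1, m - 1) else (min (i + 1) (j + 1), max (i + 1) (j + 1)))"

text \<open>The matrix of the family at the point \<open>x\<close>, over an arbitrary ring of values.\<close>
definition SM :: "nat \<Rightarrow> (nat \<times> nat \<Rightarrow> 'r) \<Rightarrow> 'r mat" where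
  "SM m x = mat m m (\<lambda>(i, j). x (vx m i j))"

lemma SM_carrier [simp]: "SM m x \<in> carrier_mat m m" by (simp add: SM_def)
lemma SM_index [simp]: "i < m \<Longrightarrow> j < m \<Longrightarrow> SM m x $$ (i, j) = x (vx m i j)" by (simp add: SM_def)
lemma SM_dim [simp]: "dim_row (SM m x) = m" "dim_col (SM m x) = m" by (simp_all add: SM_def)

lemma SC_eq_SM: "SC m = SM m Var"
  by (rule eq_matI) (auto simp: SC_def generic_symmetric_def vx_def)

lemma map_SM: "map_mat h (SM m x) = SM m (\<lambda>v. h (x v))"
  by (rule eq_matI) auto

lemma vx_commute: "vx m i j = vx m j i"
  by (auto simp: vx_def min.commute max.commute)

lemma SM_sym: "transpose_mat (SM m x) = SM m x"
  by (rule eq_matI) (auto simp: vx_commute)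

lemma vx_in_SC_vars: "m \<ge> 2 \<Longrightarrow> i < m \<Longrightarrow> j < m \<Longrightarrow> vx m i j \<in> SC_vars m"
  by (auto simp: vx_def SC_vars_def)

lemma vx_eq_offdiag:
  "i < m \<Longrightarrow> j < m \<Longrightarrow> k < m \<Longrightarrow> l < m \<Longrightarrow> i \<noteq> j \<Longrightarrow> vx m k l = vx m i j \<longleftrightarrow> (k = i \<and> l = j) \<or> (k = j \<and> l = i)"
  by (auto simp: vx_def min_def max_def split: if_splits)

lemma vx_eq_diag:
  "m \<ge> 2 \<Longrightarrow> a < m \<Longrightarrow> k < m \<Longrightarrow> l < m \<Longrightarrow> vx m k l = vx m a a \<longleftrightarrow> k = l \<and> (k = a \<or> (k \<ge> m - 2 \<and> a \<ge> m - 2))"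
  by (auto simp: vx_def min_def max_def split: if_splits)

lemma SC_vars_vx: "v \<in> SC_vars m \<Longrightarrow> \<exists>i j. i \<le> j \<and> j < m \<and> i + 1 < m \<and> v = vx m i j \<and> v = (i + 1, j + 1)"
proof -
  assume "v \<in> SC_vars m"
  then obtain a b where ab: "v = (a, b)" "1 \<le> a" "a \<le> b" "b \<le> m" "(a, b) \<noteq> (m, m)" by (auto simp: SC_vars_def)
  then show ?thesis by (intro exI[of _ "a - 1"] exI[of _ "b - 1"]) (auto simp: vx_def)
qed

lemma finite_SC_vars [simp]: "finite (SC_vars m)"
  by (rule finite_subset[of _ "{..m} \<times> {..m}"]) (auto simp: SC_vars_def)

lemma SC_vars_Suc: "m \<ge> 1 \<Longrightarrow> insert (m, m) (SC_vars m) = (SIGMA j:{1..m}. {1..j})\<inverse>"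
  by (auto simp: SC_vars_def)

lemma card_SC_vars: "m \<ge> 1 \<Longrightarrow> card (SC_vars m) = ((m + 1) choose 2) - 1"
proof -
  assume m: "m \<ge> 1"
  have "card (insert (m, m) (SC_vars m)) = card (SIGMA j:{1..m}. {1..j})"
    unfolding SC_vars_Suc[OF m] by simp
  also have "\<dots> = (\<Sum>j\<in>{1..m}. j)" by simp
  also have "\<dots> = (m + 1) choose 2" by (induction m) (auto simp: numeral_2_eq_2)
  finally have "card (insert (m, m) (SC_vars m)) = (m + 1) choose 2" .
  moreover have "(m, m) \<notin> SC_vars m" by (simp add: SC_vars_def)
  ultimately show ?thesis by simp
qed

section \<open>Masked minors\<close>

text \<open>The principal minor with rows and columns \<open>K\<close>, written as a determinant of size \<open>n\<close>.\<close>
definition masked :: "'r::comm_ring_1 mat \<Rightarrow> nat set \<Rightarrow> 'r mat" where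
  "masked A K = mat (dim_row A) (dim_col A) (\<lambda>(i, j). if i \<in> K \<and> j \<in> K then A $$ (i, j) else if i = j then 1 else 0)"

definition setrow :: "'r mat \<Rightarrow> nat \<Rightarrow> (nat \<Rightarrow> 'r) \<Rightarrow> 'r mat" where
  "setrow A a r = mat (dim_row A) (dim_col A) (\<lambda>(i, j). if i = a then r j else A $$ (i, j))"

abbreviation unitrow :: "nat \<Rightarrow> nat \<Rightarrow> 'r::comm_ring_1" where "unitrow b \<equiv> (\<lambda>l. if l = b then 1 else 0)"

lemma setrow_carrier [simp]: "A \<in> carrier_mat n n \<Longrightarrow> setrow A a r \<in> carrier_mat n n"
  by (simp add: setrow_def)

lemma masked_carrier [simp]: "A \<in> carrier_mat n n \<Longrightarrow> masked A K \<in> carrier_mat n n"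
  by (simp add: masked_def)

text \<open>Cofactors as determinants of the full size, which spares the reindexing of deleted rows and columns.\<close>
lemma det_setrow_unit:
  assumes A: "A \<in> carrier_mat n n" and "a < n" "b < n"
  shows "det (setrow A a (unitrow b)) = cofactor A a b"
proof -
  let ?S = "setrow A a (unitrow b)"
  have "det ?S = (\<Sum>j<n. ?S $$ (a, j) * cofactor ?S a j)"
    using assms by (intro laplace_expansion_row) auto
  also have "\<dots> = (\<Sum>j<n. if j = b then cofactor ?S a j else 0)"
    using assms by (intro sum.cong refl) (auto simp: setrow_def)
  also have "\<dots> = cofactor ?S a b" using assms by simp
  also have "mat_delete ?S a b = mat_delete A a b"
    using assms by (intro eq_matI) (auto simp: mat_delete_def setrow_def)
  then have "cofactor ?S a b = cofactor A a b" by (simp add: cofactor_def)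
  finally show ?thesis .
qed

lemma cofactor_masked:
  assumes A: "A \<in> carrier_mat n n" and a: "a < n" "a \<in> K"
  shows "cofactor (masked A K) a a = det (masked A (K - {a}))"
proof -
  have "masked A (K - {a}) = setrow (masked A (K - {a})) a (unitrow a)"
    using A by (intro eq_matI) (auto simp: masked_def setrow_def)
  then have "det (masked A (K - {a})) = cofactor (masked A (K - {a})) a a"
    using det_setrow_unit[OF masked_carrier[OF A] a(1) a(1)] by metis
  also have "mat_delete (masked A (K - {a})) a a = mat_delete (masked A K) a a"
    using A a by (intro eq_matI) (auto simp: mat_delete_def masked_def)
  then have "cofactor (masked A (K - {a})) a a = cofactor (masked A K) a a" by (simp add: cofactor_def)
  finally show ?thesis by simp
qed

lemma masked_all: "A \<in> carrier_mat n n \<Longrightarrow> masked A {..<n} = A"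
  by (rule eq_matI) (auto simp: masked_def)

lemma masked_none: "A \<in> carrier_mat n n \<Longrightarrow> masked A {} = 1\<^sub>m n"
  by (rule eq_matI) (auto simp: masked_def)

lemma cofactor_diag: "A \<in> carrier_mat n n \<Longrightarrow> a < n \<Longrightarrow> cofactor A a a = det (masked A ({..<n} - {a}))"
  using cofactor_masked[of A n a "{..<n}"] by (simp add: masked_all)

lemma det_swapped_units:
  assumes A: "A \<in> carrier_mat n n" and ab: "a < n" "b < n" "a \<noteq> b"
  shows "det (setrow (setrow A a (unitrow b)) b (unitrow a)) = - det (masked A ({..<n} - {a, b}))"
proof -
  let ?S = "setrow (setrow A a (unitrow a)) b (unitrow b)"
  have "setrow (setrow A a (unitrow b)) b (unitrow a) = swaprows a b ?S"
    using assms by (intro eq_matI) (auto simp: setrow_def)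
  then have "det (setrow (setrow A a (unitrow b)) b (unitrow a)) = - det ?S"
    using det_swaprows[OF ab, of ?S] A by simp
  also have "det ?S = cofactor (setrow A a (unitrow a)) b b" using A ab by (intro det_setrow_unit) auto
  also have "\<dots> = cofactor (setrow (masked A ({..<n} - {b})) a (unitrow a)) b b"
  proof -
    have "mat_delete (setrow A a (unitrow a)) b b = mat_delete (setrow (masked A ({..<n} - {b})) a (unitrow a)) b b"
      using A ab by (intro eq_matI) (auto simp: mat_delete_def masked_def setrow_def)
    then show ?thesis by (simp add: cofactor_def)
  qed
  also have "\<dots> = det (setrow (setrow (masked A ({..<n} - {b})) a (unitrow a)) b (unitrow b))"
    using A ab by (intro det_setrow_unit[symmetric]) auto
  also have "setrow (setrow (masked A ({..<n} - {b})) a (unitrow a)) b (unitrow b) = setrow (masked A ({..<n} - {b})) a (unitrow a)"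
    using A ab by (intro eq_matI) (auto simp: masked_def setrow_def)
  also have "det \<dots> = cofactor (masked A ({..<n} - {b})) a a" using A ab by (intro det_setrow_unit) auto
  also have "\<dots> = det (masked A ({..<n} - {b} - {a}))" using A ab by (intro cofactor_masked) auto
  also have "{..<n} - {b} - {a} = {..<n} - {a, b}" by auto
  finally show ?thesis .
qed

lemma masked_masked: "A \<in> carrier_mat n n \<Longrightarrow> masked (masked A K) L = masked A (K \<inter> L)"
  by (rule eq_matI) (auto simp: masked_def)

lemma masked_lessThan: "A \<in> carrier_mat n n \<Longrightarrow> masked A (K \<inter> {..<n}) = masked A K"
  by (rule eq_matI) (auto simp: masked_def)

lemma det_swapped_units_masked:
  assumes A: "A \<in> carrier_mat n n" and ab: "a < n" "b < n" "a \<noteq> b"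
  shows "det (setrow (setrow (masked A K) a (unitrow b)) b (unitrow a)) = - det (masked A (K - {a, b}))"
proof -
  have "K \<inter> ({..<n} - {a, b}) = (K - {a, b}) \<inter> {..<n}" by auto
  then show ?thesis
    using det_swapped_units[OF masked_carrier[OF A] ab, of K] masked_masked[OF A] masked_lessThan[OF A] by metis
qed

context derivation begin

lemma D_det_setrow:
  assumes A: "A \<in> carrier_mat n n"
  shows "D (det A) = (\<Sum>i<n. det (setrow A i (\<lambda>l. D (A $$ (i, l)))))"
  unfolding D_det[OF A]
  using A by (intro sum.cong refl arg_cong[of _ _ det] eq_matI) (auto simp: setrow_def)

lemma D_det_single_entry:
  assumes A: "A \<in> carrier_mat n n" and ab: "a < n" "b < n"
    and D: "\<And>k l. k < n \<Longrightarrow> l < n \<Longrightarrow> D (A $$ (k, l)) = (if k = a \<and> l = b then 1 else 0)"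
  shows "D (det A) = det (setrow A a (unitrow b))"
proof -
  have "det (setrow A i (\<lambda>l. D (A $$ (i, l)))) = (if i = a then det (setrow A a (unitrow b)) else 0)" if i: "i < n" for i
  proof (cases "i = a")
    case True
    have "setrow A i (\<lambda>l. D (A $$ (i, l))) = setrow A a (unitrow b)"
      using A ab D True by (intro eq_matI) (auto simp: setrow_def)
    then show ?thesis using True by simp
  next
    case False
    have "setrow A i (\<lambda>l. D (A $$ (i, l))) = mat\<^sub>r n n (\<lambda>k. if k = i then 0\<^sub>v n else row A k)"
      using A i D False by (intro eq_matI) (auto simp: setrow_def)
    then show ?thesis using det_row_0[OF i, of "row A"] A False by auto
  qed
  then have "D (det A) = (\<Sum>i<n. if i = a then det (setrow A a (unitrow b)) else 0)"
    unfolding D_det_setrow[OF A] by (intro sum.cong) auto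
  then show ?thesis using ab by simp
qed

lemma D_det_zero:
  assumes A: "A \<in> carrier_mat n n" 
    and D: "\<And>k l. k < n \<Longrightarrow> l < n \<Longrightarrow> D (A $$ (k, l)) = 0"
  shows "D (det A) = 0"
  unfolding D_det_cofactor[OF A] using D by (intro sum.neutral ballI) auto

lemma D_det_two_entries:
  assumes A: "A \<in> carrier_mat n n" and ab: "a < n" "b < n" "a \<noteq> b"
    and D: "\<And>k l. k < n \<Longrightarrow> l < n \<Longrightarrow> D (A $$ (k, l)) = (if (k = a \<and> l = b) \<or> (k = b \<and> l = a) then 1 else 0)"
  shows "D (det A) = det (setrow A a (unitrow b)) + det (setrow A b (unitrow a))"
proof -
  have "D (det A) = (\<Sum>i<n. \<Sum>j<n. D (A $$ (i, j)) * cofactor A i j)" by (rule D_det_cofactor[OF A])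
  also have "\<dots> = (\<Sum>i<n. \<Sum>j<n. (if i = a then if j = b then cofactor A i j else 0 else 0) + (if i = b then if j = a then cofactor A i j else 0 else 0))"
    using ab by (intro sum.cong refl) (auto simp: D)
  also have "\<dots> = (\<Sum>i<n. (if i = a then cofactor A i b else 0) + (if i = b then cofactor A i a else 0))"
    using ab by (intro sum.cong refl) (auto simp: sum.distrib)
  also have "\<dots> = cofactor A a b + cofactor A b a" using ab by (simp add: sum.distrib)
  finally show ?thesis using A ab by (simp add: det_setrow_unit)
qed

text \<open>A symmetric off-diagonal pair of entries makes the determinant quadratic in their common value, with leading coefficient
  minus the principal minor on the remaining indices.\<close>
lemma D2_det_two_entries:
  assumes A: "A \<in> carrier_mat n n" and ab: "a < n" "b < n" "a \<noteq> b"
    and D: "\<And>k l. k < n \<Longrightarrow> l < n \<Longrightarrow> D (masked A K $$ (k, l)) = (if (k = a \<and> l = b) \<or> (k = b \<and> l = a) then 1 else 0)"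
  shows "D (D (det (masked A K))) = - (2 * det (masked A (K - {a, b})))"
proof -
  let ?M = "masked A K"
  have M: "?M \<in> carrier_mat n n" using A by simp
  have Da: "D (det (setrow ?M a (unitrow b))) = det (setrow (setrow ?M a (unitrow b)) b (unitrow a))"
    using M ab by (intro D_det_single_entry) (auto simp: setrow_def D)
  have Db: "D (det (setrow ?M b (unitrow a))) = det (setrow (setrow ?M b (unitrow a)) a (unitrow b))"
    using M ab by (intro D_det_single_entry) (auto simp: setrow_def D)
  have "K - {b, a} = K - {a, b}" by auto
  then show ?thesis
    using det_swapped_units_masked[OF A ab, of K] det_swapped_units_masked[OF A ab(2,1) ab(3)[symmetric], of K]
    by (simp add: D_det_two_entries[OF M ab D] D_add Da Db)
qed

end

section \<open>The determinant of the degenerate symmetric matrix\<close>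

locale degenerate_symmetric =
  fixes m :: nat and ty :: "'a::field_char_0 itself"
  assumes m3: "m \<ge> 3"
begin

abbreviation V where "V \<equiv> SC_vars m"
abbreviation XX :: "(nat \<times> nat, 'a) mpoly mat" where "XX \<equiv> SC m"
abbreviation f :: "(nat \<times> nat, 'a) mpoly" where "f \<equiv> det (SC m)"
abbreviation C :: "nat \<Rightarrow> nat \<Rightarrow> (nat \<times> nat, 'a) mpoly" where "C \<equiv> cofactor XX"
abbreviation DK :: "nat set \<Rightarrow> (nat \<times> nat, 'a) mpoly" where "DK K \<equiv> det (masked XX K)"

lemma X_carrier [simp]: "XX \<in> carrier_mat m m" by (simp add: SC_eq_SM)
lemma X_dim [simp]: "dim_row XX = m" "dim_col XX = m" by (simp_all add: SC_eq_SM)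
lemma X_index [simp]: "i < m \<Longrightarrow> j < m \<Longrightarrow> XX $$ (i, j) = Var (vx m i j)" by (simp add: SC_eq_SM)

lemma Xij_V: "i < m \<Longrightarrow> j < m \<Longrightarrow> Var (vx m i j) \<in> polys V"
  using m3 by (intro polys_Var vx_in_SC_vars) auto

lemma C_sym: "i < m \<Longrightarrow> j < m \<Longrightarrow> C i j = C j i"
  by (rule cofactor_sym[OF X_carrier]) (auto simp: SC_eq_SM SM_sym)

lemma f_V: "f \<in> polys V" by (rule polys_det[OF X_carrier]) (simp add: Xij_V)

lemma C_V: "i < m \<Longrightarrow> j < m \<Longrightarrow> C i j \<in> polys V"
  unfolding det_setrow_unit[OF X_carrier, symmetric]
  by (rule polys_det[of _ m]) (auto simp: setrow_def Xij_V)

lemma XC: "i < m \<Longrightarrow> j < m \<Longrightarrow> (\<Sum>k<m. Var (vx m i k) * C j k) = (if i = j then f else 0)"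
  using sum_cofactor[OF X_carrier, of i j] by simp

text \<open>By Jacobi's formula the gradient consists of cofactors, one for each position of the variable; the shared variable
  yields the sum of the two last principal cofactors.\<close>
lemma partial_f: "partial v f = (\<Sum>i<m. \<Sum>j<m. (if vx m i j = v then C i j else 0))"
proof -
  interpret derivation "partial v :: (nat \<times> nat, 'a) mpoly \<Rightarrow> _" by (rule derivation_partial)
  show ?thesis unfolding D_det_cofactor[OF X_carrier]
    by (intro sum.cong refl) (auto simp: partial_Var)
qed

lemma partial_offdiag: "a < m \<Longrightarrow> b < m \<Longrightarrow> a \<noteq> b \<Longrightarrow> partial (vx m a b) f = 2 * C a b"
proof -
  assume ab: "a < m" "b < m" "a \<noteq> b"
  have "partial (vx m a b) f = (\<Sum>i<m. \<Sum>j<m. (if i = a then if j = b then C i j else 0 else 0) + (if i = b then if j = a then C i j else 0 else 0))"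
    unfolding partial_f using ab by (intro sum.cong refl) (auto simp: vx_eq_offdiag)
  also have "\<dots> = (\<Sum>i<m. (if i = a then C i b else 0) + (if i = b then C i a else 0))"
    using ab by (intro sum.cong refl) (auto simp: sum.distrib)
  also have "\<dots> = C a b + C b a" using ab by (simp add: sum.distrib)
  finally show ?thesis using C_sym[of a b] ab by simp
qed

lemma partial_diag: "a < m - 2 \<Longrightarrow> partial (vx m a a) f = C a a"
proof -
  assume a: "a < m - 2"
  have "partial (vx m a a) f = (\<Sum>i<m. \<Sum>j<m. (if i = a then if j = a then C i j else 0 else 0))"
    unfolding partial_f using a m3 by (intro sum.cong refl) (auto simp: vx_eq_diag)
  also have "\<dots> = (\<Sum>i<m. (if i = a then C i a else 0))"
    using a by (intro sum.cong refl) auto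
  also have "\<dots> = C a a" using a by simp
  finally show ?thesis .
qed

lemma partial_last: "partial (vx m (m - 2) (m - 2)) f = C (m - 2) (m - 2) + C (m - 1) (m - 1)"
proof -
  let ?a = "m - 2" and ?b = "m - 1"
  have ab: "?a < m" "?b < m" "?a \<noteq> ?b" using m3 by auto
  have "partial (vx m ?a ?a) f = (\<Sum>i<m. \<Sum>j<m. (if i = ?a then if j = ?a then C i j else 0 else 0) + (if i = ?b then if j = ?b then C i j else 0 else 0))"
    unfolding partial_f using ab m3 by (intro sum.cong refl) (auto simp: vx_eq_diag)
  also have "\<dots> = (\<Sum>i<m. (if i = ?a then C i ?a else 0) + (if i = ?b then C i ?b else 0))"
    using ab by (intro sum.cong refl) (auto simp: sum.distrib)
  also have "\<dots> = C ?a ?a + C ?b ?b" using ab by (simp add: sum.distrib)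
  finally show ?thesis .
qed

lemma ins_f: "comm_ring_hom \<phi> \<Longrightarrow> ins \<phi> x f = det (SM m x)"
proof -
  assume h: "comm_ring_hom \<phi>"
  interpret h: comm_ring_hom "ins \<phi> x" by (rule comm_ring_hom_ins[OF h])
  show ?thesis by (simp add: SC_eq_SM map_SM ins_Var[OF h] flip: h.hom_det)
qed

lemma ins_C: "comm_ring_hom \<phi> \<Longrightarrow> i < m \<Longrightarrow> j < m \<Longrightarrow> ins \<phi> x (C i j) = cofactor (SM m x) i j"
proof -
  assume h: "comm_ring_hom \<phi>" and ij: "i < m" "j < m"
  interpret h: comm_ring_hom "ins \<phi> x" by (rule comm_ring_hom_ins[OF h])
  show ?thesis using ij by (simp add: h.hom_cofactor) (simp add: SC_eq_SM map_SM ins_Var[OF h])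
qed

lemma ins_DK: "comm_ring_hom \<phi> \<Longrightarrow> ins \<phi> x (DK K) = det (masked (SM m x) K)"
proof -
  assume h: "comm_ring_hom \<phi>"
  interpret h: comm_ring_hom "ins \<phi> x" by (rule comm_ring_hom_ins[OF h])
  have "map_mat (ins \<phi> x) (masked XX K) = masked (SM m x) K"
    by (rule eq_matI) (auto simp: masked_def ins_Var[OF h])
  then show ?thesis by (simp flip: h.hom_det)
qed

section \<open>Primes containing the gradient\<close>

lemma partial_DK_zero:
  assumes "\<And>k l. k \<in> K \<Longrightarrow> l \<in> K \<Longrightarrow> k < m \<Longrightarrow> l < m \<Longrightarrow> vx m k l \<noteq> v"
  shows "partial v (DK K) = 0"
proof -
  interpret derivation "partial v :: (nat \<times> nat, 'a) mpoly \<Rightarrow> _" by (rule derivation_partial)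
  show ?thesis by (rule D_det_zero[of _ m]) (use assms in \<open>auto simp: masked_def partial_Var\<close>)
qed

lemma partial_DK_diag:
  assumes a: "a < m" "a \<notin> K" and K: "\<And>k. k \<in> K \<Longrightarrow> k < m \<Longrightarrow> vx m k k \<noteq> vx m a a"
  shows "partial (vx m a a) (DK (insert a K)) = DK K"
proof -
  interpret derivation "partial (vx m a a) :: (nat \<times> nat, 'a) mpoly \<Rightarrow> _" by (rule derivation_partial)
  have ent: "partial (vx m a a) (masked XX (insert a K) $$ (k, l)) = (if k = a \<and> l = a then 1 else 0)" if kl: "k < m" "l < m" for k l
  proof (cases "k \<in> insert a K \<and> l \<in> insert a K")
    case True
    have "vx m k l = vx m a a \<longleftrightarrow> k = a \<and> l = a"
      using True kl a K[of k] vx_eq_diag[of m a k l] m3 by auto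
    then show ?thesis using True kl by (auto simp: masked_def partial_Var)
  next
    case False
    then have "\<not> (k = a \<and> l = a)" by auto
    with False kl show ?thesis by (auto simp: masked_def)
  qed
  have "partial (vx m a a) (DK (insert a K)) = det (setrow (masked XX (insert a K)) a (unitrow a))"
    by (rule D_det_single_entry[of _ m]) (use a ent in auto)
  also have "\<dots> = cofactor (masked XX (insert a K)) a a" by (rule det_setrow_unit[of _ m]) (use a in auto)
  also have "\<dots> = DK (insert a K - {a})" by (rule cofactor_masked[of _ m]) (use a in auto)
  also have "insert a K - {a} = K" using a by auto
  finally show ?thesis .
qed

lemma partial2_DK_offdiag:
  assumes ab: "a < m" "b < m" "a \<noteq> b" "a \<notin> K" "b \<notin> K"
  shows "partial (vx m a b) (partial (vx m a b) (DK (insert a (insert b K)))) = - (2 * DK K)"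
proof -
  interpret derivation "partial (vx m a b) :: (nat \<times> nat, 'a) mpoly \<Rightarrow> _" by (rule derivation_partial)
  have eq: "insert a (insert b K) - {a, b} = K" using ab by auto
  have "partial (vx m a b) (masked XX (insert a (insert b K)) $$ (k, l)) = (if (k = a \<and> l = b) \<or> (k = b \<and> l = a) then 1 else 0)"
    if "k < m" "l < m" for k l
    using vx_eq_offdiag[OF ab(1,2) that ab(3)] that ab by (auto simp: masked_def partial_Var eq_commute[of "vx m a b"])
  from D2_det_two_entries[OF X_carrier ab(1-3) this] show ?thesis by (simp only: eq)
qed

lemma DK_nonzero: "DK K \<noteq> 0"
proof
  assume "DK K = 0"
  then have "ins (\<lambda>c::'a. c) (\<lambda>(i, j). if i = j then 1 else 0) (DK K) = 0" by (simp add: ins_0[OF comm_ring_hom_id])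
  moreover have "masked (SM m (\<lambda>(i, j). if i = j then 1 else (0::'a))) K = 1\<^sub>m m"
    by (rule eq_matI) (auto simp: masked_def vx_def split: if_splits)
  ultimately show False by (simp add: ins_DK[OF comm_ring_hom_id])
qed

text \<open>At the identity matrix with a further entry one in the upper right corner and its mirror image, only the second minor contains these
  entries, and two of its rows agree.\<close>
lemma DK_last_differ: "DK (insert (m - 2) {..<m - 2}) - DK (insert (m - 1) {..<m - 2}) \<noteq> 0"
proof
  assume h: "DK (insert (m - 2) {..<m - 2}) - DK (insert (m - 1) {..<m - 2}) = 0"
  define x where "x = (\<lambda>(i::nat, j). if i = j \<or> (i = 1 \<and> j = m) then 1 else (0::'a))"
  have "masked (SM m x) (insert (m - 2) {..<m - 2}) = 1\<^sub>m m"
    by (rule eq_matI) (use m3 in \<open>auto simp: x_def masked_def vx_def min_def max_def split: if_splits\<close>)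
  then have 1: "ins (\<lambda>c. c) x (DK (insert (m - 2) {..<m - 2})) = 1" by (simp add: ins_DK[OF comm_ring_hom_id])
  have "det (masked (SM m x) (insert (m - 1) {..<m - 2})) = 0"
  proof (rule det_identical_rows[of _ m 0 "m - 1"])
    show "row (masked (SM m x) (insert (m - 1) {..<m - 2})) 0 = row (masked (SM m x) (insert (m - 1) {..<m - 2})) (m - 1)"
      by (rule eq_vecI) (use m3 in \<open>auto simp: x_def masked_def vx_def min_def max_def split: if_splits\<close>)
  qed (use m3 in auto)
  then have 2: "ins (\<lambda>c. c) x (DK (insert (m - 1) {..<m - 2})) = 0" by (simp add: ins_DK[OF comm_ring_hom_id])
  interpret e: comm_ring_hom "ins (\<lambda>c. c) x" by (rule comm_ring_hom_ins[OF comm_ring_hom_id])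
  show False using arg_cong[OF h, of "ins (\<lambda>c. c) x"] 1 2 by (simp add: e.hom_minus ins_0[OF comm_ring_hom_id])
qed

lemma two_times_in_ideal:
  assumes "is_ideal V I" "2 * p \<in> I"
  shows "(p :: (nat \<times> nat, 'a) mpoly) \<in> I"
proof -
  have "Const (1 / 2) * (2 * p) \<in> I" using is_idealD(4)[OF assms] polys_Const by blast
  moreover have "Const (1 / 2) * (2 * p) = p"
  proof -
    have "Const (1 / 2 :: 'a) * (2 :: (nat \<times> nat, 'a) mpoly) = 1"
      by (simp flip: Const_numeral Const_mult Const_1)
    then show ?thesis by (simp flip: mult.assoc)
  qed
  ultimately show ?thesis by simp
qed

text \<open>Let \<open>K\<close> be maximal with \<open>DK K\<close> not in \<open>P\<close>. Its complement has at least two elements \<open>a\<close> and \<open>b\<close>, because \<open>f\<close> and the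
  principal cofactors lie in \<open>P\<close>. All minors on larger index sets lie in \<open>P\<close>, while their derivatives with respect to the
  variables at \<open>(a, b)\<close> and \<open>(a, a)\<close> lead back to \<open>DK K\<close>. This is a rank argument: matrices of corank two
  in a space of symmetric matrices form a set of codimension three.\<close>
theorem chain_below_prime_over_principal_cofactors:
  assumes P: "is_prime V P" and fP: "f \<in> P" and CP: "\<And>a. a < m \<Longrightarrow> C a a \<in> P"
  shows "\<exists>c. pchain V 3 c \<and> c 3 = P"
proof -
  note I = is_prime_ideal[OF P]
  let ?S = "{K. K \<subseteq> {..<m} \<and> DK K \<notin> P}"
  have fin: "finite ?S" by (rule finite_subset[of _ "Pow {..<m}"]) auto
  have "{} \<in> ?S" using P by (auto simp: masked_none[OF X_carrier] is_prime_def)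
  then have "finite (card ` ?S)" "card ` ?S \<noteq> {}" using fin by auto
  from Max_in[OF this] obtain K where K: "K \<subseteq> {..<m}" "DK K \<notin> P" "card K = Max (card ` ?S)" by auto
  have max: "DK L \<in> P" if "K \<subset> L" "L \<subseteq> {..<m}" for L
  proof (rule ccontr)
    assume "DK L \<notin> P"
    then have "card L \<le> Max (card ` ?S)" using that fin by (intro Max_ge) auto
    moreover have "card K < card L" using that finite_subset[of L "{..<m}"] by (intro psubset_card_mono) auto
    ultimately show False using K(3) by simp
  qed
  have "K \<noteq> {..<m}" using K(2) fP by (auto simp: masked_all[OF X_carrier])
  then obtain a0 where a0: "a0 < m" "a0 \<notin> K" using K(1) by auto
  have "K \<noteq> {..<m} - {a0}" using K(2) CP[OF a0(1)] cofactor_diag[OF X_carrier a0(1)] by auto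
  then obtain b0 where b0: "b0 < m" "b0 \<notin> K" "b0 \<noteq> a0" using K(1) a0 by auto
  have neg: "2 * DK K \<notin> P" "- (2 * DK K) \<notin> P"
    using two_times_in_ideal[OF I] is_idealD(6)[OF I, of "- (2 * DK K)"] K(2) by auto
  show ?thesis
  proof (cases "\<exists>a<m - 2. a \<notin> K")
    case True
    then obtain a where a: "a < m - 2" "a \<notin> K" by auto
    obtain b where b: "b < m" "b \<notin> K" "b \<noteq> a" using a0 b0 by metis
    have am: "a < m" using a by simp
    have vd: "vx m k k \<noteq> vx m a a" if "k < m" "k \<noteq> a" for k
      using that a vx_eq_diag[of m a k k] m3 by auto
    show ?thesis
    proof (rule chain_of_length_3[OF P, of "DK (insert b K)" "DK (insert a K)" "DK (insert a (insert b K))" "vx m a b" "vx m a a"])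
      show "DK (insert b K) \<in> P" "DK (insert a K) \<in> P" "DK (insert a (insert b K)) \<in> P"
        using a b am K(1) by (auto intro!: max)
      show "partial (vx m a b) (partial (vx m a b) (DK (insert a (insert b K)))) \<notin> P"
        using partial2_DK_offdiag[of a b K] a b am neg by auto
      show "partial (vx m a b) (DK (insert a K)) = 0"
        using a b am by (intro partial_DK_zero) (auto simp: vx_eq_offdiag)
      show "partial (vx m a a) (DK (insert a K)) \<notin> P"
        using partial_DK_diag[OF am a(2)] vd a K(2) by metis
      show "partial (vx m a b) (DK (insert b K)) = 0"
        using a b am by (intro partial_DK_zero) (auto simp: vx_eq_offdiag)
      show "partial (vx m a a) (DK (insert b K)) = 0"
        using a b am m3 by (intro partial_DK_zero) (auto simp: vx_eq_diag)
      show "DK (insert b K) \<noteq> 0" by (rule DK_nonzero)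
    qed
  next
    \<comment> \<open>Here \<open>a\<close> and \<open>b\<close> are the last two indices, which share their diagonal variable; the difference of the two minors is free of it.\<close>
    case False
    let ?a = "m - 2" and ?b = "m - 1"
    have ab: "?a < m" "?b < m" "?a \<noteq> ?b" using m3 by auto
    have "a0 \<ge> m - 2" "b0 \<ge> m - 2" using a0 b0 False by (meson leI)+
    then have "(a0 = ?a \<and> b0 = ?b) \<or> (a0 = ?b \<and> b0 = ?a)" using a0(1) b0(1,3) m3 by arith
    then have "?a \<notin> K" "?b \<notin> K" using a0(2) b0(2) by auto
    have "{..<m - 2} \<subseteq> K" using False by auto
    have K': "K = {..<m - 2}"
    proof -
      have "k < m - 2" if "k \<in> K" for k
      proof -
        have "k < m" "k \<noteq> ?a" "k \<noteq> ?b" using that K(1) \<open>?a \<notin> K\<close> \<open>?b \<notin> K\<close> by auto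
        then show ?thesis by linarith
      qed
      then show ?thesis using \<open>{..<m - 2} \<subseteq> K\<close> by auto
    qed
    have vab: "vx m ?b ?b = vx m ?a ?a" using vx_eq_diag[of m ?a ?b ?b] m3 by auto
    let ?v = "vx m ?a ?a" and ?w = "vx m ?a ?b"
    have da: "partial ?v (DK (insert ?a K)) = DK K"
      by (rule partial_DK_diag) (use K' m3 in \<open>auto simp: vx_eq_diag\<close>)
    have db: "partial ?v (DK (insert ?b K)) = DK K"
      unfolding vab[symmetric] by (rule partial_DK_diag) (use K' m3 in \<open>auto simp: vx_eq_diag\<close>)
    have wa: "partial ?w (DK (insert ?a K)) = 0"
      using ab K' by (intro partial_DK_zero) (auto simp: vx_eq_offdiag)
    have wb: "partial ?w (DK (insert ?b K)) = 0"
      using ab K' by (intro partial_DK_zero) (auto simp: vx_eq_offdiag)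
    have inP: "DK (insert ?a K) \<in> P" "DK (insert ?b K) \<in> P" "DK (insert ?a (insert ?b K)) \<in> P"
      using ab K(1) \<open>?a \<notin> K\<close> \<open>?b \<notin> K\<close> by (auto intro!: max)
    interpret dv: derivation "partial ?v :: (nat \<times> nat, 'a) mpoly \<Rightarrow> _" by (rule derivation_partial)
    interpret dw: derivation "partial ?w :: (nat \<times> nat, 'a) mpoly \<Rightarrow> _" by (rule derivation_partial)
    show ?thesis
    proof (rule chain_of_length_3[OF P, of "DK (insert ?a K) - DK (insert ?b K)" "DK (insert ?a K)" "DK (insert ?a (insert ?b K))" ?w ?v])
      show "DK (insert ?a K) - DK (insert ?b K) \<in> P" using inP is_idealD(7)[OF I] by blast
      show "partial ?w (partial ?w (DK (insert ?a (insert ?b K)))) \<notin> P"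
        using partial2_DK_offdiag[OF ab, of K] K' neg by auto
      show "partial ?w (DK (insert ?a K) - DK (insert ?b K)) = 0" by (simp only: dw.D_diff wa wb diff_self)
      show "partial ?v (DK (insert ?a K) - DK (insert ?b K)) = 0" by (simp only: dv.D_diff da db diff_self)
      show "DK (insert ?a K) - DK (insert ?b K) \<noteq> 0" using DK_last_differ by (simp add: K')
    qed (use inP da wa K in auto)
  qed
qed

text \<open>Only the last two principal cofactors need an argument, since just their sum is known to lie in \<open>P\<close>. If the last one were
  outside \<open>P\<close>, then \<open>X C = f I\<close> would put the whole last column of \<open>X\<close> into \<open>P\<close>, and with it the other principal
  cofactor, which is a minor containing that column.\<close>
lemma principal_cofactors_in_prime:
  assumes P: "is_prime V P"
    and off: "\<And>a b. a < m \<Longrightarrow> b < m \<Longrightarrow> a \<noteq> b \<Longrightarrow> C a b \<in> P"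
    and diag: "\<And>a. a < m - 2 \<Longrightarrow> C a a \<in> P"
    and last: "C (m - 2) (m - 2) + C (m - 1) (m - 1) \<in> P"
  shows "f \<in> P" "a < m \<Longrightarrow> C a a \<in> P"
proof -
  note I = is_prime_ideal[OF P]
  have "(\<Sum>k<m. Var (vx m 0 k) * C 0 k) \<in> P"
  proof (rule is_ideal_sum[OF I])
    fix k assume "k \<in> {..<m}"
    then have "C 0 k \<in> P" using off[of 0 k] diag[of 0] m3 by (cases "k = 0") auto
    then show "Var (vx m 0 k) * C 0 k \<in> P" using is_idealD(4)[OF I] Xij_V[of 0 k] m3 \<open>k \<in> {..<m}\<close> by auto
  qed
  then show fP: "f \<in> P" using XC[of 0 0] m3 by simp
  have last1: "C (m - 1) (m - 1) \<in> P"
  proof (rule ccontr)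
    assume c: "C (m - 1) (m - 1) \<notin> P"
    have col: "Var (vx m i (m - 1)) \<in> P" if i: "i < m" for i
    proof -
      have s1: "(\<Sum>k<m. Var (vx m i k) * C (m - 1) k) \<in> P" 
        using XC[OF i, of "m - 1"] fP is_idealD(2)[OF I] m3 by auto
      have s2: "(\<Sum>k<m - 1. Var (vx m i k) * C (m - 1) k) \<in> P"
        using off m3 i by (intro is_ideal_sum[OF I] is_idealD(4)[OF I] Xij_V) auto
      have "(\<Sum>k<m. Var (vx m i k) * C (m - 1) k) = (\<Sum>k<m - 1. Var (vx m i k) * C (m - 1) k) + Var (vx m i (m - 1)) * C (m - 1) (m - 1)"
        using m3 sum.lessThan_Suc[of _ "m - 1"] by (simp add: Suc_diff_1)
      then have "Var (vx m i (m - 1)) * C (m - 1) (m - 1) \<in> P"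
        using is_idealD(7)[OF I s1 s2] by (simp only: add_diff_cancel_left')
      moreover have m1: "m - 1 < m" using m3 by simp
      ultimately show ?thesis using is_primeD[OF P Xij_V[OF i m1] C_V[OF m1 m1]] c by blast
    qed
    let ?K = "{..<m} - {m - 2}"
    have "C (m - 2) (m - 2) = DK ?K" by (rule cofactor_diag) (use m3 in auto)
    also have "\<dots> = (\<Sum>i<m. masked XX ?K $$ (i, m - 1) * cofactor (masked XX ?K) i (m - 1))"
      by (rule laplace_expansion_column) (use m3 in auto)
    also have "\<dots> \<in> P"
    proof (rule is_ideal_sum[OF I], rule is_idealD(5)[OF I])
      fix i assume i: "i \<in> {..<m}"
      show "masked XX ?K $$ (i, m - 1) \<in> P" using i col[of i] m3 is_idealD(2)[OF I] by (auto simp: masked_def)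
      have "cofactor (masked XX ?K) i (m - 1) = det (setrow (masked XX ?K) i (unitrow (m - 1)))"
        by (rule det_setrow_unit[symmetric, of _ m]) (use i m3 in auto)
      also have "\<dots> \<in> polys V" by (rule polys_det[of _ m]) (auto simp: setrow_def masked_def Xij_V)
      finally show "cofactor (masked XX ?K) i (m - 1) \<in> polys V" .
    qed
    finally have "C (m - 2) (m - 2) \<in> P" .
    from is_idealD(7)[OF I last this] show False using c by (simp only: add_diff_cancel_left' simp_thms)
  qed
  show "C a a \<in> P" if am: "a < m"
  proof -
    consider "a < m - 2" | "a = m - 2" | "a = m - 1" using am by linarith
    then show ?thesis
    proof cases
      case 2
      then show ?thesis using is_idealD(7)[OF I last last1] by (simp only: add_diff_cancel_right')
    qed (use diag last1 in auto)
  qed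
qed

lemma chain_below_prime_over_gradient:
  assumes P: "is_prime V P" and g: "\<And>v. v \<in> V \<Longrightarrow> partial v f \<in> P"
  shows "\<exists>c. pchain V 3 c \<and> c 3 = P"
proof -
  note I = is_prime_ideal[OF P]
  have off: "C a b \<in> P" if "a < m" "b < m" "a \<noteq> b" for a b
    using g[of "vx m a b"] that vx_in_SC_vars[of m a b] m3 two_times_in_ideal[OF I] by (auto simp: partial_offdiag)
  have diag: "C a a \<in> P" if "a < m - 2" for a
    using g[of "vx m a a"] that vx_in_SC_vars[of m a a] m3 by (auto simp: partial_diag)
  have last: "C (m - 2) (m - 2) + C (m - 1) (m - 1) \<in> P"
    using g[of "vx m (m - 2) (m - 2)"] vx_in_SC_vars[of m "m - 2" "m - 2"] m3 by (auto simp: partial_last)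
  show ?thesis
    by (rule chain_below_prime_over_principal_cofactors[OF P]) (use principal_cofactors_in_prime[OF P off diag last] in auto)
qed

end

section \<open>Fractions of a domain\<close>

context domain
begin

definition fr :: "'a \<Rightarrow> 'a \<Rightarrow> ('a \<times> 'a) set" where "fr a b = fraction_class R a b"

definition nz :: "'a set" where "nz = carrier R - {\<zero>}"

lemma nzD [simp]: "b \<in> nz \<Longrightarrow> b \<in> carrier R" "b \<in> nz \<Longrightarrow> b \<noteq> \<zero>"
  unfolding nz_def by auto

lemma nz_mult [simp]: "b \<in> nz \<Longrightarrow> d \<in> nz \<Longrightarrow> b \<otimes> d \<in> nz"
  by (simp add: nz_def integral_iff del: nzD)

lemma nz_one [simp]: "\<one> \<in> nz" by (simp add: nz_def del: nzD)

lemma nz_cancel: "b \<in> nz \<Longrightarrow> x \<in> carrier R \<Longrightarrow> y \<in> carrier R \<Longrightarrow> b \<otimes> x = b \<otimes> y \<Longrightarrow> x = y"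
  using m_lcancel[of b x y] by (auto simp: nz_def simp del: nzD)

lemma fr_set: "a \<in> carrier R \<Longrightarrow> b \<in> nz \<Longrightarrow>
  fr a b = {(c, d). c \<in> carrier R \<and> d \<in> nz \<and> a \<otimes> d = c \<otimes> b}"
  by (auto simp: fr_def fraction_class_def frac_rel_def nz_def simp del: nzD)

lemma fr_eq_iff:
  assumes "a \<in> carrier R" "b \<in> nz" "c \<in> carrier R" "d \<in> nz"
  shows "fr a b = fr c d \<longleftrightarrow> a \<otimes> d = c \<otimes> b"
proof
  assume "fr a b = fr c d"
  moreover have "(c, d) \<in> fr c d" using assms by (simp add: fr_set)
  ultimately show "a \<otimes> d = c \<otimes> b" using assms by (auto simp: fr_set)
next
  assume eq: "a \<otimes> d = c \<otimes> b"
  have "a \<otimes> y = x \<otimes> b \<longleftrightarrow> c \<otimes> y = x \<otimes> d" if xy: "x \<in> carrier R" "y \<in> nz" for x y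
  proof
    assume h: "a \<otimes> y = x \<otimes> b"
    have "b \<otimes> (c \<otimes> y) = (c \<otimes> b) \<otimes> y" using assms xy by (simp add: m_ac)
    also have "\<dots> = (a \<otimes> d) \<otimes> y" by (simp only: eq)
    also have "\<dots> = (a \<otimes> y) \<otimes> d" using assms xy by (simp add: m_ac)
    also have "\<dots> = (x \<otimes> b) \<otimes> d" by (simp only: h)
    also have "\<dots> = b \<otimes> (x \<otimes> d)" using assms xy by (simp add: m_ac)
    finally show "c \<otimes> y = x \<otimes> d" using assms xy nz_cancel[of b "c \<otimes> y" "x \<otimes> d"] by auto
  next
    assume h: "c \<otimes> y = x \<otimes> d"
    have "d \<otimes> (a \<otimes> y) = (a \<otimes> d) \<otimes> y" using assms xy by (simp add: m_ac)
    also have "\<dots> = (c \<otimes> b) \<otimes> y" by (simp only: eq)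
    also have "\<dots> = (c \<otimes> y) \<otimes> b" using assms xy by (simp add: m_ac)
    also have "\<dots> = (x \<otimes> d) \<otimes> b" by (simp only: h)
    also have "\<dots> = d \<otimes> (x \<otimes> b)" using assms xy by (simp add: m_ac)
    finally show "a \<otimes> y = x \<otimes> b" using assms xy nz_cancel[of d "a \<otimes> y" "x \<otimes> b"] by auto
  qed
  then show "fr a b = fr c d" using assms by (auto simp: fr_set)
qed

lemma fr_self: "a \<in> carrier R \<Longrightarrow> b \<in> nz \<Longrightarrow> (a, b) \<in> fr a b"
  by (simp add: fr_set)

lemma fr_mult:
  assumes "a \<in> carrier R" "b \<in> nz" "c \<in> carrier R" "d \<in> nz"
  shows "fr a b \<otimes>\<^bsub>fraction_field R\<^esub> fr c d = fr (a \<otimes> c) (b \<otimes> d)"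
proof -
  have "fr (a' \<otimes> c') (b' \<otimes> d') = fr (a \<otimes> c) (b \<otimes> d)"
    if "(a', b') \<in> fr a b" "(c', d') \<in> fr c d" for a' b' c' d'
  proof -
    have h: "a' \<in> carrier R" "b' \<in> nz" "c' \<in> carrier R" "d' \<in> nz" 
      "a \<otimes> b' = a' \<otimes> b" "c \<otimes> d' = c' \<otimes> d" using that assms by (auto simp: fr_set)
    have "(a' \<otimes> c') \<otimes> (b \<otimes> d) = (a' \<otimes> b) \<otimes> (c' \<otimes> d)" using h assms by (simp add: m_ac)
    also have "\<dots> = (a \<otimes> b') \<otimes> (c \<otimes> d')" using h by simp
    also have "\<dots> = (a \<otimes> c) \<otimes> (b' \<otimes> d')" using h(1-4) assms by (simp add: m_ac)
    finally show ?thesis using h assms by (subst fr_eq_iff) auto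
  qed
  note * = this
  have "(\<Union>(a', b')\<in>fr a b. \<Union>(c', d')\<in>fr c d. fr (a' \<otimes> c') (b' \<otimes> d')) = fr (a \<otimes> c) (b \<otimes> d)"
    (is "?L = ?R")
  proof
    show "?L \<subseteq> ?R" using * by auto
    show "?R \<subseteq> ?L" using fr_self[OF assms(1,2)] fr_self[OF assms(3,4)] by blast
  qed
  then show ?thesis by (simp add: fraction_field_def fr_def)
qed

lemma fr_add:
  assumes "a \<in> carrier R" "b \<in> nz" "c \<in> carrier R" "d \<in> nz"
  shows "fr a b \<oplus>\<^bsub>fraction_field R\<^esub> fr c d = fr (a \<otimes> d \<oplus> c \<otimes> b) (b \<otimes> d)"
proof -
  have "fr (a' \<otimes> d' \<oplus> c' \<otimes> b') (b' \<otimes> d') = fr (a \<otimes> d \<oplus> c \<otimes> b) (b \<otimes> d)"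
    if "(a', b') \<in> fr a b" "(c', d') \<in> fr c d" for a' b' c' d'
  proof -
    have h: "a' \<in> carrier R" "b' \<in> nz" "c' \<in> carrier R" "d' \<in> nz" 
      "a \<otimes> b' = a' \<otimes> b" "c \<otimes> d' = c' \<otimes> d" using that assms by (auto simp: fr_set)
    have "(a' \<otimes> d' \<oplus> c' \<otimes> b') \<otimes> (b \<otimes> d) = (a' \<otimes> b) \<otimes> (d \<otimes> d') \<oplus> (c' \<otimes> d) \<otimes> (b \<otimes> b')"
      using h(1-4) assms by (simp add: m_ac l_distr r_distr)
    also have "\<dots> = (a \<otimes> b') \<otimes> (d \<otimes> d') \<oplus> (c \<otimes> d') \<otimes> (b \<otimes> b')" using h by simp
    also have "\<dots> = (a \<otimes> d \<oplus> c \<otimes> b) \<otimes> (b' \<otimes> d')" using h(1-4) assms by (simp add: m_ac l_distr r_distr)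
    finally show ?thesis using h assms by (subst fr_eq_iff) auto
  qed
  note * = this
  have "(\<Union>(a', b')\<in>fr a b. \<Union>(c', d')\<in>fr c d. fr (a' \<otimes> d' \<oplus> c' \<otimes> b') (b' \<otimes> d')) = fr (a \<otimes> d \<oplus> c \<otimes> b) (b \<otimes> d)"
    (is "?L = ?R")
  proof
    show "?L \<subseteq> ?R" using * by auto
    show "?R \<subseteq> ?L" using fr_self[OF assms(1,2)] fr_self[OF assms(3,4)] by blast
  qed
  then show ?thesis by (simp add: fraction_field_def fr_def)
qed

lemma fr_carrier: "x \<in> carrier (fraction_field R) \<longleftrightarrow> (\<exists>a b. a \<in> carrier R \<and> b \<in> nz \<and> x = fr a b)"
  by (auto simp: fraction_field_def fr_def nz_def simp del: nzD)

lemma fr_carrierE: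
  assumes "x \<in> carrier (fraction_field R)"
  obtains a b where "a \<in> carrier R" "b \<in> nz" "x = fr a b"
  using assms fr_carrier by blast

lemma fr_in_carrier [simp]: "a \<in> carrier R \<Longrightarrow> b \<in> nz \<Longrightarrow> fr a b \<in> carrier (fraction_field R)"
  using fr_carrier by blast

lemma fr_zero: "\<zero>\<^bsub>fraction_field R\<^esub> = fr \<zero> \<one>" and fr_one: "\<one>\<^bsub>fraction_field R\<^esub> = fr \<one> \<one>"
  by (simp_all add: fraction_field_def fr_def)

lemma ring_fraction_field: "ring (fraction_field R)"
proof (rule ringI)
  show "abelian_group (fraction_field R)"
  proof (rule abelian_groupI)
    fix x y assume "x \<in> carrier (fraction_field R)" "y \<in> carrier (fraction_field R)"
    then show "x \<oplus>\<^bsub>fraction_field R\<^esub> y \<in> carrier (fraction_field R)"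
      by (elim fr_carrierE) (simp add: fr_add)
  next
    show "\<zero>\<^bsub>fraction_field R\<^esub> \<in> carrier (fraction_field R)" by (simp add: fr_zero)
  next
    fix x y z assume "x \<in> carrier (fraction_field R)" "y \<in> carrier (fraction_field R)" "z \<in> carrier (fraction_field R)"
    then show "(x \<oplus>\<^bsub>fraction_field R\<^esub> y) \<oplus>\<^bsub>fraction_field R\<^esub> z = x \<oplus>\<^bsub>fraction_field R\<^esub> (y \<oplus>\<^bsub>fraction_field R\<^esub> z)"
      by (elim fr_carrierE) (simp add: fr_add fr_eq_iff l_distr r_distr a_ac m_ac)
  next
    fix x y assume "x \<in> carrier (fraction_field R)" "y \<in> carrier (fraction_field R)"
    then show "x \<oplus>\<^bsub>fraction_field R\<^esub> y = y \<oplus>\<^bsub>fraction_field R\<^esub> x"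
      by (elim fr_carrierE) (simp add: fr_add fr_eq_iff l_distr r_distr a_ac m_ac)
  next
    fix x assume "x \<in> carrier (fraction_field R)"
    then show "\<zero>\<^bsub>fraction_field R\<^esub> \<oplus>\<^bsub>fraction_field R\<^esub> x = x"
      by (elim fr_carrierE) (simp add: fr_zero fr_add fr_eq_iff)
  next
    fix x assume "x \<in> carrier (fraction_field R)"
    then obtain a b where ab: "a \<in> carrier R" "b \<in> nz" "x = fr a b" by (rule fr_carrierE)
    then have "fr (\<ominus> a) b \<oplus>\<^bsub>fraction_field R\<^esub> x = \<zero>\<^bsub>fraction_field R\<^esub>"
      by (simp add: fr_zero fr_add fr_eq_iff l_distr[symmetric] l_neg)
    then show "\<exists>y\<in>carrier (fraction_field R). y \<oplus>\<^bsub>fraction_field R\<^esub> x = \<zero>\<^bsub>fraction_field R\<^esub>"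
      using ab by (intro bexI[of _ "fr (\<ominus> a) b"]) auto
  qed
  show "monoid (fraction_field R)"
  proof (rule monoidI)
    fix x y assume "x \<in> carrier (fraction_field R)" "y \<in> carrier (fraction_field R)"
    then show "x \<otimes>\<^bsub>fraction_field R\<^esub> y \<in> carrier (fraction_field R)"
      by (elim fr_carrierE) (simp add: fr_mult)
  next
    show "\<one>\<^bsub>fraction_field R\<^esub> \<in> carrier (fraction_field R)" by (simp add: fr_one)
  next
    fix x y z assume "x \<in> carrier (fraction_field R)" "y \<in> carrier (fraction_field R)" "z \<in> carrier (fraction_field R)"
    then show "(x \<otimes>\<^bsub>fraction_field R\<^esub> y) \<otimes>\<^bsub>fraction_field R\<^esub> z = x \<otimes>\<^bsub>fraction_field R\<^esub> (y \<otimes>\<^bsub>fraction_field R\<^esub> z)"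
      by (elim fr_carrierE) (simp add: fr_mult fr_eq_iff m_ac)
  next
    fix x assume "x \<in> carrier (fraction_field R)"
    then show "\<one>\<^bsub>fraction_field R\<^esub> \<otimes>\<^bsub>fraction_field R\<^esub> x = x"
      "x \<otimes>\<^bsub>fraction_field R\<^esub> \<one>\<^bsub>fraction_field R\<^esub> = x"
      by (auto elim!: fr_carrierE simp: fr_one fr_mult fr_eq_iff)
  qed
next
  fix x y z assume "x \<in> carrier (fraction_field R)" "y \<in> carrier (fraction_field R)" "z \<in> carrier (fraction_field R)"
  then show "(x \<oplus>\<^bsub>fraction_field R\<^esub> y) \<otimes>\<^bsub>fraction_field R\<^esub> z = x \<otimes>\<^bsub>fraction_field R\<^esub> z \<oplus>\<^bsub>fraction_field R\<^esub> y \<otimes>\<^bsub>fraction_field R\<^esub> z"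
    by (elim fr_carrierE) (simp add: fr_mult fr_add fr_eq_iff l_distr r_distr m_ac)
next
  fix x y z assume "x \<in> carrier (fraction_field R)" "y \<in> carrier (fraction_field R)" "z \<in> carrier (fraction_field R)"
  then show "z \<otimes>\<^bsub>fraction_field R\<^esub> (x \<oplus>\<^bsub>fraction_field R\<^esub> y) = z \<otimes>\<^bsub>fraction_field R\<^esub> x \<oplus>\<^bsub>fraction_field R\<^esub> z \<otimes>\<^bsub>fraction_field R\<^esub> y"
    by (elim fr_carrierE) (simp add: fr_mult fr_add fr_eq_iff l_distr r_distr m_ac)
qed

text \<open>The homogenization \<open>\<Sum> c\<^sub>i a\<^sup>i b\<^sup>n\<^sup>-\<^sup>i\<close> of a polynomial given by its coefficients, highest first.\<close>
fun hom_eval :: "'a \<Rightarrow> 'a \<Rightarrow> 'a list \<Rightarrow> 'a" where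
  "hom_eval a b [] = \<zero>"
| "hom_eval a b (c # cs) = c \<otimes> a [^] length cs \<oplus> b \<otimes> hom_eval a b cs"

lemma hom_eval_carrier: "a \<in> carrier R \<Longrightarrow> b \<in> carrier R \<Longrightarrow> set cs \<subseteq> carrier R \<Longrightarrow> hom_eval a b cs \<in> carrier R"
  by (induction cs) auto

lemma nz_pow [simp]: "b \<in> nz \<Longrightarrow> b [^] (n::nat) \<in> nz"
  by (induction n) auto

lemma fr_pow:
  assumes "a \<in> carrier R" "b \<in> nz"
  shows "fr a b [^]\<^bsub>fraction_field R\<^esub> (n::nat) = fr (a [^] n) (b [^] n)"
proof -
  interpret F: ring "fraction_field R" by (rule ring_fraction_field)
  show ?thesis using assms
    by (induction n) (auto simp: fr_one fr_mult)
qed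

lemma eval_fr:
  assumes "a \<in> carrier R" "b \<in> nz" "set cs \<subseteq> carrier R"
  shows "ring.eval (fraction_field R) (map (\<lambda>c. fr c \<one>) cs) (fr a b) = fr (b \<otimes> hom_eval a b cs) (b [^] length cs)"
  using assms(3)
proof (induction cs)
  case Nil
  interpret F: ring "fraction_field R" by (rule ring_fraction_field)
  show ?case using assms by (simp add: fr_zero fr_eq_iff)
next
  case (Cons c cs)
  interpret F: ring "fraction_field R" by (rule ring_fraction_field)
  have [simp]: "hom_eval a b cs \<in> carrier R" using assms Cons by (intro hom_eval_carrier) auto
  have IH: "F.eval (map (\<lambda>c. fr c \<one>) cs) (fr a b) = fr (b \<otimes> hom_eval a b cs) (b [^] length cs)"
    using Cons by simp
  define x y z where "x = c \<otimes> a [^] length cs" and "y = b \<otimes> hom_eval a b cs" and "z = b [^] length cs"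
  have c: "c \<in> carrier R" using Cons.prems by simp
  have xyz: "x \<in> carrier R" "y \<in> carrier R" "z \<in> nz" using assms(1,2) c by (auto simp: x_def y_def z_def)
  have "F.eval (map (\<lambda>c. fr c \<one>) (c # cs)) (fr a b) = fr x z \<oplus>\<^bsub>fraction_field R\<^esub> fr y z"
    using assms(1,2) c by (simp add: IH fr_pow fr_mult x_def y_def z_def)
  also have "\<dots> = fr (x \<otimes> z \<oplus> y \<otimes> z) (z \<otimes> z)" using xyz by (simp add: fr_add)
  also have "\<dots> = fr (b \<otimes> (x \<oplus> y)) (z \<otimes> b)"
  proof -
    have "(x \<otimes> z \<oplus> y \<otimes> z) \<otimes> (z \<otimes> b) = (b \<otimes> (x \<oplus> y)) \<otimes> (z \<otimes> z)"
      using xyz assms(2) by (simp add: l_distr r_distr m_ac)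
    then show ?thesis using xyz assms(2) by (subst fr_eq_iff) auto
  qed
  finally have e: "F.eval (map (\<lambda>c. fr c \<one>) (c # cs)) (fr a b) = fr (b \<otimes> (x \<oplus> y)) (z \<otimes> b)" .
  have "hom_eval a b (c # cs) = x \<oplus> y" and "b [^] length (c # cs) = z \<otimes> b"
    by (simp_all add: x_def y_def z_def)
  from arg_cong2[OF arg_cong[OF this(1), of "(\<otimes>) b"] this(2), of fr, symmetric] show ?case by (rule trans[OF e])
qed

text \<open>The integrality condition in the fraction field unfolds to a homogeneous relation between numerator and denominator in
  the domain itself.\<close>
lemma normal_domainI:
  assumes *: "\<And>a b cs. a \<in> carrier R \<Longrightarrow> b \<in> carrier R \<Longrightarrow> b \<noteq> \<zero> \<Longrightarrow> set cs \<subseteq> carrier R \<Longrightarrow>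
    hom_eval a b (\<one> # cs) = \<zero> \<Longrightarrow> \<exists>c\<in>carrier R. a = b \<otimes> c"
  shows "normal_domain R"
  unfolding normal_domain_def Let_def
proof (intro conjI ballI impI)
  show "domain R" by (rule domain_axioms)
next
  interpret F: ring "fraction_field R" by (rule ring_fraction_field)
  fix x assume x: "x \<in> carrier (fraction_field R)"
  let ?S = "(\<lambda>a. fraction_class R a \<one>) ` carrier R"
  assume int: "integral_over (fraction_field R) ?S x"
  obtain a b where ab: "a \<in> carrier R" "b \<in> nz" "x = fr a b" using x by (rule fr_carrierE)
  obtain p where p: "p \<noteq> []" "set p \<subseteq> ?S" "hd p = \<one>\<^bsub>fraction_field R\<^esub>" "F.eval p x = \<zero>\<^bsub>fraction_field R\<^esub>"
    using int by (auto simp: integral_over_def)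
  have lift: "\<exists>cs. set cs \<subseteq> carrier R \<and> ps = map (\<lambda>c. fr c \<one>) cs" if "set ps \<subseteq> ?S" for ps
    using that
  proof (induction ps)
    case (Cons q ps)
    have "q \<in> ?S" by (rule subsetD[OF Cons.prems]) simp
    have "set ps \<subseteq> ?S" by (rule subset_trans[OF _ Cons.prems]) auto
    from Cons.IH[OF this] obtain cs where "set cs \<subseteq> carrier R" "ps = map (\<lambda>c. fr c \<one>) cs" by blast
    moreover obtain c where "c \<in> carrier R" "q = fr c \<one>" using \<open>q \<in> ?S\<close> unfolding fr_def by blast
    ultimately show ?case by (intro exI[of _ "c # cs"]) auto
  qed auto
  have "set (tl p) \<subseteq> ?S" by (rule subset_trans[OF _ p(2)]) (use p(1) in \<open>auto dest: list.set_sel(2)\<close>)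
  from lift[OF this] obtain ds where ds: "set ds \<subseteq> carrier R" "tl p = map (\<lambda>c. fr c \<one>) ds" by blast
  then have pe: "p = map (\<lambda>c. fr c \<one>) (\<one> # ds)" using p(1,3) by (cases p) (auto simp: fr_one)
  have c: "hom_eval a b (\<one> # ds) \<in> carrier R" using ab ds by (intro hom_eval_carrier) auto
  have "fr (b \<otimes> hom_eval a b (\<one> # ds)) (b [^] length (\<one> # ds)) = fr \<zero> \<one>"
    using p(4) eval_fr[of a b "\<one> # ds"] ab ds pe by (simp add: fr_zero del: hom_eval.simps)
  then have "b \<otimes> hom_eval a b (\<one> # ds) = \<zero>"
    using ab c by (subst (asm) fr_eq_iff) (auto simp del: hom_eval.simps nat_pow_Suc)
  then have "hom_eval a b (\<one> # ds) = \<zero>"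
    using integral[OF _ _ c] ab by (metis c integral nzD(1) nzD(2))
  then obtain c where "c \<in> carrier R" "a = b \<otimes> c" using *[of a b ds] ab ds by auto
  then have "x = fr c \<one>" using ab by (simp add: fr_eq_iff m_comm)
  then show "x \<in> ?S" using \<open>c \<in> carrier R\<close> by (auto simp: fr_def)
qed

end

section \<open>Division by polynomials that are monic in one variable\<close>

text \<open>Division with remainder; the divisor is monic in \<open>T\<close>, so that no denominators arise.\<close>
lemma monic_remainder:
  fixes p F :: "('v::linorder, 'a::field) mpoly"
  assumes F: "F \<in> polys V" "lead_coeff (uni T F) = 1" and T: "T \<in> V" and p: "p \<in> polys V"
  shows "\<exists>h r. h \<in> polys V \<and> r \<in> polys V \<and> p = F * h + r \<and> (uni T r = 0 \<or> pdeg (uni T r) < pdeg (uni T F))"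
  using p
proof (induction "pdeg (uni T p)" arbitrary: p rule: less_induct)
  case less
  define n where "n = pdeg (uni T p)"
  define d where "d = pdeg (uni T F)"
  show ?case
  proof (cases "n < d")
    case True
    then show ?thesis using less.prems by (intro exI[of _ 0] exI[of _ p]) (auto simp: n_def d_def)
  next
    case False
    define l where "l = pcoeff (uni T p) n"
    have lT: "l \<in> polys (V - {T})" unfolding l_def by (rule uni_coeff[OF less.prems])
    have l: "l \<in> polys V" by (rule polys_mono[OF _ lT]) auto
    define u where "u = l * Var T ^ (n - d)"
    have u: "u \<in> polys V" using l T by (auto simp: u_def intro!: polys_mult polys_power polys_Var)
    define p' where "p' = p - F * u"
    have p': "p' \<in> polys V" using less.prems F u by (auto simp: p'_def intro!: polys_diff polys_mult)
    have mon: "[:0, 1::('v,'a) mpoly:] ^ k = Polynomial.monom 1 k" for k by (simp add: monom_altdef)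
    have uu: "uni T u = Polynomial.monom l (n - d)"
      using uni_const[OF lT, of T] by (simp add: u_def uni.hom_mult uni.hom_power uni_Var mon smult_monom)
    have up': "uni T p' = uni T p - uni T F * Polynomial.monom l (n - d)"
      by (simp add: p'_def uni.hom_minus uni.hom_mult uu)
    have "pdeg (uni T F * Polynomial.monom l (n - d)) \<le> d + (n - d)"
      unfolding d_def by (rule order_trans[OF degree_mult_le]) (simp add: degree_monom_le)
    then have "pdeg (uni T p') \<le> n"
      unfolding up' using False by (intro degree_diff_le) (auto simp: n_def)
    moreover have "pcoeff (uni T F * Polynomial.monom l (n - d)) n = l"
      using coeff_monom_mult[of l "n - d" "uni T F" n] False F(2) by (simp add: d_def mult.commute)
    then have "pcoeff (uni T p') n = 0" by (simp add: up' l_def)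
    ultimately have "uni T p' = 0 \<or> pdeg (uni T p') < n" by (rule eq_zero_or_degree_less)
    then have "\<exists>h r. h \<in> polys V \<and> r \<in> polys V \<and> p' = F * h + r \<and> (uni T r = 0 \<or> pdeg (uni T r) < d)"
    proof
      assume z: "uni T p' = 0"
      then have "p' = 0" using uni_inj[of T p' 0] by simp
      then show ?thesis by (intro exI[of _ 0]) auto
    next
      assume "pdeg (uni T p') < n"
      then show ?thesis using less.hyps[of p'] p' by (simp add: n_def d_def)
    qed
    then obtain h r where hr: "h \<in> polys V" "r \<in> polys V" "p' = F * h + r" "uni T r = 0 \<or> pdeg (uni T r) < d" by blast
    have "p = F * (h + u) + r" using hr(3) by (simp add: p'_def algebra_simps)
    then show ?thesis using hr u by (intro exI[of _ "h + u"] exI[of _ r]) (auto simp: d_def intro!: polys_add)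
  qed
qed

lemma is_prime_multiples:
  fixes F :: "('v::linorder, 'a::field) mpoly"
  assumes "F \<in> polys V" "\<not> F dvd 1"
    and "\<And>a b. a \<in> polys V \<Longrightarrow> b \<in> polys V \<Longrightarrow> F dvd a * b \<Longrightarrow> F dvd a \<or> F dvd b"
  shows "is_prime V {r \<in> polys V. F dvd r}"
  using assms by (auto simp: is_prime_def is_ideal_def intro: polys_add polys_mult)

text \<open>Height plus dimension is at most the number of variables.\<close>
lemma card_Diff_le_growth:
  fixes C :: "nat \<Rightarrow> ('v, 'a::field) mpoly set"
  assumes "pchain V n C" "finite V" "U \<subseteq> V" "C n \<inter> polys U \<subseteq> {0}"
  shows "n + card U \<le> card V"
  using pchain_growth[OF assms(1) growth_polys[OF finite_subset[OF assms(3,2)] assms(3,4)] assms(2)] .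

text \<open>The quotient by a polynomial that is monic in \<open>T\<close> is a free module over the polynomials without \<open>T\<close>. A fraction that
  has, for each further variable \<open>v\<close>, a denominator free of \<open>T\<close> and \<open>v\<close> has polynomial coordinates by
  \<open>separately_dvd\<close> and lies in the quotient.\<close>
lemma monic_fraction:
  fixes F p q :: "('v::linorder, 'a::field) mpoly"
  assumes V: "finite V" and T: "T \<in> V" and F: "F \<in> polys V" "lead_coeff (uni T F) = 1" "pdeg (uni T F) > 0"
    and prime: "\<And>a b. a \<in> polys V \<Longrightarrow> b \<in> polys V \<Longrightarrow> F dvd a * b \<Longrightarrow> F dvd a \<or> F dvd b"
    and q: "q \<in> polys V" "\<not> F dvd q" and p: "p \<in> polys V"
    and s: "\<And>v. v \<in> V - {T} \<Longrightarrow> \<exists>s\<in>polys (V - {T} - {v}). s \<noteq> 0 \<and> (\<exists>a\<in>polys V. F dvd s * p - q * a)"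
  shows "\<exists>a\<in>polys V. F dvd p - q * a"
proof -
  have no_const: "b = 0" if bT: "b \<in> polys (V - {T})" and Fb: "F dvd b" for b
  proof (rule ccontr)
    assume "b \<noteq> 0"
    obtain c where c: "b = F * c" using Fb by auto
    have "uni T b = [:b:]" using uni_const[OF bT] by simp
    then have "uni T F * uni T c = [:b:]" using c by (metis uni.hom_mult)
    then have "pdeg (uni T F) \<le> pdeg [:b:]" using \<open>b \<noteq> 0\<close>
      by (metis dvd_imp_degree_le dvd_triv_left pCons_eq_0_iff)
    then show False using F(3) by simp
  qed
  have nF1: "\<not> F dvd 1" using no_const[of 1] by auto
  \<comment> \<open>If \<open>(q, F)\<close> contained no such \<open>b\<close>, it would lie in a prime of height at least two whose quotient has dimension at least \<open>|V| - 1\<close>.\<close>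
  have "\<exists>b. b \<noteq> 0 \<and> b \<in> polys (V - {T}) \<and> (\<exists>a\<in>polys V. \<exists>c\<in>polys V. b = q * a + F * c)"
  proof (rule ccontr)
    assume neg: "\<not> ?thesis"
    define I where "I = {q * a + F * c | a c. a \<in> polys V \<and> c \<in> polys V}"
    have "is_ideal V I"
      unfolding is_ideal_def
    proof (intro conjI ballI)
      show "I \<subseteq> polys V" using q F by (auto simp: I_def intro!: polys_add polys_mult)
      show "0 \<in> I" unfolding I_def by (intro CollectI exI[of _ 0]) auto
    next
      fix x y assume "x \<in> I" "y \<in> I"
      then obtain a c a' c' where "x = q * a + F * c" "y = q * a' + F * c'" "a \<in> polys V" "c \<in> polys V" "a' \<in> polys V" "c' \<in> polys V"
        unfolding I_def by blast
      then show "x + y \<in> I" unfolding I_def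
        by (intro CollectI exI[of _ "a + a'"] exI[of _ "c + c'"]) (auto simp: algebra_simps intro: polys_add)
    next
      fix x r :: "('v, 'a) mpoly" assume "x \<in> I" "r \<in> polys V"
      then obtain a c where "x = q * a + F * c" "a \<in> polys V" "c \<in> polys V" unfolding I_def by blast
      then show "r * x \<in> I" unfolding I_def using \<open>r \<in> polys V\<close>
        by (intro CollectI exI[of _ "r * a"] exI[of _ "r * c"]) (auto simp: algebra_simps intro: polys_mult)
    qed
    moreover have "s = 0" if "s \<in> I" "s \<in> polys (V - {T})" for s using neg that unfolding I_def by blast
    ultimately obtain Q where Q: "is_prime V Q" "I \<subseteq> Q" "Q \<inter> polys (V - {T}) \<subseteq> {0}"
      using prime_avoiding_polys[of V I "V - {T}"] by blast
    define M where "M = {r \<in> polys V. F dvd r}"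
    have M: "is_prime V M" unfolding M_def by (rule is_prime_multiples[OF F(1) nF1 prime])
    have "q \<in> I" unfolding I_def using q by (intro CollectI exI[of _ 1] exI[of _ 0]) auto
    then have "q \<in> Q" "q \<notin> M" using Q(2) q by (auto simp: M_def)
    moreover have "M \<subseteq> I"
    proof
      fix r assume "r \<in> M"
      then obtain c where "c \<in> polys V" "r = F * c" using dvd_polysE[OF _ F(1), of r] by (auto simp: M_def)
      then show "r \<in> I" unfolding I_def by (intro CollectI exI[of _ 0] exI[of _ c]) auto
    qed
    ultimately have MQ: "M \<subset> Q" using Q(2) by blast
    have "F \<in> M" "F \<noteq> 0" using F by (auto simp: M_def)
    moreover have "0 \<in> M" by (simp add: M_def)
    ultimately have zM: "{0} \<subset> M" by blast
    define C where "C i = (if i = 0 then {0} else if i = 1 then M else Q)" for i :: nat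
    have "pchain V 2 C"
      unfolding pchain_def
    proof (intro conjI allI impI)
      fix i :: nat assume "i < 2"
      then have "i = 0 \<or> i = 1" by auto
      then show "C i \<subset> C (Suc i)" using zM MQ by (auto simp: C_def)
    qed (auto simp: C_def is_prime_zero Q M)
    then have "2 + card (V - {T}) \<le> card V" using V Q(3) by (intro card_Diff_le_growth[where C = C]) (auto simp: C_def)
    then show False using T V by (simp add: card_Diff_singleton)
  qed
  then obtain b qs c where b: "b \<noteq> 0" "b \<in> polys (V - {T})" "b = q * qs + F * c" "qs \<in> polys V" "c \<in> polys V" by blast
  have bV: "b \<in> polys V" by (rule polys_mono[OF _ b(2)]) auto
  have nqs: "\<not> F dvd qs"
  proof
    assume "F dvd qs"
    then have "F dvd b" unfolding b(3) by simp
    then show False using no_const[OF b(2)] b(1) by simp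
  qed
  \<comment> \<open>The quotient by \<open>F\<close> has the powers of \<open>T\<close> below the degree as a basis, so divisibility by \<open>b\<close> can be tested on remainders.\<close>
  obtain h r where hr: "h \<in> polys V" "r \<in> polys V" "qs * p = F * h + r" "uni T r = 0 \<or> pdeg (uni T r) < pdeg (uni T F)"
    using monic_remainder[OF F(1,2) T polys_mult[OF b(4) p]] by blast
  have "b dvd r"
  proof (rule separately_dvd[OF V hr(2) bV b(1)])
    fix v assume v: "v \<in> V"
    show "\<exists>s\<in>polys (V - {v}). s \<noteq> 0 \<and> b dvd s * r"
    proof (cases "v = T")
      case True then show ?thesis using b by (intro bexI[of _ b]) auto
    next
      case False
      then obtain s a where sa: "s \<in> polys (V - {T} - {v})" "s \<noteq> 0" "a \<in> polys V" "F dvd s * p - q * a"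
        using s[of v] v by blast
      have sT: "s \<in> polys (V - {T})" by (rule polys_mono[OF _ sa(1)]) auto
      obtain h' r' where hr': "a = F * h' + r'" "uni T r' = 0 \<or> pdeg (uni T r') < pdeg (uni T F)"
        using monic_remainder[OF F(1,2) T sa(3)] by blast
      obtain e where e: "s * p - q * a = F * e" using sa(4) by auto
      have "s * r - b * r' = F * (qs * e - c * a - s * h + b * h')"
      proof -
        have "s * r = s * (qs * p) - s * F * h" using hr(3) by (simp add: algebra_simps)
        also have "s * (qs * p) = qs * (s * p)" by (simp add: ac_simps)
        also have "s * p = q * a + F * e" using e by (simp add: algebra_simps)
        also have "qs * (q * a + F * e) = (b - F * c) * a + F * (qs * e)" using b(3) by (simp add: algebra_simps)
        finally have 1: "s * r = (b - F * c) * a + F * (qs * e) - s * F * h" .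
        have 2: "b * r' = b * a - b * F * h'" using hr'(1) by (simp add: algebra_simps)
        show ?thesis unfolding 1 2 by (simp add: algebra_simps)
      qed
      then have dv: "uni T F dvd uni T (s * r - b * r')" by (metis dvdI uni.hom_mult)
      have eq: "uni T (s * r - b * r') = Polynomial.smult s (uni T r) - Polynomial.smult b (uni T r')"
        using uni_const[OF sT, of T] uni_const[OF b(2), of T] by (simp add: uni.hom_minus uni.hom_mult)
      have "pdeg (Polynomial.smult s (uni T r)) < pdeg (uni T F)" "pdeg (Polynomial.smult b (uni T r')) < pdeg (uni T F)"
        using hr(4) hr'(2) F(3) by auto
      then have "pdeg (uni T (s * r - b * r')) < pdeg (uni T F)" unfolding eq by (rule degree_diff_less)
      then have "uni T (s * r - b * r') = 0" using dv dvd_imp_degree_le by (metis not_le)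
      then have "s * r - b * r' = 0" using uni_inj[of T "s * r - b * r'" 0] by (simp only: uni.hom_zero)
      then have "b dvd s * r" by (metis dvd_triv_left eq_iff_diff_eq_0)
      moreover have "s \<in> polys (V - {v})" by (rule polys_mono[OF _ sa(1)]) auto
      ultimately show ?thesis using sa(2) by blast
    qed
  qed
  then obtain r1 where r1: "r1 \<in> polys V" "r = b * r1" using dvd_polysE[OF hr(2) bV] by blast
  have "qs * (p - q * r1) = F * (h + c * r1)"
  proof -
    have "qs * p = F * h + (q * qs + F * c) * r1" using hr(3) r1(2) b(3) by simp
    then show ?thesis by (simp add: algebra_simps)
  qed
  then have "F dvd qs * (p - q * r1)" by simp
  then have "F dvd p - q * r1" using prime[OF b(4) polys_diff[OF p polys_mult[OF q(1) r1(1)]]] nqs by blast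
  then show ?thesis using r1(1) by blast
qed

lemma comm_ring_hom_to_fract: "comm_ring_hom (to_fract :: 'b::idom \<Rightarrow> 'b fract)"
  by unfold_locales auto

lemma is_prime_preimage:
  assumes h: "comm_ring_hom h" "\<And>p. p \<in> polys V \<Longrightarrow> h p \<in> polys V" and Q: "is_prime V Q"
  shows "is_prime V {p \<in> polys V. h p \<in> Q}"
proof -
  interpret h: comm_ring_hom h by (rule h(1))
  note I = is_prime_ideal[OF Q]
  show ?thesis
    unfolding is_prime_def is_ideal_def
    using h(2) Q is_idealD(2,3,4)[OF I] is_primeD[OF Q]
    by (auto simp: h.hom_add h.hom_mult is_prime_def intro: polys_add polys_mult)
qed

section \<open>Directions in which the determinant is affine\<close>

context degenerate_symmetric begin

text \<open>The directions \<open>\<xi> \<xi>\<^sup>T\<close> that stay inside the family of matrices with equal last two diagonal entries. Along such a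
  rank one direction the determinant is affine, with slope \<open>gd \<xi>\<close>. The normalization \<open>\<xi> 0 = 1\<close> keeps the slope away from
  zero at a suitable singular matrix.\<close>
definition iso :: "(nat \<Rightarrow> 'a) \<Rightarrow> bool" where
  "iso \<xi> \<longleftrightarrow> \<xi> 0 = 1 \<and> \<xi> (m - 2) * \<xi> (m - 2) = \<xi> (m - 1) * \<xi> (m - 1)"

text \<open>The bilinear form of the matrix of cofactors.\<close>
definition bil :: "(nat \<Rightarrow> 'a) \<Rightarrow> (nat \<Rightarrow> 'a) \<Rightarrow> (nat \<times> nat, 'a) mpoly" where
  "bil \<eta> \<zeta> = (\<Sum>i<m. \<Sum>j<m. Const (\<eta> i * \<zeta> j) * C i j)"

abbreviation gd :: "(nat \<Rightarrow> 'a) \<Rightarrow> (nat \<times> nat, 'a) mpoly" where "gd \<xi> \<equiv> bil \<xi> \<xi>"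

lemma bil_V: "bil \<eta> \<zeta> \<in> polys V"
  unfolding bil_def by (intro polys_sum polys_mult C_V) auto

lemma bil_add1: "bil (\<lambda>i. \<eta> i + \<eta>' i) \<zeta> = bil \<eta> \<zeta> + bil \<eta>' \<zeta>"
  by (simp add: bil_def distrib_right Const_add sum.distrib)
lemma bil_add2: "bil \<zeta> (\<lambda>i. \<eta> i + \<eta>' i) = bil \<zeta> \<eta> + bil \<zeta> \<eta>'"
  by (simp add: bil_def distrib_right distrib_left Const_add sum.distrib)
lemma bil_diff1: "bil (\<lambda>i. \<eta> i - \<eta>' i) \<zeta> = bil \<eta> \<zeta> - bil \<eta>' \<zeta>"
  by (simp add: bil_def left_diff_distrib Const_diff sum_subtractf)
lemma bil_diff2: "bil \<zeta> (\<lambda>i. \<eta> i - \<eta>' i) = bil \<zeta> \<eta> - bil \<zeta> \<eta>'"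
  by (simp add: bil_def left_diff_distrib right_diff_distrib Const_diff sum_subtractf)
lemma bil_sym: "bil \<eta> \<zeta> = bil \<zeta> \<eta>"
  unfolding bil_def by (subst sum.swap) (intro sum.cong refl, auto simp: C_sym mult.commute)

abbreviation ev :: "nat \<Rightarrow> nat \<Rightarrow> 'a" where "ev a \<equiv> (\<lambda>i. if i = a then 1 else 0)"

lemma bil_unit: "a < m \<Longrightarrow> b < m \<Longrightarrow> bil (ev a) (ev b) = C a b"
proof -
  assume ab: "a < m" "b < m"
  have "bil (ev a) (ev b) = (\<Sum>i<m. \<Sum>j<m. if i = a then if j = b then C i j else 0 else 0)"
    unfolding bil_def by (intro sum.cong refl) auto
  also have "\<dots> = (\<Sum>i<m. if i = a then C i b else 0)" using ab by (intro sum.cong refl) auto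
  finally show ?thesis using ab by simp
qed

text \<open>Polarization: the matrices \<open>\<xi> \<xi>\<^sup>T\<close> span the family, so the derivatives \<open>gd \<xi>\<close> in these directions generate the whole
  gradient, up to factors of two.\<close>
lemma gradient_from_iso:
  assumes I: "is_ideal V P" and g: "\<And>\<xi>. iso \<xi> \<Longrightarrow> gd \<xi> \<in> P"
  shows "a < m \<Longrightarrow> b < m \<Longrightarrow> a \<noteq> b \<Longrightarrow> C a b \<in> P" "a < m - 2 \<Longrightarrow> C a a \<in> P"
    "C (m - 2) (m - 2) + C (m - 1) (m - 1) \<in> P"
proof -
  note half = two_times_in_ideal[OF I]
  define null where "null \<eta> \<longleftrightarrow> \<eta> 0 = 0 \<and> \<eta> (m - 2) * \<eta> (m - 2) = \<eta> (m - 1) * \<eta> (m - 1)" for \<eta> :: "nat \<Rightarrow> 'a"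
  have pos: "(0::nat) \<noteq> m - 2" "(0::nat) \<noteq> m - 1" "m - 2 \<noteq> 0" "m - 1 \<noteq> 0" "m - 2 \<noteq> m - 1" "m - 1 \<noteq> m - 2" using m3 by auto
  have e0: "bil (ev 0) (ev 0) \<in> P" using g[of "ev 0"] pos by (auto simp: iso_def)
  have A: "bil \<eta> \<eta> \<in> P \<and> bil (ev 0) \<eta> \<in> P" if n: "null \<eta>" for \<eta>
  proof -
    have "iso (\<lambda>i. ev 0 i + \<eta> i)" "iso (\<lambda>i. ev 0 i - \<eta> i)" using n pos by (auto simp: iso_def null_def)
    then have p: "gd (\<lambda>i. ev 0 i + \<eta> i) \<in> P" and mi: "gd (\<lambda>i. ev 0 i - \<eta> i) \<in> P" using g by auto
    have "gd (\<lambda>i. ev 0 i + \<eta> i) + gd (\<lambda>i. ev 0 i - \<eta> i) = 2 * (bil (ev 0) (ev 0) + bil \<eta> \<eta>)"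
      by (simp add: bil_add1 bil_add2 bil_diff1 bil_diff2 algebra_simps)
    with is_idealD(3)[OF I p mi] have "bil (ev 0) (ev 0) + bil \<eta> \<eta> \<in> P" by - (rule half, simp only:)
    from is_idealD(7)[OF I this e0] have 1: "bil \<eta> \<eta> \<in> P" by simp
    have "gd (\<lambda>i. ev 0 i + \<eta> i) - gd (\<lambda>i. ev 0 i - \<eta> i) = 2 * (2 * bil (ev 0) \<eta>)"
      using bil_sym[of \<eta> "ev 0"] by (simp add: bil_add1 bil_add2 bil_diff1 bil_diff2 algebra_simps)
    with is_idealD(7)[OF I p mi] have "bil (ev 0) \<eta> \<in> P" by - (rule half, rule half, simp only:)
    with 1 show ?thesis by blast
  qed
  have B: "bil \<eta> \<zeta> \<in> P" if "null \<eta>" "null \<zeta>" "null (\<lambda>i. \<eta> i + \<zeta> i)" for \<eta> \<zeta>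
  proof -
    have "bil (\<lambda>i. \<eta> i + \<zeta> i) (\<lambda>i. \<eta> i + \<zeta> i) - bil \<eta> \<eta> - bil \<zeta> \<zeta> = 2 * bil \<eta> \<zeta>"
      using bil_sym[of \<eta> \<zeta>] by (simp add: bil_add1 bil_add2)
    moreover have "bil (\<lambda>i. \<eta> i + \<zeta> i) (\<lambda>i. \<eta> i + \<zeta> i) - bil \<eta> \<eta> - bil \<zeta> \<zeta> \<in> P"
      using A that by (intro is_idealD(7)[OF I]) auto
    ultimately show ?thesis by - (rule half, simp only:)
  qed
  define u where "u = (\<lambda>i. ev (m - 2) i + ev (m - 1) i)"
  define w where "w = (\<lambda>i. ev (m - 2) i - ev (m - 1) i)"
  have nu: "null u" "null w" using pos by (auto simp: null_def u_def w_def)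
  have ne: "null (ev b)" if "0 < b" "b < m - 2" for b using that pos by (auto simp: null_def)
  have neu: "null (\<lambda>i. ev b i + u i)" "null (\<lambda>i. ev b i + w i)" if "0 < b" "b < m - 2" for b
    using that pos by (auto simp: null_def u_def w_def)
  have nee: "null (\<lambda>i. ev b i + ev c i)" if "0 < b" "b < m - 2" "0 < c" "c < m - 2" for b c
    using that pos by (auto simp: null_def)
  have ab: "m - 2 < m" "m - 1 < m" "0 < m" using m3 by auto
  have both: "bil \<eta> (ev (m - 2)) \<in> P \<and> bil \<eta> (ev (m - 1)) \<in> P" if "bil \<eta> u \<in> P" "bil \<eta> w \<in> P" for \<eta>
  proof -
    have "bil \<eta> u + bil \<eta> w = 2 * bil \<eta> (ev (m - 2))" "bil \<eta> u - bil \<eta> w = 2 * bil \<eta> (ev (m - 1))"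
      unfolding u_def w_def bil_add2 bil_diff2 by simp_all
    with is_idealD(3,7)[OF I that] show ?thesis by - (rule conjI; rule half; simp only:)
  qed
  have last2: "C b (m - 2) \<in> P \<and> C b (m - 1) \<in> P" if b: "b < m - 2" for b
  proof (cases "b = 0")
    case True then show ?thesis using both[of "ev 0"] A nu ab by (simp add: bil_unit)
  next
    case False
    then show ?thesis using both[of "ev b"] B ne[of b] neu[of b] nu ab b by (simp add: bil_unit)
  qed
  have small: "C a b \<in> P" if "a < b" "b < m - 2" for a b
  proof (cases "a = 0")
    case True then show ?thesis using A[OF ne[of b]] that ab by (simp add: bil_unit)
  next
    case False
    then show ?thesis using B[OF ne[of a] ne[of b] nee[of a b]] that ab by (simp add: bil_unit)
  qed
  have uu: "bil u u \<in> P" "bil w w \<in> P" using A nu by auto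
  have eu: "bil u u = C (m - 2) (m - 2) + C (m - 1) (m - 1) + 2 * C (m - 2) (m - 1)"
    and ew: "bil w w = C (m - 2) (m - 2) + C (m - 1) (m - 1) - 2 * C (m - 2) (m - 1)"
    unfolding u_def w_def bil_add1 bil_add2 bil_diff1 bil_diff2 using ab C_sym[of "m - 1" "m - 2"]
    by (simp_all add: bil_unit)
  have "bil u u - bil w w = 2 * (2 * C (m - 2) (m - 1))" by (simp add: eu ew)
  with is_idealD(7)[OF I uu] have mid: "C (m - 2) (m - 1) \<in> P" by - (rule half, rule half, simp only:)
  have "bil u u + bil w w = 2 * (C (m - 2) (m - 2) + C (m - 1) (m - 1))" by (simp add: eu ew algebra_simps)
  with is_idealD(3)[OF I uu] show "C (m - 2) (m - 2) + C (m - 1) (m - 1) \<in> P" by - (rule half, simp only:)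
  have less: "C a b \<in> P" if ab': "a < b" "b < m" for a b
  proof -
    consider "b < m - 2" | "b = m - 2" | "b = m - 1" "a < m - 2" | "b = m - 1" "a = m - 2" using ab' by linarith
    then show ?thesis by cases (use small last2 mid ab' in auto)
  qed
  show "C a b \<in> P" if "a < m" "b < m" "a \<noteq> b"
    using less[of a b] less[of b a] that C_sym[of a b] by (cases "a < b") auto
  show "C a a \<in> P" if "a < m - 2"
  proof (cases "a = 0")
    case True then show ?thesis using e0 ab by (simp add: bil_unit)
  next
    case False then show ?thesis using A[OF ne[of a]] that ab by (simp add: bil_unit)
  qed
qed

lemma chain_below_prime_over_iso:
  assumes P: "is_prime V P" and g: "\<And>\<xi>. iso \<xi> \<Longrightarrow> gd \<xi> \<in> P"
  shows "\<exists>c. pchain V 3 c \<and> c 3 = P"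
proof -
  note grad = gradient_from_iso[OF is_prime_ideal[OF P] g]
  show ?thesis
    by (rule chain_below_prime_over_principal_cofactors[OF P]) (use principal_cofactors_in_prime[OF P grad(1) grad(2) grad(3)] in simp_all)
qed

section \<open>A singular point\<close>

text \<open>The diagonal matrix with entries \<open>0, 1, \<dots>, 1\<close>. It has corank one, and its only nonzero cofactor is the first.\<close>
definition x0 :: "nat \<times> nat \<Rightarrow> 'a" where "x0 = (\<lambda>(i, j). if i = j \<and> i \<noteq> 1 then 1 else 0)"

abbreviation ev0 :: "(nat \<times> nat, 'a) mpoly \<Rightarrow> 'a" where "ev0 \<equiv> ins (\<lambda>c. c) x0"

interpretation ev0: comm_ring_hom ev0 by (rule comm_ring_hom_ins[OF comm_ring_hom_id])

lemma SM_x0: "i < m \<Longrightarrow> j < m \<Longrightarrow> SM m x0 $$ (i, j) = (if i = j \<and> i \<noteq> 0 then 1 else 0)"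
  using m3 by (auto simp: x0_def vx_def min_def max_def split: if_splits)

lemma det_zero_row:
  assumes A: "A \<in> carrier_mat n n" and k: "k < n" "\<And>j. j < n \<Longrightarrow> A $$ (k, j) = 0"
  shows "det A = 0"
  using laplace_expansion_row[OF A k(1)] k(2) by simp

lemma ev0_f: "ev0 f = 0"
  unfolding ins_f[OF comm_ring_hom_id]
  by (rule det_zero_row[OF SM_carrier, of 0]) (use m3 in \<open>auto simp: SM_x0 simp del: SM_index\<close>)

lemma ev0_C: "i < m \<Longrightarrow> j < m \<Longrightarrow> ev0 (C i j) = (if i = 0 \<and> j = 0 then 1 else 0)"
proof -
  assume ij: "i < m" "j < m"
  let ?S = "setrow (SM m x0) i (unitrow j)"
  have S: "?S \<in> carrier_mat m m" by simp
  have "ev0 (C i j) = det ?S" using ij by (simp add: ins_C[OF comm_ring_hom_id] det_setrow_unit[of _ m])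
  also have "det ?S = (if i = 0 \<and> j = 0 then 1 else 0)"
  proof (cases "i = 0")
    case False
    then have "det ?S = 0" by (intro det_zero_row[OF S, of 0]) (use m3 in \<open>auto simp: setrow_def SM_x0 simp del: SM_index\<close>)
    then show ?thesis using False by simp
  next
    case i: True
    show ?thesis
    proof (cases "j = 0")
      case True
      have "?S = 1\<^sub>m m" by (rule eq_matI) (use i True in \<open>auto simp: setrow_def SM_x0 simp del: SM_index\<close>)
      then show ?thesis using i True by simp
    next
      case False
      have "det ?S = 0"
      proof (rule det_identical_rows[OF S, of 0 j])
        show "row ?S 0 = row ?S j"
          by (rule eq_vecI) (use ij i False in \<open>auto simp: setrow_def SM_x0 simp del: SM_index\<close>)
      qed (use ij i False in auto)
      then show ?thesis using False by simp
    qed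
  qed
  finally show ?thesis .
qed

lemma ev0_bil: "ev0 (bil \<eta> \<zeta>) = \<eta> 0 * \<zeta> 0"
proof -
  have "ev0 (bil \<eta> \<zeta>) = (\<Sum>i<m. \<Sum>j<m. \<eta> i * \<zeta> j * (if i = 0 \<and> j = 0 then 1 else 0))"
    unfolding bil_def ev0.hom_sum ev0.hom_mult by (intro sum.cong refl) (auto simp: ev0_C ins_Const[OF comm_ring_hom_id])
  also have "\<dots> = (\<Sum>i<m. \<Sum>j<m. if i = 0 then if j = 0 then \<eta> 0 * \<zeta> 0 else 0 else 0)"
    by (intro sum.cong refl) auto
  also have "\<dots> = (\<Sum>i<m. if i = 0 then \<eta> 0 * \<zeta> 0 else 0)" using m3 by (intro sum.cong refl) auto
  also have "\<dots> = \<eta> 0 * \<zeta> 0" using m3 by simp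
  finally show ?thesis .
qed

text \<open>At the singular matrix \<open>x0\<close> the determinant vanishes, whereas the slopes take the value one.\<close>
lemma f_not_dvd_gd: "iso \<xi> \<Longrightarrow> iso \<xi>' \<Longrightarrow> \<not> f dvd gd \<xi> ^ k * gd \<xi>' ^ l"
proof
  assume iso: "iso \<xi>" "iso \<xi>'" and "f dvd gd \<xi> ^ k * gd \<xi>' ^ l"
  then obtain c where "gd \<xi> ^ k * gd \<xi>' ^ l = f * c" by auto
  from arg_cong[OF this, of ev0] show False using iso
    by (simp add: ev0.hom_mult ev0.hom_power ev0_f ev0_bil iso_def)
qed

lemma gd_nonzero: "iso \<xi> \<Longrightarrow> gd \<xi> \<noteq> 0"
  using f_not_dvd_gd[of \<xi> \<xi> 1 0] by auto

section \<open>Retraction to the hypersurface\<close>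

abbreviation F :: "(nat \<times> nat, 'a) mpoly \<Rightarrow> (nat \<times> nat, 'a) mpoly fract" where "F \<equiv> to_fract"

definition coord :: "(nat \<Rightarrow> 'a) \<Rightarrow> nat \<times> nat \<Rightarrow> 'a" where "coord \<xi> v = \<xi> (fst v - 1) * \<xi> (snd v - 1)"

lemma coord_vx: "iso \<xi> \<Longrightarrow> i < m \<Longrightarrow> j < m \<Longrightarrow> coord \<xi> (vx m i j) = \<xi> i * \<xi> j"
  using m3 by (auto simp: coord_def vx_def iso_def min_def max_def diff_diff_left numeral_2_eq_2 mult.commute)

text \<open>Moving along the line in the direction \<open>\<xi> \<xi>\<^sup>T\<close> to the point where the affine function \<open>f\<close> vanishes retracts the space
  rationally onto the hypersurface. This embeds the quotient by \<open>f\<close> into a field of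
  rational functions, with powers of \<open>gd \<xi>\<close> as the only denominators.\<close>
definition rho :: "(nat \<Rightarrow> 'a) \<Rightarrow> (nat \<times> nat, 'a) mpoly \<Rightarrow> (nat \<times> nat, 'a) mpoly fract" where
  "rho \<xi> = ins (\<lambda>c. F (Const c)) (\<lambda>v. F (Var v) - F f / F (gd \<xi>) * F (Const (coord \<xi> v)))"

lemma rho_base: "comm_ring_hom (\<lambda>c. F (Const c))"
  by unfold_locales (auto simp: Const_add Const_mult)

lemma rho_hom: "comm_ring_hom (rho \<xi>)"
  unfolding rho_def by (rule comm_ring_hom_ins[OF rho_base])

text \<open>The vector \<open>w = C \<xi>\<close> spans the kernel of the shifted matrix: \<open>X w = f \<xi>\<close> and \<open>\<xi>\<^sup>T w = gd \<xi>\<close>.\<close>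
lemma rho_f: assumes iso: "iso \<xi>" shows "rho \<xi> f = 0"
proof -
  interpret F: comm_ring_hom F by (rule comm_ring_hom_to_fract)
  define t where "t = F f / F (gd \<xi>)"
  define A where "A = SM m (\<lambda>v. F (Var v) - t * F (Const (coord \<xi> v)))"
  have A: "A \<in> carrier_mat m m" by (simp add: A_def)
  have Aij: "A $$ (i, j) = F (Var (vx m i j)) - t * F (Const (\<xi> i)) * F (Const (\<xi> j))" if "i < m" "j < m" for i j
    using that coord_vx[OF iso that] by (simp add: A_def Const_mult F.hom_mult mult.assoc)
  define w where "w j = (\<Sum>k<m. C j k * Const (\<xi> k))" for j
  have Xw: "(\<Sum>j<m. Var (vx m i j) * w j) = Const (\<xi> i) * f" if i: "i < m" for i
  proof -
    have "(\<Sum>j<m. Var (vx m i j) * w j) = (\<Sum>j<m. \<Sum>k<m. Const (\<xi> k) * (Var (vx m i j) * C k j))"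
      unfolding w_def sum_distrib_left by (intro sum.cong refl) (auto simp: C_sym mult_ac)
    also have "\<dots> = (\<Sum>k<m. Const (\<xi> k) * (\<Sum>j<m. Var (vx m i j) * C k j))"
      by (subst sum.swap) (simp add: sum_distrib_left)
    also have "\<dots> = (\<Sum>k<m. if k = i then Const (\<xi> k) * f else 0)"
      using i by (intro sum.cong refl) (auto simp: XC)
    finally show ?thesis using i by simp
  qed
  have xw: "(\<Sum>j<m. Const (\<xi> j) * w j) = gd \<xi>"
    unfolding w_def bil_def sum_distrib_left by (intro sum.cong refl) (simp add: Const_mult mult_ac)
  define z where "z = vec m (\<lambda>j. F (w j))"
  have "z \<noteq> 0\<^sub>v m"
  proof
    assume z: "z = 0\<^sub>v m"
    have "F (w j) = 0" if "j < m" for j using arg_cong[OF z, of "\<lambda>u. u $ j"] that by (simp add: z_def)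
    then have "F (\<Sum>j<m. Const (\<xi> j) * w j) = 0" unfolding F.hom_sum F.hom_mult by (intro sum.neutral) auto
    then show False using gd_nonzero[OF iso] by (simp add: xw)
  qed
  moreover have "A *\<^sub>v z = 0\<^sub>v m"
  proof (rule eq_vecI)
    fix i assume "i < dim_vec (0\<^sub>v m :: (nat \<times> nat, 'a) mpoly fract vec)"
    then have i: "i < m" by simp
    have "(A *\<^sub>v z) $ i = (\<Sum>j<m. A $$ (i, j) * F (w j))"
      using A i by (auto simp: scalar_prod_def z_def lessThan_atLeast0 intro!: sum.cong)
    also have "\<dots> = (\<Sum>j<m. F (Var (vx m i j) * w j) - t * F (Const (\<xi> i)) * F (Const (\<xi> j) * w j))"
      using i by (intro sum.cong refl) (simp add: Aij F.hom_mult left_diff_distrib mult.assoc)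
    also have "\<dots> = F (Const (\<xi> i) * f) - t * F (Const (\<xi> i)) * F (gd \<xi>)"
      by (simp only: sum_subtractf sum_distrib_left[symmetric] F.hom_sum[symmetric] Xw[OF i] xw)
    also have "\<dots> = 0" using gd_nonzero[OF iso] by (simp add: t_def F.hom_mult)
    finally show "(A *\<^sub>v z) $ i = 0\<^sub>v m $ i" using i by simp
  qed (use A in auto)
  moreover have "z \<in> carrier_vec m" by (simp add: z_def)
  ultimately have "det A = 0" using det_0_iff_vec_prod_zero[OF A] by blast
  then show ?thesis unfolding rho_def ins_f[OF rho_base] by (simp add: A_def t_def)
qed

text \<open>Clearing the denominators of the retraction changes a polynomial only by a power of the slope, modulo \<open>f\<close>.\<close>
lemma rho_lift:
  assumes iso: "iso \<xi>" and p: "p \<in> polys V"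
  shows "\<exists>k p'. p' \<in> polys V \<and> rho \<xi> p * F (gd \<xi>) ^ k = F p' \<and> f dvd p' - gd \<xi> ^ k * p"
proof -
  interpret F: comm_ring_hom F by (rule comm_ring_hom_to_fract)
  interpret r: comm_ring_hom "rho \<xi>" by (rule rho_hom)
  have g0: "F (gd \<xi>) \<noteq> 0" using gd_nonzero[OF iso] by simp
  show ?thesis using p
  proof (induction rule: mpoly_induct)
    case (Const c)
    show ?case by (intro exI[of _ 0] exI[of _ "Const c"]) (simp add: rho_def ins_Const[OF rho_base])
  next
    case (Var v)
    have "rho \<xi> (Var v) * F (gd \<xi>) ^ 1 = F (Var v * gd \<xi> - f * Const (coord \<xi> v))"
      using g0 by (simp add: rho_def ins_Var[OF rho_base] F.hom_minus F.hom_mult field_simps)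
    moreover have "Var v * gd \<xi> - f * Const (coord \<xi> v) \<in> polys V"
      using Var by (intro polys_diff polys_mult polys_Var bil_V f_V polys_Const)
    moreover have "f dvd (Var v * gd \<xi> - f * Const (coord \<xi> v)) - gd \<xi> ^ 1 * Var v" by (simp add: mult.commute)
    ultimately show ?case by blast
  next
    case (add p q)
    then obtain k p' l q' where h: "p' \<in> polys V" "rho \<xi> p * F (gd \<xi>) ^ k = F p'" "f dvd p' - gd \<xi> ^ k * p"
      "q' \<in> polys V" "rho \<xi> q * F (gd \<xi>) ^ l = F q'" "f dvd q' - gd \<xi> ^ l * q" by blast
    let ?r = "gd \<xi> ^ l * p' + gd \<xi> ^ k * q'"
    have "rho \<xi> (p + q) * F (gd \<xi>) ^ (k + l) = F (gd \<xi>) ^ l * (rho \<xi> p * F (gd \<xi>) ^ k) + F (gd \<xi>) ^ k * (rho \<xi> q * F (gd \<xi>) ^ l)"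
      by (simp add: r.hom_add power_add algebra_simps)
    then have "rho \<xi> (p + q) * F (gd \<xi>) ^ (k + l) = F ?r"
      unfolding h by (simp add: F.hom_add F.hom_mult F.hom_power)
    moreover have "?r \<in> polys V" using h by (intro polys_add polys_mult polys_power bil_V) auto
    moreover have "?r - gd \<xi> ^ (k + l) * (p + q) = gd \<xi> ^ l * (p' - gd \<xi> ^ k * p) + gd \<xi> ^ k * (q' - gd \<xi> ^ l * q)"
      by (simp add: power_add algebra_simps)
    then have "f dvd ?r - gd \<xi> ^ (k + l) * (p + q)" using h by (simp add: dvd_add dvd_mult)
    ultimately show ?case by blast
  next
    case (mult p q)
    then obtain k p' l q' where h: "p' \<in> polys V" "rho \<xi> p * F (gd \<xi>) ^ k = F p'" "f dvd p' - gd \<xi> ^ k * p"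
      "q' \<in> polys V" "rho \<xi> q * F (gd \<xi>) ^ l = F q'" "f dvd q' - gd \<xi> ^ l * q" by blast
    let ?r = "p' * q'"
    have "rho \<xi> (p * q) * F (gd \<xi>) ^ (k + l) = (rho \<xi> p * F (gd \<xi>) ^ k) * (rho \<xi> q * F (gd \<xi>) ^ l)"
      by (simp add: r.hom_mult power_add algebra_simps)
    then have "rho \<xi> (p * q) * F (gd \<xi>) ^ (k + l) = F ?r"
      unfolding h by (simp add: F.hom_mult)
    moreover have "?r \<in> polys V" using h by (intro polys_mult) auto
    moreover have "?r - gd \<xi> ^ (k + l) * (p * q) = (p' - gd \<xi> ^ k * p) * q' + gd \<xi> ^ k * p * (q' - gd \<xi> ^ l * q)"
      by (simp add: power_add algebra_simps)
    then have "f dvd ?r - gd \<xi> ^ (k + l) * (p * q)" using h by (simp add: dvd_add dvd_mult dvd_mult2)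
    ultimately show ?case by blast
  qed
qed

lemma rho_lift_ge:
  assumes iso: "iso \<xi>" and p: "p \<in> polys V"
  shows "\<exists>k0. \<forall>k\<ge>k0. \<exists>p'. p' \<in> polys V \<and> rho \<xi> p * F (gd \<xi>) ^ k = F p' \<and> f dvd p' - gd \<xi> ^ k * p"
proof -
  interpret F: comm_ring_hom F by (rule comm_ring_hom_to_fract)
  obtain k0 p' where h: "p' \<in> polys V" "rho \<xi> p * F (gd \<xi>) ^ k0 = F p'" "f dvd p' - gd \<xi> ^ k0 * p"
    using rho_lift[OF iso p] by blast
  have "\<exists>p''. p'' \<in> polys V \<and> rho \<xi> p * F (gd \<xi>) ^ k = F p'' \<and> f dvd p'' - gd \<xi> ^ k * p" if "k \<ge> k0" for k
  proof (intro exI conjI)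
    let ?u = "gd \<xi> ^ (k - k0)"
    have pw: "x ^ k = x ^ (k - k0) * x ^ k0" for x :: "'z::comm_ring_1" using that by (simp flip: power_add)
    show "?u * p' \<in> polys V" using h by (intro polys_mult polys_power bil_V)
    have "rho \<xi> p * F (gd \<xi>) ^ k = F (gd \<xi>) ^ (k - k0) * (rho \<xi> p * F (gd \<xi>) ^ k0)"
      unfolding pw[of "F (gd \<xi>)"] by (simp add: mult_ac)
    then show "rho \<xi> p * F (gd \<xi>) ^ k = F (?u * p')" unfolding h by (simp add: F.hom_mult F.hom_power)
    have "?u * p' - gd \<xi> ^ k * p = ?u * (p' - gd \<xi> ^ k0 * p)"
      unfolding pw[of "gd \<xi>"] by (simp add: algebra_simps)
    then show "f dvd ?u * p' - gd \<xi> ^ k * p" using h(3) by (simp add: dvd_mult)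
  qed
  then show ?thesis by blast
qed

lemma rho_dvd: "iso \<xi> \<Longrightarrow> f dvd p \<Longrightarrow> rho \<xi> p = 0"
proof -
  assume "iso \<xi>" "f dvd p"
  interpret r: comm_ring_hom "rho \<xi>" by (rule rho_hom)
  show ?thesis using \<open>f dvd p\<close> rho_f[OF \<open>iso \<xi>\<close>] by (auto simp: r.hom_mult)
qed

lemma rho_zeroD: "iso \<xi> \<Longrightarrow> p \<in> polys V \<Longrightarrow> rho \<xi> p = 0 \<Longrightarrow> \<exists>k. f dvd gd \<xi> ^ k * p"
proof -
  assume h: "iso \<xi>" "p \<in> polys V" "rho \<xi> p = 0"
  obtain k p' where "rho \<xi> p * F (gd \<xi>) ^ k = F p'" "f dvd p' - gd \<xi> ^ k * p" using rho_lift[OF h(1,2)] by blast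
  then have "p' = 0" using h(3) by simp
  with \<open>f dvd p' - gd \<xi> ^ k * p\<close> have "f dvd gd \<xi> ^ k * p" by simp
  then show ?thesis by blast
qed

text \<open>If \<open>f\<close> does not divide \<open>p\<close>, this shows in some variable \<open>v\<close>: the multipliers of \<open>p\<close> into \<open>(f)\<close> extend to a prime
  whose quotient has dimension at least \<open>|V| - 1\<close>. That prime contains all slopes, hence the gradient, and has height at
  least three: a contradiction.\<close>
lemma dvd_if_gd_powers:
  assumes p: "p \<in> polys V" and g: "\<And>\<xi>. iso \<xi> \<Longrightarrow> \<exists>k. f dvd gd \<xi> ^ k * p"
  shows "f dvd p"
proof (rule ccontr)
  assume np: "\<not> f dvd p"
  have f0: "f \<noteq> 0" using DK_nonzero[of "{..<m}"] by (simp add: masked_all[OF X_carrier])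
  obtain v where v: "v \<in> V" "\<And>s. s \<in> polys (V - {v}) \<Longrightarrow> f dvd s * p \<Longrightarrow> s = 0"
    using separately_dvd[OF finite_SC_vars p f_V f0] np by blast
  define I where "I = {s \<in> polys V. f dvd s * p}"
  have "is_ideal V I"
    by (auto simp: is_ideal_def I_def distrib_right mult.assoc intro: polys_add polys_mult dvd_add dvd_mult)
  then obtain Q where Q: "is_prime V Q" "I \<subseteq> Q" "Q \<inter> polys (V - {v}) \<subseteq> {0}"
    using prime_avoiding_polys[of V I "V - {v}"] v(2) by (auto simp: I_def)
  have "gd \<xi> \<in> Q" if iso: "iso \<xi>" for \<xi>
  proof -
    obtain k where "f dvd gd \<xi> ^ k * p" using g[OF iso] by blast
    then have "gd \<xi> ^ k \<in> Q" using Q(2) by (auto simp: I_def intro: polys_power bil_V)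
    then show ?thesis using is_prime_power[OF Q(1) bil_V] by blast
  qed
  then obtain c where c: "pchain V 3 c" "c 3 = Q" using chain_below_prime_over_iso[OF Q(1)] by blast
  have "3 + card (V - {v}) \<le> card V" using c Q(3) by (intro card_Diff_le_growth[where C = c]) auto
  then show False using card_Suc_Diff1[OF finite_SC_vars v(1)] by linarith
qed

lemma iso_ev0: "iso (ev 0)" using m3 by (auto simp: iso_def)

text \<open>The retraction \<open>rho\<close> maps into a field and its kernel consists, up to powers of the slope, of the multiples of \<open>f\<close>.
  The powers can be removed because this holds for all directions at once.\<close>
lemma f_prime:
  assumes p: "p \<in> polys V" "q \<in> polys V" and d: "f dvd p * q"
  shows "f dvd p \<or> f dvd q"
proof -
  have *: "f dvd p" if p: "p \<in> polys V" and z: "rho (ev 0) p = 0" for p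
  proof (rule dvd_if_gd_powers[OF p])
    fix \<xi> assume iso: "iso \<xi>"
    interpret r: comm_ring_hom "rho \<xi>" by (rule rho_hom)
    obtain k where "f dvd gd (ev 0) ^ k * p" using rho_zeroD[OF iso_ev0 p z] by blast
    from rho_dvd[OF iso this] have "rho \<xi> (gd (ev 0)) ^ k * rho \<xi> p = 0" by (simp add: r.hom_mult r.hom_power)
    moreover have "rho \<xi> (gd (ev 0)) \<noteq> 0"
    proof
      assume "rho \<xi> (gd (ev 0)) = 0"
      then obtain l where "f dvd gd \<xi> ^ l * gd (ev 0)" using rho_zeroD[OF iso bil_V] by blast
      then show False using f_not_dvd_gd[OF iso iso_ev0, of l 1] by simp
    qed
    ultimately have "rho \<xi> p = 0" by simp
    then show "\<exists>k. f dvd gd \<xi> ^ k * p" by (rule rho_zeroD[OF iso p])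
  qed
  interpret r: comm_ring_hom "rho (ev 0)" by (rule rho_hom)
  have "rho (ev 0) p * rho (ev 0) q = 0" using rho_dvd[OF iso_ev0 d] by (simp add: r.hom_mult)
  then show ?thesis using * p by auto
qed

lemma rho_zero_iff: "iso \<xi> \<Longrightarrow> p \<in> polys V \<Longrightarrow> rho \<xi> p = 0 \<longleftrightarrow> f dvd p"
proof
  assume h: "iso \<xi>" "p \<in> polys V" "rho \<xi> p = 0"
  then obtain k where "f dvd gd \<xi> ^ k * p" using rho_zeroD by blast
  then have "f dvd gd \<xi> ^ k \<or> f dvd p" using f_prime[OF polys_power[OF bil_V] h(2)] by blast
  then show "f dvd p" using f_not_dvd_gd[OF h(1) h(1), of k 0] by auto
qed (rule rho_dvd)

section \<open>Denominators of integral fractions\<close>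

text \<open>The retraction carries an integral fraction modulo \<open>f\<close> to an integral fraction of polynomials, which is a polynomial.
  Coming back costs a power of the slope. The exponent \<open>2 K\<close> below clears all denominators with one common power \<open>K\<close>.\<close>
lemma gd_power_denominator:
  assumes iso: "iso \<xi>" and p: "p \<in> polys V" and q: "q \<in> polys V" "\<not> f dvd q"
    and c: "\<And>i. i < n \<Longrightarrow> c i \<in> polys V" and rel: "f dvd p ^ n + (\<Sum>i<n. c i * p ^ i * q ^ (n - i))"
  shows "\<exists>k. \<exists>a\<in>polys V. f dvd gd \<xi> ^ k * p - q * a"
proof -
  interpret F: comm_ring_hom F by (rule comm_ring_hom_to_fract)
  interpret r: comm_ring_hom "rho \<xi>" by (rule rho_hom)
  define \<gamma> where "\<gamma> = F (gd \<xi>)"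
  have \<gamma>0: "\<gamma> \<noteq> 0" using gd_nonzero[OF iso] by (simp add: \<gamma>_def)
  obtain kp where kp: "\<And>k. k \<ge> kp \<Longrightarrow> \<exists>p'. p' \<in> polys V \<and> rho \<xi> p * \<gamma> ^ k = F p' \<and> f dvd p' - gd \<xi> ^ k * p"
    using rho_lift_ge[OF iso p] unfolding \<gamma>_def by blast
  obtain kq where kq: "\<And>k. k \<ge> kq \<Longrightarrow> \<exists>p'. p' \<in> polys V \<and> rho \<xi> q * \<gamma> ^ k = F p' \<and> f dvd p' - gd \<xi> ^ k * q"
    using rho_lift_ge[OF iso q(1)] unfolding \<gamma>_def by blast
  have "\<forall>i. \<exists>ki. i < n \<longrightarrow> (\<forall>k\<ge>ki. \<exists>p'. p' \<in> polys V \<and> rho \<xi> (c i) * \<gamma> ^ k = F p')"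
    using rho_lift_ge[OF iso c] unfolding \<gamma>_def by blast
  then obtain kc where kc: "\<And>i k. i < n \<Longrightarrow> k \<ge> kc i \<Longrightarrow> \<exists>p'. p' \<in> polys V \<and> rho \<xi> (c i) * \<gamma> ^ k = F p'" by metis
  define K where "K = kp + kq + (\<Sum>i<n. kc i)"
  have Kc: "K \<ge> kc i" if "i < n" for i
    using member_le_sum[of i "{..<n}" kc] that by (simp add: K_def)
  obtain p' where p': "p' \<in> polys V" "rho \<xi> p * \<gamma> ^ K = F p'" "f dvd p' - gd \<xi> ^ K * p" using kp[of K] by (auto simp: K_def)
  obtain q' where q': "q' \<in> polys V" "rho \<xi> q * \<gamma> ^ K = F q'" "f dvd q' - gd \<xi> ^ K * q" using kq[of K] by (auto simp: K_def)
  have "\<forall>i. \<exists>p'. i < n \<longrightarrow> rho \<xi> (c i) * \<gamma> ^ K = F p'" using kc Kc by meson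
  then obtain c' where c': "\<And>i. i < n \<Longrightarrow> rho \<xi> (c i) * \<gamma> ^ K = F (c' i)" by metis
  define A where "A = gd \<xi> ^ K * p'"
  define d where "d i = c' i * gd \<xi> ^ (K * (n - i - 1))" for i
  have rel': "rho \<xi> p ^ n + (\<Sum>i<n. rho \<xi> (c i) * rho \<xi> p ^ i * rho \<xi> q ^ (n - i)) = 0"
    using rho_dvd[OF iso rel] by (simp add: r.hom_add r.hom_sum r.hom_mult r.hom_power)
  have "\<gamma> ^ (2 * K) = \<gamma> ^ K * \<gamma> ^ K" by (simp add: mult_2 power_add)
  then have FA: "F A = \<gamma> ^ (2 * K) * rho \<xi> p"
    by (simp only: A_def F.hom_mult F.hom_power \<gamma>_def[symmetric] p'(2)[symmetric] mult_ac)
  have summand: "F (d i * A ^ i * q' ^ (n - i)) = \<gamma> ^ (2 * K * n) * (rho \<xi> (c i) * rho \<xi> p ^ i * rho \<xi> q ^ (n - i))" if i: "i < n" for i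
  proof -
    have "F (d i * A ^ i * q' ^ (n - i)) = (rho \<xi> (c i) * \<gamma> ^ K) * \<gamma> ^ (K * (n - i - 1)) * (\<gamma> ^ (2 * K) * rho \<xi> p) ^ i * (rho \<xi> q * \<gamma> ^ K) ^ (n - i)"
      by (simp add: F.hom_mult F.hom_power d_def c'[OF i] FA q'(2) \<gamma>_def[symmetric])
    also have "\<dots> = (\<gamma> ^ K * \<gamma> ^ (K * (n - i - 1)) * \<gamma> ^ (2 * K * i) * \<gamma> ^ (K * (n - i))) * (rho \<xi> (c i) * rho \<xi> p ^ i * rho \<xi> q ^ (n - i))"
      by (simp add: power_mult_distrib power_mult[symmetric] mult_ac)
    also have "\<gamma> ^ K * \<gamma> ^ (K * (n - i - 1)) * \<gamma> ^ (2 * K * i) * \<gamma> ^ (K * (n - i)) = \<gamma> ^ (2 * K * n)"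
    proof -
      obtain j where j: "n = Suc (i + j)" using i less_imp_Suc_add by blast
      show ?thesis unfolding j by (simp add: power_add[symmetric] algebra_simps)
    qed
    finally show ?thesis .
  qed
  have "F (A ^ n + (\<Sum>i<n. d i * A ^ i * q' ^ (n - i))) = F (A ^ n) + (\<Sum>i<n. F (d i * A ^ i * q' ^ (n - i)))"
    by (simp only: F.hom_add F.hom_sum)
  also have "F (A ^ n) = \<gamma> ^ (2 * K * n) * rho \<xi> p ^ n"
    by (simp only: F.hom_power FA power_mult_distrib power_mult)
  also have "(\<Sum>i<n. F (d i * A ^ i * q' ^ (n - i))) = (\<Sum>i<n. \<gamma> ^ (2 * K * n) * (rho \<xi> (c i) * rho \<xi> p ^ i * rho \<xi> q ^ (n - i)))"
    by (intro sum.cong refl summand) auto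
  also have "\<gamma> ^ (2 * K * n) * rho \<xi> p ^ n + \<dots> = \<gamma> ^ (2 * K * n) * (rho \<xi> p ^ n + (\<Sum>i<n. rho \<xi> (c i) * rho \<xi> p ^ i * rho \<xi> q ^ (n - i)))"
    by (simp only: distrib_left sum_distrib_left)
  finally have "F (A ^ n + (\<Sum>i<n. d i * A ^ i * q' ^ (n - i))) = \<gamma> ^ (2 * K * n) * (rho \<xi> p ^ n + (\<Sum>i<n. rho \<xi> (c i) * rho \<xi> p ^ i * rho \<xi> q ^ (n - i)))" .
  then have "F (A ^ n + (\<Sum>i<n. d i * A ^ i * q' ^ (n - i))) = F 0" by (simp only: rel' mult_zero_right to_fract_0)
  then have eq0: "A ^ n + (\<Sum>i<n. d i * A ^ i * q' ^ (n - i)) = 0" by (simp only: to_fract_eq_iff)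
  have "rho \<xi> q \<noteq> 0" using rho_zero_iff[OF iso q(1)] q(2) by simp
  then have "F q' \<noteq> 0" using q'(2)[symmetric] \<gamma>0 by simp
  then have q'0: "q' \<noteq> 0" by auto
  have AV: "A \<in> polys V" unfolding A_def using p' by (intro polys_mult polys_power bil_V)
  have "q' dvd A" by (rule polys_integrally_closed[OF finite_SC_vars AV q'(1) q'0 eq0])
  then obtain h where h: "h \<in> polys V" "A = q' * h" using dvd_polysE[OF AV q'(1)] by blast
  have "gd \<xi> ^ (2 * K) * p - q * (gd \<xi> ^ K * h) = - (gd \<xi> ^ K * (p' - gd \<xi> ^ K * p)) + (q' - gd \<xi> ^ K * q) * h"
  proof -
    have "gd \<xi> ^ (2 * K) = gd \<xi> ^ K * gd \<xi> ^ K" by (simp add: mult_2 power_add)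
    moreover have "gd \<xi> ^ K * p' = q' * h" using h(2) by (simp add: A_def)
    ultimately show ?thesis by (simp add: algebra_simps)
  qed
  also have "f dvd \<dots>" using p'(3) q'(3) by (simp add: dvd_add dvd_mult dvd_mult2)
  finally show ?thesis using h(1) by (intro exI[of _ "2 * K"] bexI[of _ "gd \<xi> ^ K * h"]) (auto intro!: polys_mult polys_power bil_V)
qed

section \<open>Coordinates in which the determinant is monic\<close>

definition T1 :: "nat \<times> nat" where "T1 = (1, 1)"

text \<open>Adds \<open>c\<close> times the first diagonal variable to the other diagonal ones. For \<open>c = 1\<close> the determinant becomes a characteristic
  polynomial in the first variable, and hence monic in it.\<close>
definition shift :: "'a \<Rightarrow> (nat \<times> nat, 'a) mpoly \<Rightarrow> (nat \<times> nat, 'a) mpoly" where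
  "shift c = psub (\<lambda>v. if fst v = snd v \<and> v \<noteq> T1 then Var v + Const c * Var T1 else Var v)"

lemma shift_hom: "comm_ring_hom (shift c)" unfolding shift_def by (rule psub_hom)

lemma shift_Var: "shift c (Var v) = (if fst v = snd v \<and> v \<noteq> T1 then Var v + Const c * Var T1 else Var v)"
  by (simp add: shift_def)

lemma shift_Const: "shift c (Const d) = Const d"
  by (simp add: shift_def)

lemma T_in_V: "T1 \<in> V" using m3 by (auto simp: SC_vars_def T1_def)

lemma shift_V: "p \<in> polys V \<Longrightarrow> shift c p \<in> polys V"
  unfolding shift_def by (erule psub_polys) (use T_in_V in \<open>auto intro!: polys_add polys_mult polys_Var\<close>)

lemma shift_shift: "shift c (shift (- c) p) = p"
proof -
  interpret h: comm_ring_hom "shift c" by (rule shift_hom)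
  interpret h': comm_ring_hom "shift (- c)" by (rule shift_hom)
  have Va: "shift c (shift (- c) (Var v)) = Var v" for v
    by (auto simp: shift_Var shift_Const h.hom_add h.hom_mult h.hom_minus h.hom_uminus Const_uminus)
  have Co: "shift c (shift (- c) (Const d)) = Const d" for d by (simp add: shift_Const)
  show ?thesis using polys_UNIV[of p]
    by (induction rule: mpoly_induct) (simp_all add: Va Co h.hom_add h'.hom_add h.hom_mult h'.hom_mult)
qed

lemma shift_f_monic: "lead_coeff (uni T1 (shift 1 f)) = 1" "pdeg (uni T1 (shift 1 f)) = m"
proof -
  define A where "A = mat m m (\<lambda>(i, j). if i = 0 \<and> j = 0 then 0 else - Var (vx m i j) :: (nat \<times> nat, 'a) mpoly)"
  have A: "A \<in> carrier_mat m m" by (simp add: A_def)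
  have "shift 1 f = det (SM m (\<lambda>v. if fst v = snd v \<and> v \<noteq> T1 then Var v + Var T1 else Var v))"
    unfolding shift_def ins_f[OF comm_ring_hom_Const] by (simp cong: if_cong)
  then have "uni T1 (shift 1 f) = det (SM m (\<lambda>v. uni T1 (if fst v = snd v \<and> v \<noteq> T1 then Var v + Var T1 else Var v)))"
    by (simp add: map_SM flip: uni.hom_det)
  also have "SM m (\<lambda>v. uni T1 (if fst v = snd v \<and> v \<noteq> T1 then Var v + Var T1 else Var v)) = char_poly_matrix A"
  proof (rule eq_matI)
    fix i j assume "i < dim_row (char_poly_matrix A)" "j < dim_col (char_poly_matrix A)"
    then have ij: "i < m" "j < m" by (auto simp: A_def char_poly_matrix_def)
    have v: "vx m i j = T1 \<longleftrightarrow> i = 0 \<and> j = 0" "fst (vx m i j) = snd (vx m i j) \<longleftrightarrow> i = j"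
      using m3 ij by (auto simp: T1_def vx_def min_def max_def split: if_splits)
    show "SM m (\<lambda>v. uni T1 (if fst v = snd v \<and> v \<noteq> T1 then Var v + Var T1 else Var v)) $$ (i, j) = char_poly_matrix A $$ (i, j)"
      using ij v by (auto simp: char_poly_matrix_def A_def uni_Var uni.hom_add)
  qed (auto simp: A_def char_poly_matrix_def)
  finally have "uni T1 (shift 1 f) = char_poly A" by (simp add: char_poly_def)
  then show "lead_coeff (uni T1 (shift 1 f)) = 1" "pdeg (uni T1 (shift 1 f)) = m"
    using degree_monic_char_poly[OF A] by auto
qed

text \<open>Suppose that an integral fraction \<open>p / q\<close> modulo \<open>f\<close> is not in the quotient ring. As that ring is a free module over a
  polynomial ring in one variable less, the failure shows in some further variable \<open>v\<close>, and the ideal of denominators lies in a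
  prime whose quotient has dimension at least \<open>|V| - 2\<close>. But the denominators contain powers of all slopes, so the prime has height at
  least three.\<close>
theorem integral_fraction_in_quotient:
  assumes p: "p \<in> polys V" and q: "q \<in> polys V" "\<not> f dvd q"
    and c: "\<And>i. i < n \<Longrightarrow> c i \<in> polys V" and rel: "f dvd p ^ n + (\<Sum>i<n. c i * p ^ i * q ^ (n - i))"
  shows "\<exists>a\<in>polys V. f dvd p - q * a"
proof (rule ccontr)
  assume neg: "\<not> ?thesis"
  define S T where "S = shift 1" and "T = shift (- 1)"
  interpret S: comm_ring_hom S unfolding S_def by (rule shift_hom)
  interpret T: comm_ring_hom T unfolding T_def by (rule shift_hom)
  have ST: "S (T r) = r" and TS: "T (S r) = r" for r
    using shift_shift[of 1 r] shift_shift[of "- 1" r] by (simp_all add: S_def T_def)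
  have SV: "S r \<in> polys V" and TV: "T r \<in> polys V" if "r \<in> polys V" for r
    using that by (auto simp: S_def T_def shift_V)
  have S_dvd: "S a dvd S b \<longleftrightarrow> a dvd b" for a b
  proof
    assume "S a dvd S b"
    then obtain e where e: "S b = S a * e" by auto
    have "T (S b) = T (S a * e)" by (simp only: e)
    then have "b = a * T e" by (simp only: T.hom_mult TS)
    then show "a dvd b" by simp
  qed (auto simp: S.hom_mult)
  have prime: "S f dvd a \<or> S f dvd b" if "a \<in> polys V" "b \<in> polys V" "S f dvd a * b" for a b
  proof -
    have "S f dvd S (T a * T b)" using that(3) by (simp add: S.hom_mult ST)
    then have "f dvd T a \<or> f dvd T b" using f_prime[OF TV TV] that(1,2) by (simp only: S_dvd)
    then show ?thesis using S_dvd[of f "T a"] S_dvd[of f "T b"] by (simp add: ST)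
  qed
  have neg': "\<not> (\<exists>a\<in>polys V. S f dvd S p - S q * a)"
  proof
    assume "\<exists>a\<in>polys V. S f dvd S p - S q * a"
    then obtain a where a: "a \<in> polys V" "S f dvd S p - S q * a" by blast
    have "S p - S q * a = S (p - q * T a)" by (simp add: S.hom_minus S.hom_mult ST)
    then have "f dvd p - q * T a" using a(2) S_dvd by metis
    then show False using neg TV[OF a(1)] by blast
  qed
  have "\<exists>v\<in>V - {T1}. \<forall>s\<in>polys (V - {T1} - {v}). s \<noteq> 0 \<longrightarrow> \<not> (\<exists>a\<in>polys V. S f dvd s * S p - S q * a)"
  proof (rule ccontr)
    assume "\<not> ?thesis"
    then have h: "\<And>v. v \<in> V - {T1} \<Longrightarrow> \<exists>s\<in>polys (V - {T1} - {v}). s \<noteq> 0 \<and> (\<exists>a\<in>polys V. S f dvd s * S p - S q * a)" by blast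
    have mon: "lead_coeff (uni T1 (S f)) = 1" "pdeg (uni T1 (S f)) > 0"
      using shift_f_monic m3 by (auto simp: S_def)
    have nq: "\<not> S f dvd S q" using q(2) S_dvd by simp
    show False using neg' monic_fraction[OF finite_SC_vars T_in_V SV[OF f_V] mon prime SV[OF q(1)] nq SV[OF p] h] by blast
  qed
  then obtain v where v: "v \<in> V - {T1}"
    and vs: "\<And>s a. s \<in> polys (V - {T1} - {v}) \<Longrightarrow> a \<in> polys V \<Longrightarrow> S f dvd s * S p - S q * a \<Longrightarrow> s = 0" by blast
  define I where "I = {s \<in> polys V. \<exists>a\<in>polys V. S f dvd s * S p - S q * a}"
  have "is_ideal V I"
    unfolding is_ideal_def
  proof (intro conjI ballI)
    show "I \<subseteq> polys V" "0 \<in> I" by (auto simp: I_def intro!: bexI[of _ 0])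
  next
    fix s t assume "s \<in> I" "t \<in> I"
    then obtain a b where ab: "s \<in> polys V" "t \<in> polys V" "a \<in> polys V" "S f dvd s * S p - S q * a" "b \<in> polys V" "S f dvd t * S p - S q * b"
      by (auto simp: I_def)
    have "(s + t) * S p - S q * (a + b) = (s * S p - S q * a) + (t * S p - S q * b)" by (simp add: algebra_simps)
    then have "S f dvd (s + t) * S p - S q * (a + b)" using ab by simp
    then show "s + t \<in> I" using ab unfolding I_def by (blast intro: polys_add)
  next
    fix s r :: "(nat \<times> nat, 'a) mpoly" assume "s \<in> I" and r: "r \<in> polys V"
    then obtain a where ab: "s \<in> polys V" "a \<in> polys V" "S f dvd s * S p - S q * a" by (auto simp: I_def)
    have "(r * s) * S p - S q * (r * a) = r * (s * S p - S q * a)" by (simp add: algebra_simps)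
    then have "S f dvd (r * s) * S p - S q * (r * a)" using ab by simp
    then show "r * s \<in> I" using ab r unfolding I_def by (blast intro: polys_mult)
  qed
  moreover have "s = 0" if "s \<in> I" "s \<in> polys (V - {T1} - {v})" for s using that vs by (auto simp: I_def)
  moreover have "V - {T1} - {v} \<subseteq> V" by auto
  ultimately obtain Q where Q: "is_prime V Q" "I \<subseteq> Q" "Q \<inter> polys (V - {T1} - {v}) \<subseteq> {0}"
    using prime_avoiding_polys[of V I "V - {T1} - {v}"] by blast
  define P where "P = {r \<in> polys V. S r \<in> Q}"
  have P: "is_prime V P" unfolding P_def by (rule is_prime_preimage[OF S.comm_ring_hom_axioms SV Q(1)])
  have "gd \<xi> \<in> P" if iso: "iso \<xi>" for \<xi>
  proof -
    obtain k a where ka: "a \<in> polys V" "f dvd gd \<xi> ^ k * p - q * a"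
      using gd_power_denominator[OF iso p q c rel] by blast
    have "S (gd \<xi> ^ k * p - q * a) = S (gd \<xi>) ^ k * S p - S q * S a"
      by (simp add: S.hom_minus S.hom_mult S.hom_power)
    then have "S f dvd S (gd \<xi>) ^ k * S p - S q * S a" using ka(2) S_dvd by metis
    then have "S (gd \<xi>) ^ k \<in> Q" using Q(2) SV[OF ka(1)] SV[OF bil_V[of \<xi> \<xi>]] by (auto simp: I_def intro: polys_power)
    then show ?thesis using is_prime_power[OF Q(1) SV[OF bil_V]] bil_V by (auto simp: P_def)
  qed
  then obtain d where d: "pchain V 3 d" "d 3 = P" using chain_below_prime_over_iso[OF P] by blast
  \<comment> \<open>The chain of primes was found in the original coordinates and is carried back along the change of variables.\<close>
  define d' where "d' i = {r \<in> polys V. T r \<in> d i}" for i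
  have sub: "d i \<subseteq> polys V" if "i \<le> 3" for i
    using d(1) that is_prime_ideal is_idealD(1) unfolding pchain_def by blast
  have "pchain V 3 d'"
    unfolding pchain_def
  proof (intro conjI allI impI)
    fix i :: nat assume "i \<le> 3"
    then show "is_prime V (d' i)" unfolding d'_def using d(1)
      by (intro is_prime_preimage[OF T.comm_ring_hom_axioms TV]) (auto simp: pchain_def)
  next
    fix i :: nat assume i: "i < 3"
    then have di: "d i \<subset> d (Suc i)" using d(1) by (auto simp: pchain_def)
    then obtain r where r: "r \<in> d (Suc i)" "r \<notin> d i" by blast
    have "r \<in> polys V" using sub[of "Suc i"] r(1) i by auto
    then have "S r \<in> d' (Suc i)" "S r \<notin> d' i" using r SV by (auto simp: d'_def TS)
    moreover have "d' i \<subseteq> d' (Suc i)" using di by (auto simp: d'_def)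
    ultimately show "d' i \<subset> d' (Suc i)" by blast
  qed
  moreover have "d' 3 = Q" using is_idealD(1)[OF is_prime_ideal[OF Q(1)]] TV by (auto simp: d'_def d(2) P_def ST)
  ultimately have "3 + card (V - {T1} - {v}) \<le> card V"
    using Q(3) by (intro card_Diff_le_growth[where C = d']) auto
  moreover have "card (V - {T1} - {v}) = card V - 2" using v T_in_V by (simp add: card_Diff_singleton)
  moreover have "card {T1, v} \<le> card V" using v T_in_V by (intro card_mono) auto
  ultimately show False using v by auto
qed

end

section \<open>Normality of the hypersurface ring\<close>

text \<open>The same homogenization as \<open>hom_eval\<close>, for rings that are types.\<close>
fun homog_eval :: "'r::comm_ring_1 \<Rightarrow> 'r \<Rightarrow> 'r list \<Rightarrow> 'r" where
  "homog_eval a b [] = 0"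
| "homog_eval a b (c # cs) = c * a ^ length cs + b * homog_eval a b cs"

lemma homog_eval_sum:
  "b * homog_eval a b cs = (\<Sum>i<length cs. cs ! (length cs - Suc i) * a ^ i * b ^ (length cs - i))"
proof (induction cs)
  case (Cons c cs)
  let ?n = "length cs"
  have "b * homog_eval a b (c # cs) = c * a ^ ?n * b + b * (b * homog_eval a b cs)"
    by (simp add: algebra_simps)
  also have "b * (b * homog_eval a b cs) = (\<Sum>i<?n. (c # cs) ! (Suc ?n - Suc i) * a ^ i * b ^ (Suc ?n - i))"
    unfolding Cons sum_distrib_left
    by (intro sum.cong refl) (auto simp: Suc_diff_le nth_Cons' mult_ac)
  finally show ?case by (simp add: add.commute)
qed simp

context degenerate_symmetric begin

abbreviation R where "R \<equiv> mpoly_ring V :: (nat \<times> nat, 'a) mpoly ring"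

definition fI :: "(nat \<times> nat, 'a) mpoly set" where "fI = genideal R {f}"

lemma fI_eq: "fI = {r \<in> polys V. f dvd r}"
proof -
  have "fI = {h * f | h. h \<in> polys V}" unfolding fI_def by (rule genideal_single[OF f_V])
  also have "\<dots> = {r \<in> polys V. f dvd r}"
  proof (intro subset_antisym subsetI)
    fix r assume "r \<in> {r \<in> polys V. f dvd r}"
    then obtain h where "h \<in> polys V" "r = f * h" using dvd_polysE[OF _ f_V] by blast
    then show "r \<in> {h * f | h. h \<in> polys V}" by (auto simp: mult.commute)
  qed (auto intro: polys_mult f_V)
  finally show ?thesis .
qed

lemma f_not_unit: "\<not> f dvd 1"
  using f_not_dvd_gd[OF iso_ev0 iso_ev0, of 0 0] by simp

lemma fI_prime: "is_prime V fI"
  unfolding fI_eq by (rule is_prime_multiples[OF f_V f_not_unit f_prime])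

text \<open>An integral relation between residue classes lifts to one modulo \<open>f\<close> between polynomials.\<close>
theorem normal_hypersurface: "normal_domain (R Quot fI)"
proof -
  interpret R: cring R by (rule cring_mpoly_ring)
  interpret P: primeideal fI R using fI_prime primeideal_iff by blast
  interpret A: domain "R Quot fI" by (rule P.quotient_is_domain)
  define cls where "cls = (\<lambda>p. fI +>\<^bsub>R\<^esub> p)"
  have hom: "cls \<in> Ring.ring_hom R (R Quot fI)" unfolding cls_def by (rule P.rcos_ring_hom)
  have c_mult: "cls (p * q) = cls p \<otimes>\<^bsub>R Quot fI\<^esub> cls q" if "p \<in> polys V" "q \<in> polys V" for p q
    using Ring.ring_hom_mult[OF hom, of p q] that by simp
  have c_add: "cls (p + q) = cls p \<oplus>\<^bsub>R Quot fI\<^esub> cls q" if "p \<in> polys V" "q \<in> polys V" for p q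
    using Ring.ring_hom_add[OF hom, of p q] that by simp
  have c_one: "cls 1 = \<one>\<^bsub>R Quot fI\<^esub>" using Ring.ring_hom_one[OF hom] by simp
  have c_carr: "cls p \<in> carrier (R Quot fI)" if "p \<in> polys V" for p
    using Ring.ring_hom_closed[OF hom, of p] that by simp
  have c_eq: "cls p = cls q \<longleftrightarrow> f dvd p - q" if "p \<in> polys V" "q \<in> polys V" for p q
    using R.quotient_eq_iff_same_a_r_cos[OF P.ideal_axioms, of p q] that
    by (auto simp: cls_def a_minus_def a_inv_mpoly_ring fI_eq intro: polys_diff)
  have c_zero: "\<zero>\<^bsub>R Quot fI\<^esub> = cls 0"
    using c_add[of 0 0] A.add.r_cancel_one[of "cls 0" "cls 0"] c_carr[of 0] by simp
  have c_surj: "\<exists>p\<in>polys V. x = cls p" if "x \<in> carrier (R Quot fI)" for x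
    using that by (auto simp: FactRing_def A_RCOSETS_def' cls_def)
  have c_pow: "cls (p ^ n) = cls p [^]\<^bsub>R Quot fI\<^esub> n" if "p \<in> polys V" for p and n :: nat
    using that by (induction n) (auto simp: c_one c_mult polys_power A.m_comm c_carr)
  have he_V: "homog_eval p q ds \<in> polys V" if "p \<in> polys V" "q \<in> polys V" "set ds \<subseteq> polys V" for p q ds
    using that by (induction ds) (auto intro: polys_add polys_mult polys_power)
  have c_he: "A.hom_eval (cls p) (cls q) (map cls ds) = cls (homog_eval p q ds)"
    if "p \<in> polys V" "q \<in> polys V" "set ds \<subseteq> polys V" for p q ds
    using that
    by (induction ds) (auto simp: c_zero c_add c_mult c_pow he_V polys_mult polys_power)
  show ?thesis
  proof (rule A.normal_domainI)
    fix a b cs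
    assume a: "a \<in> carrier (R Quot fI)" and b: "b \<in> carrier (R Quot fI)" "b \<noteq> \<zero>\<^bsub>R Quot fI\<^esub>"
      and cs: "set cs \<subseteq> carrier (R Quot fI)" and rel: "A.hom_eval a b (\<one>\<^bsub>R Quot fI\<^esub> # cs) = \<zero>\<^bsub>R Quot fI\<^esub>"
    obtain p where p: "p \<in> polys V" "a = cls p" using c_surj[OF a] by blast
    obtain q where q: "q \<in> polys V" "b = cls q" using c_surj[OF b(1)] by blast
    have "\<exists>ds. set ds \<subseteq> polys V \<and> cs = map cls ds"
      using cs
    proof (induction cs)
      case (Cons c cs)
      then obtain ds where "set ds \<subseteq> polys V" "cs = map cls ds" by auto
      moreover obtain d where "d \<in> polys V" "c = cls d" using c_surj[of c] Cons.prems by auto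
      ultimately show ?case by (intro exI[of _ "d # ds"]) auto
    qed auto
    then obtain ds where ds: "set ds \<subseteq> polys V" "cs = map cls ds" by blast
    have "cls (homog_eval p q (1 # ds)) = cls 0"
      using c_he[of p q "1 # ds"] rel p q ds by (simp add: c_one c_zero del: homog_eval.simps A.hom_eval.simps)
    then have "f dvd homog_eval p q (1 # ds)"
      using c_eq[of "homog_eval p q (1 # ds)" 0] he_V[of p q "1 # ds"] p q ds by (simp del: homog_eval.simps)
    also have "homog_eval p q (1 # ds) = p ^ length ds + (\<Sum>i<length ds. ds ! (length ds - Suc i) * p ^ i * q ^ (length ds - i))"
      by (simp add: homog_eval_sum)
    finally have rel': "f dvd p ^ length ds + (\<Sum>i<length ds. ds ! (length ds - Suc i) * p ^ i * q ^ (length ds - i))" .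
    have nq: "\<not> f dvd q" using b(2) c_eq[of q 0] q by (simp add: c_zero)
    have dsV: "ds ! (length ds - Suc i) \<in> polys V" if "i < length ds" for i
      using ds(1) that by (intro subsetD[OF ds(1)] nth_mem) auto
    obtain h where "h \<in> polys V" "f dvd p - q * h"
      using integral_fraction_in_quotient[OF p(1) q(1) nq dsV rel'] by blast
    then show "\<exists>c\<in>carrier (R Quot fI). a = b \<otimes>\<^bsub>R Quot fI\<^esub> c"
      using p q c_eq[of p "q * h"] c_mult[of q h] c_carr[of h] by (intro bexI[of _ "cls h"]) (auto intro: polys_mult)
  qed
qed

section \<open>The codimension of the gradient ideal\<close>

definition J :: "(nat \<times> nat, 'a) mpoly set" where "J = gradient_ideal V f"

lemma partial_V: "partial v f \<in> polys V" by (rule partial_polys[OF f_V])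

lemma J_ideal: "is_ideal V J"
proof -
  interpret R: ring R by (rule ring_mpoly_ring)
  have "ideal J R" unfolding J_def gradient_ideal_def by (rule R.genideal_ideal) (auto simp: partial_V)
  then show ?thesis by (simp add: ideal_iff)
qed

lemma J_gen: "v \<in> V \<Longrightarrow> partial v f \<in> J"
proof -
  assume "v \<in> V"
  interpret R: ring R by (rule ring_mpoly_ring)
  show ?thesis unfolding J_def gradient_ideal_def
    by (rule subsetD[OF R.genideal_self]) (use \<open>v \<in> V\<close> in \<open>auto simp: partial_V\<close>)
qed

lemma J_subsetI: "is_ideal V I \<Longrightarrow> (\<And>v. v \<in> V \<Longrightarrow> partial v f \<in> I) \<Longrightarrow> J \<subseteq> I"
proof -
  assume h: "is_ideal V I" "\<And>v. v \<in> V \<Longrightarrow> partial v f \<in> I"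
  interpret R: ring R by (rule ring_mpoly_ring)
  show ?thesis unfolding J_def gradient_ideal_def
    by (rule R.genideal_minimal) (use h in \<open>auto simp: ideal_iff\<close>)
qed

text \<open>A matrix with two independent kernel vectors has a kernel vector that vanishes at any given position \<open>j\<close>. It is then also in
  the kernel of the matrix whose determinant is the cofactor.\<close>
lemma cofactor_zero_if_two_kernel_vectors:
  fixes A :: "'k::idom mat"
  assumes A: "A \<in> carrier_mat n n" and ij: "i < n" "j < n" and ab: "a < n" "b < n"
    and u: "\<And>k. k < n \<Longrightarrow> (\<Sum>l<n. A $$ (k, l) * u l) = 0" "u a \<noteq> 0" "u b = 0"
    and w: "\<And>k. k < n \<Longrightarrow> (\<Sum>l<n. A $$ (k, l) * w l) = 0" "w b \<noteq> 0" "w a = 0"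
  shows "cofactor A i j = 0"
proof -
  define z where "z l = (if u j = 0 \<and> w j = 0 then u l else w j * u l - u j * w l)" for l
  have zj: "z j = 0" by (simp add: z_def)
  have "z a \<noteq> 0 \<or> z b \<noteq> 0" using u w by (auto simp: z_def)
  then obtain c where c: "c < n" "z c \<noteq> 0" using ab by auto
  have Az: "(\<Sum>l<n. A $$ (k, l) * z l) = 0" if "k < n" for k
  proof (cases "u j = 0 \<and> w j = 0")
    case False
    then have "(\<Sum>l<n. A $$ (k, l) * z l) = w j * (\<Sum>l<n. A $$ (k, l) * u l) - u j * (\<Sum>l<n. A $$ (k, l) * w l)"
      by (auto simp: z_def sum_distrib_left sum_subtractf[symmetric] algebra_simps intro!: sum.cong)
    then show ?thesis using u(1) w(1) that by simp
  qed (use u(1) that in \<open>simp add: z_def\<close>)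
  let ?S = "setrow A i (unitrow j)"
  have S: "?S \<in> carrier_mat n n" using A by simp
  have "?S *\<^sub>v vec n z = 0\<^sub>v n"
  proof (rule eq_vecI)
    fix k assume "k < dim_vec (0\<^sub>v n :: 'k vec)"
    then have k: "k < n" by simp
    have "(?S *\<^sub>v vec n z) $ k = (\<Sum>l<n. ?S $$ (k, l) * z l)"
      using S k by (auto simp: scalar_prod_def lessThan_atLeast0 intro!: sum.cong)
    also have "\<dots> = 0"
    proof (cases "k = i")
      case True
      have "(\<Sum>l<n. ?S $$ (k, l) * z l) = (\<Sum>l<n. if l = j then z j else 0)"
        using A k True by (intro sum.cong refl) (auto simp: setrow_def)
      then show ?thesis using ij zj by simp
    next
      case False
      have "(\<Sum>l<n. ?S $$ (k, l) * z l) = (\<Sum>l<n. A $$ (k, l) * z l)"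
        using A k False by (intro sum.cong refl) (auto simp: setrow_def)
      then show ?thesis using Az[OF k] by simp
    qed
    finally show "(?S *\<^sub>v vec n z) $ k = 0\<^sub>v n $ k" using k by simp
  qed (use A in \<open>auto simp: setrow_def\<close>)
  moreover have "vec n z \<noteq> 0\<^sub>v n"
  proof
    assume "vec n z = 0\<^sub>v n"
    then have "vec n z $ c = 0" using c(1) by simp
    then show False using c by simp
  qed
  ultimately have "det ?S = 0" using det_0_iff_vec_prod_zero[OF S] by (metis vec_carrier)
  then show ?thesis using det_setrow_unit[OF A ij] by simp
qed

lemma ins_F_polys:
  assumes "p \<in> polys U" "\<And>v. v \<in> U \<Longrightarrow> x v = F (Var v)"
  shows "ins (\<lambda>c. F (Const c)) x p = F p"
  by (rule comm_ring_hom_unique[OF comm_ring_hom_ins[OF rho_base] comm_ring_hom_to_fract assms(1)])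
     (auto simp: ins_Const[OF rho_base] ins_Var[OF rho_base] assms(2))

text \<open>A point of the family over the fraction field with corank two, whose coordinates contain all but three of the variables
  themselves, is the generic point of a prime of height at most three that contains the gradient.\<close>
lemma prime_from_point:
  assumes U: "U \<subseteq> V" "card V \<le> card U + 3" and x: "\<And>v. v \<in> U \<Longrightarrow> x v = F (Var v)"
    and ab: "a < m" "b < m"
    and u: "\<And>k. k < m \<Longrightarrow> (\<Sum>l<m. x (vx m k l) * u l) = 0" "u a \<noteq> 0" "u b = 0"
    and w: "\<And>k. k < m \<Longrightarrow> (\<Sum>l<m. x (vx m k l) * w l) = 0" "w b \<noteq> 0" "w a = 0"
  shows "\<exists>P. is_prime V P \<and> J \<subseteq> P \<and> height R P \<le> 3"
proof -
  define \<psi> where "\<psi> = ins (\<lambda>c. F (Const c)) x"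
  interpret \<psi>: comm_ring_hom \<psi> unfolding \<psi>_def by (rule comm_ring_hom_ins[OF rho_base])
  define P where "P = {p \<in> polys V. \<psi> p = 0}"
  have P: "is_prime V P"
    by (auto simp: is_prime_def is_ideal_def P_def \<psi>.hom_add \<psi>.hom_mult intro: polys_add polys_mult)
  have C0: "\<psi> (C i j) = 0" if "i < m" "j < m" for i j
    unfolding \<psi>_def ins_C[OF rho_base that]
    by (rule cofactor_zero_if_two_kernel_vectors[OF SM_carrier that ab, of x u w]) (use u w in auto)
  have "J \<subseteq> P"
  proof (rule J_subsetI[OF is_prime_ideal[OF P]])
    fix v
    have "\<psi> (partial v f) = (\<Sum>i<m. \<Sum>j<m. \<psi> (if vx m i j = v then C i j else 0))"
      by (simp add: partial_f \<psi>.hom_sum)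
    also have "\<dots> = 0" by (intro sum.neutral ballI) (auto simp: C0)
    finally show "partial v f \<in> P" by (simp add: P_def partial_V)
  qed
  moreover have "height R P \<le> enat 3"
  proof (rule height_le)
    fix n c assume c: "pchain V n c" "c n = P"
    have "P \<inter> polys U \<subseteq> {0}" using ins_F_polys[of _ U x] x by (auto simp: P_def \<psi>_def)
    then have "n + card U \<le> card V" using c U by (intro card_Diff_le_growth[where C = c]) auto
    then show "n \<le> 3" using U by linarith
  qed
  then have "height R P \<le> 3" by (simp add: numeral_eq_enat)
  ultimately show ?thesis using P by blast
qed

text \<open>For \<open>m = 3\<close>: the matrix of rank one with the first row \<open>(s, t, t)\<close> has equal last two diagonal entries.\<close>
lemma exists_prime_height_3_small:
  assumes m: "m = 3"
  shows "\<exists>P. is_prime V P \<and> J \<subseteq> P \<and> height R P \<le> 3"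
proof -
  define s t where "s = F (Var (1, 1))" and "t = F (Var (1, 2))"
  have s0: "s \<noteq> 0" by (simp add: s_def Var_def)
      (metis lookup_single_eq lookup_zero one_neq_zero)
  define x where "x = (\<lambda>(i::nat, j::nat). if i = 1 \<and> j = 1 then s else if i = 1 then t else t * t / s)"
  have n3: "(\<Sum>l<m. g l) = g 0 + g 1 + g 2" for g :: "nat \<Rightarrow> (nat \<times> nat, 'a) mpoly fract"
    by (simp add: m eval_nat_numeral)
  have lt: "k = 0 \<or> k = 1 \<or> k = 2" if "k < m" for k using m that by auto
  have x00: "x (vx m 0 0) = s" and x01: "x (vx m 0 1) = t" "x (vx m 1 0) = t" "x (vx m 0 2) = t" "x (vx m 2 0) = t"
    and x12: "x (vx m 1 2) = t * t / s" "x (vx m 2 1) = t * t / s" "x (vx m 1 1) = t * t / s" "x (vx m 2 2) = t * t / s"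
    by (simp_all add: x_def vx_def m)
  show ?thesis
  proof (rule prime_from_point[of "{(1, 1), (1, 2)}" x 1 2 "\<lambda>l. if l = 0 then - t else if l = 1 then s else 0" "\<lambda>l. if l = 0 then - t else if l = 2 then s else 0"])
    show "{(1, 1), (1, 2)} \<subseteq> V" by (auto simp: SC_vars_def m)
    show "card V \<le> card {(1::nat, 1::nat), (1, 2)} + 3" using card_SC_vars[of m] by (simp add: m eval_nat_numeral)
    show "x v = F (Var v)" if "v \<in> {(1, 1), (1, 2)}" for v using that by (auto simp: x_def s_def t_def)
    fix k assume "k < m"
    then consider "k = 0" | "k = 1" | "k = 2" using lt by blast
    note k = this
    show "(\<Sum>l<m. x (vx m k l) * (if l = 0 then - t else if l = 1 then s else 0)) = 0"
      using k
    proof cases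
      case 1 show ?thesis unfolding 1 n3 x00 x01 x12 by simp
    next
      case 2 show ?thesis unfolding 2 n3 x00 x01 x12 using s0 by simp
    next
      case 3 show ?thesis unfolding 3 n3 x00 x01 x12 using s0 by simp
    qed
    show "(\<Sum>l<m. x (vx m k l) * (if l = 0 then - t else if l = 2 then s else 0)) = 0"
      using k
    proof cases
      case 1 show ?thesis unfolding 1 n3 x00 x01 x12 by simp
    next
      case 2 show ?thesis unfolding 2 n3 x00 x01 x12 using s0 by simp
    next
      case 3 show ?thesis unfolding 3 n3 x00 x01 x12 using s0 by simp
    qed
  qed (auto simp: m s0)
qed

text \<open>For \<open>m \<ge> 4\<close>: leave all entries outside the upper left block of size two generic, and choose this block as the
  Schur complement that makes the rank equal to \<open>m - 2\<close>. The last two diagonal entries lie in the generic part.\<close>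
lemma exists_prime_height_3_large:
  assumes m: "m \<ge> 4"
  shows "\<exists>P. is_prime V P \<and> J \<subseteq> P \<and> height R P \<le> 3"
proof -
  interpret F: comm_ring_hom F by (rule comm_ring_hom_to_fract)
  define n where "n = m - 2"
  define S where "S = mat n n (\<lambda>(i, j). F (Var (vx m (i + 2) (j + 2))))"
  have S: "S \<in> carrier_mat n n" by (simp add: S_def)
  have Ssym: "transpose_mat S = S" by (rule eq_matI) (auto simp: S_def vx_commute)
  define r where "r a i = F (Var (vx m a (i + 2)))" for a i
  define d where "d = det S"
  define z where "z a i = (\<Sum>j<n. cofactor S i j * r a j)" for a i
  define y where "y a b = (\<Sum>i<n. r a i * z b i) / d" for a b
  have ysym: "y a b = y b a" for a b
  proof -
    have "(\<Sum>i<n. r a i * z b i) = (\<Sum>i<n. \<Sum>j<n. r a i * (cofactor S i j * r b j))" by (simp add: z_def sum_distrib_left)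
    also have "\<dots> = (\<Sum>j<n. \<Sum>i<n. r a i * (cofactor S i j * r b j))" by (rule sum.swap)
    also have "\<dots> = (\<Sum>j<n. r b j * z a j)"
      unfolding z_def sum_distrib_left by (intro sum.cong refl) (auto simp: cofactor_sym[OF S Ssym] mult_ac)
    finally show ?thesis by (simp add: y_def)
  qed
  have d0: "d \<noteq> 0"
  proof -
    define S' where "S' = mat n n (\<lambda>(i, j). Var (vx m (i + 2) (j + 2)) :: (nat \<times> nat, 'a) mpoly)"
    have "S = map_mat F S'" by (rule eq_matI) (auto simp: S_def S'_def)
    then have d: "d = F (det S')" by (simp add: d_def)
    interpret e: comm_ring_hom "ins (\<lambda>c::'a. c) (\<lambda>(i, j). if i = (j::nat) then 1 else 0)" by (rule comm_ring_hom_ins[OF comm_ring_hom_id])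
    have "ins (\<lambda>c::'a. c) (\<lambda>(i, j). if i = j then 1 else 0) (det S') = det (1\<^sub>m n)"
      unfolding e.hom_det[symmetric]
      by (intro arg_cong[of _ _ det] eq_matI) (auto simp: S'_def ins_Var[OF comm_ring_hom_id] vx_def min_def max_def n_def)
    then have "det S' \<noteq> 0" by (auto simp: ins_0[OF comm_ring_hom_id])
    then show ?thesis by (simp add: d)
  qed
  define x where "x v = (if v = (1, 1) then y 0 0 else if v = (1, 2) then y 0 1 else if v = (2, 2) then y 1 1 else F (Var v))" for v
  have xvx: "x (vx m k l) = (if k < 2 \<and> l < 2 then y k l else F (Var (vx m k l)))" if "k < m" "l < m" for k l
  proof (cases "k < 2 \<and> l < 2")
    case True
    then have "k = 0 \<or> k = 1" "l = 0 \<or> l = 1" by auto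
    then show ?thesis using m ysym[of 0 1] by (auto simp: x_def vx_def)
  next
    case False
    have "vx m k l \<noteq> (1, 1)" "vx m k l \<noteq> (1, 2)" "vx m k l \<noteq> (2, 2)"
      using False m that by (auto simp: vx_def min_def max_def split: if_splits)
    then have "x (vx m k l) = F (Var (vx m k l))" by (simp add: x_def)
    then show ?thesis unfolding if_not_P[OF False] .
  qed
  \<comment> \<open>Kernel vectors: the columns of \<open>(d I, - adj(S) r\<^sup>T)\<close>.\<close>
  define u where "u a l = (if l < 2 then if l = a then d else 0 else - z a (l - 2))" for a l
  have split: "(\<Sum>l<m. g l) = g 0 + g 1 + (\<Sum>i<n. g (i + 2))" for g :: "nat \<Rightarrow> (nat \<times> nat, 'a) mpoly fract"
  proof -
    have "m = Suc (Suc n)" using m by (simp add: n_def)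
    then show ?thesis by (simp add: sum.lessThan_Suc_shift eval_nat_numeral add.assoc del: sum.lessThan_Suc)
  qed
  have Su: "(\<Sum>l<m. x (vx m k l) * u a l) = 0" if k: "k < m" and a: "a < 2" for k a
  proof -
    have "(\<Sum>l<m. x (vx m k l) * u a l) = x (vx m k 0) * u a 0 + x (vx m k 1) * u a 1 + (\<Sum>i<n. x (vx m k (i + 2)) * u a (i + 2))"
      by (rule split)
    also have "x (vx m k 0) * u a 0 + x (vx m k 1) * u a 1 = x (vx m k a) * d"
    proof -
      have "a = 0 \<or> a = 1" using a by linarith
      then show ?thesis by (auto simp: u_def)
    qed
    also have "(\<Sum>i<n. x (vx m k (i + 2)) * u a (i + 2)) = - (\<Sum>i<n. F (Var (vx m k (i + 2))) * z a i)"
      unfolding sum_negf[symmetric] using k by (intro sum.cong refl) (auto simp: u_def xvx n_def)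
    also have "x (vx m k a) * d + - (\<Sum>i<n. F (Var (vx m k (i + 2))) * z a i) = 0"
    proof (cases "k < 2")
      case True
      then show ?thesis using a k m d0 by (simp add: xvx y_def r_def)
    next
      case False
      then have kn: "k - 2 < n" using k by (simp add: n_def)
      have Skn: "S $$ (k - 2, i) = F (Var (vx m k (i + 2)))" if "i < n" for i
      proof -
        have "k - 2 + 2 = k" using False by simp
        then show ?thesis unfolding S_def using kn that by (simp only: index_mat split_conv)
      qed
      have "(\<Sum>i<n. F (Var (vx m k (i + 2))) * z a i) = (\<Sum>i<n. \<Sum>j<n. r a j * (S $$ (k - 2, i) * cofactor S j i))"
        unfolding z_def sum_distrib_left
      proof (intro sum.cong refl)
        fix i j assume "i \<in> {..<n}" "j \<in> {..<n}"
        then show "F (Var (vx m k (i + 2))) * (cofactor S i j * r a j) = r a j * (S $$ (k - 2, i) * cofactor S j i)"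
          using kn cofactor_sym[OF S Ssym, of i j] Skn[of i] by (simp add: mult_ac)
      qed
      also have "\<dots> = (\<Sum>j<n. r a j * (\<Sum>i<n. S $$ (k - 2, i) * cofactor S j i))"
        by (subst sum.swap) (simp add: sum_distrib_left)
      also have "\<dots> = (\<Sum>j<n. if j = k - 2 then r a j * d else 0)"
        using kn by (intro sum.cong refl) (auto simp: sum_cofactor[OF S] d_def)
      also have "\<dots> = r a (k - 2) * d" using kn by simp
      also have "r a (k - 2) = x (vx m k a)" 
      proof -
        have e: "k - 2 + 2 = k" using False by simp
        show ?thesis using False k a m by (simp only: r_def e) (simp add: xvx vx_commute)
      qed
      finally show ?thesis by simp
    qed
    finally show ?thesis .
  qed
  show ?thesis
  proof (rule prime_from_point[of "V - {(1, 1), (1, 2), (2, 2)}" x 0 1 "u 0" "u 1"])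
    have "card {(1::nat, 1::nat), (1, 2), (2, 2)} = 3" by simp
    moreover have "{(1, 1), (1, 2), (2, 2)} \<subseteq> V" using m by (auto simp: SC_vars_def)
    ultimately have "card (V - {(1, 1), (1, 2), (2, 2)}) = card V - 3" by (subst card_Diff_subset) auto
    then show "card V \<le> card (V - {(1, 1), (1, 2), (2, 2)}) + 3" by simp
  qed (use m Su d0 in \<open>auto simp: x_def u_def\<close>)
qed

theorem codim_J: "codim R J = 3"
proof (rule antisym)
  have "m = 3 \<or> m \<ge> 4" using m3 by auto
  then obtain P where P: "is_prime V P" "J \<subseteq> P" "height R P \<le> 3"
    using exists_prime_height_3_small exists_prime_height_3_large by blast
  have "codim R J \<le> height R P" unfolding codim_def
    by (rule Inf_lower) (use P in \<open>auto simp: primeideal_iff\<close>)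
  then show "codim R J \<le> 3" using P(3) by (rule order_trans)
next
  show "3 \<le> codim R J" unfolding codim_def
  proof (rule Inf_greatest)
    fix h assume "h \<in> {height R P | P. primeideal P R \<and> J \<subseteq> P}"
    then obtain P where P: "h = height R P" "is_prime V P" "J \<subseteq> P" by (auto simp: primeideal_iff)
    have "partial v f \<in> P" if "v \<in> V" for v using J_gen[OF that] P(3) by blast
    then obtain c where c: "pchain V 3 c" "c 3 = P" using chain_below_prime_over_gradient[OF P(2)] by blast
    have "enat 3 \<le> h" unfolding P(1) by (rule height_ge[OF c])
    then show "3 \<le> h" by (simp add: numeral_eq_enat)
  qed
qed

section \<open>The ideal of submaximal minors\<close>

lemma pick_delete:
  assumes "k < m - 1" "i < m"
  shows "pick ({..<m} - {i}) k = insert_index i k"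
proof -
  let ?S = "{..<m} - {i}"
  have in_S: "insert_index i k \<in> ?S" using assms by (auto simp: insert_index_def)
  have "{a \<in> ?S. a < insert_index i k} = (if k < i then {..<k} else {..<Suc k} - {i})"
    using assms by (auto simp: insert_index_def)
  then have "card {a \<in> ?S. a < insert_index i k} = k" by (auto simp: not_less)
  then show ?thesis using pick_card_in_set[OF in_S] by metis
qed

lemma submatrix_eq_mat_delete:
  assumes "i < m" "j < m"
  shows "submatrix XX ({..<m} - {i}) ({..<m} - {j}) = mat_delete XX i j"
proof (rule eq_matI)
  have eq: "{a. a < m \<and> a \<in> {..<m} - {b}} = {..<m} - {b}" for b by auto
  have c: "card ({..<m} - {b}) = m - 1" if "b < m" for b using that by simp
  show "dim_row (submatrix XX ({..<m} - {i}) ({..<m} - {j})) = dim_row (mat_delete XX i j)"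
    "dim_col (submatrix XX ({..<m} - {i}) ({..<m} - {j})) = dim_col (mat_delete XX i j)"
    using assms by (simp_all only: dim_submatrix X_dim eq c mat_delete_dim)
  fix k l assume kl: "k < dim_row (mat_delete XX i j)" "l < dim_col (mat_delete XX i j)"
  then have kl': "k < m - 1" "l < m - 1" by auto
  have "submatrix XX ({..<m} - {i}) ({..<m} - {j}) $$ (k, l) = XX $$ (pick ({..<m} - {i}) k, pick ({..<m} - {j}) l)"
    by (rule submatrix_index) (use kl' assms in \<open>simp_all only: X_dim eq c\<close>)
  also have "\<dots> = mat_delete XX i j $$ (k, l)"
    using kl' assms by (simp add: pick_delete mat_delete_def insert_index_def)
  finally show "submatrix XX ({..<m} - {i}) ({..<m} - {j}) $$ (k, l) = mat_delete XX i j $$ (k, l)" .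
qed

lemma minor_V: "det (submatrix XX I K) \<in> polys V" if "I \<subseteq> {..<m}" "K \<subseteq> {..<m}" "card I = card K"
proof (rule polys_det)
  have eq: "{a. a < m \<and> a \<in> I} = I" "{a. a < m \<and> a \<in> K} = K" using that by auto
  show "submatrix XX I K \<in> carrier_mat (card K) (card K)"
    by (rule carrier_matI) (simp_all only: dim_submatrix X_dim eq that)
  fix i j assume ij: "i < card K" "j < card K"
  have "submatrix XX I K $$ (i, j) = XX $$ (pick I i, pick K j)"
    by (rule submatrix_index) (simp_all only: X_dim eq that ij)
  moreover have "pick I i \<in> I" "pick K j \<in> K" using ij that by (auto intro!: pick_in_set_le)
  then have "pick I i < m" "pick K j < m" using that by auto
  ultimately show "submatrix XX I K $$ (i, j) \<in> polys V" by (simp add: Xij_V)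
qed

theorem J_subset_minors: "J \<subseteq> minors_ideal V (m - 1) XX"
proof -
  interpret R: ring R by (rule ring_mpoly_ring)
  let ?S = "{det (submatrix XX I K) | I K. I \<subseteq> {..<dim_row XX} \<and> K \<subseteq> {..<dim_col XX} \<and> card I = m - 1 \<and> card K = m - 1}"
  have SV: "?S \<subseteq> carrier R" using minor_V by auto
  have I: "is_ideal V (minors_ideal V (m - 1) XX)"
    unfolding minors_ideal_def ideal_iff[symmetric] by (rule R.genideal_ideal[OF SV])
  have CI: "C i j \<in> minors_ideal V (m - 1) XX" if ij: "i < m" "j < m" for i j
  proof -
    have "det (mat_delete XX i j) \<in> ?S"
      unfolding submatrix_eq_mat_delete[OF ij, symmetric] using ij
      by (intro CollectI exI[of _ "{..<m} - {i}"] exI[of _ "{..<m} - {j}"]) auto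
    then have "det (mat_delete XX i j) \<in> minors_ideal V (m - 1) XX"
      unfolding minors_ideal_def using R.genideal_self[OF SV] by blast
    then show ?thesis unfolding cofactor_def
      by (rule is_idealD(4)[OF I]) (intro polys_power polys_uminus polys_1)
  qed
  show ?thesis
    by (rule J_subsetI[OF I], unfold partial_f, intro is_ideal_sum[OF I])
       (use CI is_idealD(2)[OF I] in auto)
qed

end

section \<open>Forms under substitution, and adjoints of symmetric matrices\<close>

lemma is_form_det_rows:
  fixes M :: "('v, 'a::comm_ring_1) mpoly mat"
  assumes M: "M \<in> carrier_mat n n" and "\<And>i j. i < n \<Longrightarrow> j < n \<Longrightarrow> is_form V (d i) (M $$ (i, j))"
  shows "is_form V (\<Sum>i<n. d i) (det M)"
  unfolding det_def'[OF M] lessThan_atLeast0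
proof (rule is_form_sum)
  fix p assume "p \<in> {p. p permutes {0..<n}}"
  then have "is_form V (\<Sum>i = 0..<n. d i) (\<Prod>i = 0..<n. M $$ (i, p i))"
    by (intro is_form_prod assms) (auto simp: permutes_in_image)
  then show "is_form V (\<Sum>i = 0..<n. d i) (signof p * (\<Prod>i = 0..<n. M $$ (i, p i)))"
    by (auto simp: sign_def is_form_uminus)
qed

lemma is_form_psub:
  assumes p: "is_form V d p" and g: "\<And>v. v \<in> V \<Longrightarrow> is_form W e (g v)"
  shows "is_form W (d * e) (psub g p)"
  unfolding ins_def
proof (rule is_form_sum)
  fix t assume t: "t \<in> mkeys p"
  have tV: "mkeys t \<subseteq> V" using is_form_polys[OF p] t by (simp only: polys_iff)
  have "is_form W (\<Sum>v\<in>mkeys t. lkp t v * e) (mev g t)"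
    unfolding mev_def by (rule is_form_prod) (use g tV in \<open>auto intro: is_form_power\<close>)
  also have "(\<Sum>v\<in>mkeys t. lkp t v * e) = d * e"
    using p t by (auto simp: is_form_def mon_deg_def simp flip: sum_distrib_right)
  finally show "is_form W (d * e) (Const (lkp p t) * mev g t)" by (rule is_form_Const_mult)
qed

lemma cofactor_scale:
  assumes A: "A \<in> carrier_mat n n" and ij: "i < n" "j < n"
  shows "cofactor (c \<cdot>\<^sub>m A) i j = c ^ (n - 1) * cofactor A i j"
proof -
  have "mat_delete (c \<cdot>\<^sub>m A) i j = c \<cdot>\<^sub>m mat_delete A i j"
    using A ij by (intro eq_matI) (auto simp: mat_delete_def)
  then show ?thesis using A by (simp add: cofactor_def mult_ac)
qed

lemma det_diag: "det (mat n n (\<lambda>(i, j). if i = j then d i else 0)) = (\<Prod>i<n. d i :: 'r::comm_ring_1)"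
proof -
  let ?A = "mat n n (\<lambda>(i, j). if i = j then d i else (0::'r))"
  have "det ?A = prod_list (diag_mat ?A)" by (rule det_upper_triangular[of _ n]) auto
  also have "diag_mat ?A = map d [0..<n]" by (auto simp: diag_mat_def)
  finally show ?thesis by (simp add: prod.distinct_set_conv_list[symmetric] lessThan_atLeast0)
qed

lemma det_masked_scale:
  assumes A: "A \<in> carrier_mat n n" and K: "K \<subseteq> {..<n}"
  shows "det (masked (c \<cdot>\<^sub>m A) K) = c ^ card K * det (masked A K)"
proof -
  let ?D = "mat n n (\<lambda>(i, j). if i = j then if i \<in> K then c else 1 else 0)"
  have "masked (c \<cdot>\<^sub>m A) K = ?D * masked A K"
  proof (rule eq_matI)
    fix i j assume "i < dim_row (?D * masked A K)" "j < dim_col (?D * masked A K)"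
    then have ij: "i < n" "j < n" using A by (auto simp: masked_def)
    have "(?D * masked A K) $$ (i, j) = (\<Sum>k<n. (if i = k then if i \<in> K then c else 1 else 0) * masked A K $$ (k, j))"
      using A ij by (auto simp: times_mat_def scalar_prod_def lessThan_atLeast0 masked_def intro!: sum.cong)
    also have "\<dots> = (\<Sum>k<n. if k = i then (if i \<in> K then c else 1) * masked A K $$ (i, j) else 0)"
      by (intro sum.cong refl) auto
    also have "\<dots> = (if i \<in> K then c else 1) * masked A K $$ (i, j)" using ij by simp
    also have "\<dots> = masked (c \<cdot>\<^sub>m A) K $$ (i, j)" using A ij by (auto simp: masked_def)
    finally show "masked (c \<cdot>\<^sub>m A) K $$ (i, j) = (?D * masked A K) $$ (i, j)" by simp
  qed (use A in \<open>auto simp: masked_def\<close>)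
  then have "det (masked (c \<cdot>\<^sub>m A) K) = det ?D * det (masked A K)"
    using A det_mult[of ?D n "masked A K"] by simp
  also have "det ?D = (\<Prod>i<n. if i \<in> K then c else 1)" by (rule det_diag)
  also have "\<dots> = (\<Prod>i\<in>K. c)" using K by (subst prod.inter_restrict[symmetric]) (auto simp: Int_absorb1)
  finally show ?thesis by simp
qed

text \<open>The determinant is affine in a diagonal entry, with the complementary principal minor as slope.\<close>
lemma det_masked_add_diag:
  assumes A: "A \<in> carrier_mat n n" "A' \<in> carrier_mat n n" and a: "a < n" "a \<notin> K"
    and A': "\<And>i j. i \<in> insert a K \<Longrightarrow> j \<in> insert a K \<Longrightarrow> i < n \<Longrightarrow> j < n \<Longrightarrow> A' $$ (i, j) = A $$ (i, j) + (if i = a \<and> j = a then s else 0)"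
  shows "det (masked A' (insert a K)) = det (masked A (insert a K)) + s * det (masked A K)"
proof -
  let ?M = "masked A (insert a K)" and ?M' = "masked A' (insert a K)"
  have M: "?M \<in> carrier_mat n n" "?M' \<in> carrier_mat n n" using A by auto
  have cof: "cofactor ?M' a j = cofactor ?M a j" if "j < n" for j
  proof -
    have "mat_delete ?M' a j = mat_delete ?M a j"
    proof (rule eq_matI)
      fix k l assume "k < dim_row (mat_delete ?M a j)" "l < dim_col (mat_delete ?M a j)"
      then show "mat_delete ?M' a j $$ (k, l) = mat_delete ?M a j $$ (k, l)"
        using A a A'[of "if k < a then k else Suc k" "if l < j then l else Suc l"]
        by (auto simp: mat_delete_def masked_def)
    qed (use A in \<open>auto simp: masked_def\<close>)
    then show ?thesis by (simp add: cofactor_def)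
  qed
  have "det ?M' = (\<Sum>j<n. ?M' $$ (a, j) * cofactor ?M' a j)" by (rule laplace_expansion_row[OF M(2) a(1)])
  also have "\<dots> = (\<Sum>j<n. ?M $$ (a, j) * cofactor ?M a j + (if j = a then s * cofactor ?M a a else 0))"
  proof (intro sum.cong refl)
    fix j assume "j \<in> {..<n}"
    then have j: "j < n" by simp
    have "?M' $$ (a, j) = ?M $$ (a, j) + (if j = a then s else 0)"
      using A a j A'[of a j] by (auto simp: masked_def)
    then show "?M' $$ (a, j) * cofactor ?M' a j = ?M $$ (a, j) * cofactor ?M a j + (if j = a then s * cofactor ?M a a else 0)"
      by (simp add: cof[OF j] distrib_right)
  qed
  also have "\<dots> = det ?M + s * cofactor ?M a a" using a by (simp add: sum.distrib laplace_expansion_row[OF M(1) a(1)])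
  also have "cofactor ?M a a = det (masked A (insert a K - {a}))" using A a by (intro cofactor_masked) auto
  also have "insert a K - {a} = K" using a by auto
  finally show ?thesis .
qed

text \<open>The adjoint of the adjoint \<open>Z\<close> of \<open>B\<close> is a multiple of \<open>B\<close>. The identity is multiplied by \<open>det B\<close>, so that it needs
  neither division nor case distinctions on the determinant.\<close>
lemma cofactor_of_adjoint:
  assumes B: "B \<in> carrier_mat n n" "transpose_mat B = B" and ij: "i < n" "j < n"
  defines "Z \<equiv> mat n n (\<lambda>(i, j). cofactor B i j)"
  shows "det B * cofactor Z i j = det Z * B $$ (i, j)"
proof -
  have Z: "Z \<in> carrier_mat n n" by (simp add: Z_def)
  have BZ: "(\<Sum>k<n. B $$ (l, k) * cofactor B k' k) = (if l = k' then det B else 0)" if "l < n" "k' < n" for l k'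
    by (rule sum_cofactor[OF B(1) that])
  have ZC: "(\<Sum>k<n. cofactor B l k * cofactor Z i k) = (if l = i then det Z else 0)" if "l < n" for l
    using sum_cofactor[OF Z that ij(1)] that by (simp add: Z_def)
  have "(\<Sum>l<n. B $$ (j, l) * (\<Sum>k<n. cofactor B l k * cofactor Z i k)) = (\<Sum>l<n. if l = i then B $$ (j, i) * det Z else 0)"
    by (intro sum.cong refl) (auto simp: ZC)
  also have "\<dots> = B $$ (j, i) * det Z" using ij by simp
  also have "B $$ (j, i) = B $$ (i, j)" using B ij by (metis carrier_matD index_transpose_mat(1))
  finally have 1: "(\<Sum>l<n. B $$ (j, l) * (\<Sum>k<n. cofactor B l k * cofactor Z i k)) = B $$ (i, j) * det Z" .
  have "(\<Sum>l<n. B $$ (j, l) * (\<Sum>k<n. cofactor B l k * cofactor Z i k)) = (\<Sum>l<n. \<Sum>k<n. cofactor Z i k * (B $$ (j, l) * cofactor B k l))"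
    unfolding sum_distrib_left by (intro sum.cong refl) (auto simp: cofactor_sym[OF B] mult_ac)
  also have "\<dots> = (\<Sum>k<n. cofactor Z i k * (\<Sum>l<n. B $$ (j, l) * cofactor B k l))"
    by (subst sum.swap) (simp add: sum_distrib_left)
  also have "\<dots> = (\<Sum>k<n. if k = j then cofactor Z i k * det B else 0)"
    using ij by (intro sum.cong refl) (auto simp: BZ)
  also have "\<dots> = det B * cofactor Z i j" using ij by (simp add: mult.commute)
  finally show ?thesis using 1 by (simp add: mult.commute)
qed

lemma det_adjoint_nonzero:
  fixes B :: "'r::idom mat"
  assumes B: "B \<in> carrier_mat n n" "transpose_mat B = B" and "det B \<noteq> 0"
  shows "det (mat n n (\<lambda>(i, j). cofactor B i j)) \<noteq> 0"
proof -
  let ?Z = "mat n n (\<lambda>(i, j). cofactor B i j)"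
  have "?Z = adj_mat B" by (rule eq_matI) (use B in \<open>auto simp: adj_mat_def cofactor_sym[OF B]\<close>)
  then have "det B * det ?Z = det (det B \<cdot>\<^sub>m 1\<^sub>m n)" using adj_mat[OF B(1)] det_mult[OF B(1), of ?Z] by simp
  then show ?thesis using assms(3) by auto
qed

lemma cofactor_one: "i < n \<Longrightarrow> j < n \<Longrightarrow> cofactor (1\<^sub>m n :: 'r::comm_ring_1 mat) i j = (if i = j then 1 else 0)"
proof -
  assume ij: "i < n" "j < n"
  have "(\<Sum>k<n. (1\<^sub>m n :: 'r mat) $$ (j, k) * cofactor (1\<^sub>m n) i k) = (\<Sum>k<n. if k = j then cofactor (1\<^sub>m n) i j else 0)"
    using ij by (intro sum.cong refl) auto
  then show ?thesis using sum_cofactor[of "1\<^sub>m n :: 'r mat" n j i] ij by auto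
qed

context degenerate_symmetric begin

lemma vx_corner: "vx m (m - 1) (m - 1) = vx m (m - 2) (m - 2)"
proof -
  have "m - 1 < m" "m - 2 < m" "m \<ge> 2" "m - 1 \<ge> m - 2" using m3 by auto
  then show ?thesis by (subst vx_eq_diag) blast+
qed

section \<open>The Hessian at the identity matrix\<close>

text \<open>The identity matrix as a point of the family.\<close>
definition one_pt :: "nat \<times> nat \<Rightarrow> 'a" where "one_pt = (\<lambda>(i, j). if i = j then 1 else 0)"

abbreviation at1 :: "(nat \<times> nat, 'a) mpoly \<Rightarrow> 'a" where "at1 \<equiv> ins (\<lambda>c. c) one_pt"

interpretation at1: comm_ring_hom at1 by (rule comm_ring_hom_ins[OF comm_ring_hom_id])

lemma SM_one: "SM m one_pt = 1\<^sub>m m"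
  by (rule eq_matI) (auto simp: one_pt_def vx_def min_def max_def split: if_splits)

lemma at1_f: "at1 f = 1" by (simp add: ins_f[OF comm_ring_hom_id] SM_one)

lemma at1_C: "i < m \<Longrightarrow> j < m \<Longrightarrow> at1 (C i j) = (if i = j then 1 else 0)"
  by (simp add: ins_C[OF comm_ring_hom_id] SM_one cofactor_one)

lemma at1_X: "i < m \<Longrightarrow> j < m \<Longrightarrow> at1 (Var (vx m i j)) = (if i = j then 1 else 0)"
  using arg_cong[OF SM_one, of "\<lambda>A. A $$ (i, j)"] by (simp add: ins_Var[OF comm_ring_hom_id])

lemma at1_partial_f: "at1 (partial v f) = (\<Sum>i<m. if vx m i i = v then 1 else 0)"
proof -
  have "at1 (partial v f) = (\<Sum>i<m. \<Sum>j<m. at1 (if vx m i j = v then C i j else 0))"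
    by (simp add: partial_f at1.hom_sum)
  also have "\<dots> = (\<Sum>i<m. \<Sum>j<m. if j = i then if vx m i i = v then 1 else 0 else 0)"
    by (intro sum.cong refl) (auto simp: at1_C ins_0[OF comm_ring_hom_id])
  also have "\<dots> = (\<Sum>i<m. if vx m i i = v then 1 else 0)" by (intro sum.cong refl) auto
  finally show ?thesis .
qed

text \<open>Differentiating \<open>X C = f I\<close> and putting \<open>X = C = I\<close>, \<open>f = 1\<close>.\<close>
lemma at1_partial_C:
  assumes ij: "i < m" "j < m"
  shows "at1 (partial v (C i j)) = (if i = j then at1 (partial v f) else 0) - (if vx m i j = v then 1 else 0)"
proof -
  interpret derivation "partial v :: (nat \<times> nat, 'a) mpoly \<Rightarrow> _" by (rule derivation_partial)
  have "at1 (partial v (\<Sum>k<m. Var (vx m j k) * C i k)) = (if i = j then at1 (partial v f) else 0)"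
    using XC[OF ij(2,1)] by (simp add: ins_0[OF comm_ring_hom_id])
  also have "at1 (partial v (\<Sum>k<m. Var (vx m j k) * C i k))
      = (\<Sum>k<m. at1 (partial v (Var (vx m j k))) * at1 (C i k) + at1 (Var (vx m j k)) * at1 (partial v (C i k)))"
    by (simp add: D_sum D_mult at1.hom_sum at1.hom_add at1.hom_mult)
  also have "\<dots> = (\<Sum>k<m. (if k = i then if vx m i j = v then 1 else 0 else 0) + (if k = j then at1 (partial v (C i j)) else 0))"
    using ij by (intro sum.cong refl) (auto simp: at1_C at1_X partial_Var vx_commute ins_0[OF comm_ring_hom_id] ins_1[OF comm_ring_hom_id])
  also have "\<dots> = (if vx m i j = v then 1 else 0) + at1 (partial v (C i j))" using ij by (simp add: sum.distrib)
  finally show ?thesis by (simp add: algebra_simps)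
qed

text \<open>At the identity matrix the Hessian is the quadratic form \<open>(tr E)\<^sup>2 - tr (E\<^sup>2)\<close> on the family. A matrix \<open>E\<close> in its kernel is
  scalar, \<open>E = t I\<close> with \<open>t = tr E = m t\<close>, and so it vanishes in characteristic zero.\<close>
theorem hessian_nonzero: "hessian_det V f \<noteq> 0"
proof
  assume h: "hessian_det V f = 0"
  define xs where "xs = sorted_list_of_set V"
  define N where "N = length xs"
  have xs: "set xs = V" "distinct xs" by (auto simp: xs_def)
  define H where "H = mat N N (\<lambda>(a, b). partial (xs ! a) (partial (xs ! b) f))"
  have "det H = 0" using h by (simp add: hessian_det_def Let_def H_def N_def xs_def)
  define H1 where "H1 = transpose_mat (map_mat at1 H)"
  have H1: "H1 \<in> carrier_mat N N" by (simp add: H1_def H_def)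
  have "det H1 = at1 (det H)" unfolding H1_def by (subst det_transpose[of _ N]) (auto simp: H_def)
  then have "det H1 = 0" using \<open>det H = 0\<close> by (simp add: ins_0[OF comm_ring_hom_id])
  then obtain w where w: "w \<in> carrier_vec N" "w \<noteq> 0\<^sub>v N" "H1 *\<^sub>v w = 0\<^sub>v N"
    using det_0_iff_vec_prod_zero[OF H1] by blast
  have bij: "bij_betw (\<lambda>a. xs ! a) {..<N} V" using bij_betw_nth[OF xs(2) refl xs(1)[symmetric]] by (simp add: N_def)
  define \<omega> where "\<omega> v = w $ (the_inv_into {..<N} (\<lambda>a. xs ! a) v)" for v
  have \<omega>: "\<omega> (xs ! a) = w $ a" if "a < N" for a
    using bij that by (auto simp: \<omega>_def the_inv_into_f_f bij_betw_def)
  have ker: "(\<Sum>v\<in>V. \<omega> v * at1 (partial v (partial x f))) = 0" if x: "x \<in> V" for x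
  proof -
    obtain b where b: "b < N" "x = xs ! b" using x bij by (auto simp: bij_betw_def)
    have "(H1 *\<^sub>v w) $ b = (\<Sum>a<N. at1 (partial (xs ! a) (partial (xs ! b) f)) * w $ a)"
      using b w(1) by (auto simp: H1_def H_def scalar_prod_def lessThan_atLeast0 intro!: sum.cong)
    also have "\<dots> = (\<Sum>a<N. \<omega> (xs ! a) * at1 (partial (xs ! a) (partial x f)))"
      by (intro sum.cong refl) (auto simp: \<omega> b mult.commute)
    also have "\<dots> = (\<Sum>v\<in>V. \<omega> v * at1 (partial v (partial x f)))"
      by (rule sum.reindex_bij_betw[OF bij])
    finally show ?thesis using w(3) b by simp
  qed
  define t where "t = (\<Sum>v\<in>V. \<omega> v * at1 (partial v f))"
  have pick: "(\<Sum>v\<in>V. \<omega> v * (if u = v then 1 else 0)) = \<omega> u" if "u \<in> V" for u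
  proof -
    have "(\<Sum>v\<in>V. \<omega> v * (if u = v then 1 else 0)) = (\<Sum>v\<in>V. if v = u then \<omega> u else 0)" by (intro sum.cong refl) auto
    then show ?thesis using that by simp
  qed
  have vV: "vx m i j \<in> V" if "i < m" "j < m" for i j using that m3 by (intro vx_in_SC_vars) auto
  have dC: "(\<Sum>v\<in>V. \<omega> v * at1 (partial v (C i j))) = (if i = j then t else 0) - \<omega> (vx m i j)" if ij: "i < m" "j < m" for i j
  proof -
    have "(\<Sum>v\<in>V. \<omega> v * at1 (partial v (C i j))) = (\<Sum>v\<in>V. (if i = j then \<omega> v * at1 (partial v f) else 0) - \<omega> v * (if vx m i j = v then 1 else 0))"
      by (intro sum.cong refl) (simp add: at1_partial_C[OF ij] algebra_simps)
    also have "\<dots> = (if i = j then t else 0) - \<omega> (vx m i j)" by (simp add: sum_subtractf pick[OF vV[OF ij]] t_def)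
    finally show ?thesis .
  qed
  have off: "\<omega> (vx m a b) = 0" if ab: "a < m" "b < m" "a \<noteq> b" for a b
  proof -
    have "partial v (partial (vx m a b) f) = partial v (C a b) + partial v (C a b)" for v
      by (simp only: partial_offdiag[OF ab] mult_2 partial_add)
    then have "(\<Sum>v\<in>V. \<omega> v * at1 (partial v (partial (vx m a b) f))) = 2 * (\<Sum>v\<in>V. \<omega> v * at1 (partial v (C a b)))"
      by (simp only: at1.hom_add distrib_left sum.distrib mult_2)
    then show ?thesis using ker[OF vV[OF ab(1,2)]] dC[OF ab(1,2)] ab(3) by simp
  qed
  have diag: "\<omega> (vx m a a) = t" if a: "a < m - 2" for a
    using ker[OF vV, of a a] a dC[of a a] by (simp add: partial_diag)
  have last: "\<omega> (vx m a a) = t" if a: "a = m - 2 \<or> a = m - 1" for a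
  proof -
    have lt: "m - 2 < m" "m - 1 < m" using m3 by auto
    have eq: "vx m (m - 1) (m - 1) = vx m (m - 2) (m - 2)" by (rule vx_corner)
    have "(\<Sum>v\<in>V. \<omega> v * at1 (partial v (partial (vx m (m - 2) (m - 2)) f)))
      = (\<Sum>v\<in>V. \<omega> v * at1 (partial v (C (m - 2) (m - 2)))) + (\<Sum>v\<in>V. \<omega> v * at1 (partial v (C (m - 1) (m - 1))))"
      by (simp only: partial_last partial_add at1.hom_add distrib_left sum.distrib)
    then have "2 * t = 2 * \<omega> (vx m (m - 2) (m - 2))"
      using ker[OF vV[OF lt(1) lt(1)]] dC[OF lt(1) lt(1)] dC[OF lt(2) lt(2)] unfolding eq by (simp add: algebra_simps)
    then show ?thesis using a eq by auto
  qed
  have all: "\<omega> (vx m a a) = t" if "a < m" for a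
    using diag[of a] last[of a] that by linarith
  have "t = (\<Sum>v\<in>V. \<Sum>i<m. \<omega> v * (if vx m i i = v then 1 else 0))"
    by (simp add: t_def at1_partial_f sum_distrib_left)
  also have "\<dots> = (\<Sum>i<m. \<omega> (vx m i i))" by (subst sum.swap) (simp add: pick vV)
  also have "\<dots> = of_nat m * t" by (simp add: all)
  finally have "(of_nat m - 1) * t = 0" by (simp add: algebra_simps)
  moreover have "(of_nat m - 1 :: 'a) \<noteq> 0" using m3 of_nat_eq_iff[of m 1, where 'a = 'a] by auto
  ultimately have t0: "t = 0" by simp
  have "\<omega> v = 0" if "v \<in> V" for v
  proof -
    obtain i j where "i \<le> j" "j < m" "v = vx m i j" using SC_vars_vx[OF \<open>v \<in> V\<close>] by blast
    then show ?thesis using off[of i j] all[of i] t0 by (cases "i = j") auto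
  qed
  then have "w $ a = 0" if "a < N" for a using \<omega>[OF that] bij_betwE[OF bij] that by simp
  then have "w = 0\<^sub>v N" using w(1) by (intro eq_vecI) auto
  then show False using w(2) by simp
qed

end

context degenerate_symmetric begin

section \<open>The polar map and its inverse\<close>

text \<open>The symmetric matrix whose pairing with \<open>SM m x\<close> is given by the coordinates \<open>y\<close>; \<open>h\<close> is one half.\<close>
definition YM :: "'r::comm_ring_1 \<Rightarrow> (nat \<times> nat \<Rightarrow> 'r) \<Rightarrow> 'r mat" where
  "YM h y = SM m (\<lambda>v. (if fst v = snd v \<and> fst v < m - 1 then 1 else h) * y v)"

text \<open>The coefficients \<open>c1\<close> and \<open>c2\<close> are chosen such that \<open>Y - c1 / (2 c2) diag (0, \<dots>, 0, 1, -1)\<close>, for \<open>Y = YM h y\<close>, has an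
  adjoint with equal last two diagonal entries; this is a linear equation for the multiplier.\<close>
definition c1 :: "'r::comm_ring_1 \<Rightarrow> (nat \<times> nat \<Rightarrow> 'r) \<Rightarrow> 'r" where
  "c1 h y = cofactor (YM h y) (m - 2) (m - 2) - cofactor (YM h y) (m - 1) (m - 1)"

definition c2 :: "'r::comm_ring_1 \<Rightarrow> (nat \<times> nat \<Rightarrow> 'r) \<Rightarrow> 'r" where
  "c2 h y = - det (masked (YM h y) {..<m - 2})"

text \<open>Moves the matrix in the direction \<open>diag (0, \<dots>, 0, 1, -1)\<close>, which is orthogonal to the family.\<close>
definition perturb :: "'r::comm_ring_1 mat \<Rightarrow> 'r \<Rightarrow> 'r mat" where
  "perturb A s = mat m m (\<lambda>(i, j). A $$ (i, j) - (if i = j then if i = m - 2 then s else if i = m - 1 then - s else 0 else 0))"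

text \<open>The moved matrix, multiplied by the denominator \<open>2 c2\<close>.\<close>
definition BM :: "'r::comm_ring_1 \<Rightarrow> (nat \<times> nat \<Rightarrow> 'r) \<Rightarrow> 'r mat" where
  "BM h y = perturb ((2 * c2 h y) \<cdot>\<^sub>m YM h y) (c1 h y)"

text \<open>The inverse of the polar map: the entries of the adjoint of \<open>BM h y\<close>.\<close>
definition GM :: "'r::comm_ring_1 \<Rightarrow> (nat \<times> nat \<Rightarrow> 'r) \<Rightarrow> nat \<times> nat \<Rightarrow> 'r" where
  "GM h y v = cofactor (BM h y) (fst v - 1) (snd v - 1)"

lemma YM_carrier [simp]: "YM h y \<in> carrier_mat m m" by (simp add: YM_def)
lemma YM_dim [simp]: "dim_row (YM h y) = m" "dim_col (YM h y) = m" by (simp_all add: YM_def)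
lemma perturb_carrier [simp]: "perturb A s \<in> carrier_mat m m" by (simp add: perturb_def)
lemma BM_carrier [simp]: "BM h y \<in> carrier_mat m m" by (simp add: BM_def)
lemma BM_dim [simp]: "dim_row (BM h y) = m" "dim_col (BM h y) = m" by (simp_all add: BM_def perturb_def)

lemma perturb_sym: "A \<in> carrier_mat m m \<Longrightarrow> transpose_mat A = A \<Longrightarrow> transpose_mat (perturb A s) = perturb A s"
proof (rule eq_matI)
  assume A: "A \<in> carrier_mat m m" "transpose_mat A = A"
  fix i j assume "i < dim_row (perturb A s)" "j < dim_col (perturb A s)"
  then have ij: "i < m" "j < m" by (auto simp: perturb_def)
  then have "A $$ (j, i) = A $$ (i, j)" using A by (metis carrier_matD index_transpose_mat(1))
  then show "transpose_mat (perturb A s) $$ (i, j) = perturb A s $$ (i, j)" using ij by (auto simp: perturb_def)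
qed (auto simp: perturb_def)

lemma YM_sym: "transpose_mat (YM h y) = YM h y" by (simp add: YM_def SM_sym)

lemma BM_sym: "transpose_mat (BM h y) = BM h y"
  unfolding BM_def
proof (rule perturb_sym)
  show "transpose_mat ((2 * c2 h y) \<cdot>\<^sub>m YM h y) = (2 * c2 h y) \<cdot>\<^sub>m YM h y"
  proof (rule eq_matI)
    fix i j assume "i < dim_row ((2 * c2 h y) \<cdot>\<^sub>m YM h y)" "j < dim_col ((2 * c2 h y) \<cdot>\<^sub>m YM h y)"
    then have ij: "i < m" "j < m" by simp_all
    then have "YM h y $$ (j, i) = transpose_mat (YM h y) $$ (i, j)" by simp
    then show "transpose_mat ((2 * c2 h y) \<cdot>\<^sub>m YM h y) $$ (i, j) = ((2 * c2 h y) \<cdot>\<^sub>m YM h y) $$ (i, j)"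
      using ij by (simp add: YM_sym)
  qed simp_all
qed simp

lemma perturb_entry:
  "i < m \<Longrightarrow> j < m \<Longrightarrow> i \<noteq> j \<Longrightarrow> perturb A s $$ (i, j) = A $$ (i, j)"
  "i < m - 2 \<Longrightarrow> perturb A s $$ (i, i) = A $$ (i, i)"
  "perturb A s $$ (m - 2, m - 2) = A $$ (m - 2, m - 2) - s"
  "perturb A s $$ (m - 1, m - 1) = A $$ (m - 1, m - 1) + s"
  using m3 by (auto simp: perturb_def)

text \<open>The two last principal cofactors are affine in the perturbation, with opposite slopes.\<close>
lemma cofactor_perturb:
  assumes A: "A \<in> carrier_mat m m"
  shows "cofactor (perturb A s) (m - 1) (m - 1) = cofactor A (m - 1) (m - 1) - s * det (masked A {..<m - 2})"
    and "cofactor (perturb A s) (m - 2) (m - 2) = cofactor A (m - 2) (m - 2) + s * det (masked A {..<m - 2})"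
proof -
  have 1: "{..<m} - {m - 1} = insert (m - 2) {..<m - 2}" and 2: "{..<m} - {m - 2} = insert (m - 1) {..<m - 2}" using m3 by auto
  have lt: "m - 1 < m" "m - 2 < m" using m3 by auto
  have "det (masked (perturb A s) (insert (m - 2) {..<m - 2})) = det (masked A (insert (m - 2) {..<m - 2})) + (- s) * det (masked A {..<m - 2})"
  proof (rule det_masked_add_diag[OF A perturb_carrier])
    show "m - 2 < m" "m - 2 \<notin> {..<m - 2}" using m3 by auto
    fix i j assume ij: "i \<in> insert (m - 2) {..<m - 2}" "j \<in> insert (m - 2) {..<m - 2}" "i < m" "j < m"
    then consider "i \<noteq> j" | "i = j" "i = m - 2" | "i = j" "i < m - 2" "i \<noteq> m - 2" by fastforce
    then show "perturb A s $$ (i, j) = A $$ (i, j) + (if i = m - 2 \<and> j = m - 2 then (- s) else 0)"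
    proof cases
      case 1
      then have n: "\<not> (i = m - 2 \<and> j = m - 2)" by blast
      show ?thesis unfolding if_not_P[OF n] using perturb_entry(1)[OF ij(3,4) 1] by simp
    next
      case 2
      then have n: "i = m - 2 \<and> j = m - 2" by blast
      show ?thesis unfolding if_P[OF n] unfolding n[THEN conjunct1] n[THEN conjunct2] perturb_entry by simp
    next
      case 3
      then have n: "\<not> (i = m - 2 \<and> j = m - 2)" by blast
      show ?thesis unfolding if_not_P[OF n] using 3 by (simp add: perturb_entry)
    qed
  qed
  then show "cofactor (perturb A s) (m - 1) (m - 1) = cofactor A (m - 1) (m - 1) - s * det (masked A {..<m - 2})"
    unfolding cofactor_diag[OF A lt(1)] cofactor_diag[OF perturb_carrier lt(1)] 1 by simp
  have "det (masked (perturb A s) (insert (m - 1) {..<m - 2})) = det (masked A (insert (m - 1) {..<m - 2})) + s * det (masked A {..<m - 2})"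
  proof (rule det_masked_add_diag[OF A perturb_carrier])
    show "m - 1 < m" "m - 1 \<notin> {..<m - 2}" using m3 by auto
    fix i j assume ij: "i \<in> insert (m - 1) {..<m - 2}" "j \<in> insert (m - 1) {..<m - 2}" "i < m" "j < m"
    then consider "i \<noteq> j" | "i = j" "i = m - 1" | "i = j" "i < m - 2" "i \<noteq> m - 1" by fastforce
    then show "perturb A s $$ (i, j) = A $$ (i, j) + (if i = m - 1 \<and> j = m - 1 then s else 0)"
    proof cases
      case 1
      then have n: "\<not> (i = m - 1 \<and> j = m - 1)" by blast
      show ?thesis unfolding if_not_P[OF n] using perturb_entry(1)[OF ij(3,4) 1] by simp
    next
      case 2
      then have n: "i = m - 1 \<and> j = m - 1" by blast
      show ?thesis unfolding if_P[OF n] unfolding n[THEN conjunct1] n[THEN conjunct2] perturb_entry by simp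
    next
      case 3
      then have n: "\<not> (i = m - 1 \<and> j = m - 1)" by blast
      show ?thesis unfolding if_not_P[OF n] using 3 by (simp add: perturb_entry)
    qed
  qed
  then show "cofactor (perturb A s) (m - 2) (m - 2) = cofactor A (m - 2) (m - 2) + s * det (masked A {..<m - 2})"
    unfolding cofactor_diag[OF A lt(2)] cofactor_diag[OF perturb_carrier lt(2)] 2 .
qed

text \<open>This is the equation that determines \<open>c1\<close> and \<open>c2\<close>.\<close>
lemma BM_cofactors: "cofactor (BM h y) (m - 2) (m - 2) = cofactor (BM h y) (m - 1) (m - 1)"
proof -
  let ?k = "2 * c2 h y"
  let ?A = "?k \<cdot>\<^sub>m YM h y"
  have A: "?A \<in> carrier_mat m m" by simp
  have lt: "m - 2 < m" "m - 1 < m" using m3 by auto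
  have "cofactor ?A (m - 2) (m - 2) - cofactor ?A (m - 1) (m - 1) = ?k ^ (m - 1) * c1 h y"
    by (simp only: cofactor_scale[OF YM_carrier lt(1) lt(1)] cofactor_scale[OF YM_carrier lt(2) lt(2)] c1_def right_diff_distrib)
  moreover have "det (masked ?A {..<m - 2}) = ?k ^ (m - 2) * (- c2 h y)"
    by (subst det_masked_scale[OF YM_carrier]) (use m3 in \<open>auto simp: c2_def\<close>)
  moreover have "?k ^ (m - 1) = ?k * ?k ^ (m - 2)"
  proof -
    have "m - 1 = Suc (m - 2)" using m3 by simp
    then show ?thesis by (simp only: power_Suc)
  qed
  ultimately show ?thesis
    unfolding BM_def cofactor_perturb[OF A] by (simp add: algebra_simps)
qed

lemma SM_GM: "SM m (GM h y) = mat m m (\<lambda>(i, j). cofactor (BM h y) i j)"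
proof (rule eq_matI)
  fix i j assume "i < dim_row (mat m m (\<lambda>(i, j). cofactor (BM h y) i j))" "j < dim_col (mat m m (\<lambda>(i, j). cofactor (BM h y) i j))"
  then have ij: "i < m" "j < m" by auto
  show "SM m (GM h y) $$ (i, j) = mat m m (\<lambda>(i, j). cofactor (BM h y) i j) $$ (i, j)"
  proof (cases "i + 1 = m \<and> j + 1 = m")
    case True
    then have "i = m - 1" "j = m - 1" by auto
    moreover have "GM h y (vx m i j) = cofactor (BM h y) (m - 2) (m - 2)" using True by (simp add: vx_def GM_def diff_diff_left numeral_2_eq_2)
    ultimately show ?thesis using ij BM_cofactors[of h y] by simp
  next
    case False
    then show ?thesis using ij cofactor_sym[OF BM_carrier BM_sym, of j i h y]
      by (auto simp: vx_def GM_def min_def max_def)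
  qed
qed auto

text \<open>Coordinates of a symmetric matrix in the dual of the space of the matrices \<open>SM m x\<close>.\<close>
definition dual :: "'r::comm_ring_1 mat \<Rightarrow> nat \<times> nat \<Rightarrow> 'r" where
  "dual A v = (\<Sum>i<m. \<Sum>j<m. if vx m i j = v then A $$ (i, j) else 0)"

text \<open>The gradient at a point is the pairing with the adjoint of the matrix at that point.\<close>
lemma psub_partial: "psub g (partial v f) = dual (mat m m (\<lambda>(i, j). cofactor (SM m g) i j)) v"
proof -
  interpret p: comm_ring_hom "psub g" by (rule psub_hom)
  show ?thesis unfolding partial_f dual_def p.hom_sum
    by (intro sum.cong refl) (auto simp: ins_C[OF comm_ring_hom_Const])
qed

lemma dual_scale: "A \<in> carrier_mat m m \<Longrightarrow> dual (c \<cdot>\<^sub>m A) v = c * dual A v"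
  unfolding dual_def sum_distrib_left by (intro sum.cong refl) auto

lemma dual_offdiag:
  assumes ab: "a < m" "b < m" "a \<noteq> b" shows "dual A (vx m a b) = A $$ (a, b) + A $$ (b, a)"
proof -
  have "dual A (vx m a b) = (\<Sum>i<m. \<Sum>j<m. (if i = a then if j = b then A $$ (i, j) else 0 else 0) + (if i = b then if j = a then A $$ (i, j) else 0 else 0))"
    unfolding dual_def using ab by (intro sum.cong refl) (auto simp: vx_eq_offdiag)
  also have "\<dots> = (\<Sum>i<m. (if i = a then A $$ (i, b) else 0) + (if i = b then A $$ (i, a) else 0))"
    using ab by (intro sum.cong refl) (auto simp: sum.distrib)
  finally show ?thesis using ab by (simp add: sum.distrib)
qed

lemma dual_diag:
  assumes a: "a < m - 2" shows "dual A (vx m a a) = A $$ (a, a)"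
proof -
  have "dual A (vx m a a) = (\<Sum>i<m. \<Sum>j<m. (if i = a then if j = a then A $$ (i, j) else 0 else 0))"
    unfolding dual_def using a m3 by (intro sum.cong refl) (auto simp: vx_eq_diag)
  also have "\<dots> = (\<Sum>i<m. (if i = a then A $$ (i, a) else 0))"
    using a by (intro sum.cong refl) auto
  finally show ?thesis using a by simp
qed

lemma dual_last: "dual A (vx m (m - 2) (m - 2)) = A $$ (m - 2, m - 2) + A $$ (m - 1, m - 1)"
proof -
  let ?a = "m - 2" and ?b = "m - 1"
  have ab: "?a < m" "?b < m" "?a \<noteq> ?b" using m3 by auto
  have "dual A (vx m ?a ?a) = (\<Sum>i<m. \<Sum>j<m. (if i = ?a then if j = ?a then A $$ (i, j) else 0 else 0) + (if i = ?b then if j = ?b then A $$ (i, j) else 0 else 0))"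
    unfolding dual_def using ab m3 by (intro sum.cong refl) (auto simp: vx_eq_diag)
  also have "\<dots> = (\<Sum>i<m. (if i = ?a then A $$ (i, ?a) else 0) + (if i = ?b then A $$ (i, ?b) else 0))"
    using ab by (intro sum.cong refl) (auto simp: sum.distrib)
  finally show ?thesis using ab by (simp add: sum.distrib)
qed

lemma V_cases:
  assumes "v \<in> V"
  obtains a b where "a < m" "b < m" "a \<noteq> b" "v = vx m a b"
  | a where "a < m - 2" "v = vx m a a"
  | "v = vx m (m - 2) (m - 2)"
proof -
  obtain i j where ij: "i \<le> j" "j < m" "i + 1 < m" "v = vx m i j" using SC_vars_vx[OF assms] by blast
  consider "i \<noteq> j" | "i = j" "i < m - 2" | "i = j" "i = m - 2" using ij by linarith
  then show thesis
  proof cases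
    case 1 then show ?thesis using that(1)[of i j] ij by simp
  next
    case 2 then show ?thesis using that(2)[of i] ij by simp
  next
    case 3 then show ?thesis using that(3) ij by simp
  qed
qed

text \<open>The direction of the perturbation is orthogonal to the family.\<close>
lemma dual_perturb: "A \<in> carrier_mat m m \<Longrightarrow> v \<in> V \<Longrightarrow> dual (perturb A s) v = dual A v"
  by (erule V_cases) (use m3 in \<open>auto simp: dual_offdiag dual_diag dual_last perturb_def\<close>)

lemma
  assumes "2 * h = (1 :: 'r::comm_ring_1)"
  shows half_add: "h * z + h * z = z" and half_mult_2: "h * (2 * z) = z"
proof -
  have "h * z + h * z = (2 * h) * z" "h * (2 * z) = (2 * h) * z" by (simp_all only: mult_2 distrib_right mult_2_right distrib_left)
  then show "h * z + h * z = z" "h * (2 * z) = z" using assms by simp_all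
qed

lemma YM_offdiag: "a < m \<Longrightarrow> b < m \<Longrightarrow> a \<noteq> b \<Longrightarrow> YM h y $$ (a, b) = h * y (vx m a b)"
proof -
  assume ab: "a < m" "b < m" "a \<noteq> b"
  then have n: "\<not> (fst (vx m a b) = snd (vx m a b) \<and> fst (vx m a b) < m - 1)"
    by (auto simp: vx_def min_def max_def split: if_splits)
  show ?thesis unfolding YM_def SM_def using ab by (simp only: index_mat split_conv if_not_P[OF n])
qed

lemma YM_diag: "a < m - 2 \<Longrightarrow> YM h y $$ (a, a) = y (vx m a a)"
proof -
  assume a: "a < m - 2"
  then have am: "a < m" and n: "fst (vx m a a) = snd (vx m a a) \<and> fst (vx m a a) < m - 1" by (auto simp: vx_def)
  show ?thesis unfolding YM_def SM_def using am by (simp only: index_mat split_conv if_P[OF n] mult_1)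
qed

lemma YM_corner:
  "YM h y $$ (m - 2, m - 2) = h * y (vx m (m - 2) (m - 2))"
  "YM h y $$ (m - 1, m - 1) = h * y (vx m (m - 2) (m - 2))"
proof -
  have lt: "m - 2 < m" "m - 1 < m" using m3 by auto
  have n: "\<not> (fst (vx m (m - 2) (m - 2)) = snd (vx m (m - 2) (m - 2)) \<and> fst (vx m (m - 2) (m - 2)) < m - 1)" using m3 by (auto simp: vx_def)
  show "YM h y $$ (m - 2, m - 2) = h * y (vx m (m - 2) (m - 2))"
    unfolding YM_def SM_def using lt by (simp only: index_mat split_conv if_not_P[OF n])
  show "YM h y $$ (m - 1, m - 1) = h * y (vx m (m - 2) (m - 2))"
    unfolding YM_def SM_def using lt by (simp only: index_mat split_conv vx_corner if_not_P[OF n])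
qed

lemma dual_YM:
  assumes h: "2 * h = 1" and v: "v \<in> V" shows "dual (YM h y) v = y v"
  using v
proof (cases rule: V_cases)
  case (1 a b)
  then show ?thesis by (simp add: dual_offdiag YM_offdiag vx_commute[of m b a] half_add[OF h])
next
  case (2 a)
  then show ?thesis by (simp add: dual_diag YM_diag)
next
  case 3
  show ?thesis unfolding 3 dual_last YM_corner half_add[OF h] ..
qed

lemma dual_BM:
  assumes h: "2 * h = 1" and v: "v \<in> V" shows "dual (BM h y) v = 2 * c2 h y * y v"
  unfolding BM_def by (subst dual_perturb) (use v in \<open>auto simp: dual_scale dual_YM[OF h]\<close>)

definition hf :: "(nat \<times> nat, 'a) mpoly" where "hf = Const (1 / 2)"

lemma hf: "2 * hf = 1"
  by (simp add: hf_def flip: Const_numeral Const_mult Const_1)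

text \<open>The inverse produces the adjoint of \<open>B = BM hf y\<close>, so the polar map applied to it pairs the adjoint of the adjoint,
  a multiple of \<open>B\<close>, with the symmetric matrices; and the perturbation in \<open>B\<close> is invisible to that pairing.\<close>
lemma polar_after_inverse:
  assumes v: "v \<in> V"
  shows "det (BM hf y) * psub (GM hf y) (partial v f) = det (SM m (GM hf y)) * (2 * c2 hf y * y v)"
proof -
  let ?B = "BM hf y" and ?Z = "mat m m (\<lambda>(i, j). cofactor (BM hf y) i j)"
  have "det ?B * dual (mat m m (\<lambda>(i, j). cofactor ?Z i j)) v = dual (det ?Z \<cdot>\<^sub>m ?B) v"
    unfolding dual_def sum_distrib_left
    by (intro sum.cong refl) (auto simp: cofactor_of_adjoint[OF BM_carrier BM_sym])
  also have "\<dots> = det ?Z * (2 * c2 hf y * y v)" by (simp add: dual_scale dual_BM[OF hf v])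
  finally show ?thesis by (simp add: psub_partial SM_GM)
qed

abbreviation Cmat :: "(nat \<times> nat, 'a) mpoly mat" where "Cmat \<equiv> mat m m (\<lambda>(i, j). C i j)"

lemma f_nonzero: "f \<noteq> 0"
  using at1_f by (auto simp: ins_0[OF comm_ring_hom_id])

lemma X_sym: "transpose_mat XX = XX" by (simp add: SC_eq_SM SM_sym)

lemma cofactor_Cmat: "i < m \<Longrightarrow> j < m \<Longrightarrow> f * cofactor Cmat i j = det Cmat * Var (vx m i j)"
  using cofactor_of_adjoint[OF X_carrier X_sym, of i j] by simp

text \<open>The coordinates of the gradient only determine the matrix \<open>C\<close> of cofactors up to a perturbation by some \<open>s\<close>. The last
  two principal cofactors of \<open>C\<close> agree, since those of the adjoint of \<open>X\<close> are multiples of the equal entries of \<open>X\<close>;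
  therefore the correction built into \<open>BM\<close> undoes the perturbation and returns a multiple of \<open>C\<close>.\<close>
lemma BM_polar: "BM hf (\<lambda>v. partial v f) = (- 2 * det (masked Cmat {..<m - 2})) \<cdot>\<^sub>m Cmat"
proof -
  let ?y = "\<lambda>v. partial v f"
  define s where "s = hf * (C (m - 2) (m - 2) - C (m - 1) (m - 1))"
  define \<Delta> where "\<Delta> = det (masked Cmat {..<m - 2})"
  have Y: "YM hf ?y = perturb Cmat s"
  proof (rule eq_matI)
    fix i j assume "i < dim_row (perturb Cmat s)" "j < dim_col (perturb Cmat s)"
    then have ij: "i < m" "j < m" by (auto simp: perturb_def)
    consider "i \<noteq> j" | "i = j" "i < m - 2" | "i = j" "i = m - 2" | "i = j" "i = m - 1" using ij by linarith
    then show "YM hf ?y $$ (i, j) = perturb Cmat s $$ (i, j)"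
    proof cases
      case 1
      have "YM hf ?y $$ (i, j) = hf * (2 * C i j)" by (simp only: YM_offdiag[OF ij 1] partial_offdiag[OF ij 1])
      also have "\<dots> = perturb Cmat s $$ (i, j)" using ij 1 by (simp add: half_mult_2[OF hf] perturb_entry)
      finally show ?thesis .
    next
      case 2
      then show ?thesis using ij by (simp add: YM_diag partial_diag perturb_entry)
    next
      case 3
      have lt: "m - 2 < m" using m3 by simp
      have i: "i = m - 2" "j = m - 2" using 3 by simp_all
      have "YM hf ?y $$ (m - 2, m - 2) = hf * (C (m - 2) (m - 2) + C (m - 1) (m - 1))" by (simp only: YM_corner partial_last)
      also have "\<dots> = C (m - 2) (m - 2) - s" using half_add[OF hf, of "C (m - 2) (m - 2)"] by (simp add: s_def algebra_simps)
      also have "\<dots> = perturb Cmat s $$ (m - 2, m - 2)" using lt by (simp only: perturb_entry index_mat split_conv)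
      finally show ?thesis unfolding i .
    next
      case 4
      have lt: "m - 1 < m" using m3 by simp
      have i: "i = m - 1" "j = m - 1" using 4 by simp_all
      have "YM hf ?y $$ (m - 1, m - 1) = hf * (C (m - 2) (m - 2) + C (m - 1) (m - 1))" by (simp only: YM_corner partial_last)
      also have "\<dots> = C (m - 1) (m - 1) + s" using half_add[OF hf, of "C (m - 1) (m - 1)"] by (simp add: s_def algebra_simps)
      also have "\<dots> = perturb Cmat s $$ (m - 1, m - 1)" using lt by (simp only: perturb_entry index_mat split_conv)
      finally show ?thesis unfolding i .
    qed
  qed (auto simp: perturb_def)
  have "masked (perturb Cmat s) {..<m - 2} = masked Cmat {..<m - 2}"
    by (rule eq_matI) (auto simp: masked_def perturb_def)
  then have c2: "c2 hf ?y = - \<Delta>" by (simp add: c2_def Y \<Delta>_def)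
  have lt: "m - 2 < m" "m - 1 < m" using m3 by auto
  have "vx m (m - 1) (m - 1) = vx m (m - 2) (m - 2)" by (rule vx_corner)
  then have "f * cofactor Cmat (m - 2) (m - 2) = f * cofactor Cmat (m - 1) (m - 1)" using lt by (simp add: cofactor_Cmat)
  then have "cofactor Cmat (m - 2) (m - 2) = cofactor Cmat (m - 1) (m - 1)" using f_nonzero by simp
  moreover have "Cmat \<in> carrier_mat m m" by simp
  ultimately have c1: "c1 hf ?y = 2 * s * \<Delta>" unfolding c1_def Y \<Delta>_def
    by (simp only: cofactor_perturb) (simp add: algebra_simps)
  show ?thesis
    unfolding BM_def Y c1 c2 \<Delta>_def[symmetric]
    by (rule eq_matI) (auto simp: perturb_def algebra_simps)
qed

lemma inverse_after_polar:
  assumes v: "v \<in> V"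
  shows "f * GM hf (\<lambda>v. partial v f) v = (- 2 * det (masked Cmat {..<m - 2})) ^ (m - 1) * det Cmat * Var v"
proof -
  obtain i j where ij: "i \<le> j" "j < m" "v = vx m i j" "v = (i + 1, j + 1)" using SC_vars_vx[OF v] by blast
  have im: "i < m" using ij by simp
  have "GM hf (\<lambda>v. partial v f) v = cofactor (BM hf (\<lambda>v. partial v f)) i j" by (simp add: GM_def ij(4))
  also have "\<dots> = (- 2 * det (masked Cmat {..<m - 2})) ^ (m - 1) * cofactor Cmat i j"
    unfolding BM_polar by (rule cofactor_scale) (use ij in auto)
  finally have "f * GM hf (\<lambda>v. partial v f) v = (- 2 * det (masked Cmat {..<m - 2})) ^ (m - 1) * (f * cofactor Cmat i j)"
    by (simp only: mult_ac)
  then show ?thesis using cofactor_Cmat[OF im ij(2)] ij(3) by (simp only: mult_ac)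
qed

lemma hom_YM:
  assumes "comm_ring_hom \<phi>"
  shows "map_mat \<phi> (YM h y) = YM (\<phi> h) (\<lambda>v. \<phi> (y v))"
proof -
  interpret comm_ring_hom \<phi> by (rule assms)
  show ?thesis by (rule eq_matI) (auto simp: YM_def hom_mult)
qed

lemma hom_GM:
  assumes h: "comm_ring_hom \<phi>" and v: "v \<in> V"
  shows "\<phi> (GM h y v) = GM (\<phi> h) (\<lambda>v. \<phi> (y v)) v"
proof -
  interpret comm_ring_hom \<phi> by (rule h)
  have Y: "map_mat \<phi> (YM h y) = YM (\<phi> h) (\<lambda>v. \<phi> (y v))"
    by (rule hom_YM[OF h])
  have lt: "m - 2 < m" "m - 1 < m" using m3 by auto
  have 1: "\<phi> (c1 h y) = c1 (\<phi> h) (\<lambda>v. \<phi> (y v))" using lt by (simp add: c1_def hom_minus hom_cofactor Y)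
  have "map_mat \<phi> (masked (YM h y) {..<m - 2}) = masked (map_mat \<phi> (YM h y)) {..<m - 2}"
    by (rule eq_matI) (auto simp: masked_def)
  then have 2: "\<phi> (c2 h y) = c2 (\<phi> h) (\<lambda>v. \<phi> (y v))" unfolding c2_def hom_uminus hom_det[symmetric] Y by (simp add: Y)
  have "map_mat \<phi> (BM h y) = perturb ((2 * \<phi> (c2 h y)) \<cdot>\<^sub>m map_mat \<phi> (YM h y)) (\<phi> (c1 h y))"
  proof (rule eq_matI)
    have two: "\<phi> 2 = 2" using hom_add[of 1 1] by (simp add: one_add_one)
    fix i j assume "i < dim_row (perturb ((2 * \<phi> (c2 h y)) \<cdot>\<^sub>m map_mat \<phi> (YM h y)) (\<phi> (c1 h y)))"
      "j < dim_col (perturb ((2 * \<phi> (c2 h y)) \<cdot>\<^sub>m map_mat \<phi> (YM h y)) (\<phi> (c1 h y)))"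
    then have ij: "i < m" "j < m" by (auto simp: perturb_def)
    then show "map_mat \<phi> (BM h y) $$ (i, j) = perturb ((2 * \<phi> (c2 h y)) \<cdot>\<^sub>m map_mat \<phi> (YM h y)) (\<phi> (c1 h y)) $$ (i, j)"
      by (auto simp: BM_def perturb_def hom_minus hom_mult hom_uminus two)
  qed (auto simp: perturb_def)
  then have B: "map_mat \<phi> (BM h y) = BM (\<phi> h) (\<lambda>v. \<phi> (y v))" unfolding 1 2 Y BM_def .
  obtain i j where ij: "i \<le> j" "j < m" "v = (i + 1, j + 1)" using SC_vars_vx[OF v] by blast
  then have "i < m" by simp
  with ij show ?thesis by (simp add: GM_def hom_cofactor B)
qed

section \<open>Degrees and non-vanishing of the inverse map\<close>

abbreviation G :: "nat \<times> nat \<Rightarrow> (nat \<times> nat, 'a) mpoly" where "G \<equiv> GM hf Var"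

lemma is_form_cofactor:
  assumes A: "A \<in> carrier_mat m m" and d: "\<And>i j. i < m \<Longrightarrow> j < m \<Longrightarrow> is_form V d (A $$ (i, j))" and ab: "a < m" "b < m"
  shows "is_form V ((m - 1) * d) (cofactor A a b :: (nat \<times> nat, 'a) mpoly)"
proof -
  have "is_form V (\<Sum>i<m. if i = a then 0 else d) (det (setrow A a (unitrow b)))"
    using A by (intro is_form_det_rows) (auto simp: setrow_def d)
  moreover have "(\<Sum>i<m. if i = a then 0 else d) = (m - 1) * d"
  proof -
    have "(\<Sum>i<m. if i = a then 0 else d) = (\<Sum>i\<in>{..<m} - {a}. d)"
      by (intro sum.mono_neutral_cong_right) auto
    then show ?thesis using ab by simp
  qed
  ultimately show ?thesis by (simp add: det_setrow_unit[OF A ab])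
qed

lemma YM_form: "i < m \<Longrightarrow> j < m \<Longrightarrow> is_form V 1 (YM hf Var $$ (i, j) :: (nat \<times> nat, 'a) mpoly)"
  using m3 vx_in_SC_vars[of m i j] by (auto simp: YM_def hf_def intro!: is_form_Const_mult is_form_Var[unfolded One_nat_def])

lemma is_form_2: "is_form V d p \<Longrightarrow> is_form V d (2 * p :: (nat \<times> nat, 'a) mpoly)"
  unfolding mult_2 by (rule is_form_add)

lemma G_form: "v \<in> V \<Longrightarrow> is_form V ((m - 1) * (m - 1)) (G v)"
proof -
  assume v: "v \<in> V"
  have lt: "m - 2 < m" "m - 1 < m" using m3 by auto
  have c1: "is_form V (m - 1) (c1 hf Var)"
    unfolding c1_def using is_form_cofactor[OF YM_carrier YM_form lt(1) lt(1)] is_form_cofactor[OF YM_carrier YM_form lt(2) lt(2)]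
    by (intro is_form_diff) auto
  have "is_form V (\<Sum>i<m. if i < m - 2 then 1 else 0) (det (masked (YM hf Var) {..<m - 2}))"
    by (rule is_form_det_rows) (auto simp: masked_def YM_form[unfolded One_nat_def])
  also have "(\<Sum>i<m. if i < m - 2 then 1 else 0) = m - 2"
  proof -
    have "(\<Sum>i<m. if i < m - 2 then 1 else 0) = (\<Sum>i<m - 2. 1 :: nat)"
      by (rule sum.mono_neutral_cong_right) auto
    then show ?thesis by simp
  qed
  finally have c2: "is_form V (m - 2) (c2 hf Var)" unfolding c2_def by (rule is_form_uminus)
  have B: "is_form V (m - 1) (BM hf Var $$ (i, j))" if ij: "i < m" "j < m" for i j
  proof -
    have "is_form V ((m - 2) + 1) (2 * c2 hf Var * YM hf Var $$ (i, j))"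
      by (intro is_form_mult is_form_2 c2 YM_form ij)
    also have "(m - 2) + 1 = m - 1" using m3 by simp
    finally show ?thesis using ij c1 by (auto simp: BM_def perturb_def intro!: is_form_diff is_form_add)
  qed
  obtain i j where ij: "i \<le> j" "j < m" "v = (i + 1, j + 1)" using SC_vars_vx[OF v] by blast
  then show ?thesis unfolding GM_def using is_form_cofactor[OF BM_carrier B] by simp
qed

lemma f_form: "is_form V m f"
  using is_form_det[OF X_carrier, of V 1] vx_in_SC_vars[of m] m3 by (simp add: is_form_Var[unfolded One_nat_def])

lemma partial_form: "is_form V (m - 1) (partial v f)"
  by (rule is_form_partial[OF f_form])

lemma partial_nonzero: "partial (vx m 0 0) f \<noteq> 0"
proof
  assume "partial (vx m 0 0) f = 0"
  then have "C 0 0 = 0" using m3 by (simp add: partial_diag)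
  then show False using at1_C[of 0 0] m3 by (simp add: ins_0[OF comm_ring_hom_id])
qed

lemma v00: "vx m 0 0 \<in> V" using m3 by (intro vx_in_SC_vars) auto

text \<open>At the coordinates \<open>y\<close> for which \<open>YM\<close> is the identity matrix all quantities are explicit.\<close>
lemma BM_nonzero: "c2 hf Var \<noteq> 0" "det (BM hf Var) \<noteq> 0"
proof -
  define y :: "nat \<times> nat \<Rightarrow> 'a" where "y = (\<lambda>(i, j). if i = j then if i < m - 1 then 1 else 2 else 0)"
  interpret e: comm_ring_hom "ins (\<lambda>c. c) y" by (rule comm_ring_hom_ins[OF comm_ring_hom_id])
  have Y: "map_mat (ins (\<lambda>c. c) y) (YM hf Var) = 1\<^sub>m m"
  proof -
    have half: "ins (\<lambda>c. c) y hf = 1 / 2" by (simp add: hf_def ins_Const[OF comm_ring_hom_id])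
    have "YM (1 / 2) y = 1\<^sub>m m"
    proof (rule eq_matI)
      fix i j assume "i < dim_row (1\<^sub>m m :: 'a mat)" "j < dim_col (1\<^sub>m m :: 'a mat)"
      then have ij: "i < m" "j < m" by simp_all
      consider "i \<noteq> j" | "i = j" "i < m - 2" | "i = m - 2" "j = m - 2" | "i = m - 1" "j = m - 1" using ij by linarith
      then show "YM (1 / 2) y $$ (i, j) = 1\<^sub>m m $$ (i, j)"
      proof cases
        case 1
        have "y (vx m i j) = 0" using 1 ij by (auto simp: y_def vx_def min_def max_def)
        then show ?thesis unfolding YM_offdiag[OF ij 1] using ij 1 by simp
      next
        case 2
        then have "y (vx m i i) = 1" by (auto simp: y_def vx_def)
        then show ?thesis using 2 ij by (simp add: YM_diag)
      next
        case 3
        have "y (vx m (m - 2) (m - 2)) = 2" using m3 by (auto simp: y_def vx_def)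
        then show ?thesis unfolding 3 YM_corner using m3 by simp
      next
        case 4
        have "y (vx m (m - 2) (m - 2)) = 2" using m3 by (auto simp: y_def vx_def)
        then show ?thesis unfolding 4 YM_corner using m3 by simp
      qed
    qed simp_all
    then show ?thesis using hom_YM[OF comm_ring_hom_ins[OF comm_ring_hom_id], of y hf Var]
      by (simp add: half ins_Var[OF comm_ring_hom_id])
  qed
  have "map_mat (ins (\<lambda>c. c) y) (masked (YM hf Var) {..<m - 2}) = masked (map_mat (ins (\<lambda>c. c) y) (YM hf Var)) {..<m - 2}"
    by (rule eq_matI) (auto simp: masked_def)
  also have "\<dots> = 1\<^sub>m m" unfolding Y by (rule eq_matI) (auto simp: masked_def)
  finally have c2: "ins (\<lambda>c. c) y (c2 hf Var) = - 1" unfolding c2_def e.hom_uminus e.hom_det[symmetric] by simp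
  then show "c2 hf Var \<noteq> 0" by (auto simp: ins_0[OF comm_ring_hom_id])
  have lt: "m - 2 < m" "m - 1 < m" using m3 by auto
  have c1: "ins (\<lambda>c. c) y (c1 hf Var) = 0" using lt by (simp add: c1_def e.hom_minus e.hom_cofactor Y cofactor_one)
  have two: "ins (\<lambda>c. c) y 2 = 2" using e.hom_add[of 1 1] by (simp add: one_add_one)
  have "ins (\<lambda>c. c) y (det (BM hf Var)) = det (map_mat (ins (\<lambda>c. c) y) (BM hf Var))" by simp
  also have "map_mat (ins (\<lambda>c. c) y) (BM hf Var) = (- 2) \<cdot>\<^sub>m map_mat (ins (\<lambda>c. c) y) (YM hf Var)"
    by (rule eq_matI) (auto simp: BM_def perturb_def e.hom_minus e.hom_mult e.hom_uminus c1 c2 two ins_0[OF comm_ring_hom_id])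
  also have "det \<dots> = (- 2) ^ m" by (simp add: Y)
  finally show "det (BM hf Var) \<noteq> 0" by (auto simp: ins_0[OF comm_ring_hom_id])
qed

lemma Cmat_nonzero: "det (masked Cmat {..<m - 2}) \<noteq> 0" "det Cmat \<noteq> 0"
proof -
  interpret at1: comm_ring_hom at1 by (rule comm_ring_hom_ins[OF comm_ring_hom_id])
  have C1: "map_mat at1 Cmat = 1\<^sub>m m" by (rule eq_matI) (auto simp: at1_C)
  have "at1 (det Cmat) = det (map_mat at1 Cmat)" by (rule at1.hom_det[symmetric])
  then show "det Cmat \<noteq> 0" by (auto simp: C1 ins_0[OF comm_ring_hom_id])
  have "map_mat at1 (masked Cmat {..<m - 2}) = 1\<^sub>m m" by (rule eq_matI) (auto simp: masked_def at1_C)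
  moreover have "at1 (det (masked Cmat {..<m - 2})) = det (map_mat at1 (masked Cmat {..<m - 2}))" by (rule at1.hom_det[symmetric])
  ultimately show "det (masked Cmat {..<m - 2}) \<noteq> 0" by (auto simp: ins_0[OF comm_ring_hom_id])
qed

text \<open>Proportionality to the identity may be checked after multiplication with a common nonzero factor.\<close>
lemma same_map_Var:
  assumes c: "c \<noteq> 0" and eq: "\<And>v. v \<in> V \<Longrightarrow> c * H v = d * Var v"
  shows "same_map V H (Var :: nat \<times> nat \<Rightarrow> (nat \<times> nat, 'a) mpoly)"
  unfolding same_map_def
proof (intro ballI)
  fix u v assume uv: "u \<in> V" "v \<in> V"
  have "c * (H u * Var v) = c * (H v * Var u)"
    unfolding mult.assoc[symmetric] eq[OF uv(1)] eq[OF uv(2)] by (simp only: mult_ac)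
  then show "H u * Var v = H v * Var u" using c by simp
qed

lemma Var_nonzero: "(Var v :: (nat \<times> nat, 'a) mpoly) \<noteq> 0"
proof
  assume "(Var v :: (nat \<times> nat, 'a) mpoly) = 0"
  then have "lkp (Var v :: (nat \<times> nat, 'a) mpoly) (msingle v 1) = 0" by simp
  then show False by (simp add: Var_def)
qed

lemma rational_mapI:
  assumes "\<And>v. v \<in> V \<Longrightarrow> is_form V e (H v)" and d: "d \<noteq> 0" and eq: "\<And>v. v \<in> V \<Longrightarrow> c * H v = d * Var v"
  shows "rational_map V (H :: nat \<times> nat \<Rightarrow> (nat \<times> nat, 'a) mpoly)"
proof -
  have "H (vx m 0 0) \<noteq> 0" using eq[OF v00] d Var_nonzero[of "vx m 0 0"] by auto
  then show ?thesis unfolding rational_map_def using assms(1) v00 by blast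
qed

text \<open>Both compositions of the polar map with \<open>G\<close> are the identity up to a common factor, and evaluation at the
  identity matrix shows that the factors are nonzero.\<close>
theorem homaloidal_f: "homaloidal V f"
proof -
  let ?F = "\<lambda>v. partial v f"
  have G_nz: "GM hf ?F (vx m 0 0) \<noteq> 0"
    using inverse_after_polar[OF v00] Cmat_nonzero Var_nonzero[of "vx m 0 0"] by auto
  have GF: "map_comp_rep G ?F v = GM hf ?F v" if "v \<in> V" for v
    using hom_GM[OF psub_hom that, of ?F hf Var] by (simp add: map_comp_rep_def poly_subst_eq hf_def)
  have FG: "map_comp_rep ?F G v = psub G (partial v f)" for v
    by (simp add: map_comp_rep_def poly_subst_eq)
  have gf: "f * map_comp_rep G ?F v = ((- 2 * det (masked Cmat {..<m - 2})) ^ (m - 1) * det Cmat) * Var v" if "v \<in> V" for v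
    using inverse_after_polar[OF that] GF[OF that] by simp
  have fg: "det (BM hf Var) * map_comp_rep ?F G v = (det (SM m G) * (2 * c2 hf Var)) * Var v" if "v \<in> V" for v
    using polar_after_inverse[OF that, of Var] by (simp add: FG mult.assoc)
  have gf0: "(- 2 * det (masked Cmat {..<m - 2})) ^ (m - 1) * det Cmat \<noteq> 0" using Cmat_nonzero by simp
  have fg0: "det (SM m G) * (2 * c2 hf Var) \<noteq> 0"
    using BM_nonzero det_adjoint_nonzero[OF BM_carrier BM_sym, of hf Var] by (simp add: SM_GM)
  have "G (vx m 0 0) \<noteq> 0"
  proof
    assume z: "G (vx m 0 0) = 0"
    have "GM hf ?F (vx m 0 0) = psub ?F (G (vx m 0 0))" using GF[OF v00] by (simp add: map_comp_rep_def poly_subst_eq)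
    then show False using G_nz z by simp
  qed
  then have rG: "rational_map V G" unfolding rational_map_def using G_form v00 by blast
  have rF: "rational_map V ?F" unfolding rational_map_def using partial_form partial_nonzero v00 by blast
  have rGF: "rational_map V (map_comp_rep G ?F)"
    by (rule rational_mapI[OF _ gf0 gf]) (auto simp: map_comp_rep_def poly_subst_eq intro!: is_form_psub G_form partial_form)
  have rFG: "rational_map V (map_comp_rep ?F G)"
    by (rule rational_mapI[OF _ fg0 fg]) (auto simp: map_comp_rep_def poly_subst_eq intro!: is_form_psub G_form partial_form)
  have "birational V ?F"
    unfolding birational_def
    using rF rG rGF rFG same_map_Var[OF f_nonzero gf] same_map_Var[OF BM_nonzero(2) fg] by blast
  then show ?thesis unfolding homaloidal_def using f_form by blast
qed

end

section \<open>The rank of a matrix with a one-dimensional left kernel\<close>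

context vec_space begin

lemma mult_mat_vec_in_span:
  assumes A: "A \<in> carrier_mat n nc" and c: "c \<in> carrier_vec nc"
  shows "A *\<^sub>v c \<in> span (set (cols A))"
proof -
  have "A *\<^sub>v c \<in> col_space A" using A c by (auto simp: col_space_eq[OF A])
  then show ?thesis by (simp add: col_space_def)
qed

lemma rank_ge_card_span:
  assumes A: "A \<in> carrier_mat n nc" and U: "U \<subseteq> span (set (cols A))" and li: "lin_indpt U"
  shows "card U \<le> rank A"
proof -
  have cA: "set (cols A) \<subseteq> carrier_vec n" using cols_dim[of A] A by auto
  then have sub: "submodule class_ring (span (set (cols A))) V" by (intro span_is_submodule) auto
  have vs: "vectorspace class_ring (span_vs (set (cols A)))"
    using field.field_axioms vectorspace_def submodule_is_module[OF sub] by metis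
  have fd: "vectorspace.fin_dim class_ring (span_vs (set (cols A)))"
    by (rule fin_dim_span_cols[OF A])
  have "\<not> LinearCombinations.module.lin_dep class_ring (span_vs (set (cols A))) U"
    using span_li_not_depend(2)[OF U sub] li by simp
  then show ?thesis unfolding rank_def
    using vectorspace.li_le_dim(2)[OF vs fd, of U] U by simp
qed

text \<open>The columns of an invertible matrix \<open>P\<close>, except the one at \<open>a\<close>, lie in the column space, which gives the lower bound.
  For the upper bound, \<open>n\<close> independent columns would form an invertible matrix with \<open>g\<close> in its left kernel.\<close>
lemma rank_one_less:
  assumes A: "A \<in> carrier_mat n nc"
    and g: "\<And>c. c < nc \<Longrightarrow> (\<Sum>r<n. g r * A $$ (r, c)) = 0" "r0 < n" "g r0 \<noteq> 0"
    and P: "P \<in> carrier_mat n n" "det P \<noteq> 0" and a: "a < n"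
    and span: "\<And>b. b < n \<Longrightarrow> b \<noteq> a \<Longrightarrow> \<exists>c\<in>carrier_vec nc. col P b = A *\<^sub>v c"
  shows "rank A = n - 1"
proof (rule antisym)
  obtain S where S: "maximal S (\<lambda>T. T \<subseteq> set (cols A) \<and> lin_indpt T)"
    using maximal_exists_superset[of "set (cols A)" "(\<lambda>T. T \<subseteq> set (cols A) \<and> lin_indpt T)" "{}"]
    by (metis List.finite_set empty_subsetI finite_lin_indpt2 empty_iff finite.emptyI)
  have r: "rank A = card S" by (rule rank_card_indpt[OF A S])
  have S1: "S \<subseteq> set (cols A)" "lin_indpt S" using S by (auto simp: maximal_def)
  have cA: "set (cols A) \<subseteq> carrier_vec n" using cols_dim[of A] A by auto
  have fS: "finite S" using S1(1) finite_subset by blast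
  have "card S \<le> n" using li_le_dim(2)[OF fin_dim _ S1(2)] S1(1) cA dim_is_n by auto
  moreover have "card S \<noteq> n"
  proof
    assume c: "card S = n"
    obtain ss where ss: "set ss = S" "distinct ss" using finite_distinct_list[OF fS] by blast
    define B where "B = mat_of_cols n ss"
    have len: "length ss = n" using ss c distinct_card by force
    have B: "B \<in> carrier_mat n n" using mat_of_cols_carrier(1)[of n ss] by (simp add: B_def len)
    have cB: "cols B = ss" unfolding B_def using ss S1 cA by (intro cols_mat_of_cols) auto
    have "rank B = n" by (rule lin_indpt_full_rank[OF B]) (use cB ss S1 in auto)
    then have dB: "det B \<noteq> 0" using det_rank_iff[OF B] by simp
    define gv where "gv = vec n g"
    have "transpose_mat B *\<^sub>v gv = 0\<^sub>v n"
    proof (rule eq_vecI)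
      fix i assume "i < dim_vec (0\<^sub>v n :: 'a vec)"
      then have i: "i < n" by simp
      have "col B i = ss ! i" using cB i len B by (metis cols_nth carrier_matD(2))
      moreover have "ss ! i \<in> set (cols A)" using i len ss S1 by (metis nth_mem subsetD)
      ultimately obtain c where c: "c < nc" "col B i = col A c"
        using A by (auto simp: cols_def)
      have "(transpose_mat B *\<^sub>v gv) $ i = (\<Sum>r<n. col A c $ r * g r)"
        using B i c(2) by (auto simp: gv_def scalar_prod_def lessThan_atLeast0 intro!: sum.cong)
      also have "\<dots> = (\<Sum>r<n. g r * A $$ (r, c))" using A c by (intro sum.cong refl) (auto simp: mult.commute)
      finally show "(transpose_mat B *\<^sub>v gv) $ i = 0\<^sub>v n $ i" using g(1)[OF c(1)] i by simp
    qed (use B in auto)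
    moreover have "gv \<noteq> 0\<^sub>v n"
    proof
      assume "gv = 0\<^sub>v n"
      then have "gv $ r0 = 0" using g(2) by simp
      then show False using g(2,3) by (simp add: gv_def)
    qed
    ultimately have "det (transpose_mat B) = 0"
      using det_0_iff_vec_prod_zero_field[of "transpose_mat B" n] B by (metis transpose_carrier_mat gv_def vec_carrier)
    then show False using dB det_transpose[OF B] by simp
  qed
  ultimately show "rank A \<le> n - 1" using r by simp
  have "rank P = n" using P det_rank_iff by blast
  have dP: "distinct (cols P)" using non_distinct_low_rank[OF P(1)] \<open>rank P = n\<close> by auto
  have liP: "lin_indpt (set (cols P))" using full_rank_lin_indpt[OF P(1) \<open>rank P = n\<close> dP] .
  let ?U = "set (cols P) - {col P a}"
  have "lin_indpt ?U" using liP by (rule subset_li_is_li) auto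
  moreover have "?U \<subseteq> span (set (cols A))"
  proof
    fix u assume u: "u \<in> ?U"
    then obtain b where b: "b < n" "u = col P b" using P(1) by (auto simp: cols_def)
    then have "b \<noteq> a" using u by auto
    then show "u \<in> span (set (cols A))" using span[OF b(1)] b(2) mult_mat_vec_in_span[OF A] by auto
  qed
  ultimately have "card ?U \<le> rank A" using rank_ge_card_span[OF A] by blast
  moreover have "card ?U = n - 1"
  proof -
    have "col P a \<in> set (cols P)" using a P(1) by (auto simp: cols_def)
    then have "card ?U = card (set (cols P)) - 1" by (simp add: card_Diff_singleton)
    also have "card (set (cols P)) = n" using distinct_card[OF dP] P(1) by simp
    finally show ?thesis .
  qed
  ultimately show "n - 1 \<le> rank A" by simp
qed

end

section \<open>Homogeneous components\<close>

definition hom_part :: "nat \<Rightarrow> ('v, 'a::comm_ring_1) mpoly \<Rightarrow> ('v, 'a) mpoly" where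
  "hom_part d p = (\<Sum>t\<in>{t\<in>mkeys p. mon_deg t = d}. msingle t (lkp p t))"

lemma lookup_hom_part: "lkp (hom_part d p) t = (if mon_deg t = d then lkp p t else 0)"
proof -
  have "lkp (hom_part d p) t = (\<Sum>s\<in>{s\<in>mkeys p. mon_deg s = d}. if s = t then lkp p t else 0)"
    by (auto simp: hom_part_def lookup_sum lookup_single when_def intro!: sum.cong)
  then show ?thesis by (simp add: in_keys_iff)
qed

lemma hom_part_add: "hom_part d (p + q) = hom_part d p + hom_part d q"
  by (rule poly_mapping_eqI) (simp add: lookup_hom_part lookup_add)

lemma hom_part_0 [simp]: "hom_part d 0 = 0"
  by (rule poly_mapping_eqI) (simp add: lookup_hom_part)

lemma hom_part_sum: "hom_part d (sum f A) = (\<Sum>i\<in>A. hom_part d (f i))"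
  by (induction A rule: infinite_finite_induct) (auto simp: hom_part_add)

lemma is_form_hom_part: "p \<in> polys V \<Longrightarrow> is_form V d (hom_part d p)"
  by (rule is_formI) (auto simp: polys_iff in_keys_iff lookup_hom_part split: if_splits)

lemma hom_part_form: "is_form V e p \<Longrightarrow> hom_part d p = (if d = e then p else 0)"
  by (rule poly_mapping_eqI) (auto simp: lookup_hom_part is_form_def in_keys_iff)

lemma sum_hom_parts: "\<exists>n. \<forall>k\<ge>n. p = (\<Sum>d<k. hom_part d p)"
proof (intro exI allI impI)
  fix k assume k: "Suc (\<Sum>t\<in>mkeys p. mon_deg t) \<le> k"
  show "p = (\<Sum>d<k. hom_part d p)"
  proof (rule poly_mapping_eqI)
    fix t
    have "lkp (\<Sum>d<k. hom_part d p) t = (\<Sum>d<k. if d = mon_deg t then lkp p t else 0)"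
      by (auto simp: lookup_sum lookup_hom_part intro!: sum.cong)
    moreover have "mon_deg t < k \<or> lkp p t = 0"
      using member_le_sum[of t "mkeys p" mon_deg] k by (auto simp: in_keys_iff)
    ultimately show "lkp p t = lkp (\<Sum>d<k. hom_part d p) t" by auto
  qed
qed

text \<open>Multiplication by a form of degree \<open>e\<close> shifts the grading by \<open>e\<close>.\<close>
lemma hom_part_mult_form:
  assumes q: "is_form V e q"
  shows "hom_part d (p * q) = (if e \<le> d then hom_part (d - e) p * q else 0)"
proof -
  obtain n where n: "p = (\<Sum>j<n. hom_part j p)" using sum_hom_parts by blast
  have q': "is_form UNIV e q" using q by (auto simp: is_form_def)
  have f: "hom_part k (hom_part j p * q) = (if k = j + e then hom_part j p * q else 0)" for j k
    by (rule hom_part_form[OF is_form_mult[OF is_form_hom_part[OF polys_UNIV] q']])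
  have "hom_part d (p * q) = (\<Sum>j<n. hom_part d (hom_part j p * q))"
    by (subst n) (simp add: sum_distrib_right hom_part_sum)
  also have "\<dots> = (\<Sum>j<n. if e \<le> d then hom_part (d - e) (hom_part j p) * q else 0)"
  proof (intro sum.cong refl)
    fix j
    have "hom_part (d - e) (hom_part j p) = (if d - e = j then hom_part j p else 0)"
      by (rule hom_part_form[OF is_form_hom_part[OF polys_UNIV]])
    then show "hom_part d (hom_part j p * q) = (if e \<le> d then hom_part (d - e) (hom_part j p) * q else 0)"
      by (auto simp: f)
  qed
  also have "\<dots> = (if e \<le> d then hom_part (d - e) (\<Sum>j<n. hom_part j p) * q else 0)"
    by (simp add: sum_distrib_right hom_part_sum)
  finally show ?thesis unfolding n[symmetric] .
qed

lemma hom_part_form_mult: "is_form V e q \<Longrightarrow> hom_part d (q * p) = (if e \<le> d then q * hom_part (d - e) p else 0)"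
  using hom_part_mult_form[of V e q d p] by (simp add: mult.commute)

lemma form_0_Const: "is_form V 0 p \<Longrightarrow> p = Const (lkp p 0)"
  by (rule poly_mapping_eqI) (auto simp: Const_def lookup_single when_def is_form_def in_keys_iff dest: mon_deg_eq_0)

lemma hom_part_0_Const: "hom_part 0 p = Const (lkp p 0)"
  using form_0_Const[OF is_form_hom_part[of p UNIV 0]] by (simp add: lookup_hom_part)

section \<open>Finite generation of graded submodules of free modules\<close>

text \<open>From any index on there is one where the value in the new coordinate is minimal for all later indices; iterating this gives the subsequence.\<close>
lemma monotone_subsequence:
  fixes s :: "nat \<Rightarrow> 'v \<Rightarrow> nat"
  assumes "finite V"
  shows "\<exists>r :: nat \<Rightarrow> nat. strict_mono r \<and> (\<forall>v\<in>V. \<forall>i j. i \<le> j \<longrightarrow> s (r i) v \<le> s (r j) v)"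
  using assms
proof (induction V rule: finite_induct)
  case empty
  have "strict_mono (id :: nat \<Rightarrow> nat)" by (simp add: strict_mono_def)
  then show ?case by blast
next
  case (insert v V)
  from insert.IH obtain r :: "nat \<Rightarrow> nat"
    where r: "strict_mono r" "\<forall>v\<in>V. \<forall>i j. i \<le> j \<longrightarrow> s (r i) v \<le> s (r j) v"
    by (elim exE conjE)
  have "\<exists>k. n \<le> k \<and> (\<forall>j. k \<le> j \<longrightarrow> s (r k) v \<le> s (r j) v)" for n
  proof -
    have "\<exists>k. n \<le> k \<and> (\<forall>j. n \<le> j \<longrightarrow> s (r k) v \<le> s (r j) v)"
      using ex_has_least_nat[of "\<lambda>k. n \<le> k" n "\<lambda>k. s (r k) v"] by auto
    then show ?thesis using order_trans by blast
  qed
  then have "\<exists>k. \<forall>n. n \<le> k n \<and> (\<forall>j. k n \<le> j \<longrightarrow> s (r (k n)) v \<le> s (r j) v)" by (intro choice) simp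
  then obtain k where k: "\<forall>n. n \<le> k n \<and> (\<forall>j. k n \<le> j \<longrightarrow> s (r (k n)) v \<le> s (r j) v)" by (elim exE)
  define q where "q = rec_nat (k 0) (\<lambda>_ m. k (Suc m))"
  have qS: "q (Suc i) = k (Suc (q i))" for i by (simp add: q_def)
  have qk: "\<exists>n. q i = k n" for i by (cases i) (auto simp: q_def)
  have sm: "strict_mono q"
    unfolding strict_mono_Suc_iff
  proof
    fix i
    have "Suc (q i) \<le> k (Suc (q i))" using k by simp
    then show "q i < q (Suc i)" by (simp only: qS Suc_le_eq)
  qed
  have q: "s (r (q i)) v \<le> s (r (q j)) v" if "i \<le> j" for i j
  proof -
    obtain n where n: "q i = k n" using qk[of i] by (elim exE)
    have "q i \<le> q j" using sm that by (simp add: strict_mono_less_eq)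
    then show ?thesis using k n by simp
  qed
  have "strict_mono (\<lambda>i. r (q i))" using strict_mono_o[OF r(1) sm] by (simp add: o_def)
  moreover have "q i \<le> q j" if "i \<le> j" for i j using sm that by (simp add: strict_mono_less_eq)
  ultimately show ?case using r(2) q by (intro exI[of _ "\<lambda>i. r (q i)"]) simp
qed

text \<open>Dickson's lemma: the minimal monomials are pairwise incomparable, and an infinite sequence of them would contain a comparable pair.\<close>
lemma dickson:
  fixes T :: "('v \<Rightarrow>\<^sub>0 nat) set"
  assumes V: "finite V" and T: "\<And>t. t \<in> T \<Longrightarrow> mkeys t \<subseteq> V"
  obtains B where "finite B" "B \<subseteq> T" "\<And>t. t \<in> T \<Longrightarrow> \<exists>b\<in>B. \<exists>u. t = b + u"
proof -
  define B where "B = {b\<in>T. \<forall>c u. c \<in> T \<longrightarrow> b = c + u \<longrightarrow> u = 0}"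
  have dvd: "\<exists>u. t = b + u" if "b \<in> T" "\<And>v. v \<in> V \<Longrightarrow> lkp b v \<le> lkp t v" for b t
  proof -
    have "lkp b v \<le> lkp t v" for v
    proof (cases "v \<in> V")
      case False
      then have "v \<notin> mkeys b" using T[OF that(1)] by auto
      then show ?thesis by (simp add: in_keys_iff)
    qed (rule that(2))
    then have "t = b + (t - b)" by (intro poly_mapping_eqI) (simp add: lookup_add lookup_minus)
    then show ?thesis by blast
  qed
  have "finite B"
  proof (rule ccontr)
    assume "infinite B"
    then obtain s :: "nat \<Rightarrow> 'v \<Rightarrow>\<^sub>0 nat" where s: "inj s" "range s \<subseteq> B"
      unfolding infinite_iff_countable_subset by (elim exE conjE)
    obtain r :: "nat \<Rightarrow> nat" where r: "strict_mono r" "\<forall>v\<in>V. \<forall>i j. i \<le> j \<longrightarrow> lkp (s (r i)) v \<le> lkp (s (r j)) v"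
      using monotone_subsequence[OF V, of "\<lambda>n. lkp (s n)"] by (elim exE conjE)
    have sB: "s i \<in> B" for i using s(2) by auto
    then have sT: "s i \<in> T" for i by (auto simp: B_def)
    obtain u where u: "s (r 1) = s (r 0) + u" using dvd[OF sT, of "r 0" "s (r 1)"] r(2) by auto
    then have "u = 0" using sB[of "r 1"] sT[of "r 0"] by (auto simp: B_def)
    then have "r 1 = r 0" using u s(1) by (simp add: inj_eq)
    then show False using strict_monoD[OF r(1), of 0 1] by simp
  qed
  moreover have "\<exists>b\<in>B. \<exists>u. t = b + u" if "t \<in> T" for t
    using that
  proof (induction "mon_deg t" arbitrary: t rule: less_induct)
    case less
    show ?case
    proof (cases "t \<in> B")
      case True
      then show ?thesis by (intro bexI[of _ t] exI[of _ 0]) auto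
    next
      case False
      then obtain c u where c: "c \<in> T" "t = c + u" "u \<noteq> 0" using less.prems by (auto simp: B_def)
      then have "mon_deg c < mon_deg t" using mon_deg_eq_0[of u] by (auto simp: mon_deg_add)
      then obtain b u' where "b \<in> B" "c = b + u'" using less.hyps c(1) by blast
      then show ?thesis using c(2) by (intro bexI[of _ b] exI[of _ "u' + u"]) (auto simp: add.assoc)
    qed
  qed
  ultimately show thesis using that[of B] by (auto simp: B_def)
qed

lemma finite_monomials_of_degree:
  assumes "finite V" shows "finite {t :: 'v \<Rightarrow>\<^sub>0 nat. mkeys t \<subseteq> V \<and> mon_deg t = e}"
  by (rule finite_subset[OF _ card_bounded_monomials(1)[OF assms, of "Suc e"]])
     (use lkp_le_mon_deg in \<open>auto simp: less_Suc_eq_le\<close>)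

lemma lookup_single_mult: "lkp (msingle u c * p) (u + s) = (c :: 'a::comm_ring_1) * lkp p (s :: 'v \<Rightarrow>\<^sub>0 nat)"
proof -
  have "msingle u c * p = (\<Sum>t\<in>mkeys p. msingle (u + t) (c * lkp p t))"
    by (subst mpoly_sum_singles[of p, symmetric]) (simp only: sum_distrib_left mult_single)
  then have "lkp (msingle u c * p) (u + s) = (\<Sum>t\<in>mkeys p. if t = s then c * lkp p s else 0)"
    by (auto simp: lookup_sum lookup_single when_def intro!: sum.cong)
  then show ?thesis by (simp add: in_keys_iff)
qed

lemma keys_single_mult:
  fixes p :: "('v, 'a::comm_ring_1) mpoly"
  assumes "t \<in> mkeys (msingle u c * p)"
  obtains s where "s \<in> mkeys p" "t = u + s"
  using keys_mult[of "msingle u c" p] assms by (fastforce split: if_splits)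

context
  fixes V :: "'v::linorder set" and F :: "nat \<Rightarrow> ('v, 'a::field) mpoly" and N e :: nat
begin

text \<open>Vectors of forms of the common degree \<open>d\<close> that are orthogonal to \<open>F\<close>.\<close>
definition form_syzygy :: "nat \<Rightarrow> (nat \<Rightarrow> ('v, 'a) mpoly) \<Rightarrow> bool" where
  "form_syzygy d h \<longleftrightarrow> (\<forall>i<N. is_form V d (h i)) \<and> (\<Sum>i<N. h i * F i) = 0"

definition supp :: "(nat \<Rightarrow> ('v, 'a) mpoly) \<Rightarrow> (nat \<times> ('v \<Rightarrow>\<^sub>0 nat)) set" where
  "supp h = (SIGMA i:{..<N}. mkeys (h i))"

text \<open>The leading monomial of a vector: positions are compared first, then monomials.\<close>
definition lead :: "(nat \<Rightarrow> ('v, 'a) mpoly) \<Rightarrow> nat \<times> ('v \<Rightarrow>\<^sub>0 nat)" where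
  "lead h = Max (supp h)"

definition combination :: "'i set \<Rightarrow> ('i \<Rightarrow> nat \<Rightarrow> ('v, 'a) mpoly) \<Rightarrow> (nat \<Rightarrow> ('v, 'a) mpoly) \<Rightarrow> bool" where
  "combination A H h \<longleftrightarrow> (\<exists>r. (\<forall>a\<in>A. r a \<in> polys V) \<and> (\<forall>i<N. h i = (\<Sum>a\<in>A. r a * H a i)))"

context
  assumes V: "finite V" and F: "\<And>i. i < N \<Longrightarrow> is_form V e (F i)"
begin

lemma finite_supp: "finite (supp h)" by (simp add: supp_def)

lemma lead_in: "supp h \<noteq> {} \<Longrightarrow> lead h \<in> supp h"
  unfolding lead_def by (rule Max_in[OF finite_supp])

lemma combination_sum:
  assumes "\<And>d. d \<in> D \<Longrightarrow> combination A H (h d)" and "\<And>i. i < N \<Longrightarrow> h' i = (\<Sum>d\<in>D. h d i)"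
  shows "combination A H h'"
proof -
  obtain r where r: "\<And>d a. d \<in> D \<Longrightarrow> a \<in> A \<Longrightarrow> r d a \<in> polys V" "\<And>d i. d \<in> D \<Longrightarrow> i < N \<Longrightarrow> h d i = (\<Sum>a\<in>A. r d a * H a i)"
    using assms(1) unfolding combination_def by metis
  have "h' i = (\<Sum>a\<in>A. (\<Sum>d\<in>D. r d a) * H a i)" if "i < N" for i
    using assms(2)[OF that] r(2)[OF _ that] by (simp add: sum_distrib_right sum.swap[of _ D A])
  then show ?thesis unfolding combination_def
    by (intro exI[of _ "\<lambda>a. \<Sum>d\<in>D. r d a"]) (auto intro: polys_sum r(1))
qed

text \<open>One step of division: a multiple of \<open>H\<close> cancels the leading term of \<open>h\<close> and only introduces smaller ones.\<close>
lemma reduce_lead: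
  assumes h: "form_syzygy d h" "supp h \<noteq> {}" "lead h = (i, b + u)"
    and H: "form_syzygy d' H" "supp H \<noteq> {}" "lead H = (i, b)"
  obtains c where "form_syzygy d (\<lambda>j. h j - msingle u c * H j)" "mkeys u \<subseteq> V"
    "\<And>x. x \<in> supp (\<lambda>j. h j - msingle u c * H j) \<Longrightarrow> x < lead h"
proof -
  have hi: "i < N" "b + u \<in> mkeys (h i)" using lead_in[OF h(2)] h(3) by (auto simp: supp_def)
  have Hi: "b \<in> mkeys (H i)" using lead_in[OF H(2)] H(3) by (auto simp: supp_def)
  have "mon_deg (b + u) = d" "mon_deg b = d'" using h(1) H(1) hi Hi by (auto simp: form_syzygy_def is_form_def)
  then have d: "d = d' + mon_deg u" by (simp add: mon_deg_add)
  have "mkeys (b + u) \<subseteq> V" using h(1) hi is_form_polys by (fastforce simp: form_syzygy_def polys_iff)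
  then have uV: "mkeys u \<subseteq> V" by (fastforce simp: in_keys_iff lookup_add)
  define c where "c = lkp (h i) (b + u) / lkp (H i) b"
  have su: "is_form V (mon_deg u) (msingle u c)" using uV by (intro is_formI) (auto simp: polys_iff split: if_splits)
  have "form_syzygy d (\<lambda>j. h j - msingle u c * H j)"
  proof -
    have "is_form V d (h j - msingle u c * H j)" if "j < N" for j
      using h(1) is_form_mult[OF su, of d' "H j"] H(1) that by (auto simp: form_syzygy_def d add.commute intro: is_form_diff)
    moreover have "(\<Sum>j<N. (h j - msingle u c * H j) * F j) = (\<Sum>j<N. h j * F j) - msingle u c * (\<Sum>j<N. H j * F j)"
      by (simp add: left_diff_distrib sum_subtractf sum_distrib_left mult.assoc)
    ultimately show ?thesis using h(1) H(1) by (simp add: form_syzygy_def)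
  qed
  moreover have "x < lead h" if x: "x \<in> supp (\<lambda>j. h j - msingle u c * H j)" for x
  proof -
    obtain j s where js: "x = (j, s)" "j < N" "s \<in> mkeys (h j - msingle u c * H j)" using x by (auto simp: supp_def)
    have "x \<noteq> lead h"
    proof
      assume "x = lead h"
      then have "j = i" "s = u + b" using js(1) h(3) by (auto simp: add.commute)
      then have "lkp (h j - msingle u c * H j) s = 0"
        using Hi by (simp add: lookup_minus lookup_single_mult c_def in_keys_iff add.commute[of b u])
      then show False using js(3) by (simp add: in_keys_iff)
    qed
    moreover have "x \<le> lead h"
    proof (cases "s \<in> mkeys (h j)")
      case True
      then have "x \<in> supp h" using js by (auto simp: supp_def)
      then show ?thesis unfolding lead_def using finite_supp by (rule Max_ge[rotated])
    next
      case False
      then have "s \<in> mkeys (msingle u c * H j)" using js(3) by (auto simp: in_keys_iff lookup_minus)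
      then obtain s' where s': "s' \<in> mkeys (H j)" "s = u + s'" by (rule keys_single_mult)
      then have "(j, s') \<in> supp H" using js by (auto simp: supp_def)
      then have "(j, s') \<le> lead H" unfolding lead_def using finite_supp by (rule Max_ge[rotated])
      then have "j < i \<or> j = i \<and> s' \<le> b" using H(3) by auto
      then have "j < i \<or> j = i \<and> u + s' \<le> u + b" by (auto intro: add_left_mono)
      then show ?thesis using js(1) s'(2) h(3) by (auto simp: add.commute)
    qed
    ultimately show ?thesis by simp
  qed
  ultimately show thesis using that[of c] uV by blast
qed

text \<open>The module of syzygies of forms is generated by finitely many homogeneous ones: for each position choose, by Dickson's lemma,
  syzygies whose leading monomials divide all others. In each degree there are finitely many monomials, so
  otherwise there would be a homogeneous syzygy outside the span whose leading monomial is minimal, and it could be reduced.\<close>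
lemma finite_generators:
  obtains A :: "(nat \<times> ('v \<Rightarrow>\<^sub>0 nat)) set" and H \<delta>
  where "finite A" "\<And>a. a \<in> A \<Longrightarrow> form_syzygy (\<delta> a) (H a)"
    "\<And>h. (\<And>i. i < N \<Longrightarrow> h i \<in> polys V) \<Longrightarrow> (\<Sum>i<N. h i * F i) = 0 \<Longrightarrow> combination A H h"
proof -
  define T where "T i = {t. \<exists>d h. form_syzygy d h \<and> supp h \<noteq> {} \<and> lead h = (i, t)}" for i
  have TV: "mkeys t \<subseteq> V" if t: "t \<in> T i" for i t
  proof -
    obtain d h where h: "form_syzygy d h" "supp h \<noteq> {}" "lead h = (i, t)" using t by (auto simp: T_def)
    then have "i < N" "t \<in> mkeys (h i)" using lead_in[OF h(2)] by (auto simp: supp_def)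
    then show ?thesis using h(1) is_form_polys by (fastforce simp: form_syzygy_def polys_iff)
  qed
  have "\<exists>B. finite B \<and> B \<subseteq> T i \<and> (\<forall>t\<in>T i. \<exists>b\<in>B. \<exists>u. t = b + u)" for i
  proof (rule dickson[OF V TV[of _ i]])
    fix B assume "finite B" "B \<subseteq> T i" "\<And>t. t \<in> T i \<Longrightarrow> \<exists>b\<in>B. \<exists>u. t = b + u"
    then show ?thesis by (intro exI[of _ B]) simp
  qed
  then obtain B where B: "\<And>i. finite (B i)" "\<And>i. B i \<subseteq> T i" "\<And>i t. t \<in> T i \<Longrightarrow> \<exists>b\<in>B i. \<exists>u. t = b + u" by metis
  define A where "A = (SIGMA i:{..<N}. B i)"
  have finA: "finite A" using B(1) by (auto simp: A_def)
  have "\<exists>d h. form_syzygy d h \<and> supp h \<noteq> {} \<and> lead h = a" if "a \<in> A" for a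
    using that B(2) by (fastforce simp: A_def T_def)
  then obtain \<delta> H where H: "\<And>a. a \<in> A \<Longrightarrow> form_syzygy (\<delta> a) (H a)" "\<And>a. a \<in> A \<Longrightarrow> supp (H a) \<noteq> {}"
    "\<And>a. a \<in> A \<Longrightarrow> lead (H a) = a" by metis
  have zero: "combination A H h" if "supp h = {}" for h
  proof -
    have "h i = 0" if "i < N" for i
    proof -
      have "(i, t) \<notin> supp h" for t using \<open>supp h = {}\<close> by simp
      then have "\<not> t \<in> mkeys (h i)" for t using that by (auto simp: supp_def)
      then show ?thesis by (intro poly_mapping_eqI) (simp add: in_keys_iff)
    qed
    then show ?thesis unfolding combination_def by (intro exI[of _ "\<lambda>_. 0"]) simp
  qed
  have hom: "combination A H h" if "form_syzygy d h" for d h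
  proof (rule ccontr)
    assume n: "\<not> combination A H h"
    define XX where "XX = {lead h | h. form_syzygy d h \<and> \<not> combination A H h}"
    have memX: "x \<in> XX \<longleftrightarrow> (\<exists>h. x = lead h \<and> form_syzygy d h \<and> \<not> combination A H h)" for x
      unfolding XX_def by blast
    have "XX \<subseteq> {..<N} \<times> {t. mkeys t \<subseteq> V \<and> mon_deg t = d}"
    proof
      fix x assume "x \<in> XX"
      then obtain h where h: "x = lead h" "form_syzygy d h" "\<not> combination A H h" unfolding memX by (elim exE conjE)
      have hs: "supp h \<noteq> {}" using zero[of h] h(3) by metis
      obtain j s where js: "x = (j, s)" by (cases x)
      then have "j < N" "s \<in> mkeys (h j)" using lead_in[OF hs] h(1) by (auto simp: supp_def)
      then show "x \<in> {..<N} \<times> {t. mkeys t \<subseteq> V \<and> mon_deg t = d}"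
        using js h(2) by (auto simp: form_syzygy_def is_form_def vars_def)
    qed
    then have fX: "finite XX" by (rule finite_subset) (simp add: finite_monomials_of_degree[OF V])
    have "lead h \<in> XX" using that n memX by blast
    then have "Min XX \<in> XX" using Min_in[OF fX] by blast
    then obtain g where g': "Min XX = lead g" "form_syzygy d g" "\<not> combination A H g" unfolding memX by (elim exE conjE)
    then have g: "form_syzygy d g" "\<not> combination A H g" "lead g = Min XX" by simp_all
    have gs: "supp g \<noteq> {}" using zero[of g] g(2) by metis
    obtain i t where it: "lead g = (i, t)" by (cases "lead g")
    then have iN: "i < N" using lead_in[OF gs] by (auto simp: supp_def)
    have "t \<in> T i" using g(1) gs it by (auto simp: T_def)
    then obtain b u where b: "b \<in> B i" "t = b + u" using B(3) by blast
    have a: "(i, b) \<in> A" using b iN by (simp add: A_def)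
    have lg: "lead g = (i, b + u)" using it b(2) by simp
    obtain c where c: "form_syzygy d (\<lambda>j. g j - msingle u c * H (i, b) j)" "mkeys u \<subseteq> V"
      "\<And>x. x \<in> supp (\<lambda>j. g j - msingle u c * H (i, b) j) \<Longrightarrow> x < lead g"
      using reduce_lead[OF g(1) gs lg H(1)[OF a] H(2)[OF a] H(3)[OF a]] by blast
    let ?g = "\<lambda>j. g j - msingle u c * H (i, b) j"
    show False
    proof (cases "combination A H ?g")
      case False
      then have "supp ?g \<noteq> {}" using zero[of ?g] by metis
      then have "lead ?g < lead g" by (intro c(3) lead_in)
      moreover have "lead ?g \<in> XX" unfolding memX using c(1) False by (intro exI[of _ ?g]) simp
      then have "Min XX \<le> lead ?g" by (rule Min_le[OF fX])
      ultimately show False using g(3) by simp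
    next
      case True
      then obtain r where r: "\<And>a. a \<in> A \<Longrightarrow> r a \<in> polys V" "\<And>j. j < N \<Longrightarrow> ?g j = (\<Sum>a\<in>A. r a * H a j)"
        unfolding combination_def by blast
      have "g j = (\<Sum>a\<in>A. (r a + (if a = (i, b) then msingle u c else 0)) * H a j)" if "j < N" for j
      proof -
        have "(\<Sum>a\<in>A. (r a + (if a = (i, b) then msingle u c else 0)) * H a j)
          = (\<Sum>a\<in>A. r a * H a j + (if a = (i, b) then msingle u c * H (i, b) j else 0))"
          by (intro sum.cong refl) (auto simp: distrib_right)
        also have "\<dots> = ?g j + msingle u c * H (i, b) j" using finA a r(2)[OF that] by (simp add: sum.distrib)
        finally show ?thesis by simp
      qed
      moreover have "msingle u c \<in> polys V" using c(2) by (auto simp: polys_iff split: if_splits)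
      ultimately have "combination A H g" unfolding combination_def
        by (intro exI[of _ "\<lambda>a. r a + (if a = (i, b) then msingle u c else 0)"]) (auto intro: polys_add r(1))
      then show False using g(2) by simp
    qed
  qed
  have "combination A H h" if h: "\<And>i. i < N \<Longrightarrow> h i \<in> polys V" "(\<Sum>i<N. h i * F i) = 0" for h
  proof -
    have "\<exists>n. \<forall>i. \<forall>k\<ge>n i. h i = (\<Sum>d<k. hom_part d (h i))"
      by (intro choice allI sum_hom_parts)
    then obtain n where n: "\<forall>i. \<forall>k\<ge>n i. h i = (\<Sum>d<k. hom_part d (h i))" by (elim exE)
    define k where "k = (\<Sum>i<N. n i)"
    have "combination A H (\<lambda>i. hom_part d (h i))" for d
    proof (rule hom)
      have "(\<Sum>i<N. hom_part d (h i) * F i) = hom_part (d + e) (\<Sum>i<N. h i * F i)"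
        unfolding hom_part_sum by (intro sum.cong refl) (simp add: hom_part_mult_form[OF F])
      then show "form_syzygy d (\<lambda>i. hom_part d (h i))"
        using h by (auto simp: form_syzygy_def is_form_hom_part)
    qed
    moreover have "h i = (\<Sum>d<k. hom_part d (h i))" if "i < N" for i
    proof -
      have "n i \<le> k" using member_le_sum[of i "{..<N}" n] that by (simp add: k_def)
      then show ?thesis using spec[OF n, of i] by blast
    qed
    ultimately show ?thesis by (intro combination_sum[of "{..<k}" A H "\<lambda>d i. hom_part d (h i)" h])
  qed
  note all = this
  show thesis
  proof (rule that[of A \<delta> H])
    show "finite A" by (rule finA)
    show "form_syzygy (\<delta> a) (H a)" if "a \<in> A" for a using that by (rule H(1))
    show "combination A H h" if "\<And>i. i < N \<Longrightarrow> h i \<in> polys V" "(\<Sum>i<N. h i * F i) = 0" for h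
      using that by (rule all)
  qed
qed

end

end

section \<open>Minimal generators and linear syzygies\<close>

text \<open>Only the constant parts of the coefficients matter in the degree of the generators.\<close>
lemma form_in_ideal_of_forms:
  assumes "finite A" and F: "\<And>i. i \<in> A \<Longrightarrow> is_form V d (F i)"
    and g: "is_form V d (g :: ('v, 'a::comm_ring_1) mpoly)" "g \<in> genideal (mpoly_ring V) (F ` A)"
  shows "\<exists>c. g = (\<Sum>i\<in>A. Const (c i) * F i)"
proof -
  have "genideal (mpoly_ring V) (F ` A) = {\<Sum>i\<in>A. r i * F i | r. \<forall>i\<in>A. r i \<in> polys V}"
    by (rule genideal_image) (use assms(1) F is_form_polys in auto)
  then obtain r where r: "g = (\<Sum>i\<in>A. r i * F i)" using g(2) by auto
  have "g = hom_part d g" using hom_part_form[OF g(1), of d] by simp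
  also have "\<dots> = (\<Sum>i\<in>A. Const (lkp (r i) 0) * F i)"
    unfolding r hom_part_sum by (intro sum.cong refl) (simp add: hom_part_mult_form[OF F] hom_part_0_Const)
  finally show ?thesis by (intro exI[of _ "\<lambda>i. lkp (r i) 0"])
qed

lemma forms_in_ideal_degree:
  assumes "finite A" and F: "\<And>i. i \<in> A \<Longrightarrow> is_form V d (F i)"
    and g: "is_form V e (g :: ('v, 'a::comm_ring_1) mpoly)" "g \<in> genideal (mpoly_ring V) (F ` A)" "g \<noteq> 0"
  shows "d \<le> e"
proof (rule ccontr)
  assume n: "\<not> d \<le> e"
  have "genideal (mpoly_ring V) (F ` A) = {\<Sum>i\<in>A. r i * F i | r. \<forall>i\<in>A. r i \<in> polys V}"
    by (rule genideal_image) (use assms(1) F is_form_polys in auto)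
  then obtain r where r: "g = (\<Sum>i\<in>A. r i * F i)" using g(2) by auto
  have "g = hom_part e g" using hom_part_form[OF g(1), of e] by simp
  also have "\<dots> = 0" unfolding r hom_part_sum by (intro sum.neutral ballI) (use n in \<open>simp add: hom_part_mult_form[OF F]\<close>)
  finally show False using g(3) by simp
qed

lemma nth_image_set: "set gs = (\<lambda>i. gs ! i) ` {..<length gs}"
  by (auto simp: set_conv_nth)

lemma indep_modD:
  assumes "indep_mod {0} n F" "(\<Sum>i<n. Const (c i) * F i) = 0" "j < n"
  shows "c j = 0"
proof -
  have "(\<Sum>i<n. Const (c i) * F i) \<in> {0}" unfolding assms(2) by (rule insertI1)
  from mp[OF spec[OF assms(1)[unfolded indep_mod_def], of c] this] show ?thesis using assms(3) by (elim allE impE)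
qed

lemma indep_nonzero:
  assumes "indep_mod {0} n F" "i < n" shows "F i \<noteq> (0 :: ('v, 'a::comm_ring_1) mpoly)"
proof
  assume z: "F i = 0"
  define \<delta> where "\<delta> j = (if j = i then 1 else 0 :: 'a)" for j
  have "(\<Sum>j<n. Const (\<delta> j) * F j) = 0" by (intro sum.neutral ballI) (auto simp: \<delta>_def z)
  then have "\<delta> i = 0" by (rule indep_modD[OF assms(1) _ assms(2)])
  then show False by (simp add: \<delta>_def)
qed

text \<open>A linear relation with constant coefficients makes a generator superfluous.\<close>
lemma genideal_others:
  fixes gs :: "('v, 'a::field) mpoly list"
  assumes gs: "\<And>g. g \<in> set gs \<Longrightarrow> g \<in> polys V" and i: "i < length gs"
    and c: "(\<Sum>j<length gs. Const (c j) * gs ! j) = 0" "c i \<noteq> 0"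
  shows "genideal (mpoly_ring V) {gs ! j | j. j < length gs \<and> j \<noteq> i} = genideal (mpoly_ring V) (set gs)"
proof -
  let ?O = "{gs ! j | j. j < length gs \<and> j \<noteq> i}"
  interpret R: ring "mpoly_ring V :: ('v, 'a) mpoly ring" by (rule ring_mpoly_ring)
  have OV: "?O \<subseteq> carrier (mpoly_ring V)" using gs by auto
  have sV: "set gs \<subseteq> carrier (mpoly_ring V)" using gs by auto
  have id: "ideal (genideal (mpoly_ring V) ?O) (mpoly_ring V)" by (rule R.genideal_ideal[OF OV])
  then have id': "is_ideal V (genideal (mpoly_ring V) ?O)" by (simp add: ideal_iff)
  have sub: "?O \<subseteq> genideal (mpoly_ring V) ?O" by (rule R.genideal_self[OF OV])
  have "gs ! i = (\<Sum>j\<in>{..<length gs} - {i}. Const (- c j / c i) * gs ! j)"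
  proof -
    have "0 = Const (inverse (c i)) * (\<Sum>j<length gs. Const (c j) * gs ! j)" by (simp add: c(1))
    also have "\<dots> = (\<Sum>j<length gs. Const (inverse (c i) * c j) * gs ! j)"
      by (simp add: sum_distrib_left Const_mult mult.assoc)
    also have "\<dots> = gs ! i + (\<Sum>j\<in>{..<length gs} - {i}. Const (inverse (c i) * c j) * gs ! j)"
      using i c(2) by (simp add: sum.remove[of "{..<length gs}" i])
    also have "(\<Sum>j\<in>{..<length gs} - {i}. Const (inverse (c i) * c j) * gs ! j) = - (\<Sum>j\<in>{..<length gs} - {i}. Const (- c j / c i) * gs ! j)"
      unfolding sum_negf[symmetric]
    proof (intro sum.cong refl)
      fix j
      have "inverse (c i) * c j = - (- c j / c i)" by (simp add: divide_inverse mult.commute)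
      then show "Const (inverse (c i) * c j) * gs ! j = - (Const (- c j / c i) * gs ! j)"
        by (simp only: Const_uminus mult_minus_left)
    qed
    finally show ?thesis by simp
  qed
  also have "\<dots> \<in> genideal (mpoly_ring V) ?O"
    by (intro is_ideal_sum[OF id'] is_idealD(4)[OF id'] subsetD[OF sub]) auto
  finally have gi: "gs ! i \<in> genideal (mpoly_ring V) ?O" .
  have "set gs \<subseteq> genideal (mpoly_ring V) ?O"
  proof
    fix g assume "g \<in> set gs"
    then obtain j where j: "j < length gs" "g = gs ! j" by (auto simp: in_set_conv_nth)
    show "g \<in> genideal (mpoly_ring V) ?O"
    proof (cases "j = i")
      case False
      then show ?thesis using j by (intro subsetD[OF sub]) auto
    qed (use j gi in simp)
  qed
  then have "genideal (mpoly_ring V) (set gs) \<subseteq> genideal (mpoly_ring V) ?O" by (rule R.genideal_minimal[OF id])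
  moreover have "genideal (mpoly_ring V) ?O \<subseteq> genideal (mpoly_ring V) (set gs)"
  proof (rule R.genideal_minimal[OF R.genideal_ideal[OF sV]])
    show "?O \<subseteq> genideal (mpoly_ring V) (set gs)" using R.genideal_self[OF sV] by (auto simp del: mpoly_ring_simps)
  qed
  ultimately show ?thesis by blast
qed

text \<open>The two products have the same trace, so in characteristic zero they have the same size.\<close>
lemma square_if_inverse:
  fixes M :: "nat \<Rightarrow> nat \<Rightarrow> 'a::field_char_0"
  assumes "\<And>i j. i < n \<Longrightarrow> j < n \<Longrightarrow> (\<Sum>a<N. M i a * M' a j) = (if i = j then 1 else 0)"
    and "\<And>a b. a < N \<Longrightarrow> b < N \<Longrightarrow> (\<Sum>i<n. M' a i * M i b) = (if a = b then 1 else 0)"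
  shows "n = N"
proof -
  have "of_nat n = (\<Sum>i<n. \<Sum>a<N. M i a * M' a i)" using assms(1) by simp
  also have "\<dots> = (\<Sum>a<N. \<Sum>i<n. M' a i * M i a)" by (subst sum.swap) (simp add: mult.commute)
  also have "\<dots> = of_nat N" using assms(2) by simp
  finally show ?thesis by simp
qed

lemma indep_unique:
  fixes F :: "nat \<Rightarrow> ('v, 'a::comm_ring_1) mpoly"
  assumes "indep_mod {0} n F" "(\<Sum>i<n. Const (c i) * F i) = (\<Sum>i<n. Const (d i) * F i)" "i < n"
  shows "c i = d i"
proof -
  have "(\<Sum>i<n. Const (c i - d i) * F i) = 0" using assms(2) by (simp add: Const_diff left_diff_distrib sum_subtractf)
  then have "c i - d i = 0"
    by (rule indep_modD[OF assms(1) _ assms(3)])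
  then show ?thesis by simp
qed

lemma linear_substitution:
  fixes F :: "nat \<Rightarrow> ('v, 'a::comm_ring_1) mpoly"
  assumes "\<And>i. i < n \<Longrightarrow> G i = (\<Sum>a<N. Const (M i a) * F a)"
  shows "(\<Sum>i<n. Const (c i) * G i) = (\<Sum>a<N. Const (\<Sum>i<n. c i * M i a) * F a)"
proof -
  have C: "Const (\<Sum>i<n. c i * M i a) = (\<Sum>i<n. Const (c i) * Const (M i a) :: ('v, 'a) mpoly)" for a
  proof -
    interpret comm_ring_hom "Const :: 'a \<Rightarrow> ('v, 'a) mpoly" by (rule comm_ring_hom_Const)
    show ?thesis by (simp add: hom_sum hom_mult)
  qed
  have "(\<Sum>i<n. Const (c i) * G i) = (\<Sum>i<n. \<Sum>a<N. Const (c i) * Const (M i a) * F a)"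
    by (intro sum.cong refl) (simp add: assms sum_distrib_left mult.assoc)
  then show ?thesis by (simp add: C sum_distrib_right sum.swap[of _ "{..<n}"])
qed

text \<open>Two minimal systems of generators by forms have the same degree, since each lies in the ideal of the other, and express
  each other with constant matrices that are mutually inverse.\<close>
lemma min_generators_base_change:
  fixes F :: "nat \<Rightarrow> ('v, 'a::field_char_0) mpoly"
  assumes F: "\<And>a. a < N \<Longrightarrow> is_form V e (F a)" and ind: "indep_mod {0} N F" and N: "N > 0"
    and gs: "min_form_generators V (genideal (mpoly_ring V) (F ` {..<N})) gs"
  obtains M where "length gs = N" "\<And>i. i < N \<Longrightarrow> is_form V e (gs ! i)" "indep_mod {0} N (\<lambda>i. gs ! i)"
    "\<And>a. a < N \<Longrightarrow> F a = (\<Sum>i<N. Const (M a i) * gs ! i)" "det (mat N N (\<lambda>(a, i). M a i)) \<noteq> 0"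
proof -
  let ?J = "genideal (mpoly_ring V) (F ` {..<N})" and ?n = "length gs"
  interpret R: ring "mpoly_ring V :: ('v, 'a) mpoly ring" by (rule ring_mpoly_ring)
  obtain d where d: "\<And>g. g \<in> set gs \<Longrightarrow> is_form V d g"
    and J: "genideal (mpoly_ring V) (set gs) = ?J"
    and min: "\<And>i. i < ?n \<Longrightarrow> genideal (mpoly_ring V) {gs ! j | j. j < ?n \<and> j \<noteq> i} \<noteq> ?J"
    using gs unfolding min_form_generators_def by blast
  have gV: "g \<in> polys V" if "g \<in> set gs" for g using d[OF that] is_form_polys by blast
  have FJ: "F a \<in> genideal (mpoly_ring V) ((\<lambda>i. gs ! i) ` {..<?n})" if "a < N" for a
  proof -
    have "F ` {..<N} \<subseteq> ?J" by (rule R.genideal_self) (use F is_form_polys in auto)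
    then show ?thesis using that by (auto simp: J nth_image_set[symmetric])
  qed
  have gJ: "gs ! i \<in> ?J" if "i < ?n" for i
  proof -
    have "set gs \<subseteq> genideal (mpoly_ring V) (set gs)" by (rule R.genideal_self) (use gV in auto)
    then show ?thesis using that J by auto
  qed
  have gd: "is_form V d (gs ! i)" if "i \<in> {..<?n}" for i using d that by simp
  have Fe: "is_form V e (F a)" if "a \<in> {..<N}" for a using F that by simp
  have indg: "indep_mod {0} ?n (\<lambda>i. gs ! i)"
    unfolding indep_mod_def
  proof (intro allI impI)
    fix c i assume c: "(\<Sum>i<?n. Const (c i) * gs ! i) \<in> {0}" and i: "i < ?n"
    show "c i = 0"
    proof (rule ccontr)
      assume "c i \<noteq> 0"
      then have "genideal (mpoly_ring V) {gs ! j | j. j < ?n \<and> j \<noteq> i} = ?J"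
        using genideal_others[OF gV i, of c] c J by simp
      then show False using min[OF i] by simp
    qed
  qed
  have "d \<le> e" by (rule forms_in_ideal_degree[OF _ gd F[OF N] FJ[OF N] indep_nonzero[OF ind N]]) simp_all
  moreover have "e \<le> d"
  proof -
    have "?n \<noteq> 0"
    proof
      assume "?n = 0"
      then have "set gs = {}" by simp
      then have "F 0 \<in> genideal (mpoly_ring V) {}" using FJ[OF N] by simp
      moreover have "genideal (mpoly_ring V) {} = {0 :: ('v, 'a) mpoly}"
        using genideal_image[of "{} :: nat set" "\<lambda>_. 0" V] by simp
      ultimately show False using indep_nonzero[OF ind N] by simp
    qed
    then have n: "0 < ?n" by simp
    show ?thesis by (rule forms_in_ideal_degree[OF _ Fe _ gJ[OF n] indep_nonzero[OF indg n]]) (use gd n in auto)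
  qed
  ultimately have de: "d = e" by simp
  have "\<exists>c. gs ! i = (\<Sum>a<N. Const (c a) * F a)" if "i < ?n" for i
    by (rule form_in_ideal_of_forms[OF _ Fe _ gJ[OF that]]) (use gd that de in auto)
  then obtain M' where M': "\<And>i. i < ?n \<Longrightarrow> gs ! i = (\<Sum>a<N. Const (M' i a) * F a)" by metis
  have "\<exists>c. F a = (\<Sum>i<?n. Const (c i) * gs ! i)" if "a < N" for a
    by (rule form_in_ideal_of_forms[OF _ gd _ FJ[OF that]]) (use F that de in auto)
  then obtain M where M: "\<And>a. a < N \<Longrightarrow> F a = (\<Sum>i<?n. Const (M a i) * gs ! i)" by metis
  have unit: "x = (\<Sum>i<k. Const (if j = i then 1 else 0) * Y i)" if "j < k" "x = Y j" for j k x and Y :: "nat \<Rightarrow> ('v, 'a) mpoly"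
  proof -
    have "(\<Sum>i<k. Const (if j = i then 1 else 0) * Y i) = (\<Sum>i<k. if i = j then Y j else 0)" by (intro sum.cong refl) auto
    then show ?thesis using that by simp
  qed
  have MM': "(\<Sum>i<?n. M a i * M' i b) = (if a = b then 1 else 0)" if "a < N" "b < N" for a b
  proof (rule indep_unique[OF ind _ that(2)])
    show "(\<Sum>b<N. Const (\<Sum>i<?n. M a i * M' i b) * F b) = (\<Sum>b<N. Const (if a = b then 1 else 0) * F b)"
      using linear_substitution[where c = "M a" and M = M' and F = F and N = N and n = ?n and G = "\<lambda>i. gs ! i", OF M'] M[OF that(1)] unit[OF that(1) refl, of F] by simp
  qed
  have M'M: "(\<Sum>a<N. M' i a * M a j) = (if i = j then 1 else 0)" if "i < ?n" "j < ?n" for i j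
  proof (rule indep_unique[OF indg _ that(2)])
    show "(\<Sum>j<?n. Const (\<Sum>a<N. M' i a * M a j) * gs ! j) = (\<Sum>j<?n. Const (if i = j then 1 else 0) * gs ! j)"
      using linear_substitution[where c = "M' i" and M = M and G = F and n = N and N = ?n and F = "\<lambda>i. gs ! i", OF M] M'[OF that(1)] unit[OF that(1) refl, of "\<lambda>i. gs ! i"] by simp
  qed
  have n: "?n = N" by (rule square_if_inverse[where n = ?n and N = N and M = M' and M' = M]) (use MM' M'M in auto)
  have "mat N N (\<lambda>(a, i). M a i) * mat N N (\<lambda>(i, a). M' i a) = 1\<^sub>m N"
    by (rule eq_matI) (use MM' n in \<open>auto simp: scalar_prod_def lessThan_atLeast0\<close>)
  then have "det (mat N N (\<lambda>(a, i). M a i)) * det (mat N N (\<lambda>(i, a). M' i a)) = 1"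
    by (subst det_mult[symmetric, of _ N]) auto
  then have "det (mat N N (\<lambda>(a, i). M a i)) \<noteq> 0" by auto
  then show thesis using that[of M] n gd M indg de by auto
qed

lemma sum_pick: 
  assumes "finite L"
  shows "(\<Sum>j<card L. f (pick L j)) = (\<Sum>j\<in>L. f j)"
proof (rule sum.reindex_bij_betw)
  have "inj_on (pick L) {..<card L}"
    by (rule linorder_inj_onI) (use pick_mono_le[of _ L] in force)+
  moreover have "pick L ` {..<card L} = L"
  proof (intro subset_antisym subsetI)
    fix i assume i: "i \<in> L"
    have "card {a\<in>L. a < i} < card L" using i assms by (intro psubset_card_mono) auto
    then show "i \<in> pick L ` {..<card L}" using pick_card_in_set[OF i] by (intro image_eqI[of _ _ "card {a\<in>L. a < i}"]) simp_all
  qed (auto intro: pick_in_set_le)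
  ultimately show "bij_betw (pick L) {..<card L} L" by (simp add: bij_betw_def)
qed

lemma to_fract_nonzero: "x \<noteq> 0 \<Longrightarrow> to_fract x \<noteq> 0"
proof
  assume x: "x \<noteq> 0" and "to_fract x = 0"
  then have "to_fract x = to_fract 0" by (simp only: to_fract_0)
  then show False using x by (simp only: to_fract_eq_iff)
qed

lemma scalar_prod_list: "h \<in> carrier_vec (length gs) \<Longrightarrow> h \<bullet> vec_of_list gs = (\<Sum>i<length gs. h $ i * gs ! i)"
  by (auto simp: scalar_prod_def lessThan_atLeast0 vec_of_list_index intro!: sum.cong)

lemma vec_set_subset_iff: "c \<in> carrier_vec n \<Longrightarrow> set\<^sub>v c \<subseteq> S \<longleftrightarrow> (\<forall>j<n. c $ j \<in> S)"
  unfolding vec_set_def by (auto simp: image_subset_iff)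

lemma presentationD:
  assumes "graded_presentation V gs \<phi>" and h: "h \<in> carrier_vec (length gs)" "\<And>i. i < length gs \<Longrightarrow> h $ i \<in> polys V"
  shows "(\<Sum>i<length gs. h $ i * gs ! i) = 0 \<longleftrightarrow>
    (\<exists>c\<in>carrier_vec (dim_col \<phi>). (\<forall>j<dim_col \<phi>. c $ j \<in> polys V) \<and> h = \<phi> *\<^sub>v c)"
proof -
  have "set\<^sub>v h \<subseteq> carrier (mpoly_ring V)" using h(2) by (simp add: vec_set_subset_iff[OF h(1)])
  then have "h \<bullet> vec_of_list gs = 0 \<longleftrightarrow> (\<exists>c\<in>carrier_vec (dim_col \<phi>). set\<^sub>v c \<subseteq> carrier (mpoly_ring V) \<and> h = \<phi> *\<^sub>v c)"
    using assms(1) h(1) unfolding graded_presentation_def by blast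
  moreover have "set\<^sub>v c \<subseteq> carrier (mpoly_ring V) \<longleftrightarrow> (\<forall>j<dim_col \<phi>. c $ j \<in> polys V)" if "c \<in> carrier_vec (dim_col \<phi>)" for c
    by (simp add: vec_set_subset_iff[OF that])
  ultimately show ?thesis unfolding scalar_prod_list[OF h(1)] by blast
qed

lemma mult_mat_vec_entry: "a < dim_row A \<Longrightarrow> c \<in> carrier_vec (dim_col A) \<Longrightarrow> (A *\<^sub>v c) $ a = (\<Sum>j<dim_col A. A $$ (a, j) * c $ j)"
  by (auto simp: scalar_prod_def lessThan_atLeast0 intro!: sum.cong)

text \<open>Upper bound: all columns are orthogonal to the generators. Lower bound: a linear syzygy is a combination of the columns of the
  presentation, and in degree one only the linear columns contribute, with constant coefficients; columns of degree zero vanish,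
  as the generators are independent. The matrix \<open>D\<close> collects sufficiently many linear syzygies; its column at \<open>a0\<close> is arbitrary and
  only serves to state their independence as the non-vanishing of a determinant.\<close>
theorem rank_linear_part:
  fixes gs :: "('v::linorder, 'a::field) mpoly list" and D :: "nat \<Rightarrow> nat \<Rightarrow> ('v, 'a) mpoly"
  assumes N: "length gs = N" "N > 0" and ind: "indep_mod {0} N (\<lambda>i. gs ! i)"
    and gp: "graded_presentation V gs \<phi>"
    and D: "det (mat N N (\<lambda>(a, b). D a b)) \<noteq> 0" "a0 < N"
      "\<And>a b. a < N \<Longrightarrow> b < N \<Longrightarrow> b \<noteq> a0 \<Longrightarrow> is_form V 1 (D a b)"
      "\<And>b. b < N \<Longrightarrow> b \<noteq> a0 \<Longrightarrow> (\<Sum>a<N. D a b * gs ! a) = 0"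
  shows "vec_space.rank (length gs) (map_mat to_fract (linear_part V \<phi>)) = N - 1"
proof -
  define q where "q = dim_col \<phi>"
  define L where "L = {c. c < q \<and> (\<forall>r<dim_row \<phi>. is_form V 1 (\<phi> $$ (r, c)))}"
  have finL: "finite L" and Lq: "\<And>c. c \<in> L \<Longrightarrow> c < q" by (auto simp: L_def)
  have row: "dim_row \<phi> = N" using gp N by (simp add: graded_presentation_def)
  define A where "A = linear_part V \<phi>"
  have A: "A \<in> carrier_mat N (card L)"
  proof -
    have "{c. c < q \<and> c \<in> L} = L" using Lq by auto
    then show ?thesis unfolding A_def linear_part_def q_def[symmetric] L_def[symmetric] carrier_mat_def
      using row by (simp add: dim_submatrix q_def)
  qed
  have Aent: "A $$ (a, j) = \<phi> $$ (a, pick L j)" if "a < N" "j < card L" for a j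
  proof -
    have "{c. c < q \<and> c \<in> L} = L" using Lq by auto
    then show ?thesis unfolding A_def linear_part_def q_def[symmetric] L_def[symmetric]
      using that row by (subst submatrix_index) (simp_all add: q_def pick_UNIV)
  qed
  have hom: "\<exists>e. \<forall>r<N. is_form V e (\<phi> $$ (r, c))" if "c < q" for c
  proof -
    have "\<exists>e. \<forall>r<dim_row \<phi>. is_form V e (\<phi> $$ (r, c))"
      using gp that unfolding graded_presentation_def q_def by blast
    then show ?thesis by (simp only: row)
  qed
  have poly: "\<phi> $$ (r, c) \<in> polys V" if "r < N" "c < q" for r c
    using hom[OF that(2)] that(1) is_form_polys by blast
  have col: "(\<Sum>a<N. \<phi> $$ (a, c) * gs ! a) = 0" if c: "c < q" for c
  proof -
    let ?h = "vec N (\<lambda>a. \<phi> $$ (a, c))" and ?u = "unit_vec q c :: ('v, 'a) mpoly vec"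
    have "?h = \<phi> *\<^sub>v ?u"
    proof (rule eq_vecI)
      fix a assume "a < dim_vec (\<phi> *\<^sub>v ?u)"
      then have a: "a < N" using row by simp
      have "(\<phi> *\<^sub>v ?u) $ a = (\<Sum>j<q. \<phi> $$ (a, j) * ?u $ j)"
        using mult_mat_vec_entry[of a \<phi> ?u] a row by (simp add: q_def)
      also have "\<dots> = (\<Sum>j<q. if j = c then \<phi> $$ (a, c) else 0)" by (intro sum.cong refl) (use c in \<open>auto simp: unit_vec_def\<close>)
      finally show "?h $ a = (\<phi> *\<^sub>v ?u) $ a" using a c by simp
    qed (simp add: row)
    moreover have "?u \<in> carrier_vec (dim_col \<phi>)" "\<forall>j<dim_col \<phi>. ?u $ j \<in> polys V" by (auto simp: q_def unit_vec_def)
    ultimately have ex: "\<exists>c\<in>carrier_vec (dim_col \<phi>). (\<forall>j<dim_col \<phi>. c $ j \<in> polys V) \<and> ?h = \<phi> *\<^sub>v c" by blast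
    have "(\<Sum>i<length gs. ?h $ i * gs ! i) = 0"
      by (rule iffD2[OF presentationD[OF gp] ex]) (simp_all add: N poly[OF _ c])
    then show ?thesis by (simp add: N)
  qed
  have notL: "hom_part 1 (\<phi> $$ (a, j) * p) = 0" if j: "j < q" "j \<notin> L" and a: "a < N" for a j p
  proof -
    obtain e where e: "\<And>r. r < N \<Longrightarrow> is_form V e (\<phi> $$ (r, j))" using hom[OF j(1)] by blast
    have "e \<noteq> 1" using e j row by (auto simp: L_def)
    moreover have "e \<noteq> 0"
    proof
      assume "e = 0"
      then have k: "\<phi> $$ (r, j) = Const (lkp (\<phi> $$ (r, j)) 0)" if "r < N" for r using form_0_Const e that by blast
      then have "(\<Sum>r<N. Const (lkp (\<phi> $$ (r, j)) 0) * gs ! r) = 0" using col[OF j(1)] by simp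
      then have "lkp (\<phi> $$ (r, j)) 0 = 0" if "r < N" for r
        by (rule indep_modD[OF ind _ that])
      then have "\<phi> $$ (r, j) = 0" if "r < N" for r using k that by simp
      then have "j \<in> L" using j(1) row by (simp add: L_def)
      then show False using j by simp
    qed
    ultimately show ?thesis by (simp add: hom_part_form_mult[OF e[OF a]])
  qed
  interpret F: comm_ring_hom "to_fract :: ('v, 'a) mpoly \<Rightarrow> _" by unfold_locales (auto simp: to_fract_add to_fract_mult)
  let ?A = "map_mat to_fract A" and ?P = "map_mat to_fract (mat N N (\<lambda>(a, b). D a b))"
  have "vec_space.rank N ?A = N - 1"
  proof (rule vec_space.rank_one_less[where nc = "card L" and g = "\<lambda>r. to_fract (gs ! r)" and ?r0.0 = 0 and P = ?P and a = a0])
    show "?A \<in> carrier_mat N (card L)" using A by simp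
    show "(\<Sum>r<N. to_fract (gs ! r) * ?A $$ (r, c)) = 0" if c: "c < card L" for c
    proof -
      have "(\<Sum>r<N. to_fract (gs ! r) * ?A $$ (r, c)) = to_fract (\<Sum>r<N. \<phi> $$ (r, pick L c) * gs ! r)"
        unfolding F.hom_sum using A c by (intro sum.cong refl) (simp add: Aent F.hom_mult mult.commute)
      then show ?thesis using col[OF Lq[OF pick_in_set_le[OF c]]] by simp
    qed
    show "to_fract (gs ! 0) \<noteq> 0" by (rule to_fract_nonzero[OF indep_nonzero[OF ind N(2)]])
    show "0 < N" by (rule N(2))
    show "?P \<in> carrier_mat N N" by simp
    show "det ?P \<noteq> 0" unfolding F.hom_det by (rule to_fract_nonzero[OF D(1)])
    show "a0 < N" by (rule D(2))
    fix b assume b: "b < N" "b \<noteq> a0"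
    let ?h = "vec N (\<lambda>a. D a b)"
    have "(\<Sum>i<length gs. ?h $ i * gs ! i) = 0" using D(4)[OF b] N by simp
    then obtain c where c: "c \<in> carrier_vec q" "?h = \<phi> *\<^sub>v c"
      using presentationD[OF gp, of ?h] D(3)[OF _ b] is_form_polys N by (force simp: q_def)
    define c' where "c' = vec (card L) (\<lambda>j. to_fract (Const (lkp (c $ pick L j) 0)) :: ('v, 'a) mpoly fract)"
    have "col ?P b = ?A *\<^sub>v c'"
    proof (rule eq_vecI)
      fix a assume "a < dim_vec (?A *\<^sub>v c')"
      then have a: "a < N" using A by simp
      have "D a b = (\<phi> *\<^sub>v c) $ a" using a by (simp flip: c(2))
      also have "\<dots> = (\<Sum>j<q. \<phi> $$ (a, j) * c $ j)"
        using mult_mat_vec_entry[of a \<phi> c] a row c(1) by (simp add: q_def)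
      finally have Dab: "D a b = (\<Sum>j<q. \<phi> $$ (a, j) * c $ j)" .
      have "D a b = hom_part 1 (D a b)" using hom_part_form[OF D(3)[OF a b], of 1] by simp
      also have "\<dots> = (\<Sum>j<q. if j \<in> L then \<phi> $$ (a, j) * Const (lkp (c $ j) 0) else 0)"
        unfolding Dab hom_part_sum
      proof (intro sum.cong refl)
        fix j assume "j \<in> {..<q}"
        then have j: "j < q" by simp
        show "hom_part 1 (\<phi> $$ (a, j) * c $ j) = (if j \<in> L then \<phi> $$ (a, j) * Const (lkp (c $ j) 0) else 0)"
        proof (cases "j \<in> L")
          case True
          then have "is_form V 1 (\<phi> $$ (a, j))" using a row by (simp add: L_def)
          then show ?thesis using True by (simp only: hom_part_form_mult hom_part_0_Const[symmetric] if_True diff_self_eq_0 order_refl)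
        qed (use notL[OF j _ a] in simp)
      qed
      also have "\<dots> = (\<Sum>j\<in>L. \<phi> $$ (a, j) * Const (lkp (c $ j) 0))"
        by (rule sum.mono_neutral_cong_right) (use Lq in auto)
      also have "\<dots> = (\<Sum>j<card L. A $$ (a, j) * Const (lkp (c $ pick L j) 0))"
        unfolding sum_pick[OF finL, symmetric] using Aent[OF a] by (intro sum.cong refl) simp
      finally have "to_fract (D a b) = (\<Sum>j<card L. to_fract (A $$ (a, j)) * to_fract (Const (lkp (c $ pick L j) 0)))"
        by (simp add: F.hom_sum F.hom_mult)
      also have "\<dots> = (?A *\<^sub>v c') $ a"
        using mult_mat_vec_entry[of a ?A c'] a A by (simp add: c'_def)
      finally show "col ?P b $ a = (?A *\<^sub>v c') $ a" using a b by simp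
    qed (use A in simp)
    then show "\<exists>c\<in>carrier_vec (card L). col ?P b = ?A *\<^sub>v c" by (intro bexI[of _ c']) (auto simp: c'_def)
  qed
  then show ?thesis by (simp add: A_def N)
qed

text \<open>The columns are the homogeneous generators of the module of syzygies.\<close>
lemma exists_graded_presentation:
  fixes gs :: "('v::linorder, 'a::field) mpoly list"
  assumes V: "finite V" and gs: "\<And>g. g \<in> set gs \<Longrightarrow> is_form V e g"
  shows "\<exists>\<phi>. graded_presentation V gs \<phi>"
proof -
  let ?N = "length gs"
  have F: "is_form V e (gs ! i)" if "i < ?N" for i using gs that by simp
  show ?thesis
  proof (rule finite_generators[OF V, where N = ?N and e = e and F = "\<lambda>i. gs ! i", OF F])
  fix A :: "(nat \<times> ('v \<Rightarrow>\<^sub>0 nat)) set" and H \<delta>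
  assume A: "finite A"
    and H: "\<And>a. a \<in> A \<Longrightarrow> form_syzygy V (\<lambda>i. gs ! i) ?N (\<delta> a) (H a)"
    and gen: "\<And>h. (\<And>i. i < ?N \<Longrightarrow> h i \<in> polys V) \<Longrightarrow> (\<Sum>i<?N. h i * gs ! i) = 0 \<Longrightarrow> combination V ?N A H h"
  obtain as where as: "set as = A" "distinct as" using finite_distinct_list[OF A] by blast
  define \<phi> where "\<phi> = mat ?N (length as) (\<lambda>(i, c). H (as ! c) i)"
  have asum: "(\<Sum>c<length as. f (as ! c)) = (\<Sum>a\<in>A. f a)" for f :: "_ \<Rightarrow> ('v, 'a) mpoly"
    using sum.reindex_bij_betw[OF bij_betw_nth[OF as(2) refl refl], of f] as(1) by simp
  have entry: "(\<phi> *\<^sub>v c) $ i = (\<Sum>j<length as. H (as ! j) i * c $ j)" if "i < ?N" "c \<in> carrier_vec (length as)" for i c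
    using mult_mat_vec_entry[of i \<phi> c] that by (simp add: \<phi>_def)
  have "graded_presentation V gs \<phi>"
    unfolding graded_presentation_def
  proof (intro conjI allI impI ballI)
    show "dim_row \<phi> = length gs" by (simp add: \<phi>_def)
    fix c assume c: "c < dim_col \<phi>"
    then have "as ! c \<in> A" using as(1) by (auto simp: \<phi>_def)
    then show "\<exists>e. \<forall>r<dim_row \<phi>. is_form V e (\<phi> $$ (r, c))"
      using H[of "as ! c"] c by (intro exI[of _ "\<delta> (as ! c)"]) (auto simp: \<phi>_def form_syzygy_def)
  next
    fix h :: "('v, 'a) mpoly vec" assume h: "h \<in> carrier_vec (length gs)" "set\<^sub>v h \<subseteq> carrier (mpoly_ring V)"
    have hV: "h $ i \<in> polys V" if "i < ?N" for i using h(2) that by (simp add: vec_set_subset_iff[OF h(1)])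
    show "(h \<bullet> vec_of_list gs = 0) = (\<exists>c\<in>carrier_vec (dim_col \<phi>). set\<^sub>v c \<subseteq> carrier (mpoly_ring V) \<and> h = \<phi> *\<^sub>v c)"
    proof
      assume "h \<bullet> vec_of_list gs = 0"
      then have "combination V ?N A H (\<lambda>i. h $ i)" using gen[of "\<lambda>i. h $ i"] hV scalar_prod_list[OF h(1)] by simp
      then obtain r where r: "\<And>a. a \<in> A \<Longrightarrow> r a \<in> polys V" "\<And>i. i < ?N \<Longrightarrow> h $ i = (\<Sum>a\<in>A. r a * H a i)"
        unfolding combination_def by blast
      define c where "c = vec (length as) (\<lambda>j. r (as ! j))"
      have "h = \<phi> *\<^sub>v c"
      proof (rule eq_vecI)
        fix i assume "i < dim_vec (\<phi> *\<^sub>v c)"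
        then have i: "i < ?N" by (simp add: \<phi>_def)
        have "(\<phi> *\<^sub>v c) $ i = (\<Sum>j<length as. r (as ! j) * H (as ! j) i)"
          using entry[OF i, of c] by (simp add: c_def mult.commute)
        also have "\<dots> = h $ i" unfolding r(2)[OF i] by (rule asum)
        finally show "h $ i = (\<phi> *\<^sub>v c) $ i" by simp
      qed (use h in \<open>simp add: \<phi>_def\<close>)
      moreover have "set\<^sub>v c \<subseteq> carrier (mpoly_ring V)" 
      proof (subst vec_set_subset_iff[of c "length as"])
        show "c \<in> carrier_vec (length as)" by (simp add: c_def)
        show "\<forall>j<length as. c $ j \<in> carrier (mpoly_ring V)" using as(1) by (auto simp: c_def intro!: r)
      qed
      ultimately show "\<exists>c\<in>carrier_vec (dim_col \<phi>). set\<^sub>v c \<subseteq> carrier (mpoly_ring V) \<and> h = \<phi> *\<^sub>v c"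
        by (intro bexI[of _ c]) (auto simp: c_def \<phi>_def)
    next
      assume "\<exists>c\<in>carrier_vec (dim_col \<phi>). set\<^sub>v c \<subseteq> carrier (mpoly_ring V) \<and> h = \<phi> *\<^sub>v c"
      then obtain c where c: "c \<in> carrier_vec (length as)" "h = \<phi> *\<^sub>v c" by (auto simp: \<phi>_def)
      have z: "(\<Sum>i<?N. H (as ! j) i * gs ! i) = 0" if "j < length as" for j
        using H[of "as ! j"] as(1) that by (auto simp: form_syzygy_def)
      have "h \<bullet> vec_of_list gs = (\<Sum>i<?N. \<Sum>j<length as. c $ j * (H (as ! j) i * gs ! i))"
        unfolding scalar_prod_list[OF h(1)]
        by (intro sum.cong refl) (simp add: c(2) entry[OF _ c(1)] sum_distrib_right sum_distrib_left mult_ac)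
      also have "\<dots> = (\<Sum>j<length as. c $ j * (\<Sum>i<?N. H (as ! j) i * gs ! i))"
        by (subst sum.swap) (simp add: sum_distrib_left)
      also have "\<dots> = 0" by (intro sum.neutral ballI) (simp add: z)
      finally show "h \<bullet> vec_of_list gs = 0" .
    qed
  qed
  then show ?thesis by blast
  qed
qed

section \<open>Linear syzygies from infinitesimal symmetries\<close>

context degenerate_symmetric begin

text \<open>Matrices \<open>L\<close> of trace zero such that \<open>X\<close> moving by \<open>L X + X L\<^sup>T\<close> stays in the family, one for each variable: \<open>E\<^sub>a\<^sub>b\<close> for
  \<open>a < b\<close>, its symmetrization in the last block, \<open>E\<^sub>a\<^sub>a - E\<^sub>0\<^sub>0\<close>, and \<open>E\<^sub>a\<^sub>a + E\<^sub>b\<^sub>b - 2 E\<^sub>0\<^sub>0\<close> for the last two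
  diagonal positions together. The variable at \<open>(0, 0)\<close> is assigned the zero matrix.\<close>
definition lie :: "nat \<times> nat \<Rightarrow> nat \<Rightarrow> nat \<Rightarrow> 'a" where
  "lie v i k = (let a = fst v - 1; b = snd v - 1 in
     if a \<noteq> b then (if i = a \<and> k = b \<or> a = m - 2 \<and> i = b \<and> k = a then 1 else 0)
     else if i = k then (if i = a \<or> a = m - 2 \<and> i = m - 1 then 1 else 0)
       - (if i = 0 then if a = m - 2 then 2 else 1 else 0) else 0)"

text \<open>The entries of \<open>L X\<close>.\<close>
definition LX :: "nat \<times> nat \<Rightarrow> nat \<Rightarrow> nat \<Rightarrow> (nat \<times> nat, 'a) mpoly" where
  "LX v i j = (\<Sum>k<m. Const (lie v i k) * Var (vx m k j))"

definition syz :: "nat \<times> nat \<Rightarrow> nat \<times> nat \<Rightarrow> (nat \<times> nat, 'a) mpoly" where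
  "syz v w = LX v (fst w - 1) (snd w - 1) + LX v (snd w - 1) (fst w - 1)"

lemma V_pair:
  assumes "v \<in> V"
  obtains a b where "a \<le> b" "b < m" "a < m - 1" "v = vx m a b" "v = (a + 1, b + 1)"
proof -
  obtain i j where "i \<le> j \<and> j < m \<and> i + 1 < m \<and> v = vx m i j \<and> v = (i + 1, j + 1)"
    using SC_vars_vx[OF assms] by (elim exE)
  then show thesis by (intro that[of i j]) auto
qed

lemma LX_delta:
  assumes "\<And>k. k < m \<Longrightarrow> lie v i k = (if k = l then c else 0)" "l < m"
  shows "LX v i j = Const c * Var (vx m l j)"
proof -
  have "LX v i j = (\<Sum>k<m. if k = l then Const c * Var (vx m l j) else 0)"
    unfolding LX_def by (intro sum.cong refl) (simp add: assms(1))
  then show ?thesis using assms(2) by simp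
qed

lemma LX_zero: "(\<And>k. k < m \<Longrightarrow> lie v i k = 0) \<Longrightarrow> LX v i j = 0"
  unfolding LX_def by (intro sum.neutral ballI) simp

text \<open>This is the condition that the motion stays in the family.\<close>
lemma LX_corner:
  assumes v: "v \<in> V"
  shows "LX v (m - 1) (m - 1) = LX v (m - 2) (m - 2)"
proof -
  obtain a b where ab: "a \<le> b" "b < m" "a < m - 1" "v = (a + 1, b + 1)" using V_pair[OF v] by metis
  have fs: "fst v - 1 = a" "snd v - 1 = b" using ab by simp_all
  have l: "lie v i k = (if a \<noteq> b then (if i = a \<and> k = b \<or> a = m - 2 \<and> i = b \<and> k = a then 1 else 0)
     else if i = k then (if i = a \<or> a = m - 2 \<and> i = m - 1 then 1 else 0)
       - (if i = 0 then if a = m - 2 then 2 else 1 else 0) else 0)" for i k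
    unfolding lie_def fs Let_def ..
  define p where "p = m - 2"
  have m: "m = p + 2" "p \<ge> 1" using m3 by (simp_all add: p_def)
  have m1: "m - 1 = p + 1" "m - 2 = p" using m by simp_all
  have c: "vx m (p + 1) (p + 1) = vx m p p" using vx_corner unfolding m1 .
  note l' = l[unfolded m1]
  have lt: "p < m" "p + 1 < m" using m by simp_all
  show ?thesis
  proof (cases "a = p")
    case False
    then have ap: "a < p" using ab m1 by simp
    have "LX v (p + 1) (p + 1) = 0" by (rule LX_zero) (use ap m(2) in \<open>auto simp: l'\<close>)
    moreover have "LX v p p = 0" by (rule LX_zero) (use ap m(2) in \<open>auto simp: l'\<close>)
    ultimately show ?thesis unfolding m1 by simp
  next
    case ap: True
    show ?thesis
    proof (cases "a = b")
      case True
      have "LX v (p + 1) (p + 1) = Const 1 * Var (vx m (p + 1) (p + 1))"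
        by (rule LX_delta) (use ap True m(2) lt in \<open>auto simp: l'\<close>)
      moreover have "LX v p p = Const 1 * Var (vx m p p)"
        by (rule LX_delta) (use ap True m(2) lt in \<open>auto simp: l'\<close>)
      ultimately show ?thesis unfolding m1 c by simp
    next
      case False
      then have b: "b = p + 1" using ab ap m by simp
      have "LX v (p + 1) (p + 1) = Const 1 * Var (vx m p (p + 1))"
        by (rule LX_delta) (use ap b m(2) lt in \<open>auto simp: l'\<close>)
      moreover have "LX v p p = Const 1 * Var (vx m (p + 1) p)"
        by (rule LX_delta) (use ap b m(2) lt in \<open>auto simp: l'\<close>)
      ultimately show ?thesis unfolding m1 by (simp only: vx_commute[of m "p + 1" p])
    qed
  qed
qed

lemma syz_vx:
  assumes v: "v \<in> V" and ij: "i < m" "j < m"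
  shows "syz v (vx m i j) = LX v i j + LX v j i"
proof (cases "i = m - 1 \<and> j = m - 1")
  case True
  have "vx m (m - 1) (m - 1) = (m - 1, m - 1)" using m3 by (simp add: vx_def)
  moreover have "m - 1 - 1 = m - 2" by simp
  ultimately show ?thesis using True LX_corner[OF v] by (simp only: syz_def fst_conv snd_conv)
next
  case False
  then have "vx m i j = (min i j + 1, max i j + 1)" using ij by (auto simp: vx_def min_def max_def)
  then have "syz v (vx m i j) = LX v (min i j) (max i j) + LX v (max i j) (min i j)"
    by (simp only: syz_def fst_conv snd_conv add_diff_cancel_right')
  then show ?thesis by (cases "i \<le> j") (simp_all add: add.commute min_def max_def)
qed

lemma trace_lie:
  assumes v: "v \<in> V" shows "(\<Sum>i<m. lie v i i) = 0"
proof -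
  obtain a b where ab: "a \<le> b" "b < m" "a < m - 1" "v = (a + 1, b + 1)" using V_pair[OF v] by metis
  have fs: "fst v - 1 = a" "snd v - 1 = b" using ab by simp_all
  show ?thesis
  proof (cases "a = b")
    case False
    then show ?thesis unfolding lie_def fs Let_def by (intro sum.neutral ballI) auto
  next
    case True
    let ?c = "if a = m - 2 then 2 else 1 :: 'a"
    have "(\<Sum>i<m. lie v i i) = (\<Sum>i<m. (if i = a then 1 else 0) + (if i = m - 1 then if a = m - 2 then 1 else 0 else 0) - (if i = 0 then ?c else 0))"
      unfolding lie_def fs Let_def using True ab(3) by (intro sum.cong refl) auto
    also have "\<dots> = 0" using ab m3 by (simp add: sum.distrib sum_subtractf)
    finally show ?thesis .
  qed
qed

text \<open>Along \<open>L X + (L X)\<^sup>T\<close> the determinant changes by \<open>2 tr L det X\<close>, because the cofactors satisfy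
  \<open>X C = f I\<close>; and \<open>tr L = 0\<close>.\<close>
lemma syz_syzygy:
  assumes v: "v \<in> V" shows "(\<Sum>w\<in>V. syz v w * partial w f) = 0"
proof -
  have "(\<Sum>w\<in>V. syz v w * partial w f) = (\<Sum>w\<in>V. \<Sum>i<m. \<Sum>j<m. (if vx m i j = w then syz v w * C i j else 0))"
    by (intro sum.cong refl) (simp add: partial_f sum_distrib_left if_distrib[of "\<lambda>x. _ * x"] cong: if_cong)
  also have "\<dots> = (\<Sum>i<m. \<Sum>w\<in>V. \<Sum>j<m. (if vx m i j = w then syz v w * C i j else 0))" by (rule sum.swap)
  also have "\<dots> = (\<Sum>i<m. \<Sum>j<m. \<Sum>w\<in>V. (if vx m i j = w then syz v w * C i j else 0))"
    by (intro sum.cong refl sum.swap)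
  also have "\<dots> = (\<Sum>i<m. \<Sum>j<m. LX v i j * C i j + LX v j i * C j i)"
  proof (intro sum.cong refl)
    fix i j assume "i \<in> {..<m}" "j \<in> {..<m}"
    then have ij: "i < m" "j < m" by simp_all
    have "vx m i j \<in> V" using m3 ij by (intro vx_in_SC_vars) auto
    moreover have "finite V" by simp
    ultimately have "(\<Sum>w\<in>V. (if vx m i j = w then syz v w * C i j else 0)) = syz v (vx m i j) * C i j" by simp
    then show "(\<Sum>w\<in>V. (if vx m i j = w then syz v w * C i j else 0)) = LX v i j * C i j + LX v j i * C j i"
      by (simp only: syz_vx[OF v ij] distrib_right C_sym[OF ij])
  qed
  also have "\<dots> = (\<Sum>i<m. \<Sum>j<m. LX v i j * C i j) + (\<Sum>i<m. \<Sum>j<m. LX v j i * C j i)" by (simp only: sum.distrib)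
  also have "(\<Sum>i<m. \<Sum>j<m. LX v j i * C j i) = (\<Sum>i<m. \<Sum>j<m. LX v i j * C i j)" by (rule sum.swap)
  also have "(\<Sum>i<m. \<Sum>j<m. LX v i j * C i j) = 0"
  proof -
    have "(\<Sum>j<m. LX v i j * C i j) = Const (lie v i i) * f" if i: "i < m" for i
    proof -
      have "(\<Sum>j<m. LX v i j * C i j) = (\<Sum>j<m. \<Sum>k<m. Const (lie v i k) * (Var (vx m k j) * C i j))"
        by (simp only: LX_def sum_distrib_right mult.assoc)
      also have "\<dots> = (\<Sum>k<m. Const (lie v i k) * (\<Sum>j<m. Var (vx m k j) * C i j))"
        by (subst sum.swap) (simp only: sum_distrib_left)
      also have "\<dots> = (\<Sum>k<m. if k = i then Const (lie v i i) * f else 0)"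
        by (intro sum.cong refl) (auto simp: XC i)
      finally show ?thesis using i by simp
    qed
    then have "(\<Sum>i<m. \<Sum>j<m. LX v i j * C i j) = (\<Sum>i<m. Const (lie v i i) * f)" by (intro sum.cong refl) simp
    also have "\<dots> = Const (\<Sum>i<m. lie v i i) * f"
    proof -
        interpret c: comm_ring_hom "Const :: 'a \<Rightarrow> (nat \<times> nat, 'a) mpoly" by (rule comm_ring_hom_Const)
      show ?thesis by (simp only: c.hom_sum sum_distrib_right)
    qed
    finally show ?thesis by (simp add: trace_lie[OF v])
  qed
  finally show ?thesis by simp
qed

lemma syz_form:
  assumes w: "w \<in> V" shows "is_form V 1 (syz v w)"
proof -
  obtain i j where ij: "i \<le> j" "j < m" "w = (i + 1, j + 1)" using V_pair[OF w] by metis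
  have "is_form V 1 (LX v k l)" if "l < m" for k l
    unfolding LX_def
  proof (rule is_form_sum)
    fix n assume "n \<in> {..<m}"
    then have "vx m n l \<in> V" using that m3 by (intro vx_in_SC_vars) auto
    then show "is_form V 1 (Const (lie v k n) * Var (vx m n l))" by (intro is_form_Const_mult is_form_Var)
  qed
  then show ?thesis unfolding syz_def using ij by (intro is_form_add) auto
qed

text \<open>At the identity matrix the motion is \<open>L + L\<^sup>T\<close>, which is a multiple of the coordinate direction of \<open>v\<close> plus a multiple of
  the first diagonal one.\<close>
lemma at1_syz:
  assumes v: "v \<in> V" "v \<noteq> (1, 1)"
  obtains c d where "c \<noteq> 0" "\<And>w. w \<in> V \<Longrightarrow> at1 (syz v w) = (if w = v then c else 0) + (if w = (1, 1) then d else 0)"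
proof -
  interpret at1: comm_ring_hom at1 by (rule comm_ring_hom_ins[OF comm_ring_hom_id])
  obtain a b where ab: "a \<le> b" "b < m" "a < m - 1" "v = (a + 1, b + 1)" using V_pair[OF v(1)] by metis
  have fs: "fst v - 1 = a" "snd v - 1 = b" using ab by simp_all
  have LX1: "at1 (LX v i j) = lie v i j" if ij: "i < m" "j < m" for i j
  proof -
    have "at1 (LX v i j) = (\<Sum>k<m. if k = j then lie v i j else 0)"
      unfolding LX_def at1.hom_sum at1.hom_mult
      by (intro sum.cong refl) (use ij in \<open>auto simp: ins_Const[OF comm_ring_hom_id] at1_X\<close>)
    then show ?thesis using ij by simp
  qed
  have S: "at1 (syz v w) = lie v p q + lie v q p" if "w = (p + 1, q + 1)" "p < m" "q < m" for w p q
    unfolding syz_def at1.hom_add that(1) using LX1[OF that(2,3)] LX1[OF that(3,2)] by simp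
  define c :: 'a where "c = (if a \<noteq> b \<and> a < m - 2 then 1 else 2)"
  define d :: 'a where "d = (if a \<noteq> b then 0 else if a = m - 2 then - 4 else - 2)"
  show thesis
  proof (rule that)
    show "c \<noteq> 0" by (simp add: c_def)
    fix w assume w: "w \<in> V"
    obtain p q where pq: "p \<le> q" "q < m" "p < m - 1" "w = (p + 1, q + 1)" using V_pair[OF w] by metis
    have wv: "w = v \<longleftrightarrow> p = a \<and> q = b" "w = (1, 1) \<longleftrightarrow> p = 0 \<and> q = 0" using pq ab by simp_all
    have e: "at1 (syz v w) = lie v p q + lie v q p" by (rule S[OF pq(4)]) (use pq in auto)
    have b: "a = m - 2 \<Longrightarrow> a \<noteq> b \<Longrightarrow> b = m - 1" "a \<noteq> m - 2 \<Longrightarrow> a < m - 2" using ab by auto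
    show "at1 (syz v w) = (if w = v then c else 0) + (if w = (1, 1) then d else 0)"
    proof (cases "a = b")
      case False
      then have "a < b" using ab by simp
      then show ?thesis unfolding e wv lie_def fs Let_def c_def d_def using False pq ab b by auto
    next
      case True
      then have "a \<noteq> 0" using v(2) ab by auto
      show ?thesis
      proof (cases "p = q")
        case False
        then show ?thesis unfolding e wv lie_def fs Let_def using True by auto
      next
        case pqe: True
        have "p \<noteq> m - 1" using pq by simp
        then show ?thesis unfolding e wv lie_def fs Let_def c_def d_def using True pqe \<open>a \<noteq> 0\<close> by auto
      qed
    qed
  qed
qed

definition vs :: "(nat \<times> nat) list" where "vs = sorted_list_of_set V"

definition N :: nat where "N = length vs"

lemma vs: "set vs = V" "distinct vs" by (simp_all add: vs_def)

lemma N_card: "N = card V" unfolding N_def using distinct_card[OF vs(2)] vs(1) by simp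

lemma bij_vs: "bij_betw (\<lambda>a. vs ! a) {..<N} V"
  using bij_betw_nth[OF vs(2) refl vs(1)[symmetric]] by (simp add: N_def)

lemma vs_V: "a < N \<Longrightarrow> vs ! a \<in> V"
  unfolding N_def using nth_mem[of a vs] vs(1) by simp

definition grad :: "nat \<Rightarrow> (nat \<times> nat, 'a) mpoly" where "grad a = partial (vs ! a) f"

text \<open>A linear relation between the partial derivatives would, after differentiation, be one between the columns of the Hessian matrix.\<close>
lemma indep_grad: "indep_mod {0} N grad"
  unfolding indep_mod_def
proof (intro allI impI)
  fix c :: "nat \<Rightarrow> 'a" and i assume c: "(\<Sum>i<N. Const (c i) * grad i) \<in> {0}" and i: "i < N"
  define H where "H = mat N N (\<lambda>(a, b). partial (vs ! a) (partial (vs ! b) f))"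
  have H: "H \<in> carrier_mat N N" by (simp add: H_def)
  have dH: "det H \<noteq> 0" using hessian_nonzero unfolding hessian_det_def Let_def vs_def[symmetric] N_def[symmetric] H_def .
  define x where "x = vec N (\<lambda>b. Const (c b) :: (nat \<times> nat, 'a) mpoly)"
  have "H *\<^sub>v x = 0\<^sub>v N"
  proof (rule eq_vecI)
    fix a assume "a < dim_vec (0\<^sub>v N :: (nat \<times> nat, 'a) mpoly vec)"
    then have a: "a < N" by simp
    have "(H *\<^sub>v x) $ a = (\<Sum>b<N. partial (vs ! a) (Const (c b) * grad b))"
      using mult_mat_vec_entry[of a H x] a by (simp add: H_def x_def partial_mult grad_def mult.commute)
    also have "\<dots> = partial (vs ! a) (\<Sum>b<N. Const (c b) * grad b)" by (simp add: partial_sum)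
    also have "\<dots> = 0" using c by simp
    finally show "(H *\<^sub>v x) $ a = 0\<^sub>v N $ a" using a by simp
  qed (simp add: H_def)
  moreover have "x \<in> carrier_vec N" by (simp add: x_def)
  ultimately have "x = 0\<^sub>v N" using det_0_iff_vec_prod_zero[OF H] dH by blast
  then have "x $ i = 0" using i by simp
  then show "c i = 0" using i by (simp add: x_def)
qed

lemma grad_form: "is_form V (m - 1) (grad a)"
  unfolding grad_def by (rule partial_form)

lemma J_grad: "J = genideal R (grad ` {..<N})"
proof -
  have "grad ` {..<N} = (\<lambda>v. partial v f) ` ((\<lambda>a. vs ! a) ` {..<N})" by (simp add: grad_def image_image)
  also have "\<dots> = (\<lambda>v. partial v f) ` V" by (simp only: bij_betw_imp_surj_on[OF bij_vs])
  finally show ?thesis by (simp only: J_def gradient_ideal_def)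
qed

lemma T11: "(1, 1) \<in> V" using m3 by (simp add: SC_vars_def)

lemma index_11:
  obtains a0 where "a0 < N" "vs ! a0 = (1, 1)"
proof -
  have "(1, 1) \<in> (\<lambda>a. vs ! a) ` {..<N}" unfolding bij_betw_imp_surj_on[OF bij_vs] by (rule T11)
  then obtain a where "(1, 1) = vs ! a" "a \<in> {..<N}" by (elim imageE)
  then show thesis by (intro that[of a]) simp_all
qed

text \<open>The linear syzygies as columns; the column of the first variable, which has no syzygy, is replaced by a unit vector.\<close>
definition D :: "nat \<Rightarrow> nat \<Rightarrow> (nat \<times> nat, 'a) mpoly" where
  "D a b = (if vs ! b = (1, 1) then if vs ! a = (1, 1) then 1 else 0 else syz (vs ! b) (vs ! a))"

text \<open>At the identity matrix the columns are triangular with nonzero diagonal.\<close>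
lemma det_D: "det (mat N N (\<lambda>(a, b). D a b)) \<noteq> 0"
proof
  interpret at1: comm_ring_hom at1 by (rule comm_ring_hom_ins[OF comm_ring_hom_id])
  let ?B = "map_mat at1 (mat N N (\<lambda>(a, b). D a b))"
  have B: "?B \<in> carrier_mat N N" by simp
  assume "det (mat N N (\<lambda>(a, b). D a b)) = 0"
  then have "det ?B = 0" unfolding at1.hom_det by simp
  then have "det (transpose_mat ?B) = 0" using det_transpose[OF B] by simp
  then obtain w where w: "w \<in> carrier_vec N" "w \<noteq> 0\<^sub>v N" "transpose_mat ?B *\<^sub>v w = 0\<^sub>v N"
    using det_0_iff_vec_prod_zero_field[of "transpose_mat ?B" N] B by auto
  have ker: "(\<Sum>a<N. at1 (D a b) * w $ a) = 0" if b: "b < N" for b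
  proof -
    have "(transpose_mat ?B *\<^sub>v w) $ b = (\<Sum>a<N. at1 (D a b) * w $ a)"
      using mult_mat_vec_entry[of b "transpose_mat ?B" w] b w(1) by simp
    then show ?thesis using w(3) b by simp
  qed
  obtain a0 where a0: "a0 < N" "vs ! a0 = (1, 1)" by (rule index_11)
  have inj: "vs ! a = vs ! b \<longleftrightarrow> a = b" if "a < N" "b < N" for a b
    using nth_eq_iff_index_eq[OF vs(2)] that by (simp add: N_def)
  have w0: "w $ a0 = 0"
  proof -
    have "(\<Sum>a<N. at1 (D a a0) * w $ a) = (\<Sum>a<N. if a = a0 then w $ a0 else 0)"
      by (intro sum.cong refl) (use inj[OF _ a0(1)] a0 in \<open>auto simp: D_def\<close>)
    then show ?thesis using ker[OF a0(1)] a0(1) by simp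
  qed
  have "w $ b = 0" if b: "b < N" for b
  proof (cases "b = a0")
    case False
    then have nb: "vs ! b \<noteq> (1, 1)" using inj[OF b a0(1)] a0 by simp
    obtain c d where c: "c \<noteq> 0" "\<And>w. w \<in> V \<Longrightarrow> at1 (syz (vs ! b) w) = (if w = vs ! b then c else 0) + (if w = (1, 1) then d else 0)"
      by (rule at1_syz[OF vs_V[OF b] nb]) (rule that)
    have "(\<Sum>a<N. at1 (D a b) * w $ a) = (\<Sum>a<N. (if a = b then c * w $ b else 0) + (if a = a0 then d * w $ a0 else 0))"
    proof (intro sum.cong refl)
      fix a assume "a \<in> {..<N}"
      then have a: "a < N" by simp
      have "at1 (D a b) = (if a = b then c else 0) + (if a = a0 then d else 0)"
        using c(2)[OF vs_V[OF a]] nb inj[OF a b] inj[OF a a0(1)] a0 by (simp add: D_def)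
      then show "at1 (D a b) * w $ a = (if a = b then c * w $ b else 0) + (if a = a0 then d * w $ a0 else 0)"
        by (simp add: distrib_right)
    qed
    also have "\<dots> = c * w $ b + d * w $ a0" using a0(1) b by (simp add: sum.distrib)
    finally have "c * w $ b = 0" using ker[OF b] w0 by simp
    then show ?thesis using c(1) by simp
  qed (use w0 in simp)
  then have "w = 0\<^sub>v N" using w(1) by (intro eq_vecI) auto
  then show False using w(2) by simp
qed

lemma N_pos: "N > 0" unfolding N_card using T11 by (auto simp: card_gt_0_iff)

lemma min_generators_grad: "min_form_generators V J (map grad [0..<N])"
  unfolding min_form_generators_def
proof (intro conjI allI impI)
  have set: "set (map grad [0..<N]) = grad ` {..<N}" by (auto simp: atLeast0LessThan)
  show "\<exists>d. \<forall>g\<in>set (map grad [0..<N]). is_form V d g" unfolding set using grad_form by blast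
  show "genideal R (set (map grad [0..<N])) = J" unfolding set J_grad ..
  fix i assume "i < length (map grad [0..<N])"
  then have i: "i < N" by simp
  have e: "{map grad [0..<N] ! j | j. j < length (map grad [0..<N]) \<and> j \<noteq> i} = grad ` ({..<N} - {i})"
  proof (intro subset_antisym subsetI)
    fix x assume "x \<in> grad ` ({..<N} - {i})"
    then obtain j where "x = grad j" "j < N" "j \<noteq> i" by auto
    then show "x \<in> {map grad [0..<N] ! j | j. j < length (map grad [0..<N]) \<and> j \<noteq> i}"
      by (intro CollectI exI[of _ j]) simp
  qed auto
  show "genideal R {map grad [0..<N] ! j | j. j < length (map grad [0..<N]) \<and> j \<noteq> i} \<noteq> J"
  proof
    assume "genideal R {map grad [0..<N] ! j | j. j < length (map grad [0..<N]) \<and> j \<noteq> i} = J"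
    then have gi: "grad i \<in> genideal R (grad ` ({..<N} - {i}))"
      unfolding e using J_gen[OF vs_V[OF i]] by (simp add: grad_def)
    have "\<exists>c. grad i = (\<Sum>j\<in>{..<N} - {i}. Const (c j) * grad j)"
      by (rule form_in_ideal_of_forms[where F = grad, OF _ grad_form grad_form gi]) simp
    then obtain c where c: "grad i = (\<Sum>j\<in>{..<N} - {i}. Const (c j) * grad j)" by (elim exE)
    define c' where "c' j = (if j = i then - 1 else c j)" for j
    have "(\<Sum>j<N. Const (c' j) * grad j) = Const (c' i) * grad i + (\<Sum>j\<in>{..<N} - {i}. Const (c' j) * grad j)"
      using i by (intro sum.remove) auto
    also have "(\<Sum>j\<in>{..<N} - {i}. Const (c' j) * grad j) = grad i"
      unfolding c by (intro sum.cong refl) (auto simp: c'_def)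
    also have "Const (c' i) * grad i + grad i = 0" by (simp add: c'_def Const_uminus)
    finally have "c' i = 0" by (rule indep_modD[OF indep_grad _ i])
    then show False by (simp add: c'_def)
  qed
qed

text \<open>The syzygies of the partial derivatives are transported to the given generators by the invertible matrix of the base change.\<close>
lemma rank_of_presentation:
  assumes gs: "min_form_generators V J gs" and \<phi>: "graded_presentation V gs \<phi>"
  shows "vec_space.rank (length gs) (map_mat to_fract (linear_part V \<phi>)) = N - 1"
proof -
  obtain M where M: "length gs = N" "\<And>i. i < N \<Longrightarrow> is_form V (m - 1) (gs ! i)" "indep_mod {0} N (\<lambda>i. gs ! i)"
    "\<And>a. a < N \<Longrightarrow> grad a = (\<Sum>i<N. Const (M a i) * gs ! i)" "det (mat N N (\<lambda>(a, i). M a i)) \<noteq> 0"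
    by (rule min_generators_base_change[OF grad_form indep_grad N_pos gs[unfolded J_grad]]) (rule that)
  obtain a0 where a0: "a0 < N" "vs ! a0 = (1, 1)" by (rule index_11)
  have inj: "vs ! a = vs ! b \<longleftrightarrow> a = b" if "a < N" "b < N" for a b
    using nth_eq_iff_index_eq[OF vs(2)] that by (simp add: N_def)
  define E where "E i b = (\<Sum>a<N. Const (M a i) * D a b)" for i b
  show ?thesis
  proof (rule rank_linear_part[where D = E and ?a0.0 = a0])
    show "length gs = N" "N > 0" "a0 < N" by (fact M(1) N_pos a0(1))+
    show "indep_mod {0} N (\<lambda>i. gs ! i)" by (rule M(3))
    show "graded_presentation V gs \<phi>" by (rule \<phi>)
    have nb: "D a b = syz (vs ! b) (vs ! a)" if "b < N" "b \<noteq> a0" for a b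
      using inj[OF that(1) a0(1)] that a0(2) by (simp add: D_def)
    show "is_form V 1 (E i b)" if "i < N" "b < N" "b \<noteq> a0" for i b
      unfolding E_def nb[OF that(2,3)] by (intro is_form_sum is_form_Const_mult syz_form vs_V) simp
    show "(\<Sum>i<N. E i b * gs ! i) = 0" if b: "b < N" "b \<noteq> a0" for b
    proof -
      have "(\<Sum>i<N. E i b * gs ! i) = (\<Sum>i<N. \<Sum>a<N. D a b * (Const (M a i) * gs ! i))"
        by (simp add: E_def sum_distrib_right sum_distrib_left mult_ac)
      also have "\<dots> = (\<Sum>a<N. D a b * grad a)"
        by (subst sum.swap) (simp add: M(4) sum_distrib_left)
      also have "\<dots> = (\<Sum>a<N. syz (vs ! b) (vs ! a) * partial (vs ! a) f)" by (simp only: nb[OF b] grad_def)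
      also have "\<dots> = (\<Sum>w\<in>V. syz (vs ! b) w * partial w f)" by (rule sum.reindex_bij_betw[OF bij_vs])
      finally show ?thesis by (simp only: syz_syzygy[OF vs_V[OF b(1)]])
    qed
    let ?M = "mat N N (\<lambda>(a, i). M a i)" and ?D = "mat N N (\<lambda>(a, b). D a b)"
    let ?K = "map_mat (Const :: 'a \<Rightarrow> (nat \<times> nat, 'a) mpoly) ?M"
    have K: "?K \<in> carrier_mat N N" by simp
    have "mat N N (\<lambda>(i, b). E i b) = transpose_mat ?K * ?D"
      by (rule eq_matI) (auto simp: E_def scalar_prod_def lessThan_atLeast0 intro!: sum.cong)
    then have "det (mat N N (\<lambda>(i, b). E i b)) = det (transpose_mat ?K) * det ?D"
      by (simp only: det_mult[of "transpose_mat ?K" N ?D] transpose_carrier_mat K mat_carrier)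
    also have "det (transpose_mat ?K) = Const (det ?M)"
      unfolding det_transpose[OF K] by (rule comm_ring_hom.hom_det[OF comm_ring_hom_Const])
    finally show "det (mat N N (\<lambda>(i, b). E i b)) \<noteq> 0" using M(5) det_D by simp
  qed
qed

theorem linear_rank_J: "linear_rank V J = N - 1"
  unfolding linear_rank_def
proof (rule the_equality)
  obtain \<phi> where "graded_presentation V (map grad [0..<N]) \<phi>"
    using exists_graded_presentation[of V "map grad [0..<N]" "m - 1"] grad_form by auto
  then show "\<exists>gs \<phi>. min_form_generators V J gs \<and> graded_presentation V gs \<phi> \<and> N - 1 = vec_space.rank (length gs) (map_mat to_fract (linear_part V \<phi>))"
    using min_generators_grad rank_of_presentation by metis
next
  fix r assume "\<exists>gs \<phi>. min_form_generators V J gs \<and> graded_presentation V gs \<phi> \<and> r = vec_space.rank (length gs) (map_mat to_fract (linear_part V \<phi>))"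
  then show "r = N - 1" using rank_of_presentation by auto
qed

lemma length_min_generators: "min_form_generators V J gs \<Longrightarrow> length gs = N"
  using min_generators_base_change[OF grad_form indep_grad N_pos, of gs] unfolding J_grad by metis

lemma N_eq: "N = Suc (((m + 1) choose 2) - 2)"
proof -
  have "N = ((m + 1) choose 2) - 1" unfolding N_card using card_SC_vars[of m] m3 by simp
  then show ?thesis using N_pos by simp
qed

end

section \<open>The five properties of the determinant\<close>

theorem theorem2p2:
  fixes m :: nat
    and V :: "(nat \<times> nat) set"
    and R :: "(nat \<times> nat, 'a::field_char_0) mpoly ring"
    and f :: "(nat \<times> nat, 'a) mpoly"
    and J :: "(nat \<times> nat, 'a) mpoly set"
  assumes "m \<ge> 3"
    and "V = SC_vars m"
    and "R = mpoly_ring V"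
    and "f = det (SC m)"
    and "J = gradient_ideal V f"
  shows "(ideal J R \<and> codim R J = 3 \<and> J \<subseteq> minors_ideal V (m - 1) (SC m)) \<and>
    normal_domain (R Quot (genideal R {f})) \<and>
    hessian_det V f \<noteq> 0 \<and>
    (linear_rank V J = ((m + 1) choose 2) - 2 \<and>
     (\<forall>gs. min_form_generators V J gs \<longrightarrow> length gs = Suc (((m + 1) choose 2) - 2))) \<and>
    homaloidal V f"
proof -
  interpret degenerate_symmetric m "TYPE('a)" by unfold_locales (rule assms(1))
  have N1: "N - 1 = ((m + 1) choose 2) - 2" unfolding N_eq by (rule diff_Suc_1)
  show ?thesis
    unfolding assms(2-5)
  proof (intro conjI allI impI)
    show "ideal (gradient_ideal (SC_vars m) (det (SC m :: (nat \<times> nat, 'a) mpoly mat))) (mpoly_ring (SC_vars m))"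
      using J_ideal unfolding J_def ideal_iff .
    show "codim (mpoly_ring (SC_vars m)) (gradient_ideal (SC_vars m) (det (SC m :: (nat \<times> nat, 'a) mpoly mat))) = 3"
      using codim_J unfolding J_def .
    show "gradient_ideal (SC_vars m) (det (SC m :: (nat \<times> nat, 'a) mpoly mat)) \<subseteq> minors_ideal (SC_vars m) (m - 1) (SC m)"
      using J_subset_minors unfolding J_def .
    show "normal_domain (mpoly_ring (SC_vars m) Quot genideal (mpoly_ring (SC_vars m)) {det (SC m :: (nat \<times> nat, 'a) mpoly mat)})"
      using normal_hypersurface unfolding fI_def .
    show "hessian_det (SC_vars m) (det (SC m :: (nat \<times> nat, 'a) mpoly mat)) \<noteq> 0"
      by (rule hessian_nonzero)
    show "linear_rank (SC_vars m) (gradient_ideal (SC_vars m) (det (SC m :: (nat \<times> nat, 'a) mpoly mat))) = ((m + 1) choose 2) - 2"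
      using linear_rank_J unfolding J_def N1 .
    show "length gs = Suc (((m + 1) choose 2) - 2)"
      if "min_form_generators (SC_vars m) (gradient_ideal (SC_vars m) (det (SC m :: (nat \<times> nat, 'a) mpoly mat))) gs" for gs
      using length_min_generators[unfolded J_def, OF that] unfolding N_eq .
    show "homaloidal (SC_vars m) (det (SC m :: (nat \<times> nat, 'a) mpoly mat))"
      by (rule homaloidal_f)
  qed
qed

end
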